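(* Let $\mu>0$ and let $f:\mathbb R\to\mathbb R$ be continuous, odd, with $f(u)\ge0$ for $u\ge0$, such that there is $q\in(2,6)$ with $\lim_{u\to\infty}f(u)/u^{q-1}=0$, and $\lim_{u\to0}f(u)/u=0$. Then any minimising sequence for $E_\mu$ on $\mathcal M_{\mathrm{rad},\mu}$ is convergent. So $\mathfrak m_{\mathrm{rad},\mu}:=\inf_{\mathcal M_{\mathrm{rad},\mu}}E_\mu$ is achieved and the minimiser (ground state) can be assumed of one sign. Moreover, $E_\mu$ possesses infinitely many critical points $\{u_n\}$ on $\mathcal M_{\mathrm{rad},\mu}$, with associated Lagrange multipliers $\{\lambda_n\}\subset(-\infty,0)$ satisfying $$E_\mu(u_n)=\frac12\|u_n\|_\mu^2+\int_{\mathbb R^3}F(u_n)\to+\infty,\quad \|u_n\|_\mu^2\to+\infty,\quad \lambda_n=-\Big(\|u_n\|_\mu^2+\int_{\mathbb R^3}f(u_n)u_n\Big)\to-\infty.$$ In particular the equation $-\Delta u+\mu u+\lambda\phi_uu+f(u)=0$ in $\mathbb R^3$ has infinitely many solutions $(u,\lambda)$.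
   Context: $F(t)=\int_0^tf(s)\,ds$. $H^1_\mu(\mathbb R^3)$ is $H^1(\mathbb R^3)$ with norm $\|u\|_\mu^2=\int|\nabla u|^2+\mu\int u^2$; $H^1_{\mathrm{rad},\mu}(\mathbb R^3)$ is its subspace of radial functions. For $u\in H^1(\mathbb R^3)$, $\phi_u(x)=\int_{\mathbb R^3}\frac{1-e^{-|x-y|}}{|x-y|}u^2(y)\,dy$. $E_\mu(u)=\frac12\|u\|_\mu^2+\int F(u)$, $\mathcal M_\mu=\{u\in H^1_\mu(\mathbb R^3):\int\phi_uu^2=1\}$, $\mathcal M_{\mathrm{rad},\mu}=\mathcal M_\mu\cap H^1_{\mathrm{rad},\mu}(\mathbb R^3)$. Critical points of $E_\mu$ on the constraint come with Lagrange multiplier $\lambda$ so that $(u,\lambda)$ solves the equation weakly.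
   Formalization: "Any minimising sequence is convergent" is stated as: it has a subsequence converging in the norm to an element of the constraint set; the literal claim fails, since for a minimiser u the sequence u, −u, u, −u, … is minimising (f is odd) but does not converge. *)

theory Defs
  imports "HOL-Analysis.Analysis"
begin

fun Ck :: "nat \<Rightarrow> (real^3 \<Rightarrow> real) \<Rightarrow> bool" where
  "Ck 0 \<phi> = continuous_on UNIV \<phi>"
| "Ck (Suc n) \<phi> = ((\<forall>x. \<phi> differentiable (at x)) \<and>
      (\<forall>v. Ck n (\<lambda>x. frechet_derivative \<phi> (at x) v)))"

definition test_fun :: "(real^3 \<Rightarrow> real) \<Rightarrow> bool" where
  "test_fun \<phi> \<longleftrightarrow> (\<forall>n. Ck n \<phi>) \<and> compact (closure {x. \<phi> x \<noteq> 0})"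

text \<open>g is a weak gradient of u (locally integrable u, tested against C_c^infinity).\<close>
definition weak_grad :: "(real^3 \<Rightarrow> real) \<Rightarrow> (real^3 \<Rightarrow> real^3) \<Rightarrow> bool" where
  "weak_grad u g \<longleftrightarrow>
     (\<forall>\<phi> v. test_fun \<phi> \<longrightarrow>
        (LINT x|lborel. u x * frechet_derivative \<phi> (at x) v)
          = - (LINT x|lborel. (g x \<bullet> v) * \<phi> x))"

definition H1 :: "(real^3 \<Rightarrow> real) set" where
  "H1 = {u. u \<in> borel_measurable lborel \<and> integrable lborel (\<lambda>x. (u x)\<^sup>2) \<and>
          (\<exists>g. g \<in> borel_measurable lborel \<and> integrable lborel (\<lambda>x. (norm (g x))\<^sup>2)
               \<and> weak_grad u g)}"

definition grad :: "(real^3 \<Rightarrow> real) \<Rightarrow> (real^3 \<Rightarrow> real^3)" where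
  "grad u = (SOME g. g \<in> borel_measurable lborel \<and> integrable lborel (\<lambda>x. (norm (g x))\<^sup>2)
                     \<and> weak_grad u g)"

definition normsq_mu :: "real \<Rightarrow> (real^3 \<Rightarrow> real) \<Rightarrow> real" where
  "normsq_mu \<mu> u = (LINT x|lborel. (norm (grad u x))\<^sup>2) + \<mu> * (LINT x|lborel. (u x)\<^sup>2)"

definition radial :: "(real^3 \<Rightarrow> real) \<Rightarrow> bool" where
  "radial u \<longleftrightarrow> (\<exists>h :: real \<Rightarrow> real. AE x in lborel. u x = h (norm x))"

definition H1_rad :: "(real^3 \<Rightarrow> real) set" where
  "H1_rad = {u \<in> H1. radial u}"

definition primitive :: "(real \<Rightarrow> real) \<Rightarrow> real \<Rightarrow> real" where
  "primitive f t = (LBINT s=ereal 0..ereal t. f s)"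

definition phi :: "(real^3 \<Rightarrow> real) \<Rightarrow> real^3 \<Rightarrow> real" where
  "phi u x = (LINT y|lborel. (1 - exp (- dist x y)) / dist x y * (u y)\<^sup>2)"

definition energy :: "real \<Rightarrow> (real \<Rightarrow> real) \<Rightarrow> (real^3 \<Rightarrow> real) \<Rightarrow> real" where
  "energy \<mu> f u = normsq_mu \<mu> u / 2 + (LINT x|lborel. primitive f (u x))"

definition M_rad :: "(real^3 \<Rightarrow> real) set" where
  "M_rad = {u \<in> H1_rad. (LINT x|lborel. phi u x * (u x)\<^sup>2) = 1}"

definition weak_solution :: "real \<Rightarrow> (real \<Rightarrow> real) \<Rightarrow> (real^3 \<Rightarrow> real) \<Rightarrow> real \<Rightarrow> bool" where
  "weak_solution \<mu> f u lam \<longleftrightarrow> u \<in> H1 \<and>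
     (\<forall>v\<in>H1. (LINT x|lborel. grad u x \<bullet> grad v x + \<mu> * u x * v x
                 + lam * phi u x * u x * v x + f (u x) * v x) = 0)"

definition crit_point_rad :: "real \<Rightarrow> (real \<Rightarrow> real) \<Rightarrow> (real^3 \<Rightarrow> real) \<Rightarrow> real \<Rightarrow> bool" where
  "crit_point_rad \<mu> f u lam \<longleftrightarrow> u \<in> M_rad \<and> weak_solution \<mu> f u lam"

end

theory Submission
 imports Defs "HOL-Homology.Invariance_of_Domain" "HOL-Library.Function_Algebras" "HOL-Real_Asymp.Real_Asymp"
 "HOL-Complex_Analysis.Great_Picard"
begin

text \<open>Radial functions in H1 satisfy \<open>\<bar>u x\<bar> \<le> C / sqrt (norm x)\<close> and have equicontinuous profiles on
 annuli. Pairings with \<open>f u\<close> and \<open>phi u * u\<close> are, up to a small error, carried by an annulus, so they are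
 compact on bounded sets and the energy satisfies the Palais--Smale condition on the constraint. Critical
 levels are minimax values over odd maps from spheres into the constraint; by the Borsuk--Ulam theorem such
 a map meets the common zero set of finitely many linear functionals, on which the energy is large, so the
 levels tend to infinity. Averaging over rotations turns radial critical points into weak solutions. The
 sign of the minimiser comes from replacing the modulus of its profile by smooth averages, which do not
 increase the gradient norm.\<close>

no_notation (ASCII) HOL.disj (infixr "|" 30)
unbundle no cardinal_syntax
notation abs ("|_|")

section \<open>The Borsuk--Ulam theorem\<close>

text \<open>Functions are never identified modulo null sets, so \<open>H1_rad\<close> carries only a
  seminorm, and oddness or uniqueness hold up to vectors of seminorm 0. No gradient flow is used:
  the constraint functional is homogeneous of degree 4, so an explicit step along the constrained
  gradient followed by rescaling stays on the constraint, and its first-order decrease is uniform on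
  bounded sets. Weak convergence is absent as well. Its place is taken by the profile value
  \<open>ev u s\<close>, the pairing of the gradient with one fixed square-integrable field:
  finitely many such values control a function on an annulus, which yields both the convergent
  subsequences and the finite lists of linear functionals. The decay |x|^(-1/2) matches the growth
  f(t) = o(t^(q-1)) with q < 6: the pairing of f(u) with a radial function is of order |x|^(-q/2) at
  the origin, integrable as q/2 < 3. The nonnegative averages have to be rescaled back to the
  constraint, so the sign is obtained for the limit of a minimising sequence.\<close>

lemma lipschitz_misses_point:
 fixes P :: "(nat => real) => nat => real" and K R :: nat
 assumes lip: "!!z z' i. z \<in> D ==> z' \<in> D ==> i <= n ==>
   |P z i - P z' i| <= real K * (\<Sum>j<n. |z j - z' j| )"
  and bdd: "!!z j. z \<in> D ==> j < n ==> |z j| <= real R"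
 shows "EX v. (ALL i<=n. 1 <= v i & v i <= 2) & (ALL z:D. EX i<=n. P z i ~= v i)"
proof (rule ccontr)
 assume "\<not> ?thesis"
 hence hit: "EX z:D. ALL i<=n. P z i = v i" if "ALL i<=n. 1 <= v i & v i <= 2" for v
  using that by blast
 \<comment> \<open>Box counting: the N^(n+1) grid points of [1,2]^(n+1) have preimages in a cube of
   R^n cut into cells of side 1/M. Two preimages in one cell have images at most K*n/M < 1/N apart,
   so distinct grid points need distinct cells. There are at most (2RM+1)^n <= (C*N)^n cells, and N
   = C^n + 1 makes this less than N^(n+1).\<close>
 define C where "C = 2 * R * (K * n + 1) + 1"
 define N where "N = C ^ n + 1"
 define M where "M = (K * n + 1) * N"
 define T where "T = 2 * R * M + 1"
 have N0: "N > 0" and M0: "M > 0" by (simp_all add: N_def M_def)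
 let ?W = "PiE {..n} (%_. {..<N})"
 have "ALL w:?W. EX z:D. ALL i<=n. P z i = 1 + real (w i) / real N"
 proof
  fix w assume w: "w \<in> ?W"
  have "real (w i) / real N <= 1" if "i <= n" for i
  proof -
   have "w i < N" using w that by (auto simp: PiE_iff)
   thus ?thesis using N0 by (simp add: field_simps)
  qed
  thus "EX z:D. ALL i<=n. P z i = 1 + real (w i) / real N"
   using hit[of "%i. 1 + real (w i) / real N"] by force
 qed
 then obtain zz where zz: "!!w. w \<in> ?W ==> zz w \<in> D"
  "!!w i. w \<in> ?W ==> i <= n ==> P (zz w) i = 1 + real (w i) / real N"
  by metis
 define c where "c w = (\<lambda>j\<in>{..<n}. nat \<lfloor>(zz w j + R) * M\<rfloor>)" for w
 have cin: "c ` ?W \<subseteq> PiE {..<n} (%_. {..<T})"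
 proof
  fix y assume "y \<in> c ` ?W"
  then obtain w where w: "w \<in> ?W" "y = c w" by blast
  have "nat \<lfloor>(zz w j + R) * M\<rfloor> < T" if "j < n" for j
  proof -
   have "zz w j + R <= 2 * R" using bdd[OF zz(1)[OF w(1)] that] by simp
   hence "(zz w j + R) * real M <= real (2 * R) * real M" by (intro mult_right_mono) auto
   hence "(zz w j + R) * real M <= real (2 * R * M)" by simp
   hence "\<lfloor>(zz w j + R) * M\<rfloor> <= int (2 * R * M)"
    by (metis floor_mono floor_of_nat)
   thus ?thesis unfolding T_def by linarith
  qed
  thus "y \<in> PiE {..<n} (%_. {..<T})" using w(2) by (auto simp: c_def)
 qed
 have inj: "inj_on c ?W"
 proof
  fix w w' assume w: "w \<in> ?W" and w': "w' \<in> ?W" and eq: "c w = c w'"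
  have close: "|zz w j - zz w' j| <= 1 / M" if "j < n" for j
  proof -
   have a: "\<lfloor>(zz w j + R) * M\<rfloor> = \<lfloor>(zz w' j + R) * M\<rfloor>"
   proof -
    have "0 <= \<lfloor>(zz w j + R) * M\<rfloor>" "0 <= \<lfloor>(zz w' j + R) * M\<rfloor>"
     using bdd[OF zz(1)[OF w] that] bdd[OF zz(1)[OF w'] that]
     by (auto intro!: mult_nonneg_nonneg)
    moreover have "nat \<lfloor>(zz w j + R) * M\<rfloor> = nat \<lfloor>(zz w' j + R) * M\<rfloor>"
     using fun_cong[OF eq, of j] that by (simp add: c_def)
    ultimately show ?thesis by linarith
   qed
   have "|(zz w j + R) * M - (zz w' j + R) * M| <= 1" using a by linarith
   moreover have "(zz w j + R) * M - (zz w' j + R) * M = (zz w j - zz w' j) * M"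
    by (simp add: algebra_simps)
   ultimately have "|zz w j - zz w' j| * M <= 1" by (simp add: abs_mult)
   thus ?thesis using M0 by (simp add: field_simps)
  qed
  have "w i = w' i" if i: "i <= n" for i
  proof -
   have "|real (w i) - real (w' i)| / N = |P (zz w) i - P (zz w') i|"
   proof -
    have "P (zz w) i - P (zz w') i = (real (w i) - real (w' i)) / N"
     using zz(2)[OF w i] zz(2)[OF w' i] by (simp add: diff_divide_distrib)
    thus ?thesis by simp
   qed
   also have "... <= K * (\<Sum>j<n. |zz w j - zz w' j| )"
    using lip[OF zz(1)[OF w] zz(1)[OF w'] i] .
   also have "... <= K * (\<Sum>j<n. 1 / M)"
    by (intro mult_left_mono sum_mono close) auto
   also have "... = K * n / M" by simp
   finally have "|real (w i) - real (w' i)| * M <= K * n * N"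
    using N0 M0 by (simp add: field_simps)
   moreover have "real (K * n * N) < real M" using N0 by (simp add: M_def algebra_simps)
   ultimately have "|real (w i) - real (w' i)| * real M < 1 * real M" by simp
   hence "|real (w i) - real (w' i)| < 1" using M0 mult_less_cancel_right_pos by fastforce
   thus ?thesis by linarith
  qed
  thus "w = w'" using w w' by (auto simp: PiE_iff fun_eq_iff extensional_def) (metis)
 qed
 have "card ?W <= card (PiE {..<n} (%_::nat. {..<T}))"
  by (intro card_inj_on_le[OF inj cin] finite_PiE) auto
 hence "N ^ (n + 1) <= T ^ n" by (simp add: card_PiE)
 also have "T <= C * N" using N0 by (simp add: T_def C_def M_def algebra_simps)
 hence "T ^ n <= C ^ n * N ^ n" by (metis power_mono power_mult_distrib le0)
 finally have "N <= C ^ n" using N0 by simp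
 thus False by (simp add: N_def)
qed

section \<open>Unit spheres in sequence space and radial projection onto them\<close>

definition SS :: "nat => (nat => real) set" where
 "SS n = {x. (\<Sum>i\<le>n. (x i)^2) = 1 & (ALL i>n. x i = 0)}"

lemma nsphere_SS: "nsphere n = subtopology (powertop_real UNIV) (SS n)"
 by (simp add: nsphere SS_def)

lemma topspace_nsphere_SS: "topspace (nsphere n) = SS n"
 by (simp add: nsphere_SS)

lemma nsphere_map_in_SS:
 "continuous_map (nsphere n) (nsphere k) f ==> x \<in> SS n ==> f x \<in> SS k"
 using continuous_map_image_subset_topspace[of "nsphere n" "nsphere k" f]
 by (auto simp: topspace_nsphere_SS)

definition unitize :: "nat => (nat => real) => nat => real" where
 "unitize n z = (%i. if i <= n then z i / L2_set z {..n} else 0)"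

lemma unitize_in_SS:
 assumes "EX i<=n. z i ~= 0"
 shows "unitize n z \<in> SS n"
proof -
 have "L2_set z {..n} ~= 0" using assms by (auto simp: L2_set_eq_0_iff)
 hence "(L2_set z {..n})^2 ~= 0" by simp
 moreover have "(L2_set z {..n})^2 = (\<Sum>i\<le>n. (z i)^2)" by (simp add: L2_set_def sum_nonneg)
 ultimately have "(\<Sum>i\<le>n. (z i / L2_set z {..n})^2) = 1"
  by (simp add: power_divide flip: sum_divide_distrib)
 thus ?thesis by (simp add: unitize_def SS_def)
qed

lemma unitize_id: "x \<in> SS n ==> unitize n x = x"
 by (auto simp: unitize_def L2_set_def fun_eq_iff SS_def)

lemma unitize_minus: "unitize n (%i. - z i) = (%i. - unitize n z i)"
 by (auto simp: unitize_def L2_set_def)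

lemma continuous_map_unitize:
 assumes "!!i. i <= n ==> continuous_map X euclideanreal (%x. g x i)"
  and "!!x. x \<in> topspace X ==> EX i<=n. g x i ~= 0"
 shows "continuous_map X (nsphere n) (%x. unitize n (g x))"
 unfolding nsphere_SS continuous_map_in_subtopology continuous_map_componentwise_UNIV
proof (intro conjI allI)
 fix k
 have L: "continuous_map X euclideanreal (%x. L2_set (g x) {..n})"
  unfolding L2_set_def
  by (intro continuous_map_sqrt continuous_map_sum continuous_map_real_pow) (auto intro: assms(1))
 have nz: "L2_set (g x) {..n} ~= 0" if "x \<in> topspace X" for x
  using assms(2)[OF that] by (auto simp: L2_set_eq_0_iff)
 show "continuous_map X euclideanreal (%x. unitize n (g x) k)"
  unfolding unitize_def
  by (cases "k <= n") (auto intro!: continuous_map_real_divide assms(1) L nz)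
next
 show "(%x. unitize n (g x)) \<in> topspace X \<rightarrow> SS n"
  using unitize_in_SS assms(2) by auto
qed

lemma homotopic_unitize:
 assumes f: "!!i. i <= n ==> continuous_map X euclideanreal (%x. f x i)"
  and g: "!!i. i <= n ==> continuous_map X euclideanreal (%x. g x i)"
  and nz: "!!x s. x \<in> topspace X ==> 0 <= s ==> s <= 1 ==> EX i<=n. (1 - s) * f x i + s * g x i ~= 0"
 shows "homotopic_with (%_. True) X (nsphere n) (%x. unitize n (f x)) (%x. unitize n (g x))"
 unfolding homotopic_with_def
proof (intro exI conjI)
 let ?Y = "prod_topology (top_of_set {0..1::real}) X"
 let ?h = "%(s, x). unitize n (%i. (1 - s) * f x i + s * g x i)"
 have s: "continuous_map ?Y euclideanreal fst"
  by (metis continuous_map_fst continuous_map_into_fulltopology)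
 have x: "continuous_map ?Y X snd" by (rule continuous_map_snd)
 have "continuous_map ?Y (nsphere n) (%p. unitize n (%i. (1 - fst p) * f (snd p) i + fst p * g (snd p) i))"
  using nz by (intro continuous_map_unitize continuous_map_add continuous_map_real_mult
   continuous_map_diff continuous_map_canonical_const s
   continuous_map_compose[OF x f, unfolded o_def] continuous_map_compose[OF x g, unfolded o_def]) auto
 thus "continuous_map ?Y (nsphere n) ?h" by (simp add: case_prod_unfold)
qed auto

lemma compact_SS: "compact (SS n)"
proof -
 have "compactin (product_topology (%i. euclidean) UNIV) (PiE UNIV (%i::nat. {-1..1::real}))"
  by (auto simp: compactin_PiE)
 hence c: "compact (PiE UNIV (%i::nat. {-1..1::real}))"
  by (simp add: euclidean_product_topology compactin_euclidean_iff)
 have cc: "continuous_on UNIV (%x::nat => real. x i)" for i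
  by (rule continuous_on_product_coordinates)
 have "closed ({x::nat => real. (\<Sum>i\<le>n. (x i)^2) = 1} \<inter> (\<Inter>i\<in>{n<..}. {x. x i = 0}))"
  by (intro closed_Int closed_INT ballI closed_Collect_eq continuous_intros cc)
 moreover have "{x::nat => real. (\<Sum>i\<le>n. (x i)^2) = 1} \<inter> (\<Inter>i\<in>{n<..}. {x. x i = 0}) = SS n" by (auto simp: SS_def)
 ultimately have cl: "closed (SS n)" by metis
 have "|x k| <= 1" if "x \<in> SS n" for x k
  using topspace_nsphere_1[of x n k] that by (simp add: topspace_nsphere_SS abs_square_le_1)
 hence "SS n \<subseteq> PiE UNIV (%i::nat. {-1..1::real})" by (fastforce simp: abs_le_iff)
 hence "PiE UNIV (%i::nat. {-1..1::real}) \<inter> SS n = SS n" by blast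
 thus ?thesis using compact_Int_closed[OF c cl] by simp
qed

lemma SS_coord_le_1: "x \<in> SS n ==> |x k| <= 1"
 using topspace_nsphere_1[of x n k] by (simp add: topspace_nsphere_SS abs_square_le_1)

lemma continuous_map_nsphere_iff:
 "continuous_map (nsphere n) euclideanreal f \<longleftrightarrow> continuous_on (SS n) f"
 by (simp add: nsphere_SS euclidean_product_topology)

text \<open>Lipschitz functions on the sphere form an algebra (products use boundedness, which
  compactness supplies) that contains the coordinates and so separates points; Stone-Weierstrass
  then applies. Lipschitz maps are wanted because they cannot fill a cube of higher
  dimension.\<close>

lemma SS_lipschitz_approx:
 fixes f :: "(nat => real) => real"
 assumes "continuous_on (SS n) f" "e > 0"
 shows "EX g. continuous_on (SS n) g & (EX L. ALL x:SS n. ALL y:SS n. |g x - g y| <= L * (\<Sum>j\<le>n. |x j - y j| ))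
     & (ALL x:SS n. |f x - g x| < e)"
proof -
 let ?d = "%x y. \<Sum>j\<le>n. |x j - y j|"
 define R where "R = {g::(nat => real) => real. continuous_on (SS n) g & (EX L. ALL x:SS n. ALL y:SS n. |g x - g y| <= L * ?d x y)}"
 have dnn: "0 <= ?d x y" for x y :: "nat => real" by (simp add: sum_nonneg)
 interpret function_ring_on R "SS n"
 proof
  show "compact (SS n)" by (rule compact_SS)
  show "!!f. f \<in> R ==> continuous_on (SS n) f" by (simp add: R_def)
  show "(%x. f x + g x) \<in> R" if fg: "f \<in> R" "g \<in> R" for f g
  proof -
   obtain L1 L2 where L: "ALL x:SS n. ALL y:SS n. |f x - f y| <= L1 * ?d x y"
    "ALL x:SS n. ALL y:SS n. |g x - g y| <= L2 * ?d x y" using fg by (auto simp: R_def)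
   have "|(f x + g x) - (f y + g y)| <= (L1 + L2) * ?d x y" if "x \<in> SS n" "y \<in> SS n" for x y
    using bspec[OF bspec[OF L(1) that(1)] that(2)] bspec[OF bspec[OF L(2) that(1)] that(2)]
    unfolding distrib_right by linarith
   thus ?thesis using fg unfolding R_def mem_Collect_eq
    by (intro conjI continuous_on_add exI[of _ "L1 + L2"] ballI) auto
  qed
  show "(%x. f x * g x) \<in> R" if fg: "f \<in> R" "g \<in> R" for f g
  proof -
   obtain L1 L2 where L: "ALL x:SS n. ALL y:SS n. |f x - f y| <= L1 * ?d x y"
    "ALL x:SS n. ALL y:SS n. |g x - g y| <= L2 * ?d x y" using fg by (auto simp: R_def)
   have "bounded (f ` SS n)" "bounded (g ` SS n)"
    using fg by (auto simp: R_def intro!: compact_imp_bounded compact_continuous_image compact_SS)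
   then obtain A B where AB: "ALL y:f ` SS n. norm y <= A" "ALL y:g ` SS n. norm y <= B"
    unfolding bounded_iff by blast
   have A: "|f x| <= A" if "x \<in> SS n" for x using bspec[OF AB(1) imageI[OF that]] by simp
   have B: "|g x| <= B" if "x \<in> SS n" for x using bspec[OF AB(2) imageI[OF that]] by simp
   have "|f x * g x - f y * g y| <= (A * L2 + B * L1) * ?d x y" if xy: "x \<in> SS n" "y \<in> SS n" for x y
   proof -
    have "f x * g x - f y * g y = f x * (g x - g y) + g y * (f x - f y)" by (simp add: algebra_simps)
    hence "|f x * g x - f y * g y| <= |f x| * |g x - g y| + |g y| * |f x - f y|"
     by (metis abs_mult abs_triangle_ineq)
    also have "... <= A * (L2 * ?d x y) + B * (L1 * ?d x y)"
     using A[OF xy(1)] B[OF xy(2)] L xy by (intro add_mono mult_mono) (auto intro: order_trans[OF abs_ge_zero])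
    finally show ?thesis by (simp add: algebra_simps)
   qed
   thus ?thesis using fg unfolding R_def mem_Collect_eq
    by (intro conjI continuous_on_mult exI[of _ "A * L2 + B * L1"] ballI) auto
  qed
  show "(%_. c) \<in> R" for c by (auto simp: R_def intro!: exI[of _ 0])
  show "EX f:R. f x ~= f y" if xy: "x \<in> SS n" "y \<in> SS n" "x ~= y" for x y
  proof -
   obtain j where j: "x j ~= y j" using xy(3) by auto
   hence jn: "j <= n" using xy unfolding SS_def by (metis (mono_tags, lifting) mem_Collect_eq not_le)
   have "|u j - v j| <= 1 * ?d u v" for u v :: "nat => real"
    using member_le_sum[of j "{..n}" "%j. |u j - v j|"] jn by simp
   moreover have "continuous_on (SS n) (%x. x j)"
    by (rule continuous_on_subset[OF continuous_on_product_coordinates]) simp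
   ultimately have "(%x. x j) \<in> R" unfolding R_def mem_Collect_eq by (intro conjI exI[of _ 1] ballI)
   thus ?thesis by (rule bexI[rotated]) (rule j)
  qed
 qed
 show ?thesis using Stone_Weierstrass_basic[OF assms] by (auto simp: R_def)
qed

lemma SS_equator: "x \<in> SS n ==> x \<in> SS (Suc n) & x (Suc n) = 0"
 by (auto simp: SS_def)

lemma SS_equator_conv:
 assumes "x \<in> SS (Suc n)" "x (Suc n) = 0"
 shows "x \<in> SS n"
proof -
 have "x i = 0" if "i > n" for i
  using assms that by (cases "i = Suc n") (auto simp: SS_def)
 thus ?thesis using assms by (simp add: SS_def)
qed

text \<open>The extension of \<open>q\<close> by homogeneity of degree 1 stays Lipschitz at the
  origin because the factor \<open>L2_set z' {..n}\<close> cancels the growth of the derivative of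
  z/|z|. \<open>Q\<close> pays for the change of the norm; the n+1 coordinates of the direction cost
  one full distance each plus their own increments, hence n+2.\<close>

lemma cone_lipschitz:
 fixes q :: "(nat => real) => real"
 assumes L: "!!x y. x \<in> SS n ==> y \<in> SS n ==> |q x - q y| <= L * (\<Sum>j\<le>n. |x j - y j| )"
  and Q: "!!x. x \<in> SS n ==> |q x| <= Q" and L0: "L >= 0" and Q0: "Q >= 0"
 shows "|L2_set z {..n} * q (unitize n z) - L2_set z' {..n} * q (unitize n z')|
  <= (Q + L * (real n + 2)) * (\<Sum>j\<le>n. |z j - z' j| )"
proof -
 let ?N = "%z. L2_set z {..n}" and ?d = "\<Sum>j\<le>n. |z j - z' j|"
 have d0: "?d >= 0" by (simp add: sum_nonneg)
 have tri: "|?N z - ?N z'| <= ?d"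
 proof -
  have "?N z <= ?N z' + ?N (%j. z j - z' j)" "?N z' <= ?N z + ?N (%j. z' j - z j)"
   using L2_set_triangle_ineq[of "z'" "%j. z j - z' j" "{..n}"]
    L2_set_triangle_ineq[of "z" "%j. z' j - z j" "{..n}"] by simp_all
  moreover have "?N (%j. z j - z' j) <= ?d" "?N (%j. z' j - z j) <= ?d"
   using L2_set_le_sum_abs[of "%j. z j - z' j"] L2_set_le_sum_abs[of "%j. z' j - z j"]
   by (simp_all add: abs_minus_commute)
  ultimately show ?thesis by linarith
 qed
 have zero: "?N z = 0 \<or> (EX i<=n. z i ~= 0)" for z by (auto simp: L2_set_eq_0_iff)
 have Kge: "Q * ?d <= (Q + L * (real n + 2)) * ?d"
  using d0 L0 by (intro mult_right_mono) auto
 show ?thesis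
 proof (cases "?N z = 0 \<or> ?N z' = 0")
  case True
  hence "|?N z * q (unitize n z) - ?N z' * q (unitize n z')| <= |?N z - ?N z'| * Q"
   using zero[of z] zero[of z'] Q0
   by (auto simp: abs_mult intro!: mult_left_mono Q unitize_in_SS)
  also have "... <= ?d * Q" using tri Q0 by (intro mult_right_mono)
  finally show ?thesis using Kge by (simp add: mult.commute)
 next
  case False
  let ?x = "unitize n z" and ?y = "unitize n z'"
  have x: "?x \<in> SS n" and y: "?y \<in> SS n" using False zero[of z] zero[of z'] unitize_in_SS[of n z] unitize_in_SS[of n z'] by argo+
  have b: "?N z' > 0" using False L2_set_nonneg[of z' "{..n}"] by linarith
  have comp: "?N z' * |?x j - ?y j| <= ?d + |z j - z' j|" if "j <= n" for j
  proof -
   have "?N z' * (?x j - ?y j) = (?N z' - ?N z) * ?x j + (z j - z' j)"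
    using False that by (simp add: unitize_def field_simps)
   hence "?N z' * |?x j - ?y j| = |(?N z' - ?N z) * ?x j + (z j - z' j)|"
    using b by (metis abs_mult abs_of_pos)
   also have "... <= |?N z' - ?N z| * |?x j| + |z j - z' j|"
    using abs_triangle_ineq by (metis abs_mult)
   also have "|?N z' - ?N z| * |?x j| <= ?d * 1"
    using tri SS_coord_le_1[OF x, of j] d0 by (intro mult_mono) (auto simp: abs_minus_commute)
   finally show ?thesis by simp
  qed
  have "?N z * q ?x - ?N z' * q ?y = (?N z - ?N z') * q ?x + ?N z' * (q ?x - q ?y)"
   by (simp add: algebra_simps)
  hence "|?N z * q ?x - ?N z' * q ?y| <= |?N z - ?N z'| * |q ?x| + ?N z' * |q ?x - q ?y|"
   using b by (metis abs_triangle_ineq abs_mult abs_of_pos)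
  also have "|?N z - ?N z'| * |q ?x| <= ?d * Q"
   using tri Q[OF x] d0 by (intro mult_mono) auto
  also have "?N z' * |q ?x - q ?y| <= ?N z' * (L * (\<Sum>j\<le>n. |?x j - ?y j| ))"
   using L[OF x y] b by (intro mult_left_mono) auto
  also have "... = L * (\<Sum>j\<le>n. ?N z' * |?x j - ?y j| )" by (simp add: sum_distrib_left algebra_simps)
  also have "... <= L * (\<Sum>j\<le>n. ?d + |z j - z' j| )"
   using L0 comp by (intro mult_left_mono sum_mono) auto
  also have "... = L * ((real n + 2) * ?d)" by (simp add: sum.distrib algebra_simps)
  finally show ?thesis by (simp add: algebra_simps)
 qed
qed

lemma uminus_SS: "x \<in> SS n ==> (%i. - x i) \<in> SS n"
 by (auto simp: SS_def)

lemma homeomorphic_map_antipode: "homeomorphic_map (nsphere n) (nsphere n) (%x i. - x i)"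
proof -
 have "continuous_map (nsphere n) (nsphere n) (%x i. - x i)"
  unfolding nsphere_SS continuous_map_in_subtopology continuous_map_componentwise_UNIV
  by (auto intro!: continuous_map_minus continuous_map_from_subtopology continuous_map_product_projection uminus_SS)
 hence "homeomorphic_maps (nsphere n) (nsphere n) (%x i. - x i) (%x i. - x i)"
  by (simp add: homeomorphic_maps_def)
 thus ?thesis using homeomorphic_maps_map by blast
qed

text \<open>Induction on the dimension: an odd map of the m-sphere is homotopic to an odd map
  sending the equator into itself, and \<open>Borsuk_odd_mapping_degree_step\<close> compares its
  degree modulo 2 with that of the restriction. The homotopy projects along a direction
  \<open>v\<close> that the image of the equator avoids.\<close>

theorem odd_Brouwer_degree:
 assumes "continuous_map (nsphere n) (nsphere n) f"
  and "!!x. x \<in> SS n ==> f (%i. - x i) = (%i. - f x i)"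
 shows "odd (Brouwer_degree2 n f)"
 using assms
proof (induction n arbitrary: f)
 case 0
 define e where "e = (%i::nat. if i = 0 then 1 else 0::real)"
 have SS0: "x = e \<or> x = (%i. - e i)" if "x \<in> SS 0" for x
 proof -
  have "x 0 = 1 \<or> x 0 = -1" "ALL i>0. x i = 0" using that by (auto simp: power2_eq_1_iff SS_def)
  thus ?thesis by (auto simp: e_def fun_eq_iff)
 qed
 have e: "e \<in> SS 0" by (simp add: e_def SS_def)
 have "f e \<in> SS 0" using "0.prems"(1) e by (rule nsphere_map_in_SS)
 then consider "f e = e" | "f e = (%i. - e i)" using SS0 by blast
 thus ?case
 proof cases
  case 1
  hence "f x = id x" if "x \<in> topspace (nsphere 0)" for x
   using SS0[of x] that "0.prems"(2)[OF e] by (auto simp: topspace_nsphere_SS)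
  thus ?thesis using Brouwer_degree2_eq[of 0 f id] by simp
 next
  case 2
  hence "f x = (%i. - x i)" if "x \<in> topspace (nsphere 0)" for x
   using SS0[of x] that "0.prems"(2)[OF e] by (auto simp: topspace_nsphere_SS)
  hence "Brouwer_degree2 0 f = Brouwer_degree2 0 (%x i. - x i)" by (intro Brouwer_degree2_eq) auto
  moreover have "|Brouwer_degree2 0 (%x i. - x i)| = 1"
   by (rule Brouwer_degree2_homeomorphic_map[OF homeomorphic_map_antipode])
  ultimately show ?thesis by (metis abs_1 dvd_abs_iff odd_one)
 qed
next
 case (Suc n)
 define m where "m = Suc n"
 have cf: "continuous_map (nsphere m) (nsphere m) f" using Suc.prems m_def by simp
 have oddf: "f (%i. - x i) = (%i. - f x i)" if "x \<in> SS m" for x using Suc.prems(2) that m_def by simp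
 have fS: "f x \<in> SS m" if "x \<in> SS m" for x
  using cf that by (rule nsphere_map_in_SS)
 have cfi: "continuous_map (nsphere m) euclideanreal (%x. f x i)" for i
  using continuous_map_compose[OF cf continuous_map_nsphere_projection] by (simp add: o_def)
 \<comment> \<open>A unit vector in m+1 coordinates has a coordinate of size at least 1/(m+1), which
   is 2e; an approximation within e therefore stays away from 0.\<close>
 define e where "e = 1 / (2 * (real m + 1))"
 have e0: "e > 0" by (simp add: e_def)
 have "ALL i. EX g. continuous_on (SS m) g & (EX L. ALL x:SS m. ALL y:SS m. |g x - g y| <= L * (\<Sum>j\<le>m. |x j - y j| ))
     & (ALL x:SS m. |f x i - g x| < e)"
  using SS_lipschitz_approx[OF _ e0] cfi continuous_map_nsphere_iff by blast
 then obtain g where g: "!!i. continuous_on (SS m) (g i)"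
  "!!i. EX L. ALL x:SS m. ALL y:SS m. |g i x - g i y| <= L * (\<Sum>j\<le>m. |x j - y j| )"
  "!!i x. x \<in> SS m ==> |f x i - g i x| < e" by metis
 obtain L where L: "!!i x y. x \<in> SS m ==> y \<in> SS m ==> |g i x - g i y| <= L i * (\<Sum>j\<le>m. |x j - y j| )"
  using g(2) by metis
 \<comment> \<open>Taking the odd part keeps a Lipschitz bound and, \<open>f\<close> being odd, the
   error \<open>e\<close>.\<close>
 define q where "q x i = (g i x - g i (%k. - x k)) / 2" for x i
 have qf: "|f x i - q x i| < e" if "x \<in> SS m" for x i
 proof -
  have "|f x i - g i x| < e" "|- f x i - g i (%k. - x k)| < e"
   using g(3)[OF that, of i] g(3)[OF uminus_SS[OF that], of i] oddf[OF that] by auto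
  moreover have "f x i - q x i = ((f x i - g i x) - (- f x i - g i (%k. - x k))) / 2"
   by (simp add: q_def diff_divide_distrib)
  ultimately show ?thesis unfolding abs_less_iff by (simp add: field_simps)
 qed
 have oddq: "q (%k. - x k) i = - q x i" for x i
 proof -
  have "g i (%k. - (- x k)) = g i x" by simp
  thus ?thesis unfolding q_def by (simp only: minus_divide_left minus_diff_eq)
 qed
 have cq: "continuous_map (nsphere m) euclideanreal (%x. q x i)" for i
 proof -
  have a: "continuous_map (nsphere m) (nsphere m) (%x k. - x k)"
   using homeomorphic_map_antipode homeomorphic_imp_continuous_map by blast
  have b: "continuous_map (nsphere m) euclideanreal (g i)"
   using g(1) continuous_map_nsphere_iff by blast
  have "continuous_map (nsphere m) euclideanreal (%x. g i (%k. - x k))"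
   using continuous_map_compose[OF a b] by (simp add: o_def)
  thus ?thesis unfolding q_def
   using b by (intro continuous_map_real_divide continuous_map_diff) auto
 qed
 define Lm where "Lm = (\<Sum>i\<le>m. |L i| )"
 have Lip: "|q x i - q y i| <= Lm * (\<Sum>j\<le>m. |x j - y j| )" if "x \<in> SS m" "y \<in> SS m" "i <= m" for x y i
 proof -
  have "|q x i - q y i| <= L i * (\<Sum>j\<le>m. |x j - y j| )"
  proof -
   have "|(a - a') / 2 - (b - b') / 2| <= D" if "|a - b| <= D" "|a' - b'| <= D" for a a' b b' D :: real
    using that by (simp add: abs_le_iff field_simps)
   thus ?thesis unfolding q_def
    using L[OF that(1,2), of i] L[OF uminus_SS[OF that(1)] uminus_SS[OF that(2)], of i]
    by (simp add: abs_minus_commute)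
  qed
  also have "L i <= Lm" unfolding Lm_def
   using member_le_sum[of i "{..m}" "%i. |L i|"] that(3) by simp
  finally show ?thesis by (simp add: sum_nonneg mult_right_mono)
 qed
 have big: "EX i<=m. |f x i| >= 1 / (real m + 1)" if "x \<in> SS m" for x
 proof (rule ccontr)
  assume "\<not> ?thesis"
  hence "|f x i| < 1 / (real m + 1)" if "i <= m" for i using that by force
  hence "(f x i)^2 < (1 / (real m + 1))^2" if "i <= m" for i
   using that by (metis abs_ge_zero power2_abs power_strict_mono zero_less_numeral)
  hence "(\<Sum>i\<le>m. (f x i)^2) < (\<Sum>i\<le>m. (1 / (real m + 1))^2)" by (intro sum_strict_mono) auto
  also have "... = 1 / (real m + 1)" by (simp add: power2_eq_square add.commute)
  also have "... <= 1" by simp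
  finally show False using fS[OF that] by (simp add: SS_def)
 qed
 have e2: "1 / (real m + 1) = 2 * e" by (simp add: e_def field_simps)
 have bigq: "EX i<=m. |q x i| > e & |f x i| >= 2 * e" if x: "x \<in> SS m" for x
 proof -
  obtain i where i: "i <= m" "|f x i| >= 2 * e" using big[OF x] e2 by auto
  hence "|q x i| > e" using qf[OF x, of i] by linarith
  thus ?thesis using i by blast
 qed
 have h1: "homotopic_with (%_. True) (nsphere m) (nsphere m) (%x. unitize m (f x)) (%x. unitize m (q x))"
 proof (rule homotopic_unitize[OF cfi cq])
  fix x s assume x: "x \<in> topspace (nsphere m)" and s: "0 <= s" "s <= (1::real)"
  hence x': "x \<in> SS m" by (simp add: topspace_nsphere_SS)
  obtain i where i: "i <= m" "|f x i| >= 2 * e" using bigq[OF x'] by blast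
  have "(1 - s) * f x i + s * q x i = f x i - s * (f x i - q x i)" by (simp add: algebra_simps)
  moreover have "|s * (f x i - q x i)| <= 1 * e"
   unfolding abs_mult using qf[OF x', of i] s by (intro mult_mono) auto
  ultimately have "(1 - s) * f x i + s * q x i ~= 0" using i(2) e0 by linarith
  thus "EX i<=m. (1 - s) * f x i + s * q x i ~= 0" using i(1) by blast
 qed
 \<comment> \<open>The cone over the image of the equator: \<open>P\<close> is Lipschitz on bounded
   subsets of R^(n+1) = R^m with values in R^(m+1), so it misses a point \<open>v\<close> with all
   coordinates in [1,2]. The radius of \<open>D\<close> is 2/e: it bounds every t with t * q x = v,
   since the coordinates of \<open>v\<close> are at most 2 and some coordinate of q x exceeds
   e.\<close>
 define P where "P z i = L2_set z {..n} * q (unitize n z) i" for z i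
 define D where "D = {z::nat => real. ALL j<m. |z j| <= real (4 * (m + 1))}"
 have "EX v. (ALL i<=m. 1 <= v i & v i <= 2) & (ALL z:D. EX i<=m. P z i ~= v i)"
 proof (rule lipschitz_misses_point)
  fix z z' i assume "z \<in> D" "z' \<in> D" "i <= m"
  have "|P z i - P z' i| <= ((1 + e) + Lm * (real n + 2)) * (\<Sum>j\<le>n. |z j - z' j| )"
   unfolding P_def
  proof (rule cone_lipschitz)
   fix x y :: "nat => real" assume xy: "x \<in> SS n" "y \<in> SS n"
   hence "x \<in> SS m" "y \<in> SS m" "x m = 0" "y m = 0" using SS_equator m_def by auto
   thus "|q x i - q y i| <= Lm * (\<Sum>j\<le>n. |x j - y j| )"
    using Lip[of x y i] \<open>i <= m\<close> by (simp add: m_def)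
  next
   fix x :: "nat => real" assume "x \<in> SS n"
   hence "x \<in> SS m" using SS_equator m_def by auto
   thus "|q x i| <= 1 + e" using qf[of x i] SS_coord_le_1[OF fS, of x i] by linarith
  qed (use e0 in \<open>auto simp: Lm_def sum_nonneg\<close>)
  also have "... <= real (nat \<lceil>(1 + e) + Lm * (real n + 2)\<rceil>) * (\<Sum>j\<le>n. |z j - z' j| )"
   by (intro mult_right_mono) (auto simp: sum_nonneg real_nat_ceiling_ge)
  finally show "|P z i - P z' i| <= real (nat \<lceil>(1 + e) + Lm * (real n + 2)\<rceil>) * (\<Sum>j<m. |z j - z' j| )"
   by (simp add: m_def lessThan_Suc_atMost)
 next
  fix z j assume "z \<in> D" "j < m"
  thus "|z j| <= real (4 * (m + 1))" by (simp add: D_def)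
 qed
 then obtain v where v: "!!i. i <= m ==> 1 <= v i & v i <= 2" "!!z. z \<in> D ==> EX i<=m. P z i ~= v i" by blast
 \<comment> \<open>Off the last coordinate, \<open>F\<close> projects q x along \<open>v\<close>
   onto the hyperplane where the last coordinate is 0; the factor |x m| makes the last coordinate
   vanish on the equator without losing oddness. A zero on the segment from q x to F x would force s
   = 1, x on the equator and q x parallel to \<open>v\<close>, which the choice of \<open>v\<close>
   excludes.\<close>
 define F where "F x i = (if i = m then |x m| * q x m else q x i - q x m * (v i / v m))" for x i
 have F0: "EX i<=m. (1 - s) * q x i + s * F x i ~= 0" if x: "x \<in> SS m" and s: "0 <= s" "s <= 1" for x s
 proof (rule ccontr)
  assume "\<not> ?thesis"
  hence z: "(1 - s) * q x i + s * F x i = 0" if "i <= m" for i using that by blast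
  obtain k where k: "k <= m" "|q x k| > e" using bigq[OF x] by blast
  have zi: "q x i = s * q x m * (v i / v m)" if "i < m" for i
   using z[of i] that by (simp add: F_def algebra_simps)
  have qm: "q x m ~= 0"
  proof
   assume "q x m = 0"
   hence "q x k = 0" using zi[of k] k(1) by (cases "k = m") auto
   thus False using k e0 by simp
  qed
  have "((1 - s) + s * |x m| ) * q x m = 0" using z[of m] by (simp add: F_def algebra_simps)
  hence "(1 - s) + s * |x m| = 0" using qm by simp
  moreover have "s * |x m| >= 0" using s by simp
  ultimately have "1 - s = 0 & s * |x m| = 0" using s by linarith
  hence s1: "s = 1" "x m = 0" by auto
  have xn: "x \<in> SS n" using SS_equator_conv[of x n] x s1(2) unfolding m_def by blast
  define t where "t = v m / q x m"
  have vt: "v i = t * q x i" if "i <= m" for i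
   using zi[of i] that qm v(1)[of m] s1 by (cases "i = m") (auto simp: t_def field_simps)
  have t: "|t| <= real (4 * (m + 1))"
  proof -
   have "|t| * |q x k| <= 2" using vt[OF k(1)] v(1)[OF k(1)] by (simp flip: abs_mult)
   moreover have "|t| * e <= |t| * |q x k|" using k(2) by (intro mult_left_mono) auto
   ultimately have "|t| * e <= 2" by linarith
   thus ?thesis by (simp add: e_def field_simps)
  qed
  define z where "z = (%i. t * x i)"
  have zD: "z \<in> D"
  proof -
   have "|t * x j| <= real (4 * (m + 1)) * 1" for j
    unfolding abs_mult using t SS_coord_le_1[OF x, of j] by (intro mult_mono) auto
   thus ?thesis by (simp add: D_def z_def)
  qed
  have t0: "t ~= 0" using vt[of m] v(1)[of m] by auto
  have "L2_set x {..n} = 1" using xn by (simp add: L2_set_def SS_def)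
  hence Lz: "L2_set z {..n} = |t|"
   unfolding z_def L2_set_def power_mult_distrib sum_distrib_left[symmetric] by (simp add: real_sqrt_mult)
  have "unitize n z = (%i. sgn t * x i)"
   using xn t0 unfolding unitize_def Lz by (auto simp: z_def fun_eq_iff sgn_if SS_def)
  hence "P z i = t * q x i" for i
   unfolding P_def Lz using t0 oddq[of x i] by (cases "t > 0") (auto simp: sgn_if)
  thus False using v(2)[OF zD] vt by auto
 qed
 have cF: "continuous_map (nsphere m) euclideanreal (%x. F x i)" for i
 proof (cases "i = m")
  case True
  thus ?thesis unfolding F_def
   by (auto intro!: continuous_map_real_mult continuous_map_real_abs cq continuous_map_nsphere_projection)
 next
  case False
  have "continuous_map (nsphere m) euclideanreal (%x. q x i - q x m * (v i / v m))"
   by (intro continuous_map_diff continuous_map_real_mult cq) (rule continuous_map_const[THEN iffD2], simp)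
  thus ?thesis using False by (simp add: F_def)
 qed
 have h2: "homotopic_with (%_. True) (nsphere m) (nsphere m) (%x. unitize m (q x)) (%x. unitize m (F x))"
  by (rule homotopic_unitize[OF cq cF]) (use F0 topspace_nsphere_SS in auto)
 define F' where "F' x = unitize m (F x)" for x
 have "Brouwer_degree2 m f = Brouwer_degree2 m (%x. unitize m (f x))"
  by (rule Brouwer_degree2_eq) (metis fS unitize_id topspace_nsphere_SS)
 also have "... = Brouwer_degree2 m F'"
  unfolding F'_def by (rule Brouwer_degree2_homotopic[OF homotopic_with_trans[OF h1 h2]])
 finally have deg: "Brouwer_degree2 m f = Brouwer_degree2 m F'" .
 have cF': "continuous_map (nsphere m) (nsphere m) F'"
  using h2 unfolding F'_def by (rule homotopic_with_imp_continuous_maps[THEN conjunct2])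
 have oddF': "F' (%i. - x i) = (%i. - F' x i)" for x
 proof -
  have "F (%i. - x i) = (%i. - F x i)" by (auto simp: F_def oddq fun_eq_iff)
  thus ?thesis by (simp add: F'_def unitize_minus)
 qed
 have eq: "F' x \<in> SS n" if "x \<in> SS n" for x
 proof -
  have x: "x \<in> SS m" "x m = 0" using SS_equator[OF that] m_def by auto
  have "EX i<=m. F x i ~= 0" using F0[OF x(1), of 1] by simp
  hence "F' x \<in> SS m" unfolding F'_def by (rule unitize_in_SS)
  moreover have "F' x m = 0" using x(2) by (simp add: F'_def unitize_def F_def)
  ultimately show ?thesis using SS_equator_conv[of "F' x" n] unfolding m_def by blast
 qed
 have cF'n: "continuous_map (nsphere n) (nsphere n) F'"
 proof -
  have "continuous_map (nsphere n) (nsphere m) F'"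
   using continuous_map_from_subtopology[OF cF', of "{x. x m = 0}"]
   by (simp add: m_def subtopology_nsphere_equator)
  hence "continuous_map (nsphere n) (subtopology (nsphere m) {x. x m = 0}) F'"
   using eq SS_equator by (auto simp: continuous_map_in_subtopology topspace_nsphere_SS m_def)
  thus ?thesis by (simp add: m_def subtopology_nsphere_equator)
 qed
 have "odd (Brouwer_degree2 n F')" by (rule Suc.IH[OF cF'n oddF'])
 moreover have "even (Brouwer_degree2 m F' - Brouwer_degree2 (m - Suc 0) F')"
  by (rule Borsuk_odd_mapping_degree_step[OF cF']) (use eq oddF' in \<open>auto simp: m_def topspace_nsphere_SS\<close>)
 ultimately show ?case using deg by (simp add: m_def)
qed

text \<open>A zero-free odd map, padded by a zero coordinate, takes values in the equator after
  normalisation and is therefore homotopic to the constant map at the pole, of degree 0; but its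
  degree is odd.\<close>

theorem borsuk_ulam:
 fixes g :: "(nat => real) => nat => real"
 assumes cont: "!!i. i < m ==> continuous_map (nsphere m) euclideanreal (%x. g x i)"
  and odd: "!!x i. x \<in> SS m ==> i < m ==> g (%i. - x i) i = - g x i"
 shows "EX x:SS m. ALL i<m. g x i = 0"
proof (rule ccontr)
 assume "\<not> ?thesis"
 hence nz: "EX i<m. g x i ~= 0" if "x \<in> SS m" for x using that by blast
 define f where "f x i = (if i < m then g x i else 0)" for x i
 define c where "c x i = (if i = m then 1 else 0::real)" for x :: "nat => real" and i
 have cf: "continuous_map (nsphere m) euclideanreal (%x. f x i)" for i
  using cont by (auto simp: f_def)
 have h: "homotopic_with (%_. True) (nsphere m) (nsphere m) (%x. unitize m (f x)) (%x. unitize m (c x))"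
 proof (rule homotopic_unitize[OF cf])
  fix x s assume "x \<in> topspace (nsphere m)" "0 <= s" "s <= (1::real)"
  then obtain i where "i < m" "g x i ~= 0" using nz topspace_nsphere_SS by blast
  thus "EX i<=m. (1 - s) * f x i + s * c x i ~= 0"
   by (cases "s = 0") (auto simp: f_def c_def intro!: exI[of _ "if s = 0 then i else m"])
 qed (simp add: c_def)
 have "Brouwer_degree2 m (%x. unitize m (f x)) = Brouwer_degree2 m (%x. unitize m (c x))"
  by (rule Brouwer_degree2_homotopic[OF h])
 also have "... = 0" unfolding c_def by (rule Brouwer_degree2_const)
 finally have "even (Brouwer_degree2 m (%x. unitize m (f x)))" by simp
 moreover have "odd (Brouwer_degree2 m (%x. unitize m (f x)))"
 proof (rule odd_Brouwer_degree)
  show "continuous_map (nsphere m) (nsphere m) (%x. unitize m (f x))"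
   using h homotopic_with_imp_continuous_maps by blast
  fix x assume x: "x \<in> SS m"
  have "f (%i. - x i) = (%i. - f x i)" using odd[OF x] by (auto simp: f_def fun_eq_iff)
  thus "unitize m (f (%i. - x i)) = (%i. - unitize m (f x) i)" by (simp add: unitize_minus)
 qed
 ultimately show False by simp
qed

notation LIMSEQ (infix "---->" 60)

section \<open>Constrained critical points in a semi-Hilbert space\<close>

instantiation "fun" :: (type, real_vector) real_vector
begin

definition scaleR_fun :: "real => ('a => 'b) => 'a => 'b" where
 "scaleR_fun c u = (%x. c *\<^sub>R u x)"

instance
 by standard (auto simp: scaleR_fun_def fun_eq_iff scaleR_add_right scaleR_add_left)

end

lemma scaleR_fun_apply [simp]: "(c *\<^sub>R u) x = c *\<^sub>R u x"
 by (simp add: scaleR_fun_def)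

lemma null_comparison:
 fixes a b :: "nat => real"
 assumes "!!n. |a n| <= C * b n" "b ----> 0"
 shows "a ----> 0"
proof (rule Lim_null_comparison)
 show "eventually (%n. norm (a n) <= C * b n) sequentially" using assms(1) by (intro always_eventually) auto
 show "(%n. C * b n) ----> 0" by (rule tendsto_mult_right_zero[OF assms(2)])
qed

text \<open>The carrier is a subset of a vector space and \<open>ip\<close> may vanish on nonzero
  vectors, as happens for functions not identified almost everywhere. Limits provided by
  \<open>complete\<close> are unique only up to seminorm 0.\<close>

locale semi_hilbert =
 fixes V :: "'a::real_vector set" and ip :: "'a => 'a => real"
 assumes zero_V: "0 \<in> V"
  and add_V: "u \<in> V ==> v \<in> V ==> u + v \<in> V"
  and scale_V: "u \<in> V ==> c *\<^sub>R u \<in> V"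
  and ip_sym: "u \<in> V ==> v \<in> V ==> ip u v = ip v u"
  and ip_add: "u \<in> V ==> v \<in> V ==> w \<in> V ==> ip (u + v) w = ip u w + ip v w"
  and ip_scale: "u \<in> V ==> w \<in> V ==> ip (c *\<^sub>R u) w = c * ip u w"
  and ip_nonneg: "u \<in> V ==> ip u u >= 0"
  and complete: "!!s. (ALL n::nat. s n \<in> V) ==>
    (ALL e>0. EX N. ALL m>=N. ALL n>=N. ip (s m - s n) (s m - s n) < e) ==>
    EX u:V. (%n. ip (s n - u) (s n - u)) ----> 0"
begin

definition nm :: "'a => real" where "nm u = sqrt (ip u u)"

lemma minus_V: "u \<in> V ==> - u \<in> V"
 using scale_V[of u "-1"] by simp

lemma diff_V: "u \<in> V ==> v \<in> V ==> u - v \<in> V"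
 using add_V[of u "- v"] minus_V by simp

lemma sum_V: "(!!i. i \<in> A ==> e i \<in> V) ==> sum e A \<in> V"
 by (induction A rule: infinite_finite_induct) (auto intro: zero_V add_V)

lemma ip_add2: "u \<in> V ==> v \<in> V ==> w \<in> V ==> ip w (u + v) = ip w u + ip w v"
 using ip_add[of u v w] by (simp add: ip_sym add_V)

lemma ip_scale2: "u \<in> V ==> w \<in> V ==> ip w (c *\<^sub>R u) = c * ip w u"
 using ip_scale[of u w c] by (simp add: ip_sym scale_V)

lemma ip_minus: "u \<in> V ==> w \<in> V ==> ip (- u) w = - ip u w"
 using ip_scale[of u w "-1"] by simp

lemma ip_minus2: "u \<in> V ==> w \<in> V ==> ip w (- u) = - ip w u"
 using ip_scale2[of u w "-1"] by simp

lemma ip_diff: "u \<in> V ==> v \<in> V ==> w \<in> V ==> ip (u - v) w = ip u w - ip v w"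
 using ip_add[of u "- v" w] by (simp add: ip_minus minus_V)

lemma ip_diff2: "u \<in> V ==> v \<in> V ==> w \<in> V ==> ip w (u - v) = ip w u - ip w v"
 using ip_add2[of u "- v" w] by (simp add: ip_minus2 minus_V)

lemmas ip_simps = ip_add ip_add2 ip_diff ip_diff2 ip_scale ip_scale2 ip_minus ip_minus2
lemmas V_intros = zero_V add_V scale_V minus_V diff_V

lemma nm_nonneg: "u \<in> V ==> nm u >= 0"
 by (simp add: nm_def ip_nonneg)

lemma nm_sq: "u \<in> V ==> (nm u)^2 = ip u u"
 by (simp add: nm_def ip_nonneg)

lemma cauchy_schwarz:
 assumes "u \<in> V" "v \<in> V"
 shows "|ip u v| <= nm u * nm v"
proof -
 have q: "0 <= ip u u - 2 * t * ip u v + t^2 * ip v v" for t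
 proof -
  have "0 <= ip (u - t *\<^sub>R v) (u - t *\<^sub>R v)" by (intro ip_nonneg V_intros assms)
  thus ?thesis using assms
   by (simp add: ip_simps V_intros ip_sym[of v u] power2_eq_square algebra_simps)
 qed
 have "(ip u v)^2 <= ip u u * ip v v"
 proof (cases "ip v v = 0")
  case True
  have "ip u v = 0"
  proof (rule ccontr)
   assume "ip u v ~= 0"
   thus False using q[of "(ip u u + 1) / (2 * ip u v)"] True by simp
  qed
  thus ?thesis using True by simp
 next
  case False
  hence "ip v v > 0" using ip_nonneg[OF assms(2)] by simp
  thus ?thesis using q[of "ip u v / ip v v"]
   by (simp add: field_simps power2_eq_square)
 qed
 hence "(ip u v)^2 <= (nm u * nm v)^2" by (simp add: power_mult_distrib nm_sq assms)
 thus ?thesis using nm_nonneg assms by (metis abs_le_square_iff abs_of_nonneg mult_nonneg_nonneg)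
qed

lemma nm_triangle:
 assumes "u \<in> V" "v \<in> V"
 shows "nm (u + v) <= nm u + nm v"
proof (rule power2_le_imp_le)
 have "(nm (u + v))^2 = (nm u)^2 + 2 * ip u v + (nm v)^2"
  using assms by (simp add: nm_sq V_intros ip_simps ip_sym[of v u])
 also have "... <= (nm u + nm v)^2"
  using cauchy_schwarz[OF assms] by (simp add: power2_sum)
 finally show "(nm (u + v))^2 <= (nm u + nm v)^2" .
qed (simp add: assms nm_nonneg)

lemma nm_scale: "u \<in> V ==> nm (c *\<^sub>R u) = |c| * nm u"
 by (simp add: nm_def ip_simps V_intros real_sqrt_mult real_sqrt_abs flip: power2_eq_square mult.assoc)

lemma nm_minus: "u \<in> V ==> nm (- u) = nm u"
 using nm_scale[of u "-1"] by simp

lemma nm_minus_commute: "u \<in> V ==> v \<in> V ==> nm (u - v) = nm (v - u)"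
 using nm_minus[of "u - v"] by (simp add: diff_V)

lemma nm_triangle_diff: "u \<in> V ==> v \<in> V ==> nm (u - v) <= nm u + nm v"
 using nm_triangle[of u "- v"] by (simp add: nm_minus V_intros)

lemma nm_zero: "nm 0 = 0"
 using nm_scale[OF zero_V, of 0] by simp

lemma nm_sum:
 assumes "finite A" "!!i. i \<in> A ==> e i \<in> V"
 shows "nm (\<Sum>i\<in>A. c i *\<^sub>R e i) <= (\<Sum>i\<in>A. |c i| * nm (e i))"
 using assms
proof (induction rule: finite_induct)
 case (insert j A)
 have "nm (c j *\<^sub>R e j + (\<Sum>i\<in>A. c i *\<^sub>R e i)) <= nm (c j *\<^sub>R e j) + nm (\<Sum>i\<in>A. c i *\<^sub>R e i)"
  using insert.prems by (intro nm_triangle scale_V sum_V) auto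
 thus ?case using insert by (simp add: nm_scale)
qed (simp add: nm_zero)

lemma nm_conv_nm:
 assumes "!!n. s n \<in> V" "u \<in> V" "(%n. nm (s n - u)) ----> 0"
 shows "(%n. nm (s n)) ----> nm u"
proof -
 have "|nm (s n) - nm u| <= nm (s n - u)" for n
  using nm_triangle[of "s n - u" u] nm_triangle[of "u - s n" "s n"] nm_minus_commute[of u "s n"]
  by (simp add: assms V_intros abs_le_iff)
 hence "(%n. nm (s n) - nm u) ----> 0"
  by (intro Lim_null_comparison[OF _ assms(3)]) auto
 thus ?thesis by (simp add: LIM_zero_iff)
qed

lemma complete_nm:
 assumes s: "!!n. s n \<in> V" and "!!e. e > 0 ==> EX N. ALL m>=N. ALL n>=N. nm (s m - s n) < e"
 shows "EX u:V. (%n. nm (s n - u)) ----> 0"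
proof -
 have "EX u:V. (%n. ip (s n - u) (s n - u)) ----> 0"
 proof (rule complete)
  show "ALL e>0. EX N. ALL m>=N. ALL n>=N. ip (s m - s n) (s m - s n) < e"
  proof (intro allI impI)
   fix e :: real assume "e > 0"
   then obtain N where N: "ALL m>=N. ALL n>=N. nm (s m - s n) < sqrt e" using assms(2)[of "sqrt e"] by auto
   thus "EX N. ALL m>=N. ALL n>=N. ip (s m - s n) (s m - s n) < e"
    by (auto simp: nm_def)
  qed
 qed (use s in blast)
 then obtain u where u: "u \<in> V" "(%n. ip (s n - u) (s n - u)) ----> 0" by blast
 hence "(%n. nm (s n - u)) ----> sqrt 0" unfolding nm_def by (intro tendsto_real_sqrt)
 thus ?thesis using u by auto
qed

text \<open>The representing vector minimises ip v v / 2 - L v. By the parallelogram identity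
  minimising sequences are Cauchy, so the argument passes through neither orthogonal complements nor
  a quotient by null vectors.\<close>

lemma riesz:
 assumes Ladd: "!!v w. v \<in> V ==> w \<in> V ==> L (v + w) = L v + L w"
  and Lscale: "!!v c. v \<in> V ==> L (c *\<^sub>R v) = c * L v"
  and Lbdd: "!!v. v \<in> V ==> |L v| <= C * nm v"
 shows "EX z:V. ALL v:V. ip z v = L v"
proof -
 define J where "J v = ip v v / 2 - L v" for v
 have J_below: "J v >= - C\<^sup>2 / 2" if "v \<in> V" for v
 proof -
  have "0 <= (nm v - C)^2" by simp
  hence "C * nm v <= (nm v)^2 / 2 + C^2 / 2" by (simp add: power2_eq_square algebra_simps)
  thus ?thesis using Lbdd[OF that] that by (simp add: J_def nm_sq abs_le_iff)
 qed
 define m where "m = Inf (J ` V)"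
 have bb: "bdd_below (J ` V)" using J_below by (intro bdd_belowI2)
 have m_le: "m <= J v" if "v \<in> V" for v unfolding m_def using that bb by (intro cINF_lower)
 have "EX v:V. J v < m + 1 / (real n + 1)" for n
  using cINF_less_iff[OF _ bb, of "m + 1 / (real n + 1)"] zero_V by (auto simp: m_def)
 then obtain s where s: "!!n. s n \<in> V" "!!n. J (s n) < m + 1 / (real n + 1)" by metis
 have par: "ip (u - v) (u - v) <= 4 * (J u + J v - 2 * m)" if "u \<in> V" "v \<in> V" for u v
 proof -
  have "m <= J ((1/2) *\<^sub>R (u + v))" using that by (intro m_le V_intros)
  moreover have "ip (u - v) (u - v) = 4 * (J u + J v - 2 * J ((1/2) *\<^sub>R (u + v)))"
   using that by (simp add: J_def ip_simps V_intros Ladd Lscale ip_sym[of v u] algebra_simps)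
  ultimately show ?thesis by simp
 qed
 have "EX u:V. (%n. ip (s n - u) (s n - u)) ----> 0"
 proof (rule complete)
  show "ALL e>0. EX N. ALL m>=N. ALL n>=N. ip (s m - s n) (s m - s n) < e"
  proof (intro allI impI)
   fix e :: real assume e: "e > 0"
   obtain N where N: "1 / (real N + 1) < e / 8"
    using e reals_Archimedean[of "e/8"] by (auto simp: inverse_eq_divide add.commute)
   have "ip (s i - s j) (s i - s j) < e" if "i >= N" "j >= N" for i j
   proof -
    have "1 / (real i + 1) <= 1 / (real N + 1)" "1 / (real j + 1) <= 1 / (real N + 1)"
     using that by (auto simp: field_simps)
    thus ?thesis using par[OF s(1) s(1), of i j] s(2)[of i] s(2)[of j] N by argo
   qed
   thus "EX N. ALL m>=N. ALL n>=N. ip (s m - s n) (s m - s n) < e" by blast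
  qed
 qed (use s in blast)
 then obtain z where z: "z \<in> V" "(%n. ip (s n - z) (s n - z)) ----> 0" by blast
 have nmz: "(%n. nm (s n - z)) ----> 0"
  using tendsto_real_sqrt[OF z(2)] by (simp add: nm_def)
 have Jz: "J z <= m"
 proof -
  have "(%n. (nm (s n))^2 / 2) ----> (nm z)^2 / 2"
   by (intro tendsto_intros nm_conv_nm s z nmz) auto
  moreover have "(%n. L (s n)) ----> L z"
  proof -
   have "|L (s n) - L z| <= C * nm (s n - z)" for n
    using Lbdd[of "s n - z"] Ladd[of "s n - z" z] s(1) z by (simp add: V_intros)
   hence "(%n. L (s n) - L z) ----> 0"
    by (rule null_comparison[OF _ nmz])
   thus ?thesis by (simp add: LIM_zero_iff)
  qed
  ultimately have "(%n. J (s n)) ----> J z"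
   unfolding J_def using s z by (auto simp: nm_sq intro: tendsto_diff)
  moreover have "(%n. m + 1 / (real n + 1)) ----> m + 0"
   by (intro tendsto_intros) (use LIMSEQ_inverse_real_of_nat in \<open>simp add: inverse_eq_divide add.commute\<close>)
  ultimately show ?thesis using s(2) by (intro LIMSEQ_le[of "%n. J (s n)"]) (auto intro: less_imp_le)
 qed
 have "ip z v = L v" if v: "v \<in> V" for v
 proof -
  define d where "d = ip z v - L v"
  have q: "0 <= t * d + t^2 / 2 * ip v v" for t
  proof -
   have "J z <= J (z + t *\<^sub>R v)" using Jz m_le[OF add_V[OF z(1) scale_V[OF v]], of t] by linarith
   thus ?thesis using z v
    by (simp add: J_def d_def ip_simps V_intros Ladd Lscale ip_sym[of v z] power2_eq_square algebra_simps)
  qed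
  have "d = 0"
  proof (rule ccontr)
   assume d: "d ~= 0"
   \<comment> \<open>The variation of size -d/K would lower the functional; adding 1 keeps
     \<open>K\<close> positive when \<open>v\<close> is a null vector.\<close>
   define K where "K = ip v v + 1"
   have K: "K > 0" "ip v v <= K" using ip_nonneg[OF v] by (auto simp: K_def)
   have "0 <= - (d / K) * d + (d / K)^2 / 2 * ip v v" using q[of "- (d / K)"] by simp
   also have "... <= - (d / K) * d + (d / K)^2 / 2 * K" using K by (intro add_left_mono mult_left_mono) auto
   also have "... = - d\<^sup>2 / (2 * K)" using K by (simp add: power2_eq_square field_simps)
   also have "... < 0" using K d by simp
   finally show False by simp
  qed
  thus ?thesis by (simp add: d_def)
 qed
 thus ?thesis using z by blast
qed

end

text \<open>Differentiability and continuity of the derivative are required uniformly on bounded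
  sets, since the descent step acts on all of a sublevel set at once. \<open>compact_d\<close> is
  compactness of the derivative in the form used by the Palais-Smale argument: on a bounded
  sequence, after passing to a subsequence, \<open>dPhi\<close> at one term hardly sees differences
  of terms.\<close>

locale c1_functional = semi_hilbert V ip
 for V :: "'a::real_vector set" and ip +
 fixes Phi :: "'a => real" and dPhi :: "'a => 'a => real"
 assumes d_add: "u \<in> V ==> v \<in> V ==> w \<in> V ==> dPhi u (v + w) = dPhi u v + dPhi u w"
  and d_scale: "u \<in> V ==> v \<in> V ==> dPhi u (c *\<^sub>R v) = c * dPhi u v"
  and d_odd: "u \<in> V ==> v \<in> V ==> dPhi (- u) v = - dPhi u v"
  and even: "u \<in> V ==> Phi (- u) = Phi u"
  and bdd: "!!R. EX C>=0. ALL u:V. nm u <= R --> |Phi u| <= C & (ALL w:V. |dPhi u w| <= C * nm w)"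
  and diff: "!!R e. e > 0 ==> EX d>0. ALL u:V. ALL v:V. nm u <= R --> nm v <= R --> nm (v - u) <= d -->
    |Phi v - Phi u - dPhi u (v - u)| <= e * nm (v - u)"
  and cont: "!!R e. e > 0 ==> EX d>0. ALL u:V. ALL v:V. nm u <= R --> nm v <= R --> nm (v - u) <= d -->
    (ALL w:V. |dPhi v w - dPhi u w| <= e * nm w)"
  and compact_d: "!!s R. (!!n::nat. s n \<in> V) ==> (!!n. nm (s n) <= R) ==>
    EX r::nat => nat. strict_mono r & (ALL e>0. EX N. ALL m>=N. ALL n>=N. |dPhi (s (r m)) (s (r m) - s (r n))| <= e)"
begin

lemma d_minus: "u \<in> V ==> v \<in> V ==> dPhi u (- v) = - dPhi u v"
 using d_scale[of u v "-1"] by simp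

lemma d_diff: "u \<in> V ==> v \<in> V ==> w \<in> V ==> dPhi u (v - w) = dPhi u v - dPhi u w"
 using d_add[of u v "- w"] d_minus[of u w] minus_V[of w] by simp

lemma bdd_seq:
 assumes s: "!!n. s n \<in> V" and u: "u \<in> V" and conv: "(%n. nm (s n - u)) ----> 0"
 shows "EX R. nm u <= R & (ALL n. nm (s n) <= R)"
proof -
 have "Bseq (%n. nm (s n))" using nm_conv_nm[OF assms] convergent_imp_Bseq convergentI by blast
 then obtain K where "!!n. |nm (s n)| <= K" by (auto simp: Bseq_def)
 thus ?thesis by (intro exI[of _ "max K (nm u)"]) (auto intro: order_trans[OF abs_ge_self] simp: le_max_iff_disj)
qed

lemma d_conv:
 assumes s: "!!n. s n \<in> V" and u: "u \<in> V" and conv: "(%n. nm (s n - u)) ----> 0" and e: "e > 0"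
 shows "eventually (%n. ALL w:V. |dPhi (s n) w - dPhi u w| <= e * nm w) sequentially"
proof -
 obtain R where R: "nm u <= R" "!!n. nm (s n) <= R" using bdd_seq[OF s u conv] by blast
 obtain d where d: "d > 0" "!!v. v \<in> V ==> nm v <= R ==> nm (v - u) <= d ==>
   ALL w:V. |dPhi v w - dPhi u w| <= e * nm w"
  using cont[OF e, of R] u R(1) by blast
 have "eventually (%n. nm (s n - u) < d) sequentially" using order_tendstoD(2)[OF conv d(1)] .
 thus ?thesis by eventually_elim (use d(2) s R in auto)
qed

lemma d_conv_fix:
 assumes s: "!!n. s n \<in> V" and u: "u \<in> V" and conv: "(%n. nm (s n - u)) ----> 0" and w: "w \<in> V"
 shows "(%n. dPhi (s n) w) ----> dPhi u w"
proof (rule tendstoI)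
 fix e :: real assume e: "e > 0"
 define e' where "e' = e / (2 * (nm w + 1))"
 have nw: "nm w >= 0" by (rule nm_nonneg[OF w])
 have e': "e' > 0" using e nw by (simp add: e'_def)
 have "e' * nm w < e"
 proof -
  have "e' * nm w <= e' * (nm w + 1)" using e' by (intro mult_left_mono) auto
  also have "... = e / 2" using nw by (simp add: e'_def field_simps)
  finally show ?thesis using e by simp
 qed
 thus "eventually (%n. dist (dPhi (s n) w) (dPhi u w) < e) sequentially"
  using d_conv[OF s u conv e'] by (auto elim!: eventually_mono simp: dist_real_def intro: le_less_trans w)
qed

lemma d_conv_self:
 assumes s: "!!n. s n \<in> V" and u: "u \<in> V" and conv: "(%n. nm (s n - u)) ----> 0"
 shows "(%n. dPhi (s n) (s n)) ----> dPhi u u"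
proof -
 obtain R where R: "nm u <= R" "!!n. nm (s n) <= R" using bdd_seq[OF assms] by blast
 obtain C where C: "C >= 0" "!!v w. v \<in> V ==> nm v <= R ==> w \<in> V ==> |dPhi v w| <= C * nm w"
  using bdd[of R] by blast
 have "(%n. dPhi (s n) (s n - u)) ----> 0"
  by (rule null_comparison[OF C(2)[OF s R(2) diff_V[OF s u]] conv])
 moreover have "(%n. dPhi (s n) u) ----> dPhi u u" by (rule d_conv_fix[OF assms u])
 ultimately have "(%n. dPhi (s n) (s n - u) + dPhi (s n) u) ----> 0 + dPhi u u" by (rule tendsto_add)
 thus ?thesis using s u by (simp add: d_diff)
qed

lemma conv:
 assumes s: "!!n. s n \<in> V" and u: "u \<in> V" and conv: "(%n. nm (s n - u)) ----> 0"
 shows "(%n. Phi (s n)) ----> Phi u"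
proof -
 obtain R where R: "nm u <= R" "!!n. nm (s n) <= R" using bdd_seq[OF assms] by blast
 obtain C where C: "C >= 0" "!!v w. v \<in> V ==> nm v <= R ==> w \<in> V ==> |dPhi v w| <= C * nm w"
  using bdd[of R] by blast
 obtain d where d: "d > 0" "!!v. v \<in> V ==> nm v <= R ==> nm (v - u) <= d ==>
   |Phi v - Phi u - dPhi u (v - u)| <= 1 * nm (v - u)"
  using diff[of 1 R] u R(1) zero_less_one by blast
 have "eventually (%n. nm (s n - u) < d) sequentially" using order_tendstoD(2)[OF conv d(1)] .
 hence "eventually (%n. norm (Phi (s n) - Phi u) <= (C + 1) * nm (s n - u)) sequentially"
 proof eventually_elim
  case (elim n)
  have "|Phi (s n) - Phi u - dPhi u (s n - u)| <= nm (s n - u)" using d(2)[of "s n"] s R elim by auto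
  moreover have "|dPhi u (s n - u)| <= C * nm (s n - u)" using C(2)[OF u R(1) diff_V[OF s u]] .
  ultimately show ?case by (simp add: algebra_simps)
 qed
 hence "(%n. Phi (s n) - Phi u) ----> 0"
  using tendsto_mult_right_zero[OF conv, of "C + 1"] by (rule Lim_null_comparison)
 thus ?thesis by (simp add: LIM_zero_iff)
qed

end

context c1_functional
begin

text \<open>Base points and directions vary with n, so that the failure of a uniform first-order
  estimate can be refuted along sequences.\<close>

lemma diff_seq:
 assumes u: "!!n. u n \<in> V" "!!n. nm (u n) <= R" and w: "!!n. w n \<in> V" "!!n. nm (w n) <= K"
  and t: "!!n::nat. t n > 0" "t ----> 0"
 shows "(%n. (Phi (u n + t n *\<^sub>R w n) - Phi (u n)) / t n - dPhi (u n) (w n)) ----> 0"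
proof (rule tendstoI)
 fix e :: real assume e: "e > 0"
 have K0: "K >= 0" using order_trans[OF nm_nonneg[OF w(1)] w(2)] .
 define e' where "e' = e / (K + 1)"
 have e': "e' > 0" using e K0 by (simp add: e'_def)
 have e'K: "e' * K < e" using e K0 by (simp add: e'_def field_simps)
 obtain d where d: "d > 0" "!!u v. u \<in> V ==> v \<in> V ==> nm u <= R + K ==> nm v <= R + K ==> nm (v - u) <= d ==>
    |Phi v - Phi u - dPhi u (v - u)| <= e' * nm (v - u)"
  using diff[OF e', of "R + K"] by blast
 have "eventually (%n. t n < min 1 (d / (K + 1))) sequentially"
  by (rule order_tendstoD(2)[OF t(2)]) (use d(1) K0 in simp)
 thus "eventually (%n. dist ((Phi (u n + t n *\<^sub>R w n) - Phi (u n)) / t n - dPhi (u n) (w n)) 0 < e) sequentially"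
 proof eventually_elim
  case (elim n)
  have tn: "t n > 0" "t n < 1" "t n < d / (K + 1)" using elim t(1) by auto
  let ?v = "u n + t n *\<^sub>R w n"
  have nmtw: "nm (t n *\<^sub>R w n) <= t n * K" using w tn by (simp add: nm_scale)
  have tK: "t n * K <= K" "t n * K <= d"
  proof -
   show "t n * K <= K" using tn K0 by (simp add: mult_left_le_one_le)
   have "t n * K <= t n * (K + 1)" using tn by simp
   also have "... <= d" using tn(3) K0 by (simp add: field_simps)
   finally show "t n * K <= d" .
  qed
  have "|Phi ?v - Phi (u n) - dPhi (u n) (?v - u n)| <= e' * nm (?v - u n)"
  proof (rule d(2))
   show "nm ?v <= R + K" using nm_triangle[of "u n" "t n *\<^sub>R w n"] u w nmtw tK
    by (smt (verit) scale_V)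
   show "nm (?v - u n) <= d" using nmtw tK by simp
   show "u n \<in> V" "?v \<in> V" by (intro V_intros u w)+
   show "nm (u n) <= R + K" using u(2)[of n] K0 by linarith
  qed
  hence a: "|Phi ?v - Phi (u n) - t n * dPhi (u n) (w n)| <= e' * (t n * K)"
   using nmtw e' u w by (simp add: d_scale) (smt (verit) mult_left_mono)
  have "|(Phi ?v - Phi (u n)) / t n - dPhi (u n) (w n)| = |Phi ?v - Phi (u n) - t n * dPhi (u n) (w n)| / t n"
  proof -
   have "(Phi ?v - Phi (u n)) / t n - dPhi (u n) (w n) = (Phi ?v - Phi (u n) - t n * dPhi (u n) (w n)) / t n"
    using tn by (simp add: field_simps)
   thus ?thesis using tn by simp
  qed
  also have "... <= e' * (t n * K) / t n" using a tn by (intro divide_right_mono) auto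
  also have "... = e' * K" using tn by simp
  finally show ?case using e'K by (simp add: dist_real_def)
 qed
qed

end

section \<open>Constrained gradient steps and the Palais-Smale condition\<close>

lemma null_times_bdd:
 fixes a b :: "nat => real"
 assumes "a ----> 0" "!!n. |b n| <= K"
 shows "(%n. a n * b n) ----> 0"
proof (rule Lim_null_comparison)
 show "(%n. |a n| * K) ----> 0" using tendsto_mult_left_zero[OF tendsto_rabs_zero[OF assms(1)]] .
 show "eventually (%n. norm (a n * b n) <= |a n| * K) sequentially"
  using assms(2) by (intro always_eventually) (simp add: abs_mult mult_left_mono)
qed

lemma conv_bounded:
 fixes a :: "nat => real"
 assumes "a ----> l"
 shows "EX K. ALL n. |a n| <= K"
 using convergent_imp_Bseq[OF convergentI[OF assms]] by (auto simp: Bseq_def)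

text \<open>\<open>finite_rank\<close> says that on a bounded part of the constraint finitely many
  bounded additive functionals have no common zero; it forces the minimax levels to infinity.
  \<open>rich\<close> supplies subspaces of every finite dimension, hence odd maps into the
  constraint from spheres of every dimension.\<close>

locale constrained = semi_hilbert V ip +
  F: c1_functional V ip Phi dPhi + S: c1_functional V ip G dG
 for V :: "'a::real_vector set" and ip Phi dPhi G dG +
 assumes Phi_nonneg: "u \<in> V ==> Phi u >= 0"
  and dPhi_nonneg: "u \<in> V ==> dPhi u u >= 0"
  and G_hom: "u \<in> V ==> G (c *\<^sub>R u) = c ^ 4 * G u"
  and euler: "u \<in> V ==> dG u u = 4 * G u"
  and G_pos: "u \<in> V ==> nm u > 0 ==> G u > 0"
  and finite_rank: "!!R. EX (m::nat) l. (ALL i<m. (ALL u:V. ALL v:V. l i (u + v) = l i u + l i v) & (EX C. ALL u:V. |l i u| <= C * nm u))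
    & (ALL u:V. nm u <= R --> G u = 1 --> (EX i<m. l i u ~= (0::real)))"
  and rich: "!!k. EX e. (ALL i<=k. e i \<in> V) & (ALL a. (EX i<=k. a i ~= 0) --> nm (\<Sum>i\<le>(k::nat). a i *\<^sub>R e i) > 0)"
begin

definition M :: "'a set" where "M = {u \<in> V. G u = 1}"
definition E :: "'a => real" where "E u = ip u u / 2 + Phi u"
definition dE :: "'a => 'a => real" where "dE u v = ip u v + dPhi u v"
definition Lam :: "'a => real" where "Lam u = dE u u"
text \<open>The Riesz vector of the constrained derivative. The multiplier Lam u / 4 is not that of
  the orthogonal projection onto the tangent space: it is chosen to make \<open>X u\<close>
  orthogonal to \<open>u\<close>, using dG u u = 4 on the constraint. The seminorm of
  \<open>X u\<close> vanishes exactly at constrained critical points.\<close>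

definition X :: "'a => 'a" where "X u = (SOME z. z \<in> V & (ALL v:V. ip z v = dE u v - Lam u / 4 * dG u v))"
definition nrmz :: "'a => 'a" where "nrmz y = (G y powr (-1/4)) *\<^sub>R y"
text \<open>One explicit descent step followed by radial rescaling to G = 1, in place of a gradient
  flow.\<close>

definition eta :: "real => 'a => 'a" where "eta t u = nrmz (u - t *\<^sub>R X u)"

lemma dE_bdd: "EX C>=0. ALL u:V. nm u <= R --> (ALL w:V. |dE u w| <= C * nm w) & (ALL w:V. |dG u w| <= C * nm w) & |Lam u| <= C"
proof -
 obtain C1 where C1: "C1 >= 0" "!!u w. u \<in> V ==> nm u <= R ==> w \<in> V ==> |dPhi u w| <= C1 * nm w"
  using F.bdd[of R] by blast
 obtain C2 where C2: "C2 >= 0" "!!u w. u \<in> V ==> nm u <= R ==> w \<in> V ==> |dG u w| <= C2 * nm w"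
  using S.bdd[of R] by blast
 define A where "A = |R| + C1"
 have A0: "A >= 0" using C1 by (simp add: A_def)
 have dEA: "|dE u w| <= A * nm w" if "u \<in> V" "nm u <= R" "w \<in> V" for u w
 proof -
  have "|ip u w| <= |R| * nm w"
   using cauchy_schwarz[OF that(1,3)] mult_right_mono[of "nm u" "|R|" "nm w"] that nm_nonneg[OF that(3)] by linarith
  thus ?thesis using C1(2)[OF that] unfolding dE_def A_def distrib_right by linarith
 qed
 have LA: "|Lam u| <= A * |R|" if "u \<in> V" "nm u <= R" for u
 proof -
  have "|Lam u| <= A * nm u" using dEA[OF that that(1)] by (simp add: Lam_def)
  also have "... <= A * |R|" using that A0 by (intro mult_left_mono) auto
  finally show ?thesis .
 qed
 define C where "C = A + C2 + A * |R|"
 have AR: "A * |R| >= 0" using A0 by simp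
 have le: "A <= C" "C2 <= C" "A * |R| <= C" "C >= 0" using A0 C2 AR by (auto simp: C_def)
 show ?thesis
 proof (intro exI[of _ C] conjI ballI impI)
  show "|dE u w| <= C * nm w" if "u \<in> V" "nm u <= R" "w \<in> V" for u w
   using dEA[OF that] mult_right_mono[OF le(1) nm_nonneg[OF that(3)]] by linarith
  show "|dG u w| <= C * nm w" if "u \<in> V" "nm u <= R" "w \<in> V" for u w
   using C2(2)[OF that] mult_right_mono[OF le(2) nm_nonneg[OF that(3)]] by linarith
  show "|Lam u| <= C" if "u \<in> V" "nm u <= R" for u using LA[OF that] le by linarith
 qed (rule le)
qed

lemma dE_lin:
 "u \<in> V ==> v \<in> V ==> w \<in> V ==> dE u (v + w) = dE u v + dE u w"
 "u \<in> V ==> v \<in> V ==> w \<in> V ==> dE u (v - w) = dE u v - dE u w"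
 "u \<in> V ==> v \<in> V ==> dE u (c *\<^sub>R v) = c * dE u v"
 by (simp_all add: dE_def ip_simps F.d_add F.d_diff F.d_scale algebra_simps)

lemma X:
 assumes "u \<in> V"
 shows X_V: "X u \<in> V" and ip_X: "v \<in> V ==> ip (X u) v = dE u v - Lam u / 4 * dG u v"
proof -
 obtain C where C: "C >= 0" "!!w. w \<in> V ==> |dE u w| <= C * nm w" "!!w. w \<in> V ==> |dG u w| <= C * nm w"
  using dE_bdd[of "nm u"] assms by blast
 have "EX z:V. ALL v:V. ip z v = dE u v - Lam u / 4 * dG u v"
 proof (rule riesz[where C = "C + |Lam u / 4| * C"])
  fix v assume v: "v \<in> V"
  have "|dE u v - Lam u / 4 * dG u v| <= |dE u v| + |Lam u / 4| * |dG u v|"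
   by (metis abs_mult abs_triangle_ineq4)
  also have "... <= C * nm v + |Lam u / 4| * (C * nm v)" using C v by (intro add_mono mult_left_mono) auto
  finally show "|dE u v - Lam u / 4 * dG u v| <= (C + |Lam u / 4| * C) * nm v" by (simp add: algebra_simps)
 qed (auto simp: dE_lin S.d_add S.d_scale assms algebra_simps add_divide_distrib)
 hence "X u \<in> V & (ALL v:V. ip (X u) v = dE u v - Lam u / 4 * dG u v)"
  unfolding X_def Bex_def by (rule someI_ex)
 thus "X u \<in> V" "v \<in> V ==> ip (X u) v = dE u v - Lam u / 4 * dG u v" by auto
qed

lemma nm_X_bdd: "EX K>=0. ALL u:V. nm u <= R --> nm (X u) <= K"
proof -
 obtain C where C: "C >= 0" "!!u w. u \<in> V ==> nm u <= R ==> w \<in> V ==> |dE u w| <= C * nm w"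
  "!!u w. u \<in> V ==> nm u <= R ==> w \<in> V ==> |dG u w| <= C * nm w" "!!u. u \<in> V ==> nm u <= R ==> |Lam u| <= C"
  using dE_bdd[of R] by blast
 have "nm (X u) <= C + C / 4 * C" if u: "u \<in> V" "nm u <= R" for u
 proof (cases "nm (X u) = 0")
  case False
  hence pos: "nm (X u) > 0" using nm_nonneg[OF X_V[OF u(1)]] by simp
  have "(nm (X u))^2 = dE u (X u) - Lam u / 4 * dG u (X u)" using ip_X X_V u by (simp add: nm_sq)
  also have "... <= |dE u (X u)| + |Lam u| / 4 * |dG u (X u)|"
   using abs_ge_self[of "dE u (X u)"] abs_ge_minus_self[of "Lam u / 4 * dG u (X u)"] by (simp add: abs_mult)
  also have "... <= C * nm (X u) + C / 4 * (C * nm (X u))"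
   using C X_V u by (intro add_mono mult_mono divide_right_mono) auto
  finally have "nm (X u) * nm (X u) <= (C + C / 4 * C) * nm (X u)" by (simp add: power2_eq_square algebra_simps)
  thus ?thesis using pos by simp
 qed (use C in auto)
 thus ?thesis using C by (intro exI[of _ "C + C / 4 * C"]) auto
qed

lemma nrmz_M: "y \<in> V ==> G y > 0 ==> nrmz y \<in> M"
proof -
 assume y: "y \<in> V" "G y > 0"
 have "(G y powr (-1/4)) ^ 4 * G y = G y powr (-1) * G y"
  using y by (simp add: powr_power)
 also have "... = 1" using y by (simp add: powr_minus_divide)
 finally show ?thesis using y by (simp add: M_def nrmz_def G_hom V_intros)
qed

lemma M_pos: "u \<in> M ==> nm u > 0"
proof (rule ccontr)
 assume u: "u \<in> M" "\<not> nm u > 0"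
 hence uV: "u \<in> V" "G u = 1" by (auto simp: M_def)
 have n0: "nm u = 0" using u nm_nonneg[OF uV(1)] by simp
 obtain C where C: "!!w. w \<in> V ==> |dG u w| <= C * nm w" using S.bdd[of "nm u"] uV by blast
 show False using C[OF uV(1)] euler[OF uV(1)] uV n0 by simp
qed

lemma ip_X_self: "u \<in> M ==> ip (X u) u = 0"
 by (simp add: ip_X M_def euler Lam_def)

text \<open>Since \<open>X u\<close> is orthogonal to \<open>u\<close>, the step cannot shorten
  \<open>u\<close>, so it never reaches the null vectors, where rescaling would fail.\<close>

lemma step_pos:
 assumes "u \<in> M" shows "G (u - t *\<^sub>R X u) > 0"
proof (rule G_pos)
 have u: "u \<in> V" using assms by (simp add: M_def)
 show "u - t *\<^sub>R X u \<in> V" by (intro V_intros u X_V)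
 have "ip (u - t *\<^sub>R X u) (u - t *\<^sub>R X u) = ip u u + t^2 * ip (X u) (X u)"
  using u X_V[OF u] ip_X_self[OF assms] ip_sym[of u "X u"]
  by (simp add: ip_simps V_intros power2_eq_square algebra_simps)
 moreover have "ip u u > 0" using M_pos[OF assms] nm_sq[OF u] by (metis zero_less_power)
 moreover have "ip (X u) (X u) >= 0" using X_V[OF u] ip_nonneg by blast
 ultimately have "ip (u - t *\<^sub>R X u) (u - t *\<^sub>R X u) > 0" by (simp add: add_pos_nonneg)
 thus "nm (u - t *\<^sub>R X u) > 0" by (simp add: nm_def)
qed

lemma eta_M: "u \<in> M ==> eta t u \<in> M"
 unfolding eta_def by (rule nrmz_M) (auto simp: M_def step_pos intro!: V_intros X_V)

text \<open>The difference quotient of x^(-1/4) at 1, completed by the derivative -1/4. The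
  completion lets the rescaling factor minus 1 be written as a continuous function of g times (g -
  1), also when g = 1.\<close>

lemma isCont_slope: "isCont (%x::real. if x = 1 then -1/4 else (x powr (-1/4) - 1) / (x - 1)) 1"
proof -
 have "((%x::real. x powr (-1/4)) has_real_derivative -1/4) (at 1)"
  by (auto intro!: derivative_eq_intros)
 hence "((%y::real. (y powr (-1/4) - 1 powr (-1/4)) / (y - 1)) \<longlongrightarrow> -1/4) (at 1)"
  by (simp add: has_field_derivative_iff)
 hence "((%x::real. if x = 1 then -1/4 else (x powr (-1/4) - 1) / (x - 1)) \<longlongrightarrow> -1/4) (at 1)"
  by (rule Lim_transform_eventually) (auto simp: eventually_at_filter)
 thus ?thesis by (simp add: isCont_def)
qed

text \<open>To first order rescaling adds t * p * u with p = dG u (X u) / 4, so the direction of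
  motion is p u - X u. The derivative of E along it is p * Lam u - dE u (X u), which is exactly -|X
  u|^2; the choice of multiplier loses nothing.\<close>

lemma descent_seq:
 assumes u: "!!n. u n \<in> M" "!!n. nm (u n) <= R" and t: "!!n::nat. t n > 0" "t ----> 0"
 shows "(%n. (E (eta (t n) (u n)) - E (u n)) / t n + (nm (X (u n)))^2) ----> 0"
proof -
 have uV: "u n \<in> V" and G1: "G (u n) = 1" for n using u by (auto simp: M_def)
 have XV: "X (u n) \<in> V" for n using X_V uV by blast
 obtain K where K: "K >= 0" "!!n. nm (X (u n)) <= K" using nm_X_bdd[of R] uV u(2) by blast
 obtain C where C: "C >= 0" "!!n w. w \<in> V ==> |dE (u n) w| <= C * nm w"
  "!!n w. w \<in> V ==> |dG (u n) w| <= C * nm w" "!!n. |Lam (u n)| <= C"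
  using dE_bdd[of R] uV u(2) by blast
 define g where "g n = G (u n + t n *\<^sub>R (- X (u n)))" for n
 define p where "p n = dG (u n) (X (u n)) / 4" for n
 have dGX: "|dG (u n) (X (u n))| <= C * K" for n
  using C(3)[OF XV, of n n] mult_left_mono[OF K(2) C(1), of n] by linarith
 have pb: "|p n| <= C * K" for n using dGX[of n] by (simp add: p_def)
 have A: "(%n. (g n - 1) / t n + 4 * p n) ----> 0"
 proof -
  have "(%n. (G (u n + t n *\<^sub>R (- X (u n))) - G (u n)) / t n - dG (u n) (- X (u n))) ----> 0"
   by (rule S.diff_seq[OF uV u(2) _ _ t, where K = K]) (auto simp: nm_minus XV K V_intros)
  thus ?thesis by (simp add: g_def p_def S.d_minus XV uV G1)
 qed
 define D where "D = (%x::real. if x = 1 then -1/4 else (x powr (-1/4) - 1) / (x - 1))"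
 define b where "b n = g n powr (-1/4)" for n
 define bt where "bt n = (b n - 1) / t n" for n
 have g1: "g ----> 1"
 proof -
  have "(%n. t n * ((g n - 1) / t n + 4 * p n) - t n * (4 * p n)) ----> 0 * 0 - 0"
   by (intro tendsto_diff tendsto_mult t A null_times_bdd[where K = "4 * (C * K)"]) (use pb in \<open>auto simp: abs_mult\<close>)
  moreover have "t n * ((g n - 1) / t n + 4 * p n) - t n * (4 * p n) = g n - 1" for n
   using t(1)[of n] by (simp add: field_simps)
  ultimately show ?thesis by (simp add: LIM_zero_iff)
 qed
 have Dg: "(%n. D (g n)) ----> -1/4"
  using isCont_tendsto_compose[OF isCont_slope g1] by (simp add: D_def)
 have bD: "b n - 1 = D (g n) * (g n - 1)" for n
  by (auto simp: b_def D_def)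
 have b1: "b ----> 1"
 proof -
  have "(%n. D (g n) * (g n - 1)) ----> -1/4 * (1 - 1)" by (intro tendsto_intros Dg g1)
  thus ?thesis by (simp flip: bD add: LIM_zero_iff)
 qed
 have btp: "(%n. bt n - p n) ----> 0"
 proof -
  have "(%n. 4 * D (g n) + 1) ----> 4 * (-1/4) + 1" by (intro tendsto_intros Dg)
  hence "(%n. (4 * D (g n) + 1) * p n) ----> 0" using pb by (intro null_times_bdd) auto
  hence "(%n. D (g n) * ((g n - 1) / t n + 4 * p n) - (4 * D (g n) + 1) * p n) ----> -1/4 * 0 - 0"
   by (intro tendsto_diff tendsto_mult Dg A)
  moreover have "D (g n) * ((g n - 1) / t n + 4 * p n) - (4 * D (g n) + 1) * p n = bt n - p n" for n
   by (simp add: bt_def bD algebra_simps)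
  ultimately show ?thesis by simp
 qed
 obtain B1 where B1: "!!n. |bt n - p n| <= B1" using conv_bounded[OF btp] by blast
 obtain B2 where B2: "!!n. |b n| <= B2" using conv_bounded[OF b1] by blast
 define w where "w n = bt n *\<^sub>R u n - b n *\<^sub>R X (u n)" for n
 have wV: "w n \<in> V" for n unfolding w_def by (intro V_intros uV XV)
 have btb: "|bt n| <= B1 + C * K" for n using B1[of n] pb[of n] by linarith
 have wb: "nm (w n) <= (B1 + C * K) * R + B2 * K" for n
 proof -
  have "nm (w n) <= |bt n| * nm (u n) + |b n| * nm (X (u n))"
   unfolding w_def using nm_triangle_diff[of "bt n *\<^sub>R u n" "b n *\<^sub>R X (u n)"] uV XV
   by (simp add: nm_scale V_intros)
  also have "... <= (B1 + C * K) * R + B2 * K"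
   using btb[of n] u(2)[of n] B2[of n] K(2)[of n] nm_nonneg[OF uV[of n]] nm_nonneg[OF XV[of n]]
   by (intro add_mono mult_mono) auto
  finally show ?thesis .
 qed
 have etaw: "eta (t n) (u n) = u n + t n *\<^sub>R w n" for n
 proof -
  have bn: "b n = 1 + t n * bt n" using t(1)[of n] by (simp add: bt_def)
  show ?thesis
  proof -
   have "eta (t n) (u n) = b n *\<^sub>R (u n - t n *\<^sub>R X (u n))"
    by (simp add: eta_def nrmz_def b_def g_def)
   also have "... = b n *\<^sub>R u n - (t n * b n) *\<^sub>R X (u n)" by (simp add: scaleR_diff_right mult.commute)
   also have "b n *\<^sub>R u n = u n + (t n * bt n) *\<^sub>R u n" using bn by (simp add: scaleR_add_left)
   finally show ?thesis by (simp add: w_def scaleR_diff_right)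
  qed
 qed
 have Ph: "(%n. (Phi (u n + t n *\<^sub>R w n) - Phi (u n)) / t n - dPhi (u n) (w n)) ----> 0"
  by (rule F.diff_seq[OF uV u(2) wV wb t])
 have ipw: "(%n. t n / 2 * ip (w n) (w n)) ----> 0"
 proof -
  have "|ip (w n) (w n)| <= ((B1 + C * K) * R + B2 * K)^2" for n
   using power_mono[OF wb nm_nonneg[OF wV], of n 2] by (simp add: nm_sq wV ip_nonneg)
  moreover have "(%n. t n / 2) ----> 0" using tendsto_divide_zero[OF t(2)] .
  ultimately show ?thesis by (rule null_times_bdd[rotated])
 qed
 have dEb: "|dE (u n) (X (u n))| <= C * K" for n
  using C(2)[OF XV, of n n] mult_left_mono[OF K(2) C(1), of n] by linarith
 have main: "(%n. (bt n - p n) * Lam (u n) - (b n - 1) * dE (u n) (X (u n))) ----> 0 - 0"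
  by (intro tendsto_diff null_times_bdd[OF btp C(4)] null_times_bdd[OF _ dEb]) (use b1 in \<open>simp add: LIM_zero_iff\<close>)
 have "(E (eta (t n) (u n)) - E (u n)) / t n + (nm (X (u n)))^2
   = ((bt n - p n) * Lam (u n) - (b n - 1) * dE (u n) (X (u n)))
    + ((Phi (u n + t n *\<^sub>R w n) - Phi (u n)) / t n - dPhi (u n) (w n)) + t n / 2 * ip (w n) (w n)" for n
 proof -
  have 1: "(nm (X (u n)))^2 = dE (u n) (X (u n)) - Lam (u n) * p n"
   using ip_X[OF uV XV, of n n] XV by (simp add: nm_sq p_def)
  have 2: "dE (u n) (w n) = bt n * Lam (u n) - b n * dE (u n) (X (u n))"
   unfolding w_def using uV XV by (simp add: dE_lin V_intros Lam_def)
  have "ip (u n + t n *\<^sub>R w n) (u n + t n *\<^sub>R w n) = ip (u n) (u n) + 2 * t n * ip (u n) (w n) + t n * t n * ip (w n) (w n)"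
   using uV[of n] wV[of n] by (simp add: ip_simps V_intros ip_sym[of "w n" "u n"] algebra_simps)
  hence 3: "(E (u n + t n *\<^sub>R w n) - E (u n)) / t n
   = (Phi (u n + t n *\<^sub>R w n) - Phi (u n)) / t n + ip (u n) (w n) + t n / 2 * ip (w n) (w n)"
   using t(1)[of n] by (simp add: E_def field_simps)
  show ?thesis unfolding etaw 3 1 using 2 by (simp add: dE_def algebra_simps)
 qed
 thus ?thesis using tendsto_add[OF tendsto_add[OF main Ph] ipw] by simp
qed

text \<open>The threshold \<open>t0\<close> depends on \<open>R\<close> and \<open>e\<close> only. A
  sequence of violations with steps tending to 0 would contradict
  \<open>descent_seq\<close>.\<close>

lemma descent:
 assumes e: "e > 0"
 shows "EX t0>0. ALL t u. 0 < t --> t < t0 --> u \<in> M --> nm u <= R --> E (eta t u) <= E u - t * (nm (X u))^2 + t * e"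
proof (rule ccontr)
 assume "\<not> ?thesis"
 hence neg: "EX t u. 0 < t & t < t0 & u \<in> M & nm u <= R & E (eta t u) > E u - t * (nm (X u))^2 + t * e"
  if "t0 > 0" for t0 using that by (meson not_le)
 have "EX t u. 0 < t & t < 1 / (real n + 1) & u \<in> M & nm u <= R & E (eta t u) > E u - t * (nm (X u))^2 + t * e" for n
  by (rule neg) simp
 then obtain t u where tu: "!!n. 0 < t n" "!!n::nat. t n < 1 / (real n + 1)" "!!n. u n \<in> M" "!!n. nm (u n) <= R"
  "!!n. E (eta (t n) (u n)) > E (u n) - t n * (nm (X (u n)))^2 + t n * e" by metis
 have t0: "t ----> 0"
 proof (rule Lim_null_comparison)
  show "(%n. 1 / (real n + 1)) ----> 0" using LIMSEQ_inverse_real_of_nat by (simp add: inverse_eq_divide add.commute)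
  show "eventually (%n. norm (t n) <= 1 / (real n + 1)) sequentially" using tu(1,2) by (intro always_eventually) (simp add: less_imp_le)
 qed
 have "eventually (%n. (E (eta (t n) (u n)) - E (u n)) / t n + (nm (X (u n)))^2 < e) sequentially"
  using order_tendstoD(2)[OF descent_seq[OF tu(3,4,1) t0] e] .
 then obtain n where n: "(E (eta (t n) (u n)) - E (u n)) / t n + (nm (X (u n)))^2 < e"
  by (auto simp: eventually_sequentially)
 have "((E (eta (t n) (u n)) - E (u n)) / t n + (nm (X (u n)))^2) * t n < e * t n"
  using n tu(1)[of n] by (intro mult_strict_right_mono)
 moreover have "((E (eta (t n) (u n)) - E (u n)) / t n + (nm (X (u n)))^2) * t n
   = E (eta (t n) (u n)) - E (u n) + t n * (nm (X (u n)))^2"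
  using tu(1)[of n] by (simp add: distrib_left distrib_right mult.commute)
 ultimately show False using tu(5)[of n] by (simp add: mult.commute)
qed

lemma E_lower: "u \<in> V ==> (nm u)^2 <= 2 * E u"
 using Phi_nonneg by (simp add: E_def nm_sq)

lemma E_nonneg: "u \<in> V ==> 0 <= E u"
 using E_lower[of u] by (smt (verit) zero_le_power2)

lemma nm_le_E: "u \<in> V ==> E u <= B ==> nm u <= sqrt (2 * B)"
 using E_lower[of u] by (intro real_le_rsqrt) simp

lemma Lam_ge: "u \<in> V ==> ip u u <= Lam u"
 using dPhi_nonneg by (simp add: Lam_def dE_def)

lemma E_conv:
 assumes "!!n. s n \<in> V" "u \<in> V" "(%n. nm (s n - u)) ----> 0"
 shows "(%n. E (s n)) ----> E u"
proof -
 have "(%n. (nm (s n))^2 / 2 + Phi (s n)) ----> (nm u)^2 / 2 + Phi u"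
  by (intro tendsto_intros nm_conv_nm F.conv assms) simp
 thus ?thesis by (simp add: E_def nm_sq assms)
qed

lemma Lam_conv:
 assumes "!!n. s n \<in> V" "u \<in> V" "(%n. nm (s n - u)) ----> 0"
 shows "(%n. Lam (s n)) ----> Lam u"
proof -
 have "(%n. (nm (s n))^2 + dPhi (s n) (s n)) ----> (nm u)^2 + dPhi u u"
  by (intro tendsto_intros nm_conv_nm F.d_conv_self assms)
 thus ?thesis by (simp add: Lam_def dE_def nm_sq assms)
qed

text \<open>|u_m - u_n|^2 is split into ip u_m (u_m - u_n) and its mirror image. In each part
  \<open>ip_X\<close> trades the inner product for terms in X, dPhi and dG, which are small by
  hypothesis and by compactness of the derivatives. The subsequence is therefore Cauchy, and no weak
  limit is involved.\<close>

theorem palais_smale: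
 assumes s: "!!n. s n \<in> M" and Eb: "!!n. E (s n) <= B" and Xs: "(%n. nm (X (s n))) ----> 0"
 shows "EX r u. strict_mono r & u \<in> M & (%n. nm (s (r n) - u)) ----> 0 &
     (ALL v:V. dE u v = Lam u / 4 * dG u v)"
proof -
 have sV: "s n \<in> V" for n using s by (auto simp: M_def)
 define R where "R = sqrt (2 * B)"
 have sR: "nm (s n) <= R" for n unfolding R_def by (rule nm_le_E[OF sV Eb])
 have R0: "R >= 0" using order_trans[OF nm_nonneg[OF sV] sR] .
 obtain r1 :: "nat => nat" where r1: "strict_mono r1" "!!e. e > 0 ==> EX N. ALL m>=N. ALL n>=N. |dPhi (s (r1 m)) (s (r1 m) - s (r1 n))| <= e"
  using F.compact_d[of s, OF sV sR] by blast
 obtain r2 :: "nat => nat" where r2: "strict_mono r2"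
   "!!e. e > 0 ==> EX N. ALL m>=N. ALL n>=N. |dG (s (r1 (r2 m))) (s (r1 (r2 m)) - s (r1 (r2 n)))| <= e"
  using S.compact_d[of "%n. s (r1 n)", OF sV sR] by blast
 define r where "r = r1 \<circ> r2"
 have r: "strict_mono r" unfolding r_def by (rule strict_mono_o[OF r1(1) r2(1)])
 define u where "u n = s (r n)" for n
 have uV: "u n \<in> V" and uR: "nm (u n) <= R" and XV: "X (u n) \<in> V" for n
  using sV sR X_V by (auto simp: u_def)
 obtain C where C: "C >= 0" "!!n. |Lam (u n)| <= C" using dE_bdd[of R] uV uR by blast
 have Xu: "(%n. nm (X (u n))) ----> 0"
  using LIMSEQ_subseq_LIMSEQ[OF Xs r] by (simp add: u_def o_def)
 have "EX N. ALL m>=N. ALL n>=N. nm (u m - u n) < e" if e: "e > 0" for e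
 proof -
  \<comment> \<open>Each half costs at most (2R + 1 + C/4) d; the denominator dominates twice this
    factor.\<close>
  define d where "d = e^2 / (4 * (1 + 2 * R + C))"
  have d0: "d > 0" using e R0 C by (simp add: d_def)
  obtain N1 where N1: "ALL m>=N1. ALL n>=N1. |dPhi (s (r1 m)) (s (r1 m) - s (r1 n))| <= d" using r1(2)[OF d0] by blast
  obtain N2 where N2: "ALL m>=N2. ALL n>=N2. |dG (s (r1 (r2 m))) (s (r1 (r2 m)) - s (r1 (r2 n)))| <= d" using r2(2)[OF d0] by blast
  have "eventually (%n. nm (X (u n)) < d) sequentially" using order_tendstoD(2)[OF Xu d0] .
  then obtain N3 where N3: "!!n. n >= N3 ==> nm (X (u n)) < d" by (auto simp: eventually_sequentially)
  have "nm (u m - u n) < e" if mn: "m >= max N1 (max N2 N3)" "n >= max N1 (max N2 N3)" for m n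
  proof -
   have part: "|ip (u i) (u i - u j)| <= d * (2 * R) + d + C / 4 * d"
    if ij: "i >= max N1 (max N2 N3)" "j >= max N1 (max N2 N3)" for i j
   proof -
    let ?w = "u i - u j"
    have w: "?w \<in> V" by (intro V_intros uV)
    have "r2 i >= N1" "r2 j >= N1" using ij seq_suble[OF r2(1), of i] seq_suble[OF r2(1), of j] by auto
    hence p: "|dPhi (u i) ?w| <= d" using N1 by (simp add: u_def r_def)
    have g: "|dG (u i) ?w| <= d" using N2 ij by (simp add: u_def r_def)
    have "nm ?w <= 2 * R" using nm_triangle_diff[OF uV uV, of i j] uR[of i] uR[of j] by simp
    hence x: "|ip (X (u i)) ?w| <= d * (2 * R)"
     using cauchy_schwarz[OF XV w, of i] N3[of i] ij mult_mono[of "nm (X (u i))" d "nm ?w" "2 * R"] d0 nm_nonneg[OF w]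
     by force
    have l: "|Lam (u i) / 4 * dG (u i) ?w| <= C / 4 * d"
     unfolding abs_mult using C(2)[of i] g d0 C(1) by (intro mult_mono) auto
    have "ip (u i) ?w = ip (X (u i)) ?w - dPhi (u i) ?w + Lam (u i) / 4 * dG (u i) ?w"
     using ip_X[OF uV w, of i] by (simp add: dE_def)
    thus ?thesis using p x l by linarith
   qed
   have "(nm (u m - u n))^2 = ip (u m) (u m - u n) + ip (u n) (u n - u m)"
    using uV by (simp add: nm_sq V_intros ip_simps ip_sym[of "u n" "u m"])
   also have "... <= (d * (2 * R) + d + C / 4 * d) + (d * (2 * R) + d + C / 4 * d)"
    using part[OF mn] part[OF mn(2,1)] by (intro add_mono) (auto simp: abs_le_iff)
   also have "... = (4 * R + 2 + C / 2) * d" by (simp add: algebra_simps)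
   also have "... < (4 * (1 + 2 * R + C)) * d" using d0 R0 C by (intro mult_strict_right_mono) auto
   also have "... = e^2" using R0 C(1) by (simp add: d_def)
   finally show ?thesis using e by (simp add: power2_less_imp_less)
  qed
  thus ?thesis by blast
 qed
 then obtain z where z: "z \<in> V" "(%n. nm (u n - z)) ----> 0" using complete_nm[of u, OF uV] by blast
 have "(%n. G (u n)) ----> G z" by (rule S.conv[OF uV z])
 moreover have "G (u n) = 1" for n using s by (simp add: u_def M_def)
 ultimately have zM: "z \<in> M" using z by (simp add: M_def LIMSEQ_const_iff)
 have "dE z v = Lam z / 4 * dG z v" if v: "v \<in> V" for v
 proof -
  have "(%n. ip (u n) v) ----> ip z v"
  proof -
   have "|ip (u n) v - ip z v| <= nm (u n - z) * nm v" for n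
    using cauchy_schwarz[of "u n - z" v] uV z v by (simp add: ip_simps V_intros)
   hence "(%n. ip (u n) v - ip z v) ----> 0"
    by (intro null_comparison[OF _ z(2), of _ "nm v"]) (simp add: mult.commute)
   thus ?thesis by (simp add: LIM_zero_iff)
  qed
  hence "(%n. dE (u n) v - Lam (u n) / 4 * dG (u n) v) ----> dE z v - Lam z / 4 * dG z v"
   unfolding dE_def by (intro tendsto_intros F.d_conv_fix S.d_conv_fix Lam_conv uV z v) auto
  moreover have "(%n. dE (u n) v - Lam (u n) / 4 * dG (u n) v) ----> 0"
  proof -
   have "|ip (X (u n)) v| <= nm (X (u n)) * nm v" for n using cauchy_schwarz[OF XV v] .
   hence "(%n. ip (X (u n)) v) ----> 0"
    by (intro null_comparison[OF _ Xu, of _ "nm v"]) (simp add: mult.commute)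
   thus ?thesis by (simp add: ip_X uV v)
  qed
  ultimately show ?thesis using LIMSEQ_unique by fastforce
 qed
 thus ?thesis using r zM z by (auto simp: u_def)
qed

end

section \<open>Minimax levels over odd maps from spheres\<close>

lemma seq_continuous_on_SS:
 fixes f :: "(nat => real) => real"
 assumes "!!x xs. x \<in> SS k ==> (!!n. xs n \<in> SS k) ==> (!!i. (%n. xs n i) ----> x i) ==> (%n. f (xs n)) ----> f x"
 shows "continuous_on (SS k) f"
 unfolding continuous_on_sequentially o_def
proof (intro ballI allI impI)
 fix x xs assume x: "x \<in> SS k" and "(ALL n. xs n \<in> SS k) & xs ----> x"
 hence xs: "!!n. xs n \<in> SS k" "xs ----> x" by auto
 have "(%n. xs n i) ----> x i" for i
 proof -
  have "isCont (%z::nat => real. z i) x"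
   using continuous_on_product_coordinates[of i] continuous_on_eq_continuous_at[OF open_UNIV, of "%z. z i"] by blast
  thus ?thesis by (rule isCont_tendsto_compose[OF _ xs(2)])
 qed
 thus "(%n. f (xs n)) ----> f x" by (rule assms[OF x xs(1)])
qed

context constrained
begin

text \<open>Continuity is sequential, from coordinatewise convergence on the sphere to the seminorm.
  Oddness is asked only up to seminorm 0: \<open>X\<close> is picked by choice, so a step starting
  from exact antipodes need not end in exact antipodes.\<close>

definition paths :: "nat => ((nat => real) => 'a) set" where
 "paths k = {h. (ALL x:SS k. h x \<in> M) & (ALL x:SS k. nm (h (%i. - x i) + h x) = 0) &
  (ALL x:SS k. ALL xs. (ALL n. xs n \<in> SS k) --> (ALL i. (%n. xs n i) ----> x i) --> (%n. nm (h (xs n) - h x)) ----> 0)}"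

definition lv :: "nat => real set" where
 "lv k = {B. EX h:paths k. ALL x:SS k. E (h x) <= B}"

definition lev :: "nat => real" where
 "lev k = Inf (lv k)"

text \<open>The difference of the two vectors is tested against itself; continuity of the
  derivatives in the dual norm and convergence of \<open>Lam\<close> bound the result.\<close>

lemma X_conv:
 assumes s: "!!n. s n \<in> V" and u: "u \<in> V" and cv: "(%n. nm (s n - u)) ----> 0"
 shows "(%n. nm (X (s n) - X u)) ----> 0"
proof (rule tendstoI)
 fix e :: real assume e: "e > 0"
 obtain R where R: "nm u <= R" "!!n. nm (s n) <= R" using F.bdd_seq[OF assms] by blast
 obtain C where C: "C >= 0" "!!n w. w \<in> V ==> |dG (s n) w| <= C * nm w"
  using dE_bdd[of R] s R(2) by blast
 define d where "d = e / (2 * (1 + |Lam u| ))"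
 have d0: "d > 0" using e by (simp add: d_def)
 have de: "(1 + |Lam u| ) * d = e / 2" by (simp add: d_def field_simps add_pos_nonneg)
 have "(%n. nm (s n - u) + |Lam (s n) - Lam u| * C) ----> 0 + 0 * C"
  using Lam_conv[OF assms] by (intro tendsto_add tendsto_mult tendsto_rabs_zero cv tendsto_const) (simp add: LIM_zero_iff)
 hence "eventually (%n. nm (s n - u) + |Lam (s n) - Lam u| * C < e / 2) sequentially"
  by (rule order_tendstoD(2)) (use e in simp)
 thus "eventually (%n. dist (nm (X (s n) - X u)) 0 < e) sequentially"
  using F.d_conv[OF assms d0] S.d_conv[OF assms d0]
 proof eventually_elim
  case (elim n)
  let ?z = "X (s n) - X u"
  have z: "?z \<in> V" by (intro V_intros X_V s u)
  have nz: "nm ?z >= 0" by (rule nm_nonneg[OF z])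
  have "(nm ?z)^2 = ip (s n - u) ?z + (dPhi (s n) ?z - dPhi u ?z) - (Lam (s n) - Lam u) / 4 * dG (s n) ?z
    - Lam u / 4 * (dG (s n) ?z - dG u ?z)"
  proof -
   have "ip ?z ?z = ip (X (s n)) ?z - ip (X u) ?z" using X_V s u z by (simp add: ip_diff)
   also have "... = dE (s n) ?z - Lam (s n) / 4 * dG (s n) ?z - (dE u ?z - Lam u / 4 * dG u ?z)"
    using ip_X s u z by simp
   also have "... = ip (s n) ?z - ip u ?z + (dPhi (s n) ?z - dPhi u ?z) - (Lam (s n) - Lam u) / 4 * dG (s n) ?z
    - Lam u / 4 * (dG (s n) ?z - dG u ?z)"
    by (simp add: dE_def algebra_simps diff_divide_distrib)
   finally show ?thesis using s u z by (simp add: nm_sq ip_diff)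
  qed
  also have "... <= nm (s n - u) * nm ?z + d * nm ?z + |Lam (s n) - Lam u| * (C * nm ?z) + |Lam u| * (d * nm ?z)"
  proof -
   have 1: "|ip (s n - u) ?z| <= nm (s n - u) * nm ?z" using cauchy_schwarz z s u by (simp add: V_intros)
   have 2: "|dPhi (s n) ?z - dPhi u ?z| <= d * nm ?z" using elim(2) z by blast
   have "|(Lam (s n) - Lam u) / 4| * |dG (s n) ?z| <= |Lam (s n) - Lam u| * (C * nm ?z)"
    using C(2)[OF z, of n] by (intro mult_mono) auto
   hence 3: "|(Lam (s n) - Lam u) / 4 * dG (s n) ?z| <= |Lam (s n) - Lam u| * (C * nm ?z)"
    by (simp add: abs_mult)
   have "|dG (s n) ?z - dG u ?z| <= d * nm ?z" using elim(3) z by blast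
   hence "|Lam u / 4| * |dG (s n) ?z - dG u ?z| <= |Lam u| * (d * nm ?z)"
    by (intro mult_mono) auto
   hence 4: "|Lam u / 4 * (dG (s n) ?z - dG u ?z)| <= |Lam u| * (d * nm ?z)"
    by (simp add: abs_mult)
   show ?thesis using 1 2 3 4 by linarith
  qed
  also have "... = (nm (s n - u) + |Lam (s n) - Lam u| * C + (1 + |Lam u| ) * d) * nm ?z"
   by (simp add: algebra_simps)
  finally have le: "nm ?z * nm ?z <= (nm (s n - u) + |Lam (s n) - Lam u| * C + (1 + |Lam u| ) * d) * nm ?z"
   by (simp add: power2_eq_square)
  have "nm ?z < e"
  proof (cases "nm ?z = 0")
   case False
   hence "nm ?z <= nm (s n - u) + |Lam (s n) - Lam u| * C + (1 + |Lam u| ) * d" using le nz by simp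
   thus ?thesis using elim(1) de by linarith
  qed (use e in simp)
  thus ?case using nz by (simp add: dist_real_def)
 qed
qed

lemma nrmz_conv:
 assumes s: "!!n. s n \<in> V" and u: "u \<in> V" "G u > 0" and cv: "(%n. nm (s n - u)) ----> 0"
 shows "(%n. nm (nrmz (s n) - nrmz u)) ----> 0"
proof -
 define b where "b n = G (s n) powr (-1/4)" for n
 define b0 where "b0 = G u powr (-1/4)"
 have bc: "b ----> b0" unfolding b_def b0_def
  using u(2) by (intro tendsto_powr S.conv[OF s u(1) cv] tendsto_const) simp
 have lim: "(%n. |b n| * nm (s n - u) + |b n - b0| * nm u) ----> |b0| * 0 + 0 * nm u"
  using bc by (intro tendsto_intros tendsto_rabs_zero cv) (simp_all add: LIM_zero_iff)
 have "|nm (nrmz (s n) - nrmz u)| <= 1 * ( |b n| * nm (s n - u) + |b n - b0| * nm u)" for n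
 proof -
  have "nrmz (s n) - nrmz u = b n *\<^sub>R (s n - u) + (b n - b0) *\<^sub>R u"
   by (simp add: nrmz_def b_def b0_def scaleR_diff_right scaleR_diff_left)
  moreover have "nm (b n *\<^sub>R (s n - u) + (b n - b0) *\<^sub>R u) <= nm (b n *\<^sub>R (s n - u)) + nm ((b n - b0) *\<^sub>R u)"
   by (intro nm_triangle V_intros s u)
  moreover have "nm (nrmz (s n) - nrmz u) >= 0" unfolding nrmz_def by (intro nm_nonneg V_intros s u)
  ultimately show ?thesis using s[of n] u by (simp add: nm_scale V_intros)
 qed
 moreover have "(%n. |b n| * nm (s n - u) + |b n - b0| * nm u) ----> 0" using lim by simp
 ultimately show ?thesis by (rule null_comparison)
qed

lemma eta_conv:
 assumes s: "!!n. s n \<in> M" and u: "u \<in> M" and cv: "(%n. nm (s n - u)) ----> 0"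
 shows "(%n. nm (eta t (s n) - eta t u)) ----> 0"
 unfolding eta_def
proof (rule nrmz_conv)
 have sV: "s n \<in> V" and uV: "u \<in> V" for n using s u by (auto simp: M_def)
 show "s n - t *\<^sub>R X (s n) \<in> V" "u - t *\<^sub>R X u \<in> V" for n by (intro V_intros sV uV X_V)+
 show "G (u - t *\<^sub>R X u) > 0" by (rule step_pos[OF u])
 have lim: "(%n. nm (s n - u) + |t| * nm (X (s n) - X u)) ----> 0 + |t| * 0"
  by (intro tendsto_intros cv X_conv sV uV)
 have "|nm ((s n - t *\<^sub>R X (s n)) - (u - t *\<^sub>R X u))| <= 1 * (nm (s n - u) + |t| * nm (X (s n) - X u))" for n
 proof -
  have eq: "(s n - t *\<^sub>R X (s n)) - (u - t *\<^sub>R X u) = (s n - u) - t *\<^sub>R (X (s n) - X u)"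
   by (simp add: algebra_simps)
  have "nm ((s n - u) - t *\<^sub>R (X (s n) - X u)) <= nm (s n - u) + nm (t *\<^sub>R (X (s n) - X u))"
   by (intro nm_triangle_diff V_intros sV uV X_V)
  moreover have "nm ((s n - u) - t *\<^sub>R (X (s n) - X u)) >= 0"
   by (intro nm_nonneg V_intros sV uV X_V)
  ultimately show ?thesis unfolding eq using sV uV X_V by (simp add: nm_scale V_intros)
 qed
 moreover have "(%n. nm (s n - u) + |t| * nm (X (s n) - X u)) ----> 0" using lim by simp
 ultimately show "(%n. nm ((s n - t *\<^sub>R X (s n)) - (u - t *\<^sub>R X u))) ----> 0"
  by (rule null_comparison)
qed

lemma G_null: "u \<in> V ==> v \<in> V ==> nm (u - v) = 0 ==> G u = G v"
 using S.conv[of "%_. u" v] by (simp add: LIMSEQ_const_iff)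

lemma eta_null: "u \<in> M ==> v \<in> M ==> nm (u - v) = 0 ==> nm (eta t u - eta t v) = 0"
 using eta_conv[of "%_. u" v t] by (simp add: LIMSEQ_const_iff)

lemma minus_M: "u \<in> M ==> - u \<in> M"
 by (simp add: M_def minus_V S.even)

lemma X_minus:
 assumes "u \<in> V" shows "nm (X (- u) + X u) = 0"
proof -
 let ?z = "X (- u) + X u"
 have z: "?z \<in> V" and Xm: "X (- u) \<in> V" by (intro V_intros X_V assms)+
 have L: "Lam (- u) = Lam u"
  using assms by (simp add: Lam_def dE_def ip_minus ip_minus2 V_intros F.d_odd F.d_minus)
 have "ip ?z ?z = ip (X (- u)) ?z + ip (X u) ?z" by (rule ip_add[OF Xm X_V[OF assms] z])
 also have "... = 0" using assms z
  by (simp add: ip_X V_intros L dE_def ip_minus F.d_odd S.d_odd)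
 finally show ?thesis by (simp add: nm_def)
qed

text \<open>X (- u) equals - X u only up to a null vector (\<open>X_minus\<close>), but
  \<open>G\<close> does not see null vectors, so the two rescaling factors agree exactly.\<close>

lemma eta_odd:
 assumes "u \<in> M" "v \<in> M" "nm (v + u) = 0"
 shows "nm (eta t v + eta t u) = 0"
proof -
 have uV: "u \<in> V" using assms by (simp add: M_def)
 define y where "y = u - t *\<^sub>R X u"
 define y' where "y' = - u - t *\<^sub>R X (- u)"
 have yV: "y \<in> V" "y' \<in> V" unfolding y_def y'_def by (intro V_intros uV X_V)+
 have s: "y' + y = (- t) *\<^sub>R (X (- u) + X u)" by (simp add: y_def y'_def scaleR_add_right)
 have yy: "nm (y' + y) = 0"
 proof -
  have "nm (y' + y) = |- t| * nm (X (- u) + X u)" unfolding s by (intro nm_scale V_intros X_V uV)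
  thus ?thesis by (simp add: X_minus uV)
 qed
 have "G y' = G (- y)" by (rule G_null) (use yV yy in \<open>auto intro: V_intros\<close>)
 hence Gy: "G y' = G y" using S.even yV by simp
 have "eta t (- u) + eta t u = (G y powr (-1/4)) *\<^sub>R (y' + y)"
  unfolding eta_def nrmz_def y_def[symmetric] y'_def[symmetric] Gy by (simp add: scaleR_add_right)
 hence a: "nm (eta t (- u) + eta t u) = 0" using yy yV by (simp add: nm_scale V_intros)
 have b: "nm (eta t v - eta t (- u)) = 0"
  by (rule eta_null) (use assms minus_M in auto)
 have eV: "eta t u \<in> V" "eta t (- u) \<in> V" "eta t v \<in> V" using eta_M assms minus_M by (auto simp: M_def)
 have "nm (eta t v + eta t u) <= nm (eta t v - eta t (- u)) + nm (eta t (- u) + eta t u)"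
  using nm_triangle[of "eta t v - eta t (- u)" "eta t (- u) + eta t u"] eV by (simp add: V_intros)
 thus ?thesis using a b nm_nonneg[of "eta t v + eta t u"] eV by (simp add: V_intros)
qed

lemma paths_eta:
 assumes h: "h \<in> paths k"
 shows "(%x. eta t (h x)) \<in> paths k"
 unfolding paths_def mem_Collect_eq
proof (intro conjI ballI allI impI)
 have hM: "h x \<in> M" if "x \<in> SS k" for x using h that by (auto simp: paths_def)
 show "eta t (h x) \<in> M" if "x \<in> SS k" for x by (rule eta_M[OF hM[OF that]])
 show "nm (eta t (h (%i. - x i)) + eta t (h x)) = 0" if "x \<in> SS k" for x
  using h that by (intro eta_odd hM uminus_SS) (auto simp: paths_def)
 show "(%n. nm (eta t (h (xs n)) - eta t (h x))) ----> 0"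
  if "x \<in> SS k" "ALL n. xs n \<in> SS k" "ALL i. (%n. xs n i) ----> x i" for x xs
  using h that by (intro eta_conv hM) (auto simp: paths_def)
qed

lemma E_path_conv:
 assumes h: "h \<in> paths k" and x: "x \<in> SS k" "!!n. xs n \<in> SS k" "!!i. (%n. xs n i) ----> x i"
 shows "(%n. E (h (xs n))) ----> E (h x)"
proof (rule E_conv)
 have hM: "h x \<in> M" if "x \<in> SS k" for x using h that by (auto simp: paths_def)
 thus "h (xs n) \<in> V" "h x \<in> V" for n using x by (auto simp: M_def)
 show "(%n. nm (h (xs n) - h x)) ----> 0" using h x unfolding paths_def by blast
qed

text \<open>Rescaled linear combinations of k+1 independent vectors give an odd map, and its energy
  is bounded by compactness of the sphere.\<close>

lemma lv_nonempty: "lv k ~= {}"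
proof -
 obtain e where e: "!!i. i <= k ==> e i \<in> V"
  "!!a. EX i<=k. a i ~= 0 ==> nm (\<Sum>i\<le>k. a i *\<^sub>R e i) > 0" using rich[of k] by blast
 define w where "w a = (\<Sum>i\<le>k. a i *\<^sub>R e i)" for a
 have wV: "w a \<in> V" for a unfolding w_def by (intro sum_V scale_V e) auto
 have wG: "G (w x) > 0" if "x \<in> SS k" for x
 proof -
  have "EX i<=k. x i ~= 0"
  proof (rule ccontr)
   assume "\<not> ?thesis"
   hence "(\<Sum>i\<le>k. (x i)^2) = 0" by simp
   thus False using that by (simp add: SS_def)
  qed
  thus ?thesis using G_pos[OF wV] e(2) by (simp add: w_def)
 qed
 define h where "h x = nrmz (w x)" for x
 have "h \<in> paths k"
  unfolding paths_def mem_Collect_eq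
 proof (intro conjI ballI allI impI)
  show "h x \<in> M" if "x \<in> SS k" for x unfolding h_def by (rule nrmz_M[OF wV wG[OF that]])
  show "nm (h (%i. - x i) + h x) = 0" if "x \<in> SS k" for x
  proof -
   have "w (%i. - x i) = - w x" by (simp add: w_def sum_negf)
   hence "h (%i. - x i) + h x = 0" using S.even[OF wV] by (simp add: h_def nrmz_def)
   thus ?thesis by (simp add: nm_zero)
  qed
  show "(%n. nm (h (xs n) - h x)) ----> 0"
   if x: "x \<in> SS k" "ALL n. xs n \<in> SS k" "ALL i. (%n. xs n i) ----> x i" for x xs
   unfolding h_def
  proof (rule nrmz_conv[OF wV wV wG[OF x(1)]])
   have "nm (w (xs n) - w x) <= (\<Sum>i\<le>k. |xs n i - x i| * nm (e i))" for n
   proof -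
    from nm_sum[of "{..k}" e "%i. xs n i - x i"] e(1) show ?thesis
     by (simp add: w_def scaleR_diff_left sum_subtractf)
   qed
   hence "|nm (w (xs n) - w x)| <= 1 * (\<Sum>i\<le>k. |xs n i - x i| * nm (e i))" for n
    using nm_nonneg[OF diff_V[OF wV wV], of "xs n" x] by simp
   moreover have "(%n. \<Sum>i\<le>k. |xs n i - x i| * nm (e i)) ----> (\<Sum>i\<le>k. 0 * nm (e i))"
    using x(3) by (intro tendsto_intros tendsto_rabs_zero) (simp add: LIM_zero_iff)
   hence "(%n. \<Sum>i\<le>k. |xs n i - x i| * nm (e i)) ----> 0" by simp
   ultimately show "(%n. nm (w (xs n) - w x)) ----> 0"
    by (rule null_comparison)
  qed
 qed
 moreover have "EX B. ALL x:SS k. E (h x) <= B"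
 proof -
  have "continuous_on (SS k) (%x. E (h x))"
   by (rule seq_continuous_on_SS) (rule E_path_conv[OF \<open>h \<in> paths k\<close>])
  hence "bounded ((%x. E (h x)) ` SS k)"
   by (intro compact_imp_bounded compact_continuous_image compact_SS)
  then obtain B where B: "ALL y:(%x. E (h x)) ` SS k. norm y <= B" unfolding bounded_iff by blast
  have "E (h x) <= B" if "x \<in> SS k" for x
   using bspec[OF B imageI[OF that]] by simp
  thus ?thesis by blast
 qed
 ultimately show ?thesis by (auto simp: lv_def)
qed

lemma SS_nonempty: "EX x. x \<in> SS k"
 using in_topspace_nsphere topspace_nsphere_SS by blast

lemma lv_nonneg: "B \<in> lv k ==> 0 <= B"
proof -
 assume "B \<in> lv k"
 then obtain h where h: "h \<in> paths k" "ALL x:SS k. E (h x) <= B" by (auto simp: lv_def)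
 obtain x where x: "x \<in> SS k" using SS_nonempty by blast
 have "h x \<in> V" using h(1) x by (auto simp: paths_def M_def)
 thus "0 <= B" using E_nonneg[of "h x"] h(2) x by fastforce
qed

lemma lv_bdd: "bdd_below (lv k)"
 using lv_nonneg by (meson bdd_belowI)

text \<open>If no point near the level were almost critical, one step \<open>eta\<close> applied to
  a nearly optimal odd map would push its whole image below the level, and the resulting map is
  again admissible.\<close>

lemma lev_seq: "EX s. (ALL n. s n \<in> M) & (%n. E (s n)) ----> lev k & (%n::nat. nm (X (s n))) ----> 0"
proof -
 have ex: "EX u:M. |E u - lev k| <= d & nm (X u) < d" if d: "d > 0" for d
 proof (rule ccontr)
  assume "\<not> ?thesis"
  hence big: "nm (X u) >= d" if "u \<in> M" "|E u - lev k| <= d" for u using that by force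
  define R where "R = sqrt (2 * (lev k + 1))"
  have d2: "d^2 / 2 > 0" using d by simp
  obtain t0 where t0: "t0 > 0" "!!t u. 0 < t ==> t < t0 ==> u \<in> M ==> nm u <= R ==>
    E (eta t u) <= E u - t * (nm (X u))^2 + t * (d^2 / 2)"
   using descent[OF d2, of R] by blast
  \<comment> \<open>With this \<open>t\<close> the error term is at most d/4, so points below lev k
    - d stay below lev k - d/2. In the band around the level the step gains t d^2 minus the error t
    d^2 / 2, that is 2q, while the image starts less than q above the level. Both cases end at or
    below lev k - m.\<close>
  define t where "t = min (t0 / 2) (1 / d / 2)"
  have t: "t > 0" "t < t0" using t0 d by (auto simp: t_def)
  have td: "t * (d^2 / 2) <= d / 4"
  proof -
   have "t * (d^2 / 2) <= (1 / d / 2) * (d^2 / 2)" by (intro mult_right_mono) (auto simp: t_def)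
   also have "... = d / 4" using d by (simp add: power2_eq_square)
   finally show ?thesis .
  qed
  define q where "q = t * d^2 / 4"
  have q: "q > 0" using t d by (simp add: q_def)
  define ep where "ep = min (min d 1) q"
  have ep: "ep > 0" using d q by (simp add: ep_def)
  obtain B where B: "B \<in> lv k" "B < lev k + ep"
   using cInf_lessD[OF lv_nonempty, of k "lev k + ep"] ep by (auto simp: lev_def)
  then obtain h where h: "h \<in> paths k" "!!x. x \<in> SS k ==> E (h x) <= B" by (auto simp: lv_def)
  define m where "m = min q (d / 2)"
  have m: "m > 0" using q d by (simp add: m_def)
  have "E (eta t (h x)) <= lev k - m" if x: "x \<in> SS k" for x
  proof -
   have hx: "h x \<in> M" "h x \<in> V" using h(1) x by (auto simp: paths_def M_def)
   have Eh: "E (h x) < lev k + ep" using h(2)[OF x] B by simp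
   have "nm (h x) <= R" unfolding R_def using Eh ep_def by (intro nm_le_E hx) auto
   hence de: "E (eta t (h x)) <= E (h x) - t * (nm (X (h x)))^2 + t * (d^2 / 2)"
    by (rule t0(2)[OF t hx(1)])
   show ?thesis
   proof (cases "E (h x) < lev k - d")
    case True
    have "t * (nm (X (h x)))^2 >= 0" using t by simp
    thus ?thesis using de True td d unfolding m_def by linarith
   next
    case False
    hence "nm (X (h x)) >= d" using big[OF hx(1)] Eh d unfolding ep_def by linarith
    hence "t * d^2 <= t * (nm (X (h x)))^2" using t d by (intro mult_left_mono power_mono) auto
    moreover have "t * (d^2 / 2) = 2 * q" "t * d^2 = 4 * q" by (simp_all add: q_def)
    ultimately show ?thesis using de Eh unfolding ep_def m_def by linarith
   qed
  qed
  hence "lev k - m \<in> lv k" unfolding lv_def mem_Collect_eq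
   by (intro bexI[of _ "%x. eta t (h x)"] ballI paths_eta[OF h(1)])
  hence "lev k <= lev k - m" unfolding lev_def[of k] by (rule cInf_lower[OF _ lv_bdd])
  thus False using m by simp
 qed
 have "EX u:M. |E u - lev k| <= 1 / (real n + 1) & nm (X u) < 1 / (real n + 1)" for n
  by (rule ex) simp
 then obtain s where s: "!!n. s n \<in> M" "!!n. |E (s n) - lev k| <= 1 / (real n + 1)" "!!n. nm (X (s n)) < 1 / (real n + 1)"
  by metis
 have lim: "(%n. 1 / (real n + 1)) ----> 0"
  using LIMSEQ_inverse_real_of_nat by (simp add: inverse_eq_divide add.commute)
 have "(%n. E (s n) - lev k) ----> 0"
  by (rule null_comparison[OF _ lim, of _ 1]) (use s(2) in simp)
 moreover have "|nm (X (s n))| <= 1 * (1 / (real n + 1))" for n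
  using s(3)[of n] nm_nonneg[OF X_V, of "s n"] s(1)[of n] by (simp add: M_def)
 hence "(%n. nm (X (s n))) ----> 0" by (rule null_comparison[OF _ lim])
 ultimately show ?thesis using s(1) by (auto simp: LIM_zero_iff)
qed

lemma critical_levels: "EX u:M. E u = lev k & (ALL v:V. dE u v = Lam u / 4 * dG u v)"
proof -
 obtain s where s: "!!n. s n \<in> M" "(%n. E (s n)) ----> lev k" "(%n::nat. nm (X (s n))) ----> 0"
  using lev_seq[of k] by blast
 obtain B where B: "!!n. |E (s n)| <= B" using conv_bounded[OF s(2)] by blast
 obtain r u where r: "strict_mono (r::nat => nat)" "u \<in> M" "(%n. nm (s (r n) - u)) ----> 0"
  "ALL v:V. dE u v = Lam u / 4 * dG u v"
  using palais_smale[OF s(1) _ s(3), of B] B abs_le_D1 by metis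
 have "(%n. E (s (r n))) ----> E u" using s(1) r by (intro E_conv) (auto simp: M_def)
 moreover have "(%n. E (s (r n))) ----> lev k" using LIMSEQ_subseq_LIMSEQ[OF s(2) r(1)] by (simp add: o_def)
 ultimately have "E u = lev k" by (rule LIMSEQ_unique)
 thus ?thesis using r by blast
qed

text \<open>An odd map whose energy stays below b stays in the ball of radius sqrt (2 b). Composed
  with the m functionals of \<open>finite_rank\<close>, padded by zeros, it becomes an odd map from
  the k-sphere to R^k for k >= m, and its Borsuk-Ulam zero contradicts the choice of the
  functionals.\<close>

lemma lev_unbounded: "EX m. ALL k>=m. b <= lev k"
proof -
 define R where "R = sqrt (2 * b)"
 obtain m :: nat and l where ml: "(ALL i<m. (ALL u:V. ALL v:V. l i (u + v) = l i u + l i v) & (EX C. ALL u:V. |l i u| <= C * nm u))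
    & (ALL u:V. nm u <= R --> G u = 1 --> (EX i<m. l i u ~= (0::real)))"
  using finite_rank[of R] by (elim exE)
 hence l: "!!i u v. i < m ==> u \<in> V ==> v \<in> V ==> l i (u + v) = l i u + l i v"
  "!!i. i < m ==> EX C. ALL u:V. |l i u| <= C * nm u"
  "!!u. u \<in> V ==> nm u <= R ==> G u = 1 ==> EX i<m. l i u ~= (0::real)"
  by blast+
 have l0: "l i 0 = 0" if "i < m" for i using l(1)[OF that zero_V zero_V] by simp
 have lm: "l i (- u) = - l i u" if "i < m" "u \<in> V" for i u
  using l(1)[OF that(1) that(2) minus_V[OF that(2)]] l0[OF that(1)] by simp
 have "b <= lev k" if k: "k >= m" for k
 proof (rule ccontr)
  assume "\<not> b <= lev k"
  then obtain B where B: "B \<in> lv k" "B < b"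
   using cInf_lessD[OF lv_nonempty, of k b] by (auto simp: lev_def)
  then obtain h where h: "h \<in> paths k" "!!x. x \<in> SS k ==> E (h x) <= B" by (auto simp: lv_def)
  have hM: "h x \<in> M" "h x \<in> V" "G (h x) = 1" if "x \<in> SS k" for x using h(1) that by (auto simp: paths_def M_def)
  define g where "g x i = (if i < m then l i (h x) else 0)" for x i
  have "EX x:SS k. ALL i<k. g x i = 0"
  proof (rule borsuk_ulam)
   fix i assume "i < k"
   show "continuous_map (nsphere k) euclideanreal (%x. g x i)"
   proof (cases "i < m")
    case True
    obtain C where C: "!!u. u \<in> V ==> |l i u| <= C * nm u" using l(2)[OF True] by blast
    have "continuous_on (SS k) (%x. g x i)"
    proof (rule seq_continuous_on_SS)
     fix x xs assume x: "x \<in> SS k" "!!n. xs n \<in> SS k" "!!i. (%n. xs n i) ----> x i"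
     have cv: "(%n. nm (h (xs n) - h x)) ----> 0" using h(1) x unfolding paths_def by blast
     have "|l i (h (xs n)) - l i (h x)| <= C * nm (h (xs n) - h x)" for n
      using C[of "h (xs n) - h x"] l(1)[OF True, of "h (xs n) - h x" "h x"] hM x by (simp add: V_intros)
     hence "(%n. l i (h (xs n)) - l i (h x)) ----> 0" by (rule null_comparison[OF _ cv])
     thus "(%n. g (xs n) i) ----> g x i" using True by (simp add: g_def LIM_zero_iff)
    qed
    thus ?thesis by (simp add: continuous_map_nsphere_iff)
   qed (simp add: g_def)
   show "g (%i. - x i) i = - g x i" if x: "x \<in> SS k" for x
   proof (cases "i < m")
    case True
    obtain C where C: "!!u. u \<in> V ==> |l i u| <= C * nm u" using l(2)[OF True] by blast
    have hV: "h (%i. - x i) \<in> V" "h x \<in> V" using hM x uminus_SS by auto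
    have n0: "nm (h (%i. - x i) + h x) = 0" using h(1) x by (auto simp: paths_def)
    have "|l i (h (%i. - x i) + h x)| <= C * 0" using C[OF add_V[OF hV]] n0 by simp
    thus ?thesis using l(1)[OF True hV] True by (simp add: g_def)
   qed (simp add: g_def)
  qed
  then obtain x where x: "x \<in> SS k" "!!i. i < k ==> g x i = 0" by blast
  have "nm (h x) <= R" unfolding R_def using h(2)[OF x(1)] B(2) by (intro nm_le_E hM x) simp
  then obtain i where "i < m" "l i (h x) ~= 0" using l(3) hM x by blast
  thus False using x(2)[of i] k by (simp add: g_def)
 qed
 thus ?thesis by blast
qed

text \<open>Levels may repeat; their divergence makes the list infinite. The norms diverge because
  \<open>Phi\<close> is bounded on bounded sets, and \<open>Lam\<close> dominates the squared norm
  since dPhi u u >= 0.\<close>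

theorem infinitely_many_critical_points:
 "EX u. (ALL n. u n \<in> M & (ALL v:V. dE (u n) v = Lam (u n) / 4 * dG (u n) v)) &
  filterlim (%n. E (u n)) at_top sequentially & filterlim (%n. ip (u n) (u n)) at_top sequentially &
  filterlim (%n::nat. Lam (u n)) at_top sequentially"
proof -
 obtain u where u: "!!n. u n \<in> M" "!!n. E (u n) = lev n" "!!n v. v \<in> V ==> dE (u n) v = Lam (u n) / 4 * dG (u n) v"
  using critical_levels by metis
 have uV: "u n \<in> V" for n using u(1) by (auto simp: M_def)
 have Etop: "filterlim (%n. E (u n)) at_top sequentially"
  unfolding filterlim_at_top eventually_sequentially u(2) using lev_unbounded by blast
 have iptop: "filterlim (%n. ip (u n) (u n)) at_top sequentially"
  unfolding filterlim_at_top
 proof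
  fix Z :: real
  define R where "R = sqrt |Z|"
  obtain C where C: "!!v. v \<in> V ==> nm v <= R ==> |Phi v| <= C" using F.bdd[of R] by blast
  have "eventually (%n. E (u n) > |Z| / 2 + C) sequentially"
   using Etop unfolding filterlim_at_top_dense by blast
  thus "eventually (%n. Z <= ip (u n) (u n)) sequentially"
  proof eventually_elim
   case (elim n)
   show ?case
   proof (rule ccontr)
    assume "\<not> Z <= ip (u n) (u n)"
    hence l: "ip (u n) (u n) <= |Z|" by simp
    hence "nm (u n) <= R" by (simp add: nm_def R_def)
    hence "|Phi (u n)| <= C" by (rule C[OF uV])
    thus False using elim l by (simp add: E_def)
   qed
  qed
 qed
 have "filterlim (%n. Lam (u n)) at_top sequentially"
  by (rule filterlim_at_top_mono[OF iptop]) (intro always_eventually allI Lam_ge uV)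
 thus ?thesis using u Etop iptop by blast
qed

text \<open>A minimising sequence is automatically a Palais-Smale sequence: where \<open>X\<close>
  is not small, one step would take the energy below the infimum.\<close>

theorem minimizing_sequence_converges:
 assumes s: "!!n. s n \<in> M" and lim: "(%n. E (s n)) ----> Inf (E ` M)"
 shows "EX r u. strict_mono (r::nat => nat) & u \<in> M & (%n. nm (s (r n) - u)) ----> 0 & E u = Inf (E ` M)"
proof -
 have sV: "s n \<in> V" for n using s by (auto simp: M_def)
 obtain B where B: "!!n. |E (s n)| <= B" using conv_bounded[OF lim] by blast
 define R where "R = sqrt (2 * B)"
 have EB: "E (s n) <= B" for n using B[of n] by simp
 have sR: "nm (s n) <= R" for n unfolding R_def by (rule nm_le_E[OF sV EB])
 have bb: "bdd_below (E ` M)" using E_nonneg by (intro bdd_belowI2[of _ 0]) (auto simp: M_def)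
 have "(%n. (nm (X (s n)))^2) ----> 0"
 proof (rule tendstoI)
  fix e :: real assume e: "e > 0"
  obtain t0 where t0: "t0 > 0" "!!t u. 0 < t ==> t < t0 ==> u \<in> M ==> nm u <= R ==>
    E (eta t u) <= E u - t * (nm (X u))^2 + t * (e / 2)"
   using descent[of "e / 2" R] e by (metis half_gt_zero)
  define t where "t = t0 / 2"
  have t: "0 < t" "t < t0" using t0 by (auto simp: t_def)
  have "eventually (%n. E (s n) < Inf (E ` M) + t * (e / 2)) sequentially"
   by (rule order_tendstoD(2)[OF lim]) (use t e in simp)
  thus "eventually (%n. dist ((nm (X (s n)))^2) 0 < e) sequentially"
  proof eventually_elim
   case (elim n)
   have "Inf (E ` M) <= E (eta t (s n))" by (intro cINF_lower bb eta_M s)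
   also have "... <= E (s n) - t * (nm (X (s n)))^2 + t * (e / 2)" by (rule t0(2)[OF t s sR])
   finally have "t * (nm (X (s n)))^2 < t * (e / 2) + t * (e / 2)" using elim by linarith
   also have "... = t * e" by (simp add: algebra_simps)
   finally have "(nm (X (s n)))^2 < e" using t by simp
   thus ?case by (simp add: dist_real_def)
  qed
 qed
 hence "(%n. sqrt ((nm (X (s n)))^2)) ----> sqrt 0" by (intro tendsto_real_sqrt)
 hence Xs: "(%n. nm (X (s n))) ----> 0" using nm_nonneg X_V sV by simp
 obtain r u where r: "strict_mono (r::nat => nat)" "u \<in> M" "(%n. nm (s (r n) - u)) ----> 0"
  using palais_smale[OF s EB Xs] by metis
 have "(%n. E (s (r n))) ----> E u" using sV r by (intro E_conv) (auto simp: M_def)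
 moreover have "(%n. E (s (r n))) ----> Inf (E ` M)" using LIMSEQ_subseq_LIMSEQ[OF lim r(1)] by (simp add: o_def)
 ultimately have "E u = Inf (E ` M)" by (rule LIMSEQ_unique)
 thus ?thesis using r by blast
qed

end

section \<open>Smooth functions and test functions\<close>

primrec Sm :: "nat => (real => real) => bool" where
 "Sm 0 s = continuous_on UNIV s"
| "Sm (Suc n) s = (EX s'. (ALL x. (s has_real_derivative s' x) (at x)) & Sm n s')"

lemma Sm_continuous: "Sm n s ==> continuous_on UNIV s"
proof (cases n)
 case (Suc m)
 assume "Sm n s"
 then obtain s' where "!!x. (s has_real_derivative s' x) (at x)" using Suc by auto
 thus ?thesis by (intro continuous_at_imp_continuous_on ballI DERIV_isCont)
qed simp

lemma Sm_Suc_D: "Sm (Suc n) s ==> Sm n s"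
proof (induction n arbitrary: s)
 case 0
 thus ?case using Sm_continuous[of "Suc 0" s] by simp
next
 case (Suc n)
 then obtain s' where "!!x. (s has_real_derivative s' x) (at x)" "Sm (Suc n) s'" by (auto simp del: Sm.simps(1))
 thus ?case using Suc.IH by auto
qed

lemma Sm_const: "Sm n (%x. c)"
proof (induction n arbitrary: c)
 case (Suc n)
 show ?case using Suc[of 0] by (auto intro!: exI[of _ "%x. 0"])
qed simp

lemma Sm_add: "Sm n s ==> Sm n t ==> Sm n (%x. s x + t x)"
proof (induction n arbitrary: s t)
 case 0
 thus ?case by (simp add: continuous_on_add)
next
 case (Suc n)
 then obtain s' t' where "!!x. (s has_real_derivative s' x) (at x)" "Sm n s'"
  "!!x. (t has_real_derivative t' x) (at x)" "Sm n t'" by auto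
 thus ?case using Suc.IH by (auto intro!: exI[of _ "%x. s' x + t' x"] DERIV_add)
qed

lemma Sm_mult: "Sm n s ==> Sm n t ==> Sm n (%x. s x * t x)"
proof (induction n arbitrary: s t)
 case 0
 thus ?case by (simp add: continuous_on_mult)
next
 case (Suc n)
 then obtain s' t' where st: "!!x. (s has_real_derivative s' x) (at x)" "Sm n s'"
  "!!x. (t has_real_derivative t' x) (at x)" "Sm n t'" by auto
 have "Sm n (%x. s' x * t x + t' x * s x)"
  using Suc.IH st Suc.prems[THEN Sm_Suc_D] by (intro Sm_add) auto
 moreover have "((%x. s x * t x) has_real_derivative s' x * t x + t' x * s x) (at x)" for x
  using DERIV_mult[OF st(1) st(3)] .
 ultimately show ?case unfolding Sm.simps by (intro exI[of _ "%x. s' x * t x + t' x * s x"] conjI allI)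
qed

lemma Sm_cmult: "Sm n s ==> Sm n (%x. c * s x)"
 by (intro Sm_mult Sm_const)

lemma Sm_diff: "Sm n s ==> Sm n t ==> Sm n (%x. s x - t x)"
 using Sm_add[of n s "%x. -1 * t x"] Sm_cmult[of n t "-1"] by simp

lemma Sm_affine: "Sm n s ==> Sm n (%x. s (a * x + b))"
proof (induction n arbitrary: s)
 case 0
 thus ?case by (auto intro!: continuous_on_compose2[of UNIV s] continuous_intros)
next
 case (Suc n)
 then obtain s' where s': "!!x. (s has_real_derivative s' x) (at x)" "Sm n s'" by auto
 have "((%x. s (a * x + b)) has_real_derivative s' (a * x + b) * a) (at x)" for x
 proof -
  have "((%x. a * x + b) has_real_derivative a) (at x)" by (auto intro!: derivative_eq_intros)
  from DERIV_chain2[OF s'(1) this] show ?thesis .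
 qed
 moreover have "Sm n (%x. s' (a * x + b) * a)" by (intro Sm_mult Sm_const Suc.IH s')
 ultimately show ?case unfolding Sm.simps by (intro exI[of _ "%x. s' (a * x + b) * a"] conjI allI)
qed

text \<open>The standard smooth function exp(-1/x), with a power attached so that the linear span of
  the family is closed under differentiation; smoothness of all members then follows by one
  induction.\<close>

definition flat :: "real => real => real" where
 "flat a x = (if x <= 0 then 0 else x powr a * exp (- (1 / x)))"

lemma flat_lim: "((%x. x powr a * exp (- (1 / x))) \<longlongrightarrow> 0) (at_right (0::real))"
proof -
 have "((%y::real. y powr (- a) * exp (- y)) \<longlongrightarrow> 0) at_top"
 proof (rule tendsto_sandwich[of "%_. 0" _ _ "%y. y ^ nat \<lceil>|a|\<rceil> / exp y"])
  show "eventually (%y::real. y powr (- a) * exp (- y) <= y ^ nat \<lceil>|a|\<rceil> / exp y) at_top"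
   using eventually_ge_at_top[of 1]
  proof eventually_elim
   case (elim y)
   have "y powr (- a) <= y powr real (nat \<lceil>|a|\<rceil>)"
    using elim by (intro powr_mono) linarith+
   also have "... = y ^ nat \<lceil>|a|\<rceil>" using elim by (intro powr_realpow) simp
   finally show ?case using elim by (simp add: exp_minus divide_inverse mult_right_mono)
  qed
  show "((%y::real. y ^ nat \<lceil>|a|\<rceil> / exp y) \<longlongrightarrow> 0) at_top" by (rule tendsto_power_div_exp_0)
 qed auto
 hence "((%x::real. inverse x powr (- a) * exp (- inverse x)) \<longlongrightarrow> 0) (at_right 0)"
  by (simp add: filterlim_at_top_to_right)
 thus ?thesis
  by (rule Lim_transform_eventually)
   (auto simp: eventually_at_filter powr_minus inverse_eq_divide powr_divide)
qed

lemma flat_deriv: "(flat a has_real_derivative a * flat (a - 1) x + flat (a - 2) x) (at x)"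
proof -
 consider "x > 0" | "x < 0" | "x = 0" by linarith
 thus ?thesis
 proof cases
  case 1
  have "((%x. x powr a * exp (- (1 / x))) has_real_derivative
    a * x powr (a - 1) * exp (- (1 / x)) + x powr a * (exp (- (1 / x)) * (1 / x^2))) (at x)"
   using 1 by (auto intro!: derivative_eq_intros simp: power2_eq_square field_simps)
  moreover have "a * x powr (a - 1) * exp (- (1 / x)) + x powr a * (exp (- (1 / x)) * (1 / x^2))
    = a * flat (a - 1) x + flat (a - 2) x"
   using 1 by (simp add: flat_def powr_diff powr_numeral field_simps)
  ultimately have "((%x. x powr a * exp (- (1 / x))) has_real_derivative a * flat (a - 1) x + flat (a - 2) x) (at x)"
   by simp
  thus ?thesis
  proof (rule has_field_derivative_transform_within_open[of _ _ _ "{0<..}"])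
   show "!!y. y \<in> {0<..} ==> y powr a * exp (- (1 / y)) = flat a y" by (simp add: flat_def)
  qed (use 1 in auto)
 next
  case 2
  have "((%x. 0::real) has_real_derivative a * flat (a - 1) x + flat (a - 2) x) (at x)"
   using 2 by (simp add: flat_def)
  thus ?thesis
   by (rule has_field_derivative_transform_within_open[of _ _ _ "{..<0}"]) (use 2 in \<open>auto simp: flat_def\<close>)
 next
  case 3
  have "((%y. flat a y / y) \<longlongrightarrow> 0) (at 0)"
   unfolding filterlim_at_split
  proof
   show "((%y. flat a y / y) \<longlongrightarrow> 0) (at_left 0)"
    by (rule Lim_transform_eventually[of "%_. 0"]) (auto simp: eventually_at_filter flat_def)
   show "((%y. flat a y / y) \<longlongrightarrow> 0) (at_right 0)"
    by (rule Lim_transform_eventually[OF flat_lim[of "a - 1"]])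
     (auto simp: eventually_at_filter flat_def powr_diff)
  qed
  thus ?thesis unfolding 3 by (simp add: has_field_derivative_iff flat_def)
 qed
qed

lemma Sm_flat: "Sm n (flat a)"
proof (induction n arbitrary: a)
 case 0
 show ?case using flat_deriv by (auto intro!: continuous_at_imp_continuous_on DERIV_isCont)
next
 case (Suc n)
 show ?case using flat_deriv Suc by (auto intro!: exI[of _ "%x. a * flat (a - 1) x + flat (a - 2) x"] Sm_add Sm_cmult)
qed

lemma flat_nonneg: "0 <= flat a x" by (simp add: flat_def)

lemma flat0_le_1: "flat 0 x <= 1" by (simp add: flat_def)

lemma flat_pos_iff: "flat a x ~= 0 \<longleftrightarrow> x > 0" by (simp add: flat_def)

text \<open>As \<open>n\<close> grows, \<open>bump n a b\<close> increases to the indicator of \<open>{a<..<b}\<close>.\<close>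

definition bump :: "nat => real => real => real => real" where
 "bump n a b x = flat 0 (real (Suc n) * (x - a)) * flat 0 (real (Suc n) * (b - x))"

lemma Sm_bump: "Sm k (bump n a b)"
proof -
 have "Sm k (%x. flat 0 (real (Suc n) * x + (- (real (Suc n) * a))) * flat 0 ((- real (Suc n)) * x + real (Suc n) * b))"
  by (intro Sm_mult Sm_affine Sm_flat)
 thus ?thesis unfolding bump_def by (simp add: algebra_simps)
qed

lemma bump_nz: "bump n a b x ~= 0 \<longleftrightarrow> a < x & x < b"
 by (simp add: bump_def flat_pos_iff zero_less_mult_iff)

lemma bump_nonneg: "0 <= bump n a b x"
 by (simp add: bump_def flat_nonneg)

lemma bump_le_1: "bump n a b x <= 1"
 unfolding bump_def by (intro mult_le_one flat_nonneg flat0_le_1)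

lemma bump_lim: "(%n. bump n a b x) ----> (if a < x & x < b then 1 else 0)"
proof -
 have fl: "(%n. flat 0 (real (Suc n) * y)) ----> (if y > 0 then 1 else 0)" for y
 proof (cases "y > 0")
  case True
  have "(%n. exp (- (1 / (real (Suc n) * y)))) ----> 1" using True by real_asymp
  moreover have "flat 0 (real (Suc n) * y) = exp (- (1 / (real (Suc n) * y)))" for n
   using True by (simp add: flat_def zero_less_mult_iff not_le)
  ultimately show ?thesis using True by simp
 next
  case False
  hence "flat 0 (real (Suc n) * y) = 0" for n by (simp add: flat_def mult_nonneg_nonpos)
  thus ?thesis using False by simp
 qed
 have "(%n. bump n a b x) ----> (if x - a > 0 then 1 else 0) * (if b - x > 0 then 1 else 0)"
  unfolding bump_def by (intro tendsto_mult fl)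
 thus ?thesis by (auto split: if_splits)
qed

section \<open>Smooth functions and test functions in space\<close>

lemma Ck_SucI:
 assumes "!!x. (\<phi> has_derivative (%v. D v x)) (at x)" "!!v. Ck n (D v)"
 shows "Ck (Suc n) \<phi>"
proof -
 have "frechet_derivative \<phi> (at x) = (%v. D v x)" for x
  using frechet_derivative_at[OF assms(1)] by simp
 hence "(%x. frechet_derivative \<phi> (at x) v) = D v" for v by (simp add: fun_eq_iff)
 thus ?thesis using assms by (auto simp: differentiable_def)
qed

lemma Ck_SucD:
 assumes "Ck (Suc n) \<phi>"
 shows "EX D. (ALL x. (\<phi> has_derivative (%v. D v x)) (at x)) & (ALL v. Ck n (D v))"
proof (intro exI conjI allI)
 show "(\<phi> has_derivative (%v. frechet_derivative \<phi> (at x) v)) (at x)" for x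
  using assms frechet_derivative_works by auto
 show "Ck n (%x. frechet_derivative \<phi> (at x) v)" for v using assms by simp
qed

lemma Ck_continuous: "Ck n \<phi> ==> continuous_on UNIV \<phi>"
proof (cases n)
 case (Suc m)
 assume "Ck n \<phi>"
 thus ?thesis using Suc
  by (auto intro!: continuous_at_imp_continuous_on differentiable_imp_continuous_within)
qed simp

lemma Ck_Suc_D: "Ck (Suc n) \<phi> ==> Ck n \<phi>"
proof (induction n arbitrary: \<phi>)
 case 0
 thus ?case using Ck_continuous[of "Suc 0" \<phi>] by simp
next
 case (Suc n)
 then obtain D where D: "!!x. (\<phi> has_derivative (%v. D v x)) (at x)" "!!v. Ck (Suc n) (D v)"
  using Ck_SucD[OF Suc.prems] by blast
 show ?case by (rule Ck_SucI[OF D(1) Suc.IH[OF D(2)]])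
qed

lemma Ck_const: "Ck n (%x. c)"
proof (induction n arbitrary: c)
 case (Suc n)
 thus ?case by (intro Ck_SucI[of _ "%v x. 0"]) auto
qed simp

lemma Ck_add: "Ck n \<phi> ==> Ck n \<psi> ==> Ck n (%x. \<phi> x + \<psi> x)"
proof (induction n arbitrary: \<phi> \<psi>)
 case 0
 thus ?case by (simp add: continuous_on_add)
next
 case (Suc n)
 obtain D where D: "!!x. (\<phi> has_derivative (%v. D v x)) (at x)" "!!v. Ck n (D v)"
  using Ck_SucD[OF Suc.prems(1)] by blast
 obtain D' where D': "!!x. (\<psi> has_derivative (%v. D' v x)) (at x)" "!!v. Ck n (D' v)"
  using Ck_SucD[OF Suc.prems(2)] by blast
 show ?case by (rule Ck_SucI[OF has_derivative_add[OF D(1) D'(1)] Suc.IH[OF D(2) D'(2)]])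
qed

lemma Ck_mult: "Ck n \<phi> ==> Ck n \<psi> ==> Ck n (%x. \<phi> x * \<psi> x)"
proof (induction n arbitrary: \<phi> \<psi>)
 case 0
 thus ?case by (simp add: continuous_on_mult)
next
 case (Suc n)
 obtain D where D: "!!x. (\<phi> has_derivative (%v. D v x)) (at x)" "!!v. Ck n (D v)"
  using Ck_SucD[OF Suc.prems(1)] by blast
 obtain D' where D': "!!x. (\<psi> has_derivative (%v. D' v x)) (at x)" "!!v. Ck n (D' v)"
  using Ck_SucD[OF Suc.prems(2)] by blast
 show ?case
 proof (rule Ck_SucI[of _ "%v x. \<phi> x * D' v x + D v x * \<psi> x"])
  show "((%x. \<phi> x * \<psi> x) has_derivative (%v. \<phi> x * D' v x + D v x * \<psi> x)) (at x)" for x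
   by (rule has_derivative_mult[OF D(1) D'(1)])
  show "Ck n (%x. \<phi> x * D' v x + D v x * \<psi> x)" for v
   using Suc.prems[THEN Ck_Suc_D] D D' by (intro Ck_add Suc.IH)
 qed
qed

lemma Ck_prod: "finite A ==> (!!i. i \<in> A ==> Ck n (\<phi> i)) ==> Ck n (%x. \<Prod>i\<in>A. \<phi> i x)"
 by (induction A rule: finite_induct) (auto intro!: Ck_const Ck_mult)

lemma Ck_inner: "Ck n (%x. x \<bullet> w)"
proof (cases n)
 case (Suc m)
 show ?thesis unfolding Suc
  by (rule Ck_SucI[of _ "%v x. v \<bullet> w"]) (auto intro!: Ck_const has_derivative_inner_left has_derivative_ident)
qed (auto intro!: continuous_intros)

lemma Ck_component: "Ck n (%x. x $ i)"
 using Ck_inner[of n "axis i 1"] by (simp add: inner_axis)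

lemma Ck_norm_sq: "Ck n (%x. (norm x)^2)"
proof -
 have "Ck n (%x. x $ 1 * x $ 1 + x $ 2 * x $ 2 + x $ 3 * x $ 3)"
  by (intro Ck_add Ck_mult Ck_component)
 moreover have "(norm x)^2 = x $ 1 * x $ 1 + x $ 2 * x $ 2 + x $ 3 * x $ 3" for x :: "real^3"
  by (simp add: power2_norm_eq_inner inner_vec_def sum_3)
 ultimately show ?thesis by simp
qed

lemma Ck_Sm: "Sm n s ==> Ck n p ==> Ck n (%x. s (p x))"
proof (induction n arbitrary: s)
 case 0
 thus ?case by (auto intro!: continuous_on_compose2[of UNIV s])
next
 case (Suc n)
 obtain D where D: "!!x. (p has_derivative (%v. D v x)) (at x)" "!!v. Ck n (D v)"
  using Ck_SucD[OF Suc.prems(2)] by blast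
 from Suc.prems obtain s' where s': "!!x. (s has_real_derivative s' x) (at x)" "Sm n s'" by auto
 show ?case
 proof (rule Ck_SucI[of _ "%v x. s' (p x) * D v x"])
  show "((%x. s (p x)) has_derivative (%v. s' (p x) * D v x)) (at x)" for x
   using has_derivative_compose[OF D(1) s'(1)[unfolded has_field_derivative_def]] .
  show "Ck n (%x. s' (p x) * D v x)" for v
   by (rule Ck_mult[OF Suc.IH[OF s'(2) Ck_Suc_D[OF Suc.prems(2)]] D(2)])
 qed
qed

lemma Ck_linear:
 assumes "linear T"
 shows "Ck n \<phi> ==> Ck n (%x. \<phi> (T x))"
proof (induction n arbitrary: \<phi>)
 case 0
 thus ?case using linear_continuous_on[OF linear_conv_bounded_linear[THEN iffD1, OF assms], of UNIV]
  by (auto intro!: continuous_on_compose2[of UNIV \<phi>])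
next
 case (Suc n)
 obtain D where D: "!!x. (\<phi> has_derivative (%v. D v x)) (at x)" "!!v. Ck n (D v)"
  using Ck_SucD[OF Suc.prems] by blast
 show ?case
 proof (rule Ck_SucI[of _ "%v x. D (T v) (T x)"])
  show "((%x. \<phi> (T x)) has_derivative (%v. D (T v) (T x))) (at x)" for x
   using has_derivative_compose[OF linear_imp_has_derivative[OF assms] D(1)] .
  show "Ck n (%x. D (T v) (T x))" for v by (rule Suc.IH[OF D(2)])
 qed
qed

abbreviation dd :: "(real^3 => real) => real^3 => real^3 => real" where
 "dd \<phi> v x \<equiv> frechet_derivative \<phi> (at x) v"

lemma dd_eq: "(\<phi> has_derivative D) (at x) ==> dd \<phi> v x = D v"
 using frechet_derivative_at by metis

lemma test_funI:
 assumes "!!n. Ck n \<phi>" "!!x. norm x > R ==> \<phi> x = 0"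
 shows "test_fun \<phi>"
proof -
 have "{x. \<phi> x ~= 0} \<subseteq> cball 0 R" using assms(2) by force
 hence "bounded {x. \<phi> x ~= 0}" using bounded_cball bounded_subset by blast
 thus ?thesis using assms(1) by (simp add: test_fun_def compact_closure)
qed

lemma test_fun_deriv:
 assumes "test_fun \<phi>"
 shows "(\<phi> has_derivative (%v. dd \<phi> v x)) (at x)"
proof -
 have "Ck (Suc 0) \<phi>" using assms by (auto simp: test_fun_def simp del: Ck.simps)
 thus ?thesis using frechet_derivative_works by auto
qed

lemma test_fun_continuous: "test_fun \<phi> ==> continuous_on UNIV \<phi>"
 using Ck_continuous[of 0 \<phi>] by (auto simp: test_fun_def simp del: Ck.simps)

lemma test_fun_dd_continuous: "test_fun \<phi> ==> continuous_on UNIV (dd \<phi> v)"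
proof -
 assume "test_fun \<phi>"
 hence "Ck (Suc 0) \<phi>" by (auto simp: test_fun_def simp del: Ck.simps)
 thus ?thesis by simp
qed

lemma test_fun_support:
 assumes "test_fun \<phi>"
 obtains R where "R > 0" "!!x. norm x > R ==> \<phi> x = 0" "!!x v. norm x > R ==> dd \<phi> v x = 0"
proof -
 have "bounded {x. \<phi> x ~= 0}"
  using assms unfolding test_fun_def
  using bounded_subset[OF compact_imp_bounded closure_subset] by blast
 then obtain R where R: "R > 0" "ALL x:{x. \<phi> x ~= 0}. norm x <= R" unfolding bounded_pos by blast
 hence z: "\<phi> x = 0" if "norm x > R" for x using that by force
 have "dd \<phi> v x = 0" if "norm x > R" for x v
 proof -
  have "open (- cball 0 R :: (real^3) set)" by auto
  hence "(\<phi> has_derivative (%v. 0)) (at x)"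
   using that z by (intro has_derivative_transform_within_open[OF has_derivative_const[of 0], of "- cball 0 R"]) auto
  thus ?thesis by (rule dd_eq)
 qed
 thus ?thesis using that R(1) z by blast
qed

lemma cont_support_bounded:
 fixes k :: "real^3 => real"
 assumes "continuous_on UNIV k" "!!x. norm x > R ==> k x = 0"
 obtains B where "B >= 0" "!!x. |k x| <= B"
proof -
 have "bounded (k ` cball 0 R)"
  using assms(1) by (intro compact_imp_bounded compact_continuous_image) (auto intro: continuous_on_subset)
 then obtain B where B: "B > 0" "ALL y:k ` cball 0 R. norm y <= B" unfolding bounded_pos by blast
 have "|k x| <= B" for x
 proof (cases "norm x > R")
  case True
  thus ?thesis using assms(2) B(1) by simp
 next
  case False
  thus ?thesis using B(2) by (auto simp: not_less)
 qed
 thus ?thesis using that[of B] B(1) by simp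
qed

definition boxfun :: "nat => real^3 => real^3 => real^3 => real" where
 "boxfun n a b x = (\<Prod>i\<in>UNIV. bump n (a $ i) (b $ i) (x $ i))"

lemma boxfun_test: "test_fun (boxfun n a b)"
proof -
 obtain R where R: "ALL x:cbox a b. norm x <= R" using bounded_cbox bounded_iff by metis
 show ?thesis
 proof (rule test_funI)
  show "Ck k (boxfun n a b)" for k
   unfolding boxfun_def by (intro Ck_prod Ck_Sm[OF Sm_bump Ck_component] finite_class.finite_UNIV)
  show "boxfun n a b x = 0" if "norm x > R" for x
  proof (rule ccontr)
   assume "boxfun n a b x ~= 0"
   hence "x \<in> cbox a b" by (auto simp: boxfun_def bump_nz mem_box_cart less_imp_le)
   thus False using R that by force
  qed
 qed
qed

lemma boxfun_bound: "0 <= boxfun n a b x" "boxfun n a b x <= 1"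
 unfolding boxfun_def by (auto intro!: prod_nonneg prod_le_1 bump_nonneg bump_le_1)

lemma boxfun_nz: "boxfun n a b x ~= 0 ==> x \<in> box a b"
 by (auto simp: boxfun_def bump_nz mem_box_cart)

lemma boxfun_lim: "(%n. boxfun n a b x) ----> indicator (box a b) x"
proof -
 have "(%n. boxfun n a b x) ----> (\<Prod>i\<in>UNIV. if a $ i < x $ i & x $ i < b $ i then 1 else 0)"
  unfolding boxfun_def by (intro tendsto_prod bump_lim)
 also have "(\<Prod>i\<in>UNIV. if a $ i < x $ i & x $ i < b $ i then 1 else 0) = (indicator (box a b) x :: real)"
  by (auto simp: indicator_def mem_box_cart intro!: prod_zero)
 finally show ?thesis .
qed

section \<open>Square-integrable functions\<close>

lemmas L1_bound = Bochner_Integration.integrable_bound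
lemmas LINT_cong = Bochner_Integration.integral_cong

definition l2 :: "(real^3 => 'b::euclidean_space) => bool" where
 "l2 u \<longleftrightarrow> u \<in> borel_measurable lborel & integrable lborel (%x. (norm (u x))^2)"

definition n2 :: "(real^3 => 'b::euclidean_space) => real" where
 "n2 u = (LINT x|lborel. (norm (u x))^2)"

lemma l2_measurable [measurable_dest]: "l2 u ==> u \<in> borel_measurable lborel"
 by (simp add: l2_def)

lemma l2_borel: "l2 u ==> u \<in> borel_measurable borel"
 by (simp add: l2_def)

lemma int_borel: "integrable lborel u ==> u \<in> borel_measurable borel"
 using borel_measurable_integrable by simp

lemma l2_integrable: "l2 u ==> integrable lborel (%x. (norm (u x))^2)"
 by (simp add: l2_def)

lemma n2_nonneg: "0 <= n2 u"
 by (simp add: n2_def)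

lemma l2_norm_prod:
 assumes "l2 u" "l2 v"
 shows "integrable lborel (%x. norm (u x) * norm (v x))"
proof (rule L1_bound)
 show "integrable lborel (%x. (norm (u x))^2 + (norm (v x))^2)"
  using assms by (intro Bochner_Integration.integrable_add l2_integrable)
 show "(%x. norm (u x) * norm (v x)) \<in> borel_measurable lborel"
  using assms[THEN l2_measurable] by measurable
 have "a * b <= a^2 + b^2" if "a >= 0" "b >= 0" for a b :: real
  using sum_squares_bound[of a b] that mult_nonneg_nonneg[OF that] by linarith
 thus "AE x in lborel. norm (norm (u x) * norm (v x)) <= norm ((norm (u x))^2 + (norm (v x))^2)"
  by auto
qed

lemma l2_inner:
 assumes "l2 u" "l2 v"
 shows "integrable lborel (%x. u x \<bullet> v x)"
proof (rule L1_bound[OF l2_norm_prod[OF assms]])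
 show "(%x. u x \<bullet> v x) \<in> borel_measurable lborel" using assms[THEN l2_measurable] by measurable
qed (auto simp: Cauchy_Schwarz_ineq2)

lemma l2_scale: "l2 u ==> l2 (%x. c *\<^sub>R u x)"
 by (auto simp: l2_def power_mult_distrib)

lemma l2_add:
 assumes "l2 u" "l2 v"
 shows "l2 (%x. u x + v x)"
 unfolding l2_def
proof
 show m: "(%x. u x + v x) \<in> borel_measurable lborel" using assms[THEN l2_measurable] by measurable
 show "integrable lborel (%x. (norm (u x + v x))^2)"
 proof (rule L1_bound)
  show "integrable lborel (%x. 2 * (norm (u x))^2 + 2 * (norm (v x))^2)"
   using assms by (intro Bochner_Integration.integrable_add integrable_mult_right l2_integrable)
  have "(norm (x + y))^2 <= 2 * (norm x)^2 + 2 * (norm y)^2" for x y :: 'a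
  proof -
   have "(norm (x + y))^2 <= (norm x + norm y)^2" by (intro power_mono norm_triangle_ineq) auto
   also have "... <= 2 * (norm x)^2 + 2 * (norm y)^2"
    using sum_squares_bound[of "norm x" "norm y"] by (simp add: power2_sum)
   finally show ?thesis .
  qed
  thus "AE x in lborel. norm ((norm (u x + v x))^2) <= norm (2 * (norm (u x))^2 + 2 * (norm (v x))^2)"
   by auto
 qed (use m in measurable)
qed

lemma l2_diff: "l2 u ==> l2 v ==> l2 (%x. u x - v x)"
 using l2_add[of u "%x. (-1) *\<^sub>R v x"] l2_scale[of v "-1"] by simp

lemma l2_zero: "l2 (%x. 0)"
 by (simp add: l2_def)

lemma l2_cong_AE: "l2 u ==> v \<in> borel_measurable lborel ==> AE x in lborel. u x = v x ==> l2 v"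
 unfolding l2_def by (auto intro!: integrable_cong_AE_imp[where g = "%x. (norm (u x))^2"])

lemma n2_cong_AE:
 assumes "u \<in> borel_measurable lborel" "v \<in> borel_measurable lborel" "AE x in lborel. u x = v x"
 shows "n2 u = n2 v"
 unfolding n2_def using assms by (intro integral_cong_AE) auto

lemma integrable_cball [simp]: "integrable lborel (indicator (cball (a::real^3) r) :: _ => real)"
 by (intro integrable_real_indicator) (auto simp: emeasure_bounded_finite[unfolded infinity_ennreal_def])

lemma l2_bounded_support:
 fixes k :: "real^3 => 'b::euclidean_space"
 assumes "k \<in> borel_measurable lborel" "!!x. norm x > R ==> k x = 0" "!!x. norm (k x) <= B"
 shows "l2 k"
 unfolding l2_def
proof
 show "integrable lborel (%x. (norm (k x))^2)"
 proof (rule L1_bound)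
  show "integrable lborel (%x::real^3. B^2 * indicator (cball 0 R) x)" by simp
  have "(norm (k x))^2 <= B^2 * indicator (cball 0 R) x" for x
   using assms(2)[of x] power_mono[OF assms(3)[of x] norm_ge_zero, of 2] by (cases "norm x > R") (auto simp: indicator_def)
  thus "AE x in lborel. norm ((norm (k x))^2) <= norm (B^2 * indicator (cball 0 R) x)"
   by (auto intro: order_trans[OF _ abs_ge_self])
 qed (use assms(1) in measurable)
qed (rule assms)

lemma quadratic_discriminant:
 fixes A B C :: real
 assumes "!!t. 0 <= A - 2 * t * B + t^2 * C" "C >= 0"
 shows "B^2 <= A * C"
proof (cases "C = 0")
 case True
 have "B = 0"
 proof (rule ccontr)
  assume "B ~= 0"
  thus False using assms(1)[of "(A + 1) / (2 * B)"] True by simp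
 qed
 thus ?thesis using True by simp
next
 case False
 thus ?thesis using assms(1)[of "B / C"] assms(2) by (simp add: field_simps power2_eq_square)
qed

lemma cauchy_schwarz_norm:
 assumes u: "l2 u" and v: "l2 v"
 shows "(LINT x|lborel. norm (u x) * norm (v x)) <= sqrt (n2 u) * sqrt (n2 v)"
proof -
 let ?B = "LINT x|lborel. norm (u x) * norm (v x)"
 have "0 <= n2 u - 2 * t * ?B + t^2 * n2 v" for t
 proof -
  have "0 <= (LINT x|lborel. (norm (u x) - t * norm (v x))^2)" by simp
  also have "... = (LINT x|lborel. (norm (u x))^2 - 2 * t * (norm (u x) * norm (v x)) + t^2 * (norm (v x))^2)"
   by (intro LINT_cong) (auto simp: power2_eq_square algebra_simps)
  also have "... = n2 u - 2 * t * ?B + t^2 * n2 v"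
   using u v by (simp add: n2_def l2_norm_prod l2_integrable)
  finally show ?thesis .
 qed
 hence "?B^2 <= n2 u * n2 v" by (intro quadratic_discriminant n2_nonneg)
 hence "?B <= sqrt (n2 u * n2 v)" by (rule real_le_rsqrt)
 thus ?thesis by (simp add: real_sqrt_mult)
qed

lemma cauchy_schwarz_inner:
 assumes u: "l2 u" and v: "l2 v"
 shows "|LINT x|lborel. u x \<bullet> v x| <= sqrt (n2 u) * sqrt (n2 v)"
proof -
 have "|LINT x|lborel. u x \<bullet> v x| <= (LINT x|lborel. norm (u x \<bullet> v x))"
  using integral_norm_bound[of lborel "%x. u x \<bullet> v x"] by simp
 also have "... <= (LINT x|lborel. norm (u x) * norm (v x))"
  using u v by (intro integral_mono integrable_norm l2_inner l2_norm_prod) (auto simp: Cauchy_Schwarz_ineq2)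
 finally show ?thesis using cauchy_schwarz_norm[OF u v] by linarith
qed

lemma n2_zero_AE:
 assumes "l2 u" "n2 u = 0"
 shows "AE x in lborel. u x = 0"
proof -
 have "AE x in lborel. (norm (u x))^2 = 0"
  using assms integral_nonneg_eq_0_iff_AE[OF l2_integrable[OF assms(1)]] by (simp add: n2_def)
 thus ?thesis by auto
qed

lemma nn_integral_l2: "l2 u ==> (\<integral>\<^sup>+x. ennreal ((norm (u x))^2) \<partial>lborel) = ennreal (n2 u)"
 unfolding n2_def by (intro nn_integral_eq_integral l2_integrable) auto

text \<open>Riesz-Fischer, with the almost everywhere convergent subsequence exported: radiality of
  limits is read off from it.\<close>

lemma l2_complete:
 fixes s :: "nat => real^3 => 'b::euclidean_space"
 assumes s: "!!n. l2 (s n)"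
  and C: "!!e. e > 0 ==> EX N. ALL m>=N. ALL n>=N. n2 (%x. s m x - s n x) < e"
 shows "EX u r. l2 u & (%n. n2 (%x. s n x - u x)) ----> 0 & strict_mono (r::nat => nat) &
  (AE x in lborel. (%n. s (r n) x) ----> u x)"
proof -
 have sm [measurable]: "s n \<in> borel_measurable lborel" for n using s by (rule l2_measurable)
 have "ALL k. EX N. ALL m>=N. ALL n>=N. n2 (%x. s m x - s n x) < (1/4) ^ k" using C by simp
 then obtain N where N: "!!k m n. m >= N k ==> n >= N k ==> n2 (%x. s m x - s n x) < (1/4::real) ^ k" by metis
 \<comment> \<open>Consecutive terms of the subsequence are within 4^(-k) in squared norm, so
   weights 2^k still leave a summable series.\<close>
 define r where "r = rec_nat (N 0) (%k a. Suc (max a (N (Suc k))))"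
 have r: "strict_mono r" by (rule strict_monoI_Suc) (simp add: r_def)
 have rN: "r k >= N k" for k by (cases k) (auto simp: r_def)
 define d where "d k x = norm (s (r (Suc k)) x - s (r k) x)" for k x
 have dm [measurable]: "d k \<in> borel_measurable lborel" for k unfolding d_def by measurable
 have dk: "(\<integral>\<^sup>+x. ennreal ((d k x)^2) \<partial>lborel) <= ennreal ((1/4) ^ k)" for k
 proof -
  have "(\<integral>\<^sup>+x. ennreal ((d k x)^2) \<partial>lborel) = ennreal (n2 (%x. s (r (Suc k)) x - s (r k) x))"
   unfolding d_def by (rule nn_integral_l2[OF l2_diff[OF s s]])
  also have "... <= ennreal ((1/4) ^ k)"
   using N[of k "r (Suc k)" "r k"] rN[of k] strict_monoD[OF r, of k "Suc k"] by (intro ennreal_leI) simp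
  finally show ?thesis .
 qed
 have "(\<integral>\<^sup>+x. (suminf (%k. ennreal (2 ^ k * (d k x)^2))) \<partial>lborel) = suminf (%k. \<integral>\<^sup>+x. ennreal (2 ^ k * (d k x)^2) \<partial>lborel)"
  by (intro nn_integral_suminf) measurable
 also have "... <= suminf (%k. ennreal ((1/2) ^ k))"
 proof (rule suminf_le)
  fix k
  have "(\<integral>\<^sup>+x. ennreal (2 ^ k * (d k x)^2) \<partial>lborel) = ennreal (2 ^ k) * (\<integral>\<^sup>+x. ennreal ((d k x)^2) \<partial>lborel)"
   by (simp add: ennreal_mult nn_integral_cmult)
  also have "... <= ennreal (2 ^ k) * ennreal ((1/4) ^ k)" by (intro mult_left_mono dk) simp
  also have "... = ennreal ((1/2) ^ k)" by (simp add: ennreal_mult[symmetric] power_mult_distrib[symmetric])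
  finally show "(\<integral>\<^sup>+x. ennreal (2 ^ k * (d k x)^2) \<partial>lborel) <= ennreal ((1/2) ^ k)" .
 qed auto
 also have "... = ennreal (suminf (%k. (1/2) ^ k))"
  by (intro suminf_ennreal2) (auto intro: summable_geometric)
 also have "... < \<infinity>" by simp
 finally have "(\<integral>\<^sup>+x. (suminf (%k. ennreal (2 ^ k * (d k x)^2))) \<partial>lborel) ~= \<infinity>" by simp
 hence "AE x in lborel. (suminf (%k. ennreal (2 ^ k * (d k x)^2))) ~= \<infinity>"
  by (intro nn_integral_PInf_AE) measurable
 hence cv: "AE x in lborel. convergent (%k. s (r k) x)"
 proof eventually_elim
  case (elim x)
  hence "summable (%k. 2 ^ k * (d k x)^2)"
   by (intro summable_suminf_not_top) (auto simp: top_ennreal.rep_eq)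
  hence "summable (%k. 2 ^ k * (d k x)^2 + (1/2) ^ k)"
   by (intro summable_add summable_geometric) auto
  \<comment> \<open>A square completed: it turns summable weighted squares into summable
    increments.\<close>
  moreover have "d k x <= 2 ^ k * (d k x)^2 + (1/2) ^ k" for k
  proof -
   have "0 <= (2 ^ k * d k x - 1)^2" by simp
   hence "2 * (2 ^ k * d k x) <= (2 ^ k)^2 * (d k x)^2 + 1" by (simp add: power2_diff power_mult_distrib)
   hence "2 ^ k * (2 * d k x) <= 2 ^ k * (2 ^ k * (d k x)^2 + (1/2) ^ k)"
    by (simp add: power2_eq_square algebra_simps power_mult_distrib[symmetric] power_one_over)
   hence "2 * d k x <= 2 ^ k * (d k x)^2 + (1/2) ^ k" by simp
   moreover have "d k x >= 0" by (simp add: d_def)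
   ultimately show ?thesis by linarith
  qed
  ultimately have "summable (%k. s (r (Suc k)) x - s (r k) x)"
   by (intro summable_comparison_test[of "%k. s (r (Suc k)) x - s (r k) x" "%k. 2 ^ k * (d k x)^2 + (1/2) ^ k"]) (auto simp: d_def)
  hence "convergent (%n. \<Sum>k<n. s (r (Suc k)) x - s (r k) x)" by (simp add: summable_iff_convergent)
  hence "convergent (%n. s (r n) x - s (r 0) x)" using sum_lessThan_telescope[of "%k. s (r k) x"] by simp
  hence "convergent (%n. (s (r n) x - s (r 0) x) + s (r 0) x)" by (intro convergent_add convergent_const)
  thus ?case by simp
 qed
 define u where "u x = lim (%k. s (r k) x)" for x
 have um [measurable]: "u \<in> borel_measurable lborel" unfolding u_def by measurable
 have lim: "AE x in lborel. (%k. s (r k) x) ----> u x"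
  using cv by eventually_elim (simp add: u_def convergent_LIMSEQ_iff)
 have fatou: "(\<integral>\<^sup>+x. ennreal ((norm (s m x - u x))^2) \<partial>lborel) <= ennreal e"
  if e: "e >= 0" "!!n. n >= M ==> n2 (%x. s m x - s n x) <= e" for m M e
 proof -
  have "(\<integral>\<^sup>+x. ennreal ((norm (s m x - u x))^2) \<partial>lborel)
    = (\<integral>\<^sup>+x. liminf (%k. ennreal ((norm (s m x - s (r k) x))^2)) \<partial>lborel)"
  proof (rule nn_integral_cong_AE)
   show "AE x in lborel. ennreal ((norm (s m x - u x))^2) = liminf (%k. ennreal ((norm (s m x - s (r k) x))^2))"
    using lim
   proof eventually_elim
    case (elim x)
    have "(%k. ennreal ((norm (s m x - s (r k) x))^2)) ----> ennreal ((norm (s m x - u x))^2)"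
     by (intro tendsto_ennrealI tendsto_intros elim)
    thus ?case by (intro lim_imp_Liminf[symmetric]) auto
   qed
  qed
  also have "... <= liminf (%k. \<integral>\<^sup>+x. ennreal ((norm (s m x - s (r k) x))^2) \<partial>lborel)"
   by (intro nn_integral_liminf) measurable
  also have "... <= liminf (%k. ennreal e)"
  proof (rule Liminf_mono)
   show "eventually (%k. (\<integral>\<^sup>+x. ennreal ((norm (s m x - s (r k) x))^2) \<partial>lborel) <= ennreal e) sequentially"
    using eventually_ge_at_top[of M]
   proof eventually_elim
    case (elim k)
    hence "r k >= M" using seq_suble[OF r, of k] by simp
    thus ?case using e(2) nn_integral_l2[OF l2_diff[OF s s], of m "r k"] by (simp add: ennreal_leI)
   qed
  qed
  finally show ?thesis by (simp add: Liminf_const)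
 qed
 have l2d: "l2 (%x. s m x - u x) & n2 (%x. s m x - u x) <= e"
  if e: "e >= 0" "!!n. n >= M ==> n2 (%x. s m x - s n x) <= e" for m M e
 proof -
  have f: "(\<integral>\<^sup>+x. ennreal ((norm (s m x - u x))^2) \<partial>lborel) <= ennreal e" by (rule fatou[OF e])
  hence "integrable lborel (%x. (norm (s m x - u x))^2)"
   by (intro integrableI_bounded) (auto simp: less_top[symmetric] top_unique)
  hence l: "l2 (%x. s m x - u x)" by (simp add: l2_def)
  thus ?thesis using f nn_integral_l2[OF l] e(1) by (simp add: n2_nonneg)
 qed
 have ul2: "l2 u"
 proof -
  obtain M where M: "ALL m>=M. ALL n>=M. n2 (%x. s m x - s n x) < 1" using C[of 1] by auto
  hence "l2 (%x. s M x - u x)" using l2d[of 1 M M] by (auto intro: less_imp_le)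
  from l2_diff[OF s this] have "l2 (%x. s M x - (s M x - u x))" .
  thus ?thesis by (simp add: algebra_simps)
 qed
 have "(%n. n2 (%x. s n x - u x)) ----> 0"
 proof (rule tendstoI)
  fix e :: real assume e: "e > 0"
  obtain M where M: "ALL m>=M. ALL n>=M. n2 (%x. s m x - s n x) < e / 2" using C[of "e/2"] e by auto
  have "n2 (%x. s m x - u x) < e" if "m >= M" for m
  proof -
   have "n2 (%x. s m x - s n x) <= e / 2" if "n >= M" for n
    using M \<open>m >= M\<close> that by (simp add: less_imp_le)
   hence "n2 (%x. s m x - u x) <= e / 2" using l2d[of "e/2" M m] e by auto
   thus ?thesis using e by simp
  qed
  thus "eventually (%n. dist (n2 (%x. s n x - u x)) 0 < e) sequentially"
   by (auto simp: eventually_sequentially dist_real_def n2_nonneg)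
 qed
 thus ?thesis using ul2 r lim by blast
qed

lemma l2_inner_conv:
 assumes "!!n. l2 (s n)" "l2 u" "(%n. n2 (%x. s n x - u x)) ----> 0" "l2 v"
 shows "(%n. LINT x|lborel. s n x \<bullet> v x) ----> (LINT x|lborel. u x \<bullet> v x)"
proof -
 have "|(LINT x|lborel. s n x \<bullet> v x) - (LINT x|lborel. u x \<bullet> v x)| <= sqrt (n2 v) * sqrt (n2 (%x. s n x - u x))" for n
 proof -
  have "(LINT x|lborel. s n x \<bullet> v x) - (LINT x|lborel. u x \<bullet> v x) = (LINT x|lborel. (s n x - u x) \<bullet> v x)"
   using assms by (simp add: inner_diff_left l2_inner)
  thus ?thesis using cauchy_schwarz_inner[OF l2_diff[OF assms(1,2)] assms(4), of n] by (simp add: mult.commute)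
 qed
 moreover have "(%n. sqrt (n2 (%x. s n x - u x))) ----> 0"
  using tendsto_real_sqrt[OF assms(3)] by simp
 ultimately have "(%n. (LINT x|lborel. s n x \<bullet> v x) - (LINT x|lborel. u x \<bullet> v x)) ----> 0"
  by (rule null_comparison)
 thus ?thesis by (simp add: LIM_zero_iff)
qed

section \<open>Weak gradients and the space H1\<close>

lemma test_fun_l2: "test_fun \<phi> ==> l2 \<phi>"
proof -
 assume t: "test_fun \<phi>"
 obtain R where R: "!!x. norm x > R ==> \<phi> x = 0" using test_fun_support[OF t] by metis
 obtain B where "!!x. |\<phi> x| <= B" using cont_support_bounded[OF test_fun_continuous[OF t] R] by metis
 thus ?thesis using R test_fun_continuous[OF t]
  by (intro l2_bounded_support[of _ R B]) (auto intro: borel_measurable_continuous_onI)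
qed

lemma test_fun_dd_l2: "test_fun \<phi> ==> l2 (dd \<phi> v)"
proof -
 assume t: "test_fun \<phi>"
 obtain R where R: "!!x v. norm x > R ==> dd \<phi> v x = 0" using test_fun_support[OF t] by metis
 obtain B where "!!x. |dd \<phi> v x| <= B" using cont_support_bounded[OF test_fun_dd_continuous[OF t] R] by metis
 thus ?thesis using R test_fun_dd_continuous[OF t]
  by (intro l2_bounded_support[of _ R B]) (auto intro: borel_measurable_continuous_onI)
qed

lemma l2_times:
 fixes u v :: "real^3 => real"
 shows "l2 u ==> l2 v ==> integrable lborel (%x. u x * v x)"
 using l2_inner[of u v] by simp

lemma l2_component: "l2 g ==> l2 (%x. g x \<bullet> v)"
 for g :: "real^3 => real^3"
 unfolding l2_def
proof
 assume g: "g \<in> borel_measurable lborel & integrable lborel (%x. (norm (g x))^2)"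
 hence [measurable]: "g \<in> borel_measurable lborel" by simp
 show m: "(%x. g x \<bullet> v) \<in> borel_measurable lborel" by measurable
 show "integrable lborel (%x. (norm (g x \<bullet> v))^2)"
 proof (rule L1_bound)
  show "integrable lborel (%x. (norm v)^2 * (norm (g x))^2)" using g by simp
  have "(norm (y \<bullet> v))^2 <= (norm v)^2 * (norm y)^2" for y
   using power_mono[OF Cauchy_Schwarz_ineq2[of y v], of 2] by (simp add: power_mult_distrib mult.commute)
  thus "AE x in lborel. norm ((norm (g x \<bullet> v))^2) <= norm ((norm v)^2 * (norm (g x))^2)" by simp
 qed (use m in measurable)
qed

lemma H1_iff: "u \<in> H1 \<longleftrightarrow> l2 u & (EX g. l2 g & weak_grad u g)"
 by (auto simp: H1_def l2_def)

lemma grad_spec: "u \<in> H1 ==> l2 (grad u) & weak_grad u (grad u)"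
proof -
 assume "u \<in> H1"
 hence "EX g. g \<in> borel_measurable lborel & integrable lborel (%x. (norm (g x))^2) & weak_grad u g"
  by (auto simp: H1_def)
 from someI_ex[OF this] show ?thesis unfolding grad_def[symmetric] l2_def by blast
qed

lemma H1_l2: "u \<in> H1 ==> l2 u" by (simp add: H1_iff)
lemma grad_l2: "u \<in> H1 ==> l2 (grad u)" by (simp add: grad_spec)
lemma grad_weak: "u \<in> H1 ==> weak_grad u (grad u)" by (simp add: grad_spec)

lemma H1_borel: "u \<in> H1 ==> u \<in> borel_measurable borel"
 by (rule l2_borel[OF H1_l2])

lemma grad_borel: "u \<in> H1 ==> grad u \<in> borel_measurable borel"
 by (rule l2_borel[OF grad_l2])

text \<open>Averages over cubes shrinking to x converge to f x for almost every x, and all of these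
  averages vanish.\<close>

lemma zero_on_boxes_AE:
 fixes f :: "'a::euclidean_space => real"
 assumes m: "f \<in> borel_measurable lborel"
  and i: "!!a b. integrable lborel (%x. indicator (box a b) x * f x)"
  and z: "!!a b. (LINT x|lborel. indicator (box a b) x * f x) = 0"
 shows "AE x in lborel. f x = 0"
proof -
 have ib: "f integrable_on box a b" "integral (box a b) f = 0" for a b
  using set_borel_integral_eq_integral[of "box a b" f] i[of a b] z[of a b]
  by (auto simp: set_integrable_def set_lebesgue_integral_def)
 hence ic: "f integrable_on cbox a b" "integral (cbox a b) f = 0" for a b
  using integrable_on_open_interval[of f a b] integral_open_interval[of a b f] by auto
 obtain N where N: "negligible N"
   "!!x e. x \<notin> N ==> 0 < e ==>
       EX d>0. ALL h. 0 < h & h < d --> norm(integral (cbox x (x + h *\<^sub>R One)) f /\<^sub>R h ^ DIM('a) - f x) < e"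
  using integrable_ccontinuous_explicit[OF ic(1)] by metis
 have "f x = 0" if x: "x \<notin> N" for x
 proof (rule ccontr)
  assume "f x ~= 0"
  then obtain d where d: "d > 0" "ALL h. 0 < h & h < d --> norm(integral (cbox x (x + h *\<^sub>R One)) f /\<^sub>R h ^ DIM('a) - f x) < norm (f x)"
   using N(2)[OF x, of "norm (f x)"] by auto
  have "norm(integral (cbox x (x + (d/2) *\<^sub>R One)) f /\<^sub>R (d/2) ^ DIM('a) - f x) < norm (f x)"
   using d(1) by (intro d(2)[rule_format]) auto
  thus False by (simp add: ic(2))
 qed
 moreover have "AE x in lebesgue. x \<notin> N" using N(1) by (simp add: negligible_iff_null_sets AE_not_in)
 ultimately have "AE x in lebesgue. f x = 0" by auto
 thus ?thesis by (simp add: AE_completion_iff)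
qed

lemma zero_against_tests_AE:
 fixes f :: "real^3 => real"
 assumes f: "l2 f" and z: "!!\<phi>. test_fun \<phi> ==> (LINT x|lborel. f x * \<phi> x) = 0"
 shows "AE x in lborel. f x = 0"
proof (rule zero_on_boxes_AE)
 have fm [measurable]: "f \<in> borel_measurable lborel" using f by (rule l2_measurable)
 thus "f \<in> borel_measurable lborel" .
 have bl2: "l2 (indicator (box a b) :: real^3 => real)" for a b
 proof -
  obtain R where R: "ALL x:cbox a b. norm x <= R" using bounded_cbox bounded_iff by metis
  show ?thesis
   by (rule l2_bounded_support[of _ R 1]) (use R box_subset_cbox in \<open>force simp: indicator_def\<close>)+
 qed
 show i: "integrable lborel (%x. indicator (box a b) x * f x)" for a b by (rule l2_times[OF bl2 f])
 fix a b :: "real^3"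
 have "(%n. LINT x|lborel. f x * boxfun n a b x) ----> (LINT x|lborel. f x * indicator (box a b) x)"
 proof (rule integral_dominated_convergence[where w = "%x. |indicator (box a b) x * f x|"])
  show "integrable lborel (%x. |indicator (box a b) x * f x| )" using i[of a b] by (rule integrable_abs)
  show "(%x. f x * boxfun n a b x) \<in> borel_measurable lborel" for n
  proof -
   have [measurable]: "boxfun n a b \<in> borel_measurable borel"
    by (rule borel_measurable_continuous_onI[OF test_fun_continuous[OF boxfun_test]])
   show ?thesis by measurable
  qed
  show "AE x in lborel. (%n. f x * boxfun n a b x) ----> f x * indicator (box a b) x"
   by (intro AE_I2 tendsto_mult tendsto_const boxfun_lim)
  show "AE x in lborel. norm (f x * boxfun n a b x) <= |indicator (box a b) x * f x|" for n
  proof (rule AE_I2)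
   fix x
   show "norm (f x * boxfun n a b x) <= |indicator (box a b) x * f x|"
   proof (cases "x \<in> box a b")
    case True
    thus ?thesis using boxfun_bound[of n a b x] by (simp add: abs_mult mult_left_le)
   next
    case False
    hence "boxfun n a b x = 0" using boxfun_nz by blast
    thus ?thesis by simp
   qed
  qed
 qed (use fm in measurable)
 moreover have "(LINT x|lborel. f x * boxfun n a b x) = 0" for n by (rule z[OF boxfun_test])
 ultimately have "(LINT x|lborel. f x * indicator (box a b) x) = 0" by (simp add: LIMSEQ_const_iff)
 thus "(LINT x|lborel. indicator (box a b) x * f x) = 0" by (simp add: mult.commute)
qed

text \<open>Makes \<open>grad\<close>, which is a choice among representatives, well defined almost
  everywhere; formulas for gradients use it through \<open>grad_eq\<close>.\<close>

lemma weak_grad_unique: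
 assumes g: "l2 g" "weak_grad u g" and g': "l2 g'" "weak_grad u g'"
 shows "AE x in lborel. g x = g' x"
proof -
 have c: "AE x in lborel. (g x - g' x) \<bullet> v = 0" for v
 proof (rule zero_against_tests_AE)
  show l: "l2 (%x. (g x - g' x) \<bullet> v)" by (intro l2_component l2_diff g g')
  fix \<phi> assume t: "test_fun \<phi>"
  have "(LINT x|lborel. (g x \<bullet> v) * \<phi> x) = (LINT x|lborel. (g' x \<bullet> v) * \<phi> x)"
   using g(2) g'(2) t unfolding weak_grad_def by fastforce
  thus "(LINT x|lborel. ((g x - g' x) \<bullet> v) * \<phi> x) = 0"
   using l2_times[OF l2_component[OF g(1), of v] test_fun_l2[OF t]] l2_times[OF l2_component[OF g'(1), of v] test_fun_l2[OF t]]
   by (simp add: inner_diff_left left_diff_distrib)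
 qed
 have "AE x in lborel. ALL i:UNIV. (g x - g' x) \<bullet> axis i 1 = 0"
  by (rule AE_finite_allI) (use c in auto)
 thus ?thesis by eventually_elim (simp add: vec_eq_iff inner_axis)
qed

lemma grad_eq: "u \<in> H1 ==> l2 g ==> weak_grad u g ==> AE x in lborel. grad u x = g x"
 using weak_grad_unique grad_spec by blast

lemma weak_grad_add:
 assumes "l2 u" "l2 v" "l2 g" "l2 h" "weak_grad u g" "weak_grad v h"
 shows "weak_grad (%x. u x + v x) (%x. g x + h x)"
 unfolding weak_grad_def
proof (intro allI impI)
 fix \<phi> w assume t: "test_fun \<phi>"
 have "(LINT x|lborel. (u x + v x) * dd \<phi> w x) = (LINT x|lborel. u x * dd \<phi> w x) + (LINT x|lborel. v x * dd \<phi> w x)"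
  using assms t by (simp add: distrib_right l2_times test_fun_dd_l2)
 also have "... = - (LINT x|lborel. (g x \<bullet> w) * \<phi> x) - (LINT x|lborel. (h x \<bullet> w) * \<phi> x)"
  using assms t by (simp add: weak_grad_def)
 also have "... = - (LINT x|lborel. ((g x + h x) \<bullet> w) * \<phi> x)"
  using assms t by (simp add: inner_add_left distrib_right l2_times l2_component test_fun_l2)
 finally show "(LINT x|lborel. (u x + v x) * dd \<phi> w x) = - (LINT x|lborel. ((g x + h x) \<bullet> w) * \<phi> x)" .
qed

lemma weak_grad_scale: "weak_grad u g ==> weak_grad (%x. c * u x) (%x. c *\<^sub>R g x)"
 by (simp add: weak_grad_def mult.assoc)

lemma weak_grad_cong:
 assumes "weak_grad u g" "AE x in lborel. u x = u' x"
  and [measurable]: "u \<in> borel_measurable lborel" "u' \<in> borel_measurable lborel"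
 shows "weak_grad u' g"
 unfolding weak_grad_def
proof (intro allI impI)
 fix \<phi> w assume t: "test_fun \<phi>"
 have [measurable]: "dd \<phi> w \<in> borel_measurable lborel" using test_fun_dd_l2[OF t] by (rule l2_measurable)
 have "(LINT x|lborel. u' x * dd \<phi> w x) = (LINT x|lborel. u x * dd \<phi> w x)"
  using assms(2) by (intro integral_cong_AE) auto
 thus "(LINT x|lborel. u' x * dd \<phi> w x) = - (LINT x|lborel. (g x \<bullet> w) * \<phi> x)"
  using assms(1) t by (simp add: weak_grad_def)
qed

lemma weak_grad_limit:
 assumes s: "!!n. l2 (s n)" "l2 u" "(%n. n2 (%x. s n x - u x)) ----> 0"
  and g: "!!n. l2 (g n)" "l2 h" "(%n. n2 (%x. g n x - h x)) ----> 0"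
  and w: "!!n. weak_grad (s n) (g n)"
 shows "weak_grad u h"
 unfolding weak_grad_def
proof (intro allI impI)
 fix \<phi> v assume t: "test_fun \<phi>"
 have 1: "(%n. LINT x|lborel. s n x * dd \<phi> v x) ----> (LINT x|lborel. u x * dd \<phi> v x)"
  using l2_inner_conv[OF s test_fun_dd_l2[OF t, of v]] by simp
 have l: "l2 (%x. \<phi> x *\<^sub>R v)"
  using test_fun_l2[OF t] by (auto simp: l2_def power_mult_distrib)
 have "(%n. LINT x|lborel. g n x \<bullet> (\<phi> x *\<^sub>R v)) ----> (LINT x|lborel. h x \<bullet> (\<phi> x *\<^sub>R v))"
  by (rule l2_inner_conv[OF g l])
 hence "(%n. - (LINT x|lborel. (g n x \<bullet> v) * \<phi> x)) ----> - (LINT x|lborel. (h x \<bullet> v) * \<phi> x)"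
  by (intro tendsto_minus) (simp add: mult.commute)
 moreover have "(LINT x|lborel. s n x * dd \<phi> v x) = - (LINT x|lborel. (g n x \<bullet> v) * \<phi> x)" for n
  using w t by (simp add: weak_grad_def)
 ultimately show "(LINT x|lborel. u x * dd \<phi> v x) = - (LINT x|lborel. (h x \<bullet> v) * \<phi> x)"
  using LIMSEQ_unique[OF 1] by simp
qed

text \<open>Translation invariance replaces the divergence theorem: each difference quotient has
  integral 0, and the Lipschitz bound together with the bounded support dominates the passage to the
  limit.\<close>

lemma integral_deriv_zero:
 fixes g :: "real^3 => real" and G :: "real^3 => real^3"
 assumes D: "!!x. (g has_derivative (%h. G x \<bullet> h)) (at x)" and cG: "continuous_on UNIV G"
  and supp: "!!x. norm x > R ==> g x = 0"
 shows "(LINT x|lborel. G x \<bullet> v) = 0"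
proof -
 have cg: "continuous_on UNIV g"
  using D has_derivative_continuous by (blast intro: continuous_at_imp_continuous_on)
 have gm [measurable]: "g \<in> borel_measurable borel" using cg by (rule borel_measurable_continuous_onI)
 have Gm [measurable]: "G \<in> borel_measurable borel" using cG by (rule borel_measurable_continuous_onI)
 have G0: "G x = 0" if "norm x > R" for x
 proof -
  have "open (- cball 0 R :: (real^3) set)" by auto
  hence "(g has_derivative (%v. 0)) (at x)"
   using that supp by (intro has_derivative_transform_within_open[OF has_derivative_const[of 0], of "- cball 0 R"]) auto
  hence "(%h. G x \<bullet> h) = (%v. 0)" using D has_derivative_unique by blast
  thus ?thesis by (metis inner_eq_zero_iff)
 qed
 have "bounded (G ` cball 0 R)"
  using cG by (intro compact_imp_bounded compact_continuous_image) (auto intro: continuous_on_subset)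
 then obtain B where B: "B > 0" "ALL y:G ` cball 0 R. norm y <= B" unfolding bounded_pos by blast
 have GB: "norm (G x) <= B" for x
  using B G0[of x] by (cases "norm x > R") (auto simp: not_less)
 have lip: "|g y - g x| <= B * norm (y - x)" for x y
 proof -
  have "norm (g y - g x) <= B * norm (y - x)"
  proof (rule differentiable_bound[of UNIV g "%x h. G x \<bullet> h"])
   show "onorm (%h. G x \<bullet> h) <= B" for x
   proof (rule onorm_le)
    fix h
    have "|G x \<bullet> h| <= norm (G x) * norm h" by (rule Cauchy_Schwarz_ineq2)
    also have "... <= B * norm h" by (intro mult_right_mono GB) auto
    finally show "norm (G x \<bullet> h) <= B * norm h" by simp
   qed
  qed (use D in auto)
  thus ?thesis by simp
 qed
 obtain Bg where Bg: "!!x. |g x| <= Bg" using cont_support_bounded[OF cg supp] by metis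
 have gi: "integrable lborel g"
 proof (rule L1_bound[where f = "%x. Bg * indicator (cball 0 R) x"])
  have "|g x| <= |Bg * indicator (cball 0 R) x|" for x
   using Bg[of x] supp[of x] by (cases "norm x > R") (auto simp: indicator_def)
  thus "AE x in lborel. norm (g x) <= norm (Bg * indicator (cball 0 R) x)" by simp
 qed simp_all
 have shift: "integrable lborel (%x. g (x + c)) & (LINT x|lborel. g (x + c)) = (LINT x|lborel. g x)" for c
 proof -
  have "integrable (distr lborel borel ((+) c)) g" using gi by (simp add: lborel_distr_plus)
  hence 1: "integrable lborel (%x. g (x + c))" by (simp add: integrable_distr_eq add.commute)
  have "(LINT x|lborel. g x) = (LINT x|distr lborel borel ((+) c). g x)" by (simp add: lborel_distr_plus)
  also have "... = (LINT x|lborel. g (x + c))" by (simp add: integral_distr add.commute)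
  finally show ?thesis using 1 by simp
 qed
 define t where "t n = 1 / (real n + 1)" for n
 have t: "t n > 0" "t n <= 1" for n by (auto simp: t_def)
 have tl: "t ----> 0" unfolding t_def using LIMSEQ_inverse_real_of_nat by (simp add: inverse_eq_divide add.commute)
 define q where "q n x = (g (x + t n *\<^sub>R v) - g x) / t n" for n x
 have "(%n. LINT x|lborel. q n x) ----> (LINT x|lborel. G x \<bullet> v)"
 proof (rule integral_dominated_convergence)
  show "integrable lborel (%x::real^3. B * norm v * indicator (cball 0 (R + norm v)) x)" by simp
  show "AE x in lborel. norm (q n x) <= B * norm v * indicator (cball 0 (R + norm v)) x" for n
  proof (rule AE_I2)
   fix x
   show "norm (q n x) <= B * norm v * indicator (cball 0 (R + norm v)) x"
   proof (cases "x \<in> cball 0 (R + norm v)")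
    case True
    have "|g (x + t n *\<^sub>R v) - g x| <= B * (t n * norm v)" using lip[of "x + t n *\<^sub>R v" x] t(1)[of n] by simp
    thus ?thesis using True t(1)[of n] by (simp add: q_def field_simps)
   next
    case False
    hence x: "norm x > R + norm v" by simp
    have "t n * norm v <= norm v" using t[of n] by (simp add: mult_left_le_one_le)
    hence "norm (x + t n *\<^sub>R v) > R" using norm_triangle_ineq2[of x "- (t n *\<^sub>R v)"] x t(1)[of n] by simp
    moreover have "norm x > R" using x norm_ge_zero[of v] by linarith
    ultimately show ?thesis using False by (simp add: q_def supp)
   qed
  qed
  show "AE x in lborel. (%n. q n x) ----> G x \<bullet> v"
  proof (rule AE_I2)
   fix x
   have "((%s. g (x + s *\<^sub>R v)) has_derivative (%s. G x \<bullet> (s *\<^sub>R v))) (at 0)"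
   proof (rule has_derivative_compose[where g = g])
    show "((%s. x + s *\<^sub>R v) has_derivative (%s. s *\<^sub>R v)) (at 0)" by (auto intro!: derivative_eq_intros)
    show "(g has_derivative (%h. G x \<bullet> h)) (at (x + 0 *\<^sub>R v))" using D[of x] by simp
   qed
   hence "((%s. g (x + s *\<^sub>R v)) has_real_derivative G x \<bullet> v) (at 0)"
    unfolding has_field_derivative_def by (simp add: mult.commute[of _ "G x \<bullet> v"] fun_eq_iff)
   hence "((%s. (g (x + s *\<^sub>R v) - g x) / s) \<longlongrightarrow> G x \<bullet> v) (at 0)"
    by (simp add: has_field_derivative_iff)
   moreover have "filterlim t (at 0) sequentially"
    unfolding filterlim_at using tl t(1) by (auto simp: less_imp_neq[symmetric])
   ultimately show "(%n. q n x) ----> G x \<bullet> v" unfolding q_def by (rule filterlim_compose)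
  qed
 qed (auto simp: q_def)
 moreover have "(LINT x|lborel. q n x) = 0" for n
  unfolding q_def using shift[of "t n *\<^sub>R v"] gi by simp
 ultimately show ?thesis by (simp add: LIMSEQ_const_iff)
qed

lemma C1_weak_grad:
 fixes z :: "real^3 => real"
 assumes D: "!!x. (z has_derivative (%h. G x \<bullet> h)) (at x)" and cG: "continuous_on UNIV G"
  and l: "l2 z" "l2 G"
 shows "weak_grad z G"
 unfolding weak_grad_def
proof (intro allI impI)
 fix \<phi> v assume t: "test_fun \<phi>"
 define P where "P x = (\<chi> i. dd \<phi> (axis i 1) x)" for x
 have dP: "dd \<phi> h x = P x \<bullet> h" for x h
 proof -
  have lin: "linear (%h. dd \<phi> h x)" using test_fun_deriv[OF t] has_derivative_linear by blast
  have "h = (\<Sum>i\<in>UNIV. (h $ i) *\<^sub>R axis i 1)" by (simp add: vec_eq_iff axis_def if_distrib cong: if_cong)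
  hence "dd \<phi> h x = (\<Sum>i\<in>UNIV. (h $ i) * dd \<phi> (axis i 1) x)"
   using linear_sum[OF lin, of "%i. (h $ i) *\<^sub>R axis i 1" UNIV] linear_scale[OF lin] by simp
  thus ?thesis by (simp add: P_def inner_vec_def mult.commute)
 qed
 have D\<phi>: "(\<phi> has_derivative (%h. P x \<bullet> h)) (at x)" for x
  using test_fun_deriv[OF t, of x] by (simp add: dP)
 have cP: "continuous_on UNIV P" unfolding P_def by (intro continuous_intros test_fun_dd_continuous[OF t])
 obtain R where R: "!!x. norm x > R ==> \<phi> x = 0" using test_fun_support[OF t] by metis
 have cz: "continuous_on UNIV z"
  using D has_derivative_continuous by (blast intro: continuous_at_imp_continuous_on)
 have "(LINT x|lborel. (z x *\<^sub>R P x + \<phi> x *\<^sub>R G x) \<bullet> v) = 0"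
 proof (rule integral_deriv_zero[where g = "%x. z x * \<phi> x" and R = R])
  show "((%x. z x * \<phi> x) has_derivative (%h. (z x *\<^sub>R P x + \<phi> x *\<^sub>R G x) \<bullet> h)) (at x)" for x
   using has_derivative_mult[OF D D\<phi>, of x] by (simp add: inner_add_left mult.commute)
  show "continuous_on UNIV (%x. z x *\<^sub>R P x + \<phi> x *\<^sub>R G x)"
   by (intro continuous_intros cz cP cG test_fun_continuous[OF t])
 qed (simp add: R)
 moreover have "(LINT x|lborel. (z x *\<^sub>R P x + \<phi> x *\<^sub>R G x) \<bullet> v)
   = (LINT x|lborel. z x * dd \<phi> v x) + (LINT x|lborel. (G x \<bullet> v) * \<phi> x)"
 proof -
  have "(LINT x|lborel. (z x *\<^sub>R P x + \<phi> x *\<^sub>R G x) \<bullet> v) = (LINT x|lborel. z x * dd \<phi> v x + (G x \<bullet> v) * \<phi> x)"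
   by (simp add: inner_add_left dP mult.commute)
  also have "... = (LINT x|lborel. z x * dd \<phi> v x) + (LINT x|lborel. (G x \<bullet> v) * \<phi> x)"
   by (intro Bochner_Integration.integral_add l2_times test_fun_l2 test_fun_dd_l2 l2_component l t)
  finally show ?thesis .
 qed
 ultimately show "(LINT x|lborel. z x * dd \<phi> v x) = - (LINT x|lborel. (G x \<bullet> v) * \<phi> x)" by simp
qed

lemma H1_I: "l2 u ==> l2 g ==> weak_grad u g ==> u \<in> H1"
 by (auto simp: H1_iff)

lemma H1_add: "u \<in> H1 ==> v \<in> H1 ==> (%x. u x + v x) \<in> H1"
 by (rule H1_I[OF l2_add[OF H1_l2 H1_l2] l2_add[OF grad_l2 grad_l2]
    weak_grad_add[OF H1_l2 H1_l2 grad_l2 grad_l2 grad_weak grad_weak]]) assumption+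

lemma H1_scale: "u \<in> H1 ==> (%x. c * u x) \<in> H1"
 using l2_scale[of u c] by (intro H1_I[OF _ l2_scale weak_grad_scale]) (auto intro: H1_l2 grad_l2 grad_weak)

lemma H1_cong: "u \<in> H1 ==> u' \<in> borel_measurable lborel ==> AE x in lborel. u x = u' x ==> u' \<in> H1"
 by (rule H1_I[OF l2_cong_AE[OF H1_l2] grad_l2 weak_grad_cong[OF grad_weak _ l2_measurable[OF H1_l2]]]) assumption+

lemma grad_add: "u \<in> H1 ==> v \<in> H1 ==> AE x in lborel. grad (%x. u x + v x) x = grad u x + grad v x"
 by (intro grad_eq H1_add l2_add weak_grad_add H1_l2 grad_l2 grad_weak)

lemma grad_scale: "u \<in> H1 ==> AE x in lborel. grad (%x. c * u x) x = c *\<^sub>R grad u x"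
 by (intro grad_eq H1_scale l2_scale weak_grad_scale grad_l2 grad_weak)

lemma grad_cong:
 "u \<in> H1 ==> u' \<in> borel_measurable lborel ==> AE x in lborel. u x = u' x ==> AE x in lborel. grad u' x = grad u x"
 by (rule grad_eq[OF H1_cong grad_l2 weak_grad_cong[OF grad_weak _ l2_measurable[OF H1_l2]]]) assumption+

lemma normsq_mu_n2: "normsq_mu \<mu> u = n2 (grad u) + \<mu> * n2 u"
 by (simp add: normsq_mu_def n2_def)

section \<open>Polar coordinates\<close>

abbreviation R3 :: "(real^3) measure" where "R3 \<equiv> lborel"

lemma has_integral_sqrt:
 assumes "0 <= s"
 shows "((%x. 2 * pi * sqrt x) has_integral 4 / 3 * pi * sqrt s ^ 3) {0..s}"
proof -
 have "((%x. 2 * pi * sqrt x) has_integral (4 / 3 * pi * sqrt s ^ 3 - 4 / 3 * pi * sqrt 0 ^ 3)) {0..s}"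
 proof (rule fundamental_theorem_of_calculus_interior[OF assms])
  show "continuous_on {0..s} (%x. 4 / 3 * pi * sqrt x ^ 3)" by (intro continuous_intros)
  fix x assume x: "x \<in> {0<..<s}"
  have "((%x. 4 / 3 * pi * sqrt x ^ 3) has_real_derivative 2 * pi * sqrt x) (at x)"
   using x by (auto intro!: derivative_eq_intros simp: field_simps power2_eq_square)
  thus "((%x. 4 / 3 * pi * sqrt x ^ 3) has_vector_derivative 2 * pi * sqrt x) (at x)"
   by (simp add: has_real_derivative_iff_has_vector_derivative)
 qed
 thus ?thesis by simp
qed

text \<open>The variable is s = |x|^2 instead of |x|, because smooth functions of s give radial
  functions that are smooth also at the origin. The two measures agree on half-lines, where both
  give the volume of a ball of radius sqrt s.\<close>

lemma distr_norm_sq: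
 "distr lborel borel (%x::real^3. (norm x)^2) = density lborel (%s. ennreal (2 * pi * sqrt s) * indicator {0..} s)"
 (is "?L = ?R")
proof (rule measure_eqI_generator_eq[where E = "range atMost" and \<Omega> = UNIV and A = "%n. {..real n}"])
 show "Int_stable (range atMost :: real set set)"
  by (rule Int_stableI) auto
 show "sets ?L = sigma_sets UNIV (range atMost)" "sets ?R = sigma_sets UNIV (range atMost)"
  by (simp_all add: borel_eq_atMost)
 have L: "emeasure ?L {..s} = ennreal (if s >= 0 then 4 / 3 * pi * sqrt s ^ 3 else 0)" for s
 proof (cases "s >= 0")
  case True
  have "(%x::real^3. (norm x)^2) -` {..s} = cball 0 (sqrt s)"
   using True by (auto simp: real_le_rsqrt sqrt_le_D real_sqrt_le_iff intro: real_le_rsqrt)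
    (metis norm_ge_zero real_sqrt_ge_zero real_sqrt_pow2 power_mono)
  thus ?thesis using True emeasure_cball[of "sqrt s" "0::real^3"]
   by (simp add: emeasure_distr eval_unit_ball_vol)
 next
  case False
  hence "(%x::real^3. (norm x)^2) -` {..s} = {}"
   using order_trans[OF zero_le_power2, of "norm (_::real^3)" s] by auto
  thus ?thesis using False by (simp add: emeasure_distr)
 qed
 have R: "emeasure ?R {..s} = ennreal (if s >= 0 then 4 / 3 * pi * sqrt s ^ 3 else 0)" for s
 proof (cases "s >= 0")
  case True
  have "emeasure ?R {..s} = (\<integral>\<^sup>+x. ennreal (2 * pi * sqrt x) * indicator {0..} x * indicator {..s} x \<partial>lborel)"
   by (simp add: emeasure_density)
  also have "... = (\<integral>\<^sup>+x. ennreal (indicator {0..s} x * (2 * pi * sqrt x)) \<partial>lborel)"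
   by (intro nn_integral_cong) (auto simp: indicator_def)
  also have "... = ennreal (4 / 3 * pi * sqrt s ^ 3)"
  proof (rule nn_integral_has_integral_lborel)
   show "((%x. indicator {0..s} x * (2 * pi * sqrt x)) has_integral 4 / 3 * pi * sqrt s ^ 3) UNIV"
   proof -
    have "(%x. indicator {0..s} x * (2 * pi * sqrt x)) = (%x. if x \<in> {0..s} then 2 * pi * sqrt x else 0)"
     by (auto simp: indicator_def)
    thus ?thesis using has_integral_sqrt[OF True] by (simp only: has_integral_restrict_UNIV)
   qed
  qed (auto simp: indicator_def)
  finally show ?thesis using True by simp
 next
  case False
  have "emeasure ?R {..s} = (\<integral>\<^sup>+x. ennreal (2 * pi * sqrt x) * indicator {0..} x * indicator {..s} x \<partial>lborel)"
   by (simp add: emeasure_density)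
  also have "... = (\<integral>\<^sup>+x. 0 \<partial>(lborel :: real measure))"
   using False by (intro nn_integral_cong) (auto simp: indicator_def)
  finally show ?thesis using False by simp
 qed
 show "emeasure ?L X = emeasure ?R X" if "X \<in> range atMost" for X using that L R by auto
 show "(\<Union>i. {..real i}) = UNIV" using real_arch_simple by blast
 show "emeasure ?L {..real i} ~= \<infinity>" for i by (simp add: L)
qed auto

lemma polar_nn:
 assumes [measurable]: "b \<in> borel_measurable borel"
 shows "(\<integral>\<^sup>+x. b ((norm x)^2) \<partial>R3) = (\<integral>\<^sup>+s. ennreal (2 * pi * sqrt s) * indicator {0..} s * b s \<partial>lborel)"
proof -
 have "(\<integral>\<^sup>+x. b ((norm x)^2) \<partial>R3) = (\<integral>\<^sup>+s. b s \<partial>distr lborel borel (%x::real^3. (norm x)^2))"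
  by (simp add: nn_integral_distr)
 also have "... = (\<integral>\<^sup>+s. ennreal (2 * pi * sqrt s) * indicator {0..} s * b s \<partial>lborel)"
  unfolding distr_norm_sq by (subst nn_integral_density) auto
 finally show ?thesis .
qed

lemma null_norm_sq:
 assumes N: "N \<in> null_sets (lborel :: real measure)"
 shows "AE x in (lborel :: (real^3) measure). (norm x)^2 \<notin> N"
proof -
 have [measurable]: "N \<in> sets borel" using N by auto
 have "(\<integral>\<^sup>+x. indicator N ((norm x)^2) \<partial>R3) = (\<integral>\<^sup>+s. ennreal (2 * pi * sqrt s) * indicator {0..} s * indicator N s \<partial>lborel)"
  by (rule polar_nn) measurable
 also have "... = (\<integral>\<^sup>+s. 0 \<partial>(lborel :: real measure))"
  by (rule nn_integral_cong_AE) (use AE_not_in[OF N] in \<open>auto elim!: eventually_mono\<close>)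
 finally have "(\<integral>\<^sup>+x. indicator N ((norm x)^2) \<partial>R3) = 0" by simp
 hence "AE x in (lborel :: (real^3) measure). indicator N ((norm x)^2) = (0::ennreal)"
  by (subst (asm) nn_integral_0_iff_AE) measurable
 thus ?thesis by eventually_elim (auto simp: indicator_def split: if_splits)
qed

lemma AE_norm_sq:
 assumes "AE s in lborel. s > 0 --> P s"
 shows "AE x in (lborel :: (real^3) measure). P ((norm x)^2)"
proof -
 obtain N where N: "N \<in> null_sets lborel" "{s. \<not> (s > 0 --> P s)} \<subseteq> N"
  using assms by (auto simp: eventually_ae_filter)
 have "AE x in (lborel :: (real^3) measure). x ~= 0"
  using AE_lborel_singleton by blast
 thus ?thesis using null_norm_sq[OF N(1)]
 proof eventually_elim
  case (elim x)
  hence "(norm x)^2 > 0" by simp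
  thus ?case using N(2) elim by blast
 qed
qed

text \<open>The weight 1/|x| cancels the factor sqrt s of the density, leaving plain Lebesgue
  measure in s.\<close>

lemma polar_weighted_nn:
 assumes [measurable]: "b \<in> borel_measurable borel" and pos: "!!s. s <= 0 ==> b s = 0"
 shows "(\<integral>\<^sup>+x. ennreal (1 / norm x) * b ((norm x)^2) \<partial>R3) = ennreal (2 * pi) * (\<integral>\<^sup>+s. b s \<partial>lborel)"
proof -
 have "(\<integral>\<^sup>+x. ennreal (1 / norm x) * b ((norm x)^2) \<partial>R3)
   = (\<integral>\<^sup>+x. ennreal (1 / sqrt ((norm x)^2)) * b ((norm x)^2) \<partial>R3)" by simp
 also have "... = (\<integral>\<^sup>+s. ennreal (2 * pi * sqrt s) * indicator {0..} s * (ennreal (1 / sqrt s) * b s) \<partial>lborel)"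
  by (rule polar_nn[of "%s. ennreal (1 / sqrt s) * b s"]) measurable
 also have "... = (\<integral>\<^sup>+s. ennreal (2 * pi) * b s \<partial>lborel)"
 proof (rule nn_integral_cong)
  fix s :: real
  show "ennreal (2 * pi * sqrt s) * indicator {0..} s * (ennreal (1 / sqrt s) * b s) = ennreal (2 * pi) * b s"
  proof (cases "s > 0")
   case True
   hence "ennreal (2 * pi * sqrt s) * ennreal (1 / sqrt s) = ennreal (2 * pi)"
    by (simp add: ennreal_mult[symmetric])
   thus ?thesis using True by (simp add: mult.assoc[symmetric])
  qed (simp add: pos)
 qed
 also have "... = ennreal (2 * pi) * (\<integral>\<^sup>+s. b s \<partial>lborel)" by (rule nn_integral_cmult) measurable
 finally show ?thesis .
qed

lemma polar_weighted:
 fixes b :: "real => real"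
 assumes b: "integrable lborel b" and pos: "!!s. s <= 0 ==> b s = 0"
 shows "integrable lborel (%x::real^3. b ((norm x)^2) / norm x)"
  and "(LINT x|R3. b ((norm x)^2) / norm x) = 2 * pi * (LINT s|lborel. b s)"
proof -
 note bm [measurable] = int_borel[OF b]
 have nn: "(\<integral>\<^sup>+x. ennreal (c ((norm x)^2) / norm x) \<partial>R3) = ennreal (2 * pi) * (\<integral>\<^sup>+s. ennreal (c s) \<partial>lborel)"
  if [measurable]: "c \<in> borel_measurable borel" and "!!s. s <= 0 ==> c s = 0" for c
 proof -
  have "(\<integral>\<^sup>+x. ennreal (c ((norm x)^2) / norm x) \<partial>R3)
    = (\<integral>\<^sup>+x. ennreal (1 / norm x) * ennreal (c ((norm x)^2)) \<partial>R3)"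
  proof (rule nn_integral_cong)
   fix x :: "real^3"
   show "ennreal (c ((norm x)^2) / norm x) = ennreal (1 / norm x) * ennreal (c ((norm x)^2))"
    using ennreal_mult'[of "1 / norm x" "c ((norm x)^2)"] by simp
  qed
  also have "... = ennreal (2 * pi) * (\<integral>\<^sup>+s. ennreal (c s) \<partial>lborel)"
   by (rule polar_weighted_nn) (use that in auto)
  finally show ?thesis .
 qed
 show i: "integrable lborel (%x::real^3. b ((norm x)^2) / norm x)"
 proof (rule integrableI_bounded)
  have "(\<integral>\<^sup>+x. ennreal (norm (b ((norm x)^2) / norm x)) \<partial>R3) = ennreal (2 * pi) * (\<integral>\<^sup>+s. ennreal |b s| \<partial>lborel)"
   using nn[of "%s. |b s|"] pos by simp
  also have "... < \<infinity>" using b by (auto simp: integrable_iff_bounded ennreal_mult_less_top)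
  finally show "(\<integral>\<^sup>+x. ennreal (norm (b ((norm x)^2) / norm x)) \<partial>R3) < \<infinity>" .
 qed measurable
 have "(LINT x|R3. b ((norm x)^2) / norm x)
  = enn2real (\<integral>\<^sup>+x. ennreal (b ((norm x)^2) / norm x) \<partial>R3) - enn2real (\<integral>\<^sup>+x. ennreal (- (b ((norm x)^2) / norm x)) \<partial>R3)"
  by (rule real_lebesgue_integral_def[OF i])
 also have "... = 2 * pi * enn2real (\<integral>\<^sup>+s. ennreal (b s) \<partial>lborel) - 2 * pi * enn2real (\<integral>\<^sup>+s. ennreal (- b s) \<partial>lborel)"
  using nn[of b] nn[of "%s. - b s"] pos by (simp add: enn2real_mult)
 also have "... = 2 * pi * (LINT s|lborel. b s)"
  by (simp add: real_lebesgue_integral_def[OF b] right_diff_distrib)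
 finally show "(LINT x|R3. b ((norm x)^2) / norm x) = 2 * pi * (LINT s|lborel. b s)" .
qed

text \<open>The integral is the squared L2 norm of the field \<open>evk a\<close> that evaluates
  radial profiles; its size a^(-1/2) with a = |x|^2 is the source of the decay |x|^(-1/2).\<close>

lemma tail_integrable:
 assumes a: "a > 0"
 shows "integrable lborel (%x::real^3. indicator {x. a < (norm x)^2} x * (1 / norm x ^ 4))"
  and "(LINT x|R3. indicator {x. a < (norm x)^2} x * (1 / norm x ^ 4)) = 4 * pi / sqrt a"
proof -
 define b where "b s = (if s \<in> {a<..} then s powr (-3/2) else 0)" for s :: real
 have bm [measurable]: "b \<in> borel_measurable borel" unfolding b_def by measurable
 have b0: "b s = 0" if "s <= 0" for s using a that by (simp add: b_def)
 have der: "((%s. - 2 * s powr (-1/2)) has_real_derivative s powr (-3/2)) (at s)" if "s > 0" for s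
  using that by (auto intro!: derivative_eq_intros)
 have hi: "((%s. s powr (-3/2)) has_integral (2 / sqrt a)) {a..}"
 proof -
  have "- (a powr (-3/2 + 1)) / (-3/2 + 1) = 2 / sqrt a"
   using a by (simp add: powr_minus powr_half_sqrt field_simps)
  thus ?thesis using has_integral_powr_to_inf[of "-3/2" a] a by simp
 qed
 have "((%s. if s \<in> {a..} then s powr (-3/2) else 0) has_integral (2 / sqrt a)) UNIV"
  unfolding has_integral_restrict_UNIV by (rule hi)
 hence "has_bochner_integral lborel (%s. if s \<in> {a..} then s powr (-3/2) else 0) (2 / sqrt a)"
  by (intro has_bochner_integral_nn_integral nn_integral_has_integral_lborel) (auto simp: a less_imp_le)
 moreover have "AE s in lborel. (if s \<in> {a..} then s powr (-3/2) else 0) = b s"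
  using AE_lborel_singleton[of a] by eventually_elim (auto simp: b_def)
 ultimately have hb: "has_bochner_integral lborel b (2 / sqrt a)"
  using has_bochner_integral_cong_AE[of "%s. if s \<in> {a..} then s powr (-3/2) else 0" lborel b "2 / sqrt a"] bm by simp
 have eq: "b ((norm x)^2) / norm x = indicator {x. a < (norm x)^2} x * (1 / norm x ^ 4)" for x :: "real^3"
 proof (cases "a < (norm x)^2")
  case True
  hence n: "norm x > 0" using a by auto
  have "((norm x)^2) powr (-3/2) = norm x powr (-3)"
   using n by (simp add: powr_powr flip: powr_numeral)
  also have "... = 1 / norm x ^ 3" using n by (simp add: powr_minus_divide powr_numeral)
  finally show ?thesis using True by (simp add: b_def power_eq_if)
 qed (simp add: b_def)
 show "integrable lborel (%x::real^3. indicator {x. a < (norm x)^2} x * (1 / norm x ^ 4))"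
  using polar_weighted(1)[of b, OF _ b0] hb by (simp add: has_bochner_integral_iff eq)
 show "(LINT x|R3. indicator {x. a < (norm x)^2} x * (1 / norm x ^ 4)) = 4 * pi / sqrt a"
  using polar_weighted(2)[of b, OF _ b0] hb by (simp add: has_bochner_integral_iff eq)
qed

lemma ball_power_integrable:
 assumes "c < (3::real)"
 shows "integrable lborel (%x::real^3. indicator {x. norm x < 1} x * norm x powr (- c))"
proof -
 define p where "p = 1/2 - c/2"
 have p: "p > -1" using assms by (simp add: p_def)
 define b where "b s = (if s \<in> {0<..<1} then s powr p else 0)" for s :: real
 have bm [measurable]: "b \<in> borel_measurable borel" unfolding b_def by measurable
 have "((%s. s powr p) has_integral (1 powr (p + 1) / (p + 1))) {0..1}"
  by (rule has_integral_powr_from_0) (use p in auto)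
 hence "((%s. if s \<in> {0..1} then s powr p else 0) has_integral (1 / (p + 1))) UNIV"
  unfolding has_integral_restrict_UNIV by simp
 hence "has_bochner_integral lborel (%s. if s \<in> {0..1} then s powr p else 0) (1 / (p + 1))"
  using p by (intro has_bochner_integral_nn_integral nn_integral_has_integral_lborel) auto
 moreover have "AE s in lborel. (if s \<in> {0..1} then s powr p else 0) = b s"
  using AE_lborel_singleton[of 0] AE_lborel_singleton[of 1] by eventually_elim (auto simp: b_def)
 ultimately have hb: "has_bochner_integral lborel b (1 / (p + 1))"
  using has_bochner_integral_cong_AE[of "%s. if s \<in> {0..1} then s powr p else 0" lborel b "1 / (p + 1)"] bm by simp
 have "b ((norm x)^2) / norm x = indicator {x. norm x < 1} x * norm x powr (- c)" if "x ~= 0" for x :: "real^3"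
 proof (cases "norm x < 1")
  case True
  hence "(norm x)^2 < 1" using that by (simp add: power_less_one_iff)
  moreover have "((norm x)^2) powr p / norm x = norm x powr (2 * p - 1)"
   using that by (simp add: powr_powr powr_diff flip: powr_numeral)
  moreover have "2 * p - 1 = - c" by (simp add: p_def)
  ultimately show ?thesis using True that by (simp add: b_def)
 next
  case False
  hence "(norm x)^2 >= 1" using power_mono[of 1 "norm x" 2] by simp
  hence "b ((norm x)^2) = 0" by (simp only: b_def greaterThanLessThan_iff not_less[symmetric] if_False simp_thms)
  thus ?thesis using False by simp
 qed
 moreover have "AE x in (lborel :: (real^3) measure). x ~= 0" using AE_lborel_singleton by blast
 ultimately have ae: "AE x in (lborel :: (real^3) measure). b ((norm x)^2) / norm x = indicator {x. norm x < 1} x * norm x powr (- c)"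
  by auto
 have int: "integrable lborel (%x::real^3. b ((norm x)^2) / norm x)"
  by (rule polar_weighted(1)) (use hb in \<open>simp_all only: has_bochner_integral_iff\<close>, simp add: b_def)
 show ?thesis by (rule integrable_cong_AE_imp[OF int _ ae]) measurable
qed

section \<open>Averaging over rotations\<close>

lemma lborel_distr_orthogonal:
 fixes T :: "real^'n::{finite,wellorder} => real^'n::_"
 assumes T: "orthogonal_transformation T"
 shows "distr lborel borel T = lborel"
proof (rule lborel_eqI[symmetric])
 have lin: "linear T" using T by (rule orthogonal_transformation_linear)
 have bij: "bij T" using T by (rule orthogonal_transformation_bij)
 have Tm [measurable]: "T \<in> borel_measurable borel"
  by (rule borel_measurable_continuous_onI[OF linear_continuous_on[OF linear_conv_bounded_linear[THEN iffD1, OF lin]]])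
 fix l u :: "real^'n::_" assume le: "!!b. b \<in> Basis ==> l \<bullet> b <= u \<bullet> b"
 have inv: "orthogonal_transformation (inv_into UNIV T)" using T by (rule orthogonal_transformation_inv)
 have im: "T -` box l u = inv_into UNIV T ` box l u" using bij by (simp add: bij_vimage_eq_inv_image)
 have "emeasure (distr lborel borel T) (box l u) = emeasure lborel (T -` box l u)"
  by (simp add: emeasure_distr)
 also have "... = emeasure lebesgue (inv_into UNIV T ` box l u)"
  using measurable_sets_borel[OF Tm, of "box l u"] by (simp add: im)
 also have "... = ennreal (measure lebesgue (inv_into UNIV T ` box l u))"
  by (intro emeasure_eq_measure2) (auto simp: measurable_orthogonal_image[OF inv])
 also have "... = ennreal (measure lebesgue (box l u))"
  by (subst measure_orthogonal_image[OF inv]) auto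
 also have "... = emeasure lborel (box l u)"
  by (subst emeasure_eq_ennreal_measure) (use emeasure_bounded_finite[of "box l u"] in auto)
 also have "... = (\<Prod>b\<in>Basis. (u - l) \<bullet> b)" using le by (simp add: emeasure_lborel_box_eq inner_diff_left)
 finally show "emeasure (distr lborel borel T) (box l u) = (\<Prod>b\<in>Basis. (u - l) \<bullet> b)" .
qed simp

text \<open>For \<open>q ~= 0\<close>, \<open>qrot q\<close> is the rotation \<open>x \<mapsto> q x q\<^sup>-\<^sup>1\<close> of the imaginary quaternions; integrating
 over the quaternions \<open>q\<close> of the unit ball is a concrete form of the Haar average over the rotation group.\<close>

definition qmul :: "real^4 => real^4 => real^4" where
 "qmul p q = vector [
  p$1 * q$1 - p$2 * q$2 - p$3 * q$3 - p$4 * q$4,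
  p$1 * q$2 + p$2 * q$1 + p$3 * q$4 - p$4 * q$3,
  p$1 * q$3 - p$2 * q$4 + p$3 * q$1 + p$4 * q$2,
  p$1 * q$4 + p$2 * q$3 - p$3 * q$2 + p$4 * q$1]"

text \<open>The product q x conj(q) without normalisation: its entries are quadratic polynomials in
  \<open>q\<close>, so the composition and inversion laws are polynomial identities.\<close>

definition qnum :: "real^4 => real^3 => real^3" where
 "qnum q x = vector [
  ((q$1)^2 + (q$2)^2 - (q$3)\<^sup>2 - (q$4)\<^sup>2) * x$1 + 2 * (q$2 * q$3 - q$1 * q$4) * x$2 + 2 * (q$2 * q$4 + q$1 * q$3) * x$3,
  2 * (q$2 * q$3 + q$1 * q$4) * x$1 + ((q$1)^2 - (q$2)\<^sup>2 + (q$3)^2 - (q$4)\<^sup>2) * x$2 + 2 * (q$3 * q$4 - q$1 * q$2) * x$3,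
  2 * (q$2 * q$4 - q$1 * q$3) * x$1 + 2 * (q$3 * q$4 + q$1 * q$2) * x$2 + ((q$1)^2 - (q$2)\<^sup>2 - (q$3)\<^sup>2 + (q$4)^2) * x$3]"

definition qrot :: "real^4 => real^3 => real^3" where
 "qrot q x = (1 / (norm q)^2) *\<^sub>R qnum q x"

definition qconj :: "real^4 => real^4" where
 "qconj q = vector [q$1, - q$2, - q$3, - q$4]"

lemma vector_4 [simp]:
 "(vector [a, b, c, d] :: 'a::zero^4) $ 1 = a" "(vector [a, b, c, d] :: 'a::zero^4) $ 2 = b"
 "(vector [a, b, c, d] :: 'a::zero^4) $ 3 = c" "(vector [a, b, c, d] :: 'a::zero^4) $ 4 = d"
 unfolding vector_def by simp_all

lemma norm4: "(norm (q::real^4))^2 = (q$1)^2 + (q$2)^2 + (q$3)^2 + (q$4)^2"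
 by (simp add: power2_norm_eq_inner inner_vec_def sum_4 flip: power2_eq_square)

lemma norm3: "(norm (x::real^3))^2 = (x$1)^2 + (x$2)^2 + (x$3)^2"
 by (simp add: power2_norm_eq_inner inner_vec_def sum_3 flip: power2_eq_square)

lemma qnum_add: "qnum q (x + y) = qnum q x + qnum q y"
 by (simp add: qnum_def vec_eq_iff forall_3 algebra_simps)

lemma qnum_scale: "qnum q (c *\<^sub>R x) = c *\<^sub>R qnum q x"
 by (simp add: qnum_def vec_eq_iff forall_3 algebra_simps)

lemma qnum_inner: "qnum q x \<bullet> y = x \<bullet> qnum (qconj q) y"
 by (simp add: qnum_def qconj_def inner_vec_def sum_3 algebra_simps)

lemma qnum_comp: "qnum p (qnum q x) = qnum (qmul p q) x"
 unfolding vec_eq_iff forall_3 qnum_def qmul_def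
 by (simp add: power2_eq_square algebra_simps)

lemma norm_qmul: "(norm (qmul p q))^2 = (norm p)^2 * (norm q)^2"
 unfolding norm4 qmul_def by (simp add: power2_eq_square algebra_simps)

lemma norm_qconj: "norm (qconj q) = norm q"
proof -
 have "(norm (qconj q))^2 = (norm q)^2" unfolding norm4 qconj_def by simp
 thus ?thesis by (simp add: power2_eq_iff_nonneg)
qed

lemma qnum_conj: "qnum (qconj q) (qnum q x) = ((norm q)^2)^2 *\<^sub>R x"
 unfolding vec_eq_iff forall_3 qnum_def qconj_def norm4
 by (simp add: power2_eq_square algebra_simps)

lemma qconj_qconj [simp]: "qconj (qconj q) = q"
 by (simp add: qconj_def vec_eq_iff forall_4)

lemma qrot_inverse: "q ~= 0 ==> qrot (qconj q) (qrot q x) = x"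
proof -
 assume q: "q ~= 0"
 show ?thesis using q by (simp add: qrot_def qnum_scale qnum_conj norm_qconj power2_eq_square)
qed

lemma qrot_inverse': "q ~= 0 ==> qrot q (qrot (qconj q) x) = x"
 using qrot_inverse[of "qconj q"] norm_qconj[of q] by (metis norm_eq_zero qconj_qconj)

lemma qrot_inner: "qrot q x \<bullet> y = x \<bullet> qrot (qconj q) y"
 by (simp add: qrot_def qnum_inner norm_qconj)

lemma linear_qrot: "linear (qrot q)"
 by (rule linearI) (simp_all add: qrot_def qnum_add qnum_scale scaleR_add_right mult.commute)

lemma orthogonal_qrot: "q ~= 0 ==> orthogonal_transformation (qrot q)"
 unfolding orthogonal_transformation_def by (simp add: linear_qrot qrot_inner qrot_inverse)

lemma norm_qrot: "q ~= 0 ==> norm (qrot q x) = norm x"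
 using orthogonal_qrot by (simp add: orthogonal_transformation)

lemma qrot_comp: "qrot p (qrot q x) = qrot (qmul p q) x"
proof -
 show ?thesis by (simp add: qrot_def qnum_scale qnum_comp norm_qmul)
qed

text \<open>A half-turn about the axis x + y exchanges two vectors of equal length; if x + y = 0,
  any axis orthogonal to \<open>x\<close> serves. A half-turn is conjugation by a purely imaginary
  quaternion. Norm 1 is arranged so that right multiplication by \<open>p\<close> preserves the
  averaging measure.\<close>

lemma qrot_transitive:
 assumes "norm x = norm y" "x ~= y"
 shows "EX p. norm p = 1 & qrot p x = y"
proof -
 have ex: "EX p. p ~= 0 & qrot p x = y"
 proof -
  obtain a :: "real^3" where a: "a ~= 0" "(2 * (a \<bullet> x)) *\<^sub>R a = (norm a)^2 *\<^sub>R (x + y)"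
  proof (cases "x + y = 0")
   case False
   have "2 * ((x + y) \<bullet> x) = (norm (x + y))^2"
    using assms(1) by (simp add: power2_norm_eq_inner inner_add_left inner_add_right inner_commute norm_eq)
   thus ?thesis using that[of "x + y"] False by simp
  next
   case True
   obtain a where "a ~= 0" "orthogonal x a"
    using orthogonal_to_vector_exists[of x] by auto
   thus ?thesis using that[of a] True by (simp add: orthogonal_def inner_commute)
  qed
  define p :: "real^4" where "p = vector [0, a$1, a$2, a$3]"
  have np: "(norm p)^2 = (norm a)^2" by (simp add: norm4 norm3 p_def)
  have "qnum p x = (2 * (a \<bullet> x)) *\<^sub>R a - (norm a)\<^sup>2 *\<^sub>R x"
   unfolding vec_eq_iff forall_3 qnum_def p_def norm3 inner_vec_def sum_3
   by (simp add: power2_eq_square algebra_simps)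
  also have "... = (norm a)^2 *\<^sub>R y" unfolding a(2) by (simp add: scaleR_add_right)
  finally have "qrot p x = y" using a(1) by (simp add: qrot_def np)
  moreover have "p ~= 0" using np a(1) by auto
  ultimately show ?thesis by blast
 qed
 then obtain p where p: "p ~= 0" "qrot p x = y" by blast
 have "qrot (c *\<^sub>R p) x = qrot p x" if "c ~= 0" for c
 proof -
  have "qnum (c *\<^sub>R p) x = c^2 *\<^sub>R qnum p x"
   unfolding vec_eq_iff forall_3 qnum_def by (simp add: power2_eq_square algebra_simps)
  thus ?thesis using that by (simp add: qrot_def power_mult_distrib)
 qed
 from this[of "1 / norm p"] show ?thesis using p by (intro exI[of _ "(1 / norm p) *\<^sub>R p"]) simp
qed

lemma qmul_orthogonal:
 assumes "norm p = 1"
 shows "orthogonal_transformation (%q. qmul q p)"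
 unfolding orthogonal_transformation
proof
 show "linear (%q. qmul q p)"
  by (rule linearI) (simp_all add: qmul_def vec_eq_iff forall_4 algebra_simps)
 show "ALL q. norm (qmul q p) = norm q"
 proof
  fix q
  have "(norm (qmul q p))^2 = (norm q)^2" using norm_qmul[of q p] assms by simp
  thus "norm (qmul q p) = norm q" by (simp add: power2_eq_iff_nonneg)
 qed
qed

definition QM :: "(real^4) measure" where
 "QM = uniform_measure lborel (ball 0 1)"

lemma sets_QM [simp, measurable_cong]: "sets QM = sets borel"
 by (simp add: QM_def)

lemma space_QM [simp]: "space QM = UNIV"
 by (simp add: QM_def)

lemma emeasure_ball_QM: "emeasure lborel (ball 0 1 :: (real^4) set) ~= 0" "emeasure lborel (ball 0 1 :: (real^4) set) ~= \<infinity>"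
proof -
 have "unit_ball_vol (4::real) ~= 0" using unit_ball_vol_pos[of 4] by linarith
 moreover have "emeasure lborel (ball 0 1 :: (real^4) set) = ennreal (unit_ball_vol 4)"
  using emeasure_ball[of 1 "0::real^4"] by simp
 ultimately show "emeasure lborel (ball 0 1 :: (real^4) set) ~= 0" "emeasure lborel (ball 0 1 :: (real^4) set) ~= \<infinity>"
  using unit_ball_vol_pos[of 4] by (simp_all add: ennreal_eq_0_iff not_le)
qed

lemma emeasure_QM_UNIV: "emeasure QM UNIV = 1"
 using emeasure_ball_QM by (simp add: QM_def ennreal_divide_self less_top)

lemma finite_QM: "finite_measure QM"
 by (rule finite_measureI) (simp add: emeasure_QM_UNIV)

interpretation QM: finite_measure QM by (rule finite_QM)

lemma measure_QM_UNIV [simp]: "measure QM UNIV = 1"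
 by (simp add: measure_def emeasure_QM_UNIV)

interpretation QL: pair_sigma_finite QM "lborel :: (real^3) measure" ..

lemma QM_nonzero: "AE q in QM. q ~= 0"
 unfolding QM_def by (rule AE_uniform_measureI) (use AE_lborel_singleton[of "0::real^4"] in auto)

text \<open>Right multiplication by a unit quaternion is an orthogonal map of R^4, so it preserves
  Lebesgue measure and the ball. This is the invariance behind the radiality of averages.\<close>

lemma distr_QM:
 assumes "norm p = 1"
 shows "distr QM borel (%q. qmul q p) = QM"
proof (rule measure_eqI)
 let ?T = "%q. qmul q p"
 have T: "orthogonal_transformation ?T" by (rule qmul_orthogonal[OF assms])
 have nT: "norm (?T q) = norm q" for q using T by (simp add: orthogonal_transformation)
 have Tm [measurable]: "?T \<in> borel_measurable borel"
  by (rule borel_measurable_continuous_onI[OF linear_continuous_on[OF linear_conv_bounded_linear[THEN iffD1, OF orthogonal_transformation_linear[OF T]]]])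
 fix A assume "A \<in> sets (distr QM borel ?T)"
 hence A [measurable]: "A \<in> sets borel" by simp
 have "emeasure (distr QM borel ?T) A = emeasure QM (?T -` A)" by (simp add: emeasure_distr)
 also have "... = emeasure lborel (ball 0 1 \<inter> ?T -` A) / emeasure lborel (ball 0 1 :: (real^4) set)"
  using measurable_sets_borel[OF Tm A] by (simp add: QM_def)
 also have "ball 0 1 \<inter> ?T -` A = ?T -` (ball 0 1 \<inter> A)" using nT by auto
 also have "emeasure lborel (?T -` (ball 0 1 \<inter> A)) = emeasure (distr lborel borel ?T) (ball 0 1 \<inter> A)"
  by (simp add: emeasure_distr)
 also have "... = emeasure lborel (ball 0 1 \<inter> A)" by (simp add: lborel_distr_orthogonal[OF T])
 also have "... / emeasure lborel (ball 0 1 :: (real^4) set) = emeasure QM A" by (simp add: QM_def)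
 finally show "emeasure (distr QM borel ?T) A = emeasure QM A" .
qed simp

lemma measurable_qrot [measurable]:
 assumes [measurable]: "f \<in> borel_measurable M" "g \<in> borel_measurable M"
 shows "(%z. qrot (f z) (g z)) \<in> borel_measurable M"
proof -
 have c4: "(%z. f z $ i) \<in> borel_measurable M" for i
  by (rule measurable_compose[OF assms(1) borel_measurable_continuous_onI]) (intro continuous_intros)
 have c3: "(%z. g z $ i) \<in> borel_measurable M" for i
  by (rule measurable_compose[OF assms(2) borel_measurable_continuous_onI]) (intro continuous_intros)
 note [measurable] = c4 c3
 have vec: "vector [a, b, c] = (a *\<^sub>R axis 1 1 + b *\<^sub>R axis 2 1 + c *\<^sub>R axis 3 1 :: real^3)" for a b c :: real
  by (simp add: vec_eq_iff forall_3 axis_def)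
 show ?thesis unfolding qrot_def qnum_def vec by measurable
qed

lemma lborel_distr_qrot: "q ~= 0 ==> distr lborel borel (qrot q) = lborel"
 by (rule lborel_distr_orthogonal[OF orthogonal_qrot])

lemma nn_integral_qrot:
 assumes "q ~= 0" and [measurable]: "w \<in> borel_measurable borel"
 shows "(\<integral>\<^sup>+x. w (qrot q x) \<partial>lborel) = (\<integral>\<^sup>+x. w x \<partial>lborel)"
proof -
 have "(\<integral>\<^sup>+x. w x \<partial>lborel) = (\<integral>\<^sup>+x. w x \<partial>distr lborel borel (qrot q))" by (simp add: lborel_distr_qrot assms)
 also have "... = (\<integral>\<^sup>+x. w (qrot q x) \<partial>lborel)" by (rule nn_integral_distr) measurable
 finally show ?thesis by simp
qed

lemma integral_qrot:
 fixes w :: "real^3 => 'b::{banach,second_countable_topology}"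
 assumes q: "q ~= 0" and [measurable]: "w \<in> borel_measurable borel"
 shows "(LINT x|lborel. w (qrot q x)) = (LINT x|lborel. w x)" "integrable lborel (%x. w (qrot q x)) = integrable lborel w"
proof -
 have d: "distr lborel borel (qrot q) = lborel" by (rule lborel_distr_qrot[OF q])
 show "(LINT x|lborel. w (qrot q x)) = (LINT x|lborel. w x)"
  using integral_distr[of "qrot q" lborel borel w] d by simp
 show "integrable lborel (%x. w (qrot q x)) = integrable lborel w"
  using integrable_distr_eq[of "qrot q" lborel borel w] d by simp
qed

lemma AE_qrot:
 assumes "q ~= 0" "AE x in lborel. P x"
 shows "AE x in lborel. P (qrot q x)"
proof -
 have "AE x in distr lborel borel (qrot q). P x"
  unfolding lborel_distr_qrot[OF assms(1)] by (rule assms(2))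
 thus ?thesis by (rule AE_distrD[rotated]) simp
qed

lemma integrable_pair_qrot:
 fixes w :: "real^3 => real"
 assumes w: "integrable lborel w"
 shows "integrable (QM \<Otimes>\<^sub>M lborel) (%(q, x). w (qrot q x))" "integrable (QM \<Otimes>\<^sub>M lborel) (%(q, x). w x)"
proof -
 note [measurable] = int_borel[OF w]
 have fin: "(\<integral>\<^sup>+x. ennreal |w x| \<partial>lborel) < \<infinity>" using w by (simp add: integrable_iff_bounded)
 show "integrable (QM \<Otimes>\<^sub>M lborel) (%(q, x). w (qrot q x))"
 proof (rule integrableI_bounded)
  have "(\<integral>\<^sup>+z. ennreal (norm (case z of (q, x) => w (qrot q x))) \<partial>(QM \<Otimes>\<^sub>M lborel))
    = (\<integral>\<^sup>+q. \<integral>\<^sup>+x. ennreal |w (qrot q x)| \<partial>lborel \<partial>QM)"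
   by (subst lborel.nn_integral_fst[symmetric]) auto
  also have "... = (\<integral>\<^sup>+q. (\<integral>\<^sup>+x. ennreal |w x| \<partial>lborel) \<partial>QM)"
   by (rule nn_integral_cong_AE) (use QM_nonzero nn_integral_qrot[of _ "%x. ennreal |w x|"] in \<open>auto elim!: eventually_mono\<close>)
  also have "... < \<infinity>" using fin by (simp add: emeasure_QM_UNIV)
  finally show "(\<integral>\<^sup>+z. ennreal (norm (case z of (q, x) => w (qrot q x))) \<partial>(QM \<Otimes>\<^sub>M lborel)) < \<infinity>" .
 qed measurable
 show "integrable (QM \<Otimes>\<^sub>M lborel) (%(q, x). w x)"
 proof (rule integrableI_bounded)
  have "(\<integral>\<^sup>+z. ennreal (norm (case z of (q, x) => w x)) \<partial>(QM \<Otimes>\<^sub>M lborel))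
    = (\<integral>\<^sup>+q. \<integral>\<^sup>+x. ennreal |w x| \<partial>lborel \<partial>QM)"
   by (subst lborel.nn_integral_fst[symmetric]) auto
  also have "... < \<infinity>" using fin by (simp add: emeasure_QM_UNIV)
  finally show "(\<integral>\<^sup>+z. ennreal (norm (case z of (q, x) => w x)) \<partial>(QM \<Otimes>\<^sub>M lborel)) < \<infinity>" .
 qed measurable
qed

definition avg :: "(real^3 => 'b::{banach,second_countable_topology}) => real^3 => 'b" where
 "avg v x = (LINT q|QM. v (qrot q x))"

text \<open>A rotation taking x to y is absorbed by the change of variable q -> q p. The equality
  holds at every point, so the average is exactly a function of |x|.\<close>

lemma avg_radial:
 assumes [measurable]: "v \<in> borel_measurable borel" and "norm x = norm y"
 shows "avg v x = avg v y"
proof (cases "x = y")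
 case False
 then obtain p where p: "norm p = 1" "qrot p x = y" using qrot_transitive assms(2) by blast
 have Tm [measurable]: "(%q. qmul q p) \<in> borel_measurable borel"
  by (rule borel_measurable_continuous_onI[OF linear_continuous_on[OF linear_conv_bounded_linear[THEN iffD1,
   OF orthogonal_transformation_linear[OF qmul_orthogonal[OF p(1)]]]]])
 have "avg v x = (LINT q|distr QM borel (%q. qmul q p). v (qrot q x))" by (simp add: avg_def distr_QM p)
 also have "... = (LINT q|QM. v (qrot (qmul q p) x))" by (rule integral_distr) measurable
 also have "... = avg v y" by (simp add: avg_def qrot_comp[symmetric] p)
 finally show ?thesis .
qed simp

section \<open>Averages of H1 functions and symmetric criticality\<close>

lemma norm_integral_sq_le:
 fixes f :: "real^4 => 'b::euclidean_space"
 assumes [measurable]: "f \<in> borel_measurable borel" and sq: "integrable QM (%q. (norm (f q))^2)"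
 shows "integrable QM f" "(norm (LINT q|QM. f q))^2 <= (LINT q|QM. (norm (f q))^2)"
proof -
 show i: "integrable QM f"
 proof (rule L1_bound)
  show "integrable QM (%q. 1 + (norm (f q))^2)" using sq by simp
  have "a <= 1 + a^2" for a :: real using sum_squares_bound[of a 1] by (simp add: power2_eq_square) (smt (verit) zero_le_square)
  thus "AE q in QM. norm (f q) <= norm (1 + (norm (f q))^2)" by (auto intro: order_trans[OF _ abs_ge_self])
 qed simp
 define c where "c = (LINT q|QM. norm (f q))"
 have "0 <= (LINT q|QM. (norm (f q) - c)^2)" by simp
 also have "... = (LINT q|QM. (norm (f q))^2 - 2 * c * norm (f q) + c^2)"
  by (intro LINT_cong) (auto simp: power2_eq_square algebra_simps)
 also have "... = (LINT q|QM. (norm (f q))^2) - c\<^sup>2"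
  using sq i by (simp add: c_def power2_eq_square)
 finally have "c^2 <= (LINT q|QM. (norm (f q))^2)" by simp
 moreover have "(norm (LINT q|QM. f q))^2 <= c^2"
  unfolding c_def by (intro power_mono integral_norm_bound) auto
 ultimately show "(norm (LINT q|QM. f q))^2 <= (LINT q|QM. (norm (f q))^2)" by linarith
qed

text \<open>Stated for a general kernel dominated by a rotated L2 function, so that one use of
  Jensen and Fubini covers both the average of a function and the average of its gradient.\<close>

lemma avg_kernel:
 fixes K :: "real^4 => real^3 => 'b::euclidean_space" and v :: "real^3 => 'c::euclidean_space"
 assumes Km [measurable]: "(%(q, x). K q x) \<in> borel_measurable (QM \<Otimes>\<^sub>M R3)" and v: "l2 v"
  and le: "!!q x. norm (K q x) <= norm (v (qrot q x))"
 shows "l2 (%x. LINT q|QM. K q x)"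
  and "l2 \<phi> ==> (LINT x|R3. (LINT q|QM. K q x) \<bullet> \<phi> x) = (LINT q|QM. LINT x|R3. K q x \<bullet> \<phi> x)"
proof -
 note vm [measurable] = l2_borel[OF v]
 have Kx [measurable]: "(%q. K q x) \<in> borel_measurable borel" for x
  using measurable_compose[OF measurable_Pair2'[of x lborel QM] Km] by simp
 have Kq [measurable]: "K q \<in> borel_measurable borel" for q
  using measurable_compose[OF measurable_Pair1'[of q QM lborel] Km] by simp
 have Kswap [measurable]: "(%(x, q). K q x) \<in> borel_measurable (R3 \<Otimes>\<^sub>M QM)"
  using measurable_compose[OF measurable_pair_swap' Km] by (simp add: case_prod_unfold)
 have pv: "integrable (QM \<Otimes>\<^sub>M R3) (%(q, x). (norm (v (qrot q x)))^2)"
  by (rule integrable_pair_qrot(1)[OF l2_integrable[OF v]])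
 have pK: "integrable (QM \<Otimes>\<^sub>M R3) (%(q, x). (norm (K q x))^2)"
  by (rule L1_bound[OF pv]) (auto simp: le power_mono)
 have ax: "AE x in R3. integrable QM (%q. (norm (K q x))^2)" by (rule QL.AE_integrable_snd[OF pK])
 have ix: "integrable R3 (%x. LINT q|QM. (norm (K q x))^2)" by (rule QL.integrable_snd[OF pK])
 show "l2 (%x. LINT q|QM. K q x)"
  unfolding l2_def
 proof
  show m: "(%x. LINT q|QM. K q x) \<in> borel_measurable R3"
   by (rule QM.borel_measurable_lebesgue_integral[OF Kswap])
  show "integrable R3 (%x. (norm (LINT q|QM. K q x))^2)"
  proof (rule L1_bound[OF ix])
   show "(%x. (norm (LINT q|QM. K q x))^2) \<in> borel_measurable R3" using m by measurable
   show "AE x in R3. norm ((norm (LINT q|QM. K q x))^2) <= norm (LINT q|QM. (norm (K q x))^2)"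
    using ax by eventually_elim (auto dest: norm_integral_sq_le(2)[OF Kx])
  qed
 qed
 assume \<phi>: "l2 \<phi>"
 note [measurable] = l2_borel[OF \<phi>]
 have p\<phi>: "integrable (QM \<Otimes>\<^sub>M R3) (%(q, x). (norm (\<phi> x))^2)"
  by (rule integrable_pair_qrot(2)[OF l2_integrable[OF \<phi>]])
 have pp: "integrable (QM \<Otimes>\<^sub>M R3) (%(q, x). K q x \<bullet> \<phi> x)"
 proof (rule L1_bound[OF Bochner_Integration.integrable_add[OF pK p\<phi>]])
  have "|a \<bullet> b| <= (norm a)^2 + (norm b)^2" for a b :: 'b
   using Cauchy_Schwarz_ineq2[of a b] sum_squares_bound[of "norm a" "norm b"]
    mult_nonneg_nonneg[OF norm_ge_zero[of a] norm_ge_zero[of b]] by linarith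
  thus "AE z in QM \<Otimes>\<^sub>M R3. norm (case z of (q, x) => K q x \<bullet> \<phi> x)
    <= norm ((case z of (q, x) => (norm (K q x))^2) + (case z of (q, x) => (norm (\<phi> x))^2))"
   by (auto simp: case_prod_unfold intro: order_trans[OF _ abs_ge_self])
 qed measurable
 have "(LINT x|R3. LINT q|QM. K q x \<bullet> \<phi> x) = (LINT q|QM. LINT x|R3. K q x \<bullet> \<phi> x)"
  by (rule QL.Fubini_integral[OF pp])
 moreover have "(LINT x|R3. (LINT q|QM. K q x) \<bullet> \<phi> x) = (LINT x|R3. LINT q|QM. K q x \<bullet> \<phi> x)"
 proof (rule integral_cong_AE)
  show "(%x. (LINT q|QM. K q x) \<bullet> \<phi> x) \<in> borel_measurable R3"
   using QM.borel_measurable_lebesgue_integral[OF Kswap] by measurable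
  show "(%x. LINT q|QM. K q x \<bullet> \<phi> x) \<in> borel_measurable R3"
   by (rule QM.borel_measurable_lebesgue_integral) measurable
  show "AE x in R3. (LINT q|QM. K q x) \<bullet> \<phi> x = (LINT q|QM. K q x \<bullet> \<phi> x)"
   using ax by eventually_elim (auto dest: norm_integral_sq_le(1)[OF Kx])
 qed
 ultimately show "(LINT x|R3. (LINT q|QM. K q x) \<bullet> \<phi> x) = (LINT q|QM. LINT x|R3. K q x \<bullet> \<phi> x)" by simp
qed

text \<open>The gradient of a function composed with a rotation is its gradient at the rotated
  point, rotated back; \<open>qconj q\<close> gives the inverse rotation.\<close>

definition avg_grad :: "(real^3 => real^3) => real^3 => real^3" where
 "avg_grad g x = (LINT q|QM. qrot (qconj q) (g (qrot q x)))"

text \<open>At q = 0 division by zero makes \<open>qrot\<close> the zero map; the inequality covers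
  this case too, as \<open>avg_kernel\<close> quantifies over all \<open>q\<close>.\<close>

lemma norm_qrot_le: "norm (qrot q x) <= norm x"
proof (cases "q = 0")
 case False
 thus ?thesis by (rule eq_refl[OF norm_qrot])
qed (simp add: qrot_def)

lemma measurable_qconj [measurable]: "qconj \<in> borel_measurable borel"
proof -
 have "linear qconj" by (rule linearI) (simp_all add: qconj_def vec_eq_iff forall_4)
 thus ?thesis
  by (intro borel_measurable_continuous_onI linear_continuous_on) (simp add: linear_conv_bounded_linear)
qed

lemma weak_grad_rot:
 assumes q: "q ~= 0" and u: "l2 u" "l2 g" "weak_grad u g"
 shows "weak_grad (%x. u (qrot q x)) (%x. qrot (qconj q) (g (qrot q x)))"
 unfolding weak_grad_def
proof (intro allI impI)
 fix \<phi> and w :: "real^3" assume t: "test_fun \<phi>"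
 note [measurable] = l2_borel[OF u(1)] l2_borel[OF u(2)]
 define \<psi> where "\<psi> y = \<phi> (qrot (qconj q) y)" for y
 have qc: "qconj q ~= 0" using q norm_qconj[of q] by auto
 obtain R where R: "!!x. norm x > R ==> \<phi> x = 0" using test_fun_support[OF t] by metis
 have t\<psi>: "test_fun \<psi>"
 proof (rule test_funI)
  show "Ck n \<psi>" for n unfolding \<psi>_def by (rule Ck_linear[OF linear_qrot]) (use t in \<open>auto simp: test_fun_def\<close>)
  show "norm x > R ==> \<psi> x = 0" for x by (simp add: \<psi>_def R norm_qrot[OF qc])
 qed
 note [measurable] = l2_borel[OF test_fun_l2[OF t]] l2_borel[OF test_fun_l2[OF t\<psi>]] l2_borel[OF test_fun_dd_l2[OF t\<psi>]]
 have dd\<psi>: "dd \<psi> (qrot q w) (qrot q x) = dd \<phi> w x" for x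
 proof -
  have "(\<psi> has_derivative (%h. dd \<phi> (qrot (qconj q) h) (qrot (qconj q) (qrot q x)))) (at (qrot q x))"
   unfolding \<psi>_def
   by (rule has_derivative_compose[OF linear_imp_has_derivative[OF linear_qrot] test_fun_deriv[OF t]])
  from dd_eq[OF this] show ?thesis by (simp add: qrot_inverse[OF q])
 qed
 have "(LINT x|R3. u (qrot q x) * dd \<phi> w x) = (LINT x|R3. u (qrot q x) * dd \<psi> (qrot q w) (qrot q x))"
  by (simp add: dd\<psi>)
 also have "... = (LINT y|R3. u y * dd \<psi> (qrot q w) y)"
  by (rule integral_qrot(1)[OF q]) measurable
 also have "... = - (LINT y|R3. (g y \<bullet> qrot q w) * \<psi> y)" using u(3) t\<psi> by (simp add: weak_grad_def)
 also have "(LINT y|R3. (g y \<bullet> qrot q w) * \<psi> y) = (LINT x|R3. (g (qrot q x) \<bullet> qrot q w) * \<psi> (qrot q x))"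
  by (rule integral_qrot(1)[OF q, symmetric]) measurable
 also have "... = (LINT x|R3. (qrot (qconj q) (g (qrot q x)) \<bullet> w) * \<phi> x)"
  by (simp add: \<psi>_def qrot_inverse[OF q] qrot_inner)
 finally show "(LINT x|R3. u (qrot q x) * dd \<phi> w x) = - (LINT x|R3. (qrot (qconj q) (g (qrot q x)) \<bullet> w) * \<phi> x)" .
qed

lemma l2_avg: "l2 v ==> l2 (avg v)"
 and l2_avg_grad: "l2 g ==> l2 (avg_grad g)"
proof -
 show "l2 v ==> l2 (avg v)"
 proof -
  assume v: "l2 v"
  note [measurable] = l2_borel[OF v]
  show ?thesis unfolding avg_def[abs_def] by (rule avg_kernel(1)[OF _ v]) measurable
 qed
 show "l2 g ==> l2 (avg_grad g)"
 proof -
  assume g: "l2 g"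
  note [measurable] = l2_borel[OF g]
  show ?thesis unfolding avg_grad_def[abs_def] by (rule avg_kernel(1)[OF _ g]) (measurable, rule norm_qrot_le)
 qed
qed

lemma weak_grad_avg:
 assumes u: "l2 u" "l2 g" "weak_grad u g"
 shows "weak_grad (avg u) (avg_grad g)"
 unfolding weak_grad_def
proof (intro allI impI)
 fix \<phi> and w :: "real^3" assume t: "test_fun \<phi>"
 note [measurable] = l2_borel[OF u(1)] l2_borel[OF u(2)]
 note [measurable] = l2_borel[OF test_fun_l2[OF t]]
 have lw: "l2 (%x. \<phi> x *\<^sub>R w)" using test_fun_l2[OF t] by (auto simp: l2_def power_mult_distrib)
 note [measurable] = l2_borel[OF test_fun_dd_l2[OF t]]
 have "(LINT x|R3. avg u x * dd \<phi> w x) = (LINT x|R3. (LINT q|QM. u (qrot q x)) \<bullet> dd \<phi> w x)"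
  by (simp add: avg_def)
 also have "... = (LINT q|QM. LINT x|R3. u (qrot q x) \<bullet> dd \<phi> w x)"
  by (rule avg_kernel(2)[OF _ u(1) _ test_fun_dd_l2[OF t]]) auto
 also have "... = (LINT q|QM. - (LINT x|R3. qrot (qconj q) (g (qrot q x)) \<bullet> (\<phi> x *\<^sub>R w)))"
 proof (rule integral_cong_AE)
  show "AE q in QM. (LINT x|R3. u (qrot q x) \<bullet> dd \<phi> w x) = - (LINT x|R3. qrot (qconj q) (g (qrot q x)) \<bullet> (\<phi> x *\<^sub>R w))"
   using QM_nonzero
  proof eventually_elim
   case (elim q)
   show ?case using weak_grad_rot[OF elim u] t by (simp add: weak_grad_def mult.commute)
  qed
  show "(%q. LINT x|R3. u (qrot q x) \<bullet> dd \<phi> w x) \<in> borel_measurable QM"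
   by (rule lborel.borel_measurable_lebesgue_integral) measurable
  have "(%q. LINT x|R3. qrot (qconj q) (g (qrot q x)) \<bullet> (\<phi> x *\<^sub>R w)) \<in> borel_measurable QM"
   by (rule lborel.borel_measurable_lebesgue_integral) measurable
  thus "(%q. - (LINT x|R3. qrot (qconj q) (g (qrot q x)) \<bullet> (\<phi> x *\<^sub>R w))) \<in> borel_measurable QM" by measurable
 qed
 also have "... = - (LINT q|QM. LINT x|R3. qrot (qconj q) (g (qrot q x)) \<bullet> (\<phi> x *\<^sub>R w))"
  by simp
 also have "(LINT q|QM. LINT x|R3. qrot (qconj q) (g (qrot q x)) \<bullet> (\<phi> x *\<^sub>R w))
   = (LINT x|R3. (LINT q|QM. qrot (qconj q) (g (qrot q x))) \<bullet> (\<phi> x *\<^sub>R w))"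
  by (rule avg_kernel(2)[OF _ u(2) _ lw, symmetric]) (measurable, rule norm_qrot_le)
 also have "... = (LINT x|R3. (avg_grad g x \<bullet> w) * \<phi> x)" by (simp add: avg_grad_def mult.commute)
 finally show "(LINT x|R3. avg u x * dd \<phi> w x) = - (LINT x|R3. (avg_grad g x \<bullet> w) * \<phi> x)" .
qed

lemma avg_H1_rad: "v \<in> H1 ==> avg v \<in> H1_rad"
proof -
 assume v: "v \<in> H1"
 have "avg v \<in> H1"
  by (rule H1_I[OF l2_avg[OF H1_l2[OF v]] l2_avg_grad[OF grad_l2[OF v]]
    weak_grad_avg[OF H1_l2[OF v] grad_l2[OF v] grad_weak[OF v]]])
 moreover have "radial (avg v)"
  unfolding radial_def
 proof (intro exI AE_I2)
  fix x :: "real^3"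
  note [measurable] = H1_borel[OF v]
  show "avg v x = (%r. avg v ( |r| *\<^sub>R axis 1 1)) (norm x)" by (intro avg_radial) auto
 qed
 ultimately show ?thesis by (simp add: H1_rad_def)
qed

lemma radial_rot:
 assumes "radial b" "q ~= 0"
 shows "AE x in R3. b (qrot q x) = b x"
proof -
 obtain h where h: "AE x in R3. b x = h (norm x)" using assms(1) by (auto simp: radial_def)
 show ?thesis using h AE_qrot[OF assms(2) h] by eventually_elim (simp add: norm_qrot[OF assms(2)])
qed

text \<open>Radiality gives, for each rotation, invariance for almost every x; Fubini exchanges the
  two quantifiers, which is the order needed under the average.\<close>

lemma AE_pair_rot:
 assumes "radial b" and [measurable]: "b \<in> borel_measurable borel"
 shows "AE x in R3. AE q in QM. b (qrot q x) = b x"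
proof -
 have "AE q in QM. AE x in R3. b (qrot q x) = b x"
  using QM_nonzero by eventually_elim (rule radial_rot[OF assms(1)])
 moreover have "{z \<in> space (QM \<Otimes>\<^sub>M R3). b (qrot (fst z) (snd z)) = b (snd z)} \<in> sets (QM \<Otimes>\<^sub>M R3)"
  by measurable
 ultimately show ?thesis using QL.AE_commute[of "%q x. b (qrot q x) = b x"] by simp
qed

lemma avg_eq_radial:
 assumes "radial b" and [measurable]: "b \<in> borel_measurable borel"
 shows "AE x in R3. avg b x = b x"
 using AE_pair_rot[OF assms]
proof eventually_elim
 case (elim x)
 have "avg b x = (LINT q|QM. b x)" unfolding avg_def by (rule integral_cong_AE) (use elim in auto)
 thus ?case by simp
qed

lemma grad_rot:
 assumes u: "u \<in> H1_rad" and q: "q ~= 0"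
 shows "AE x in R3. grad u (qrot q x) = qrot q (grad u x)"
proof -
 have uH: "u \<in> H1" and ur: "radial u" using u by (auto simp: H1_rad_def)
 note [measurable] = H1_borel[OF uH] grad_borel[OF uH]
 have w: "weak_grad (%x. u (qrot q x)) (%x. qrot (qconj q) (grad u (qrot q x)))"
  by (rule weak_grad_rot[OF q H1_l2[OF uH] grad_l2[OF uH] grad_weak[OF uH]])
 have w': "weak_grad u (%x. qrot (qconj q) (grad u (qrot q x)))"
  by (rule weak_grad_cong[OF w radial_rot[OF ur q]]) measurable
 have qc: "qconj q ~= 0" using q norm_qconj[of q] by auto
 have l: "l2 (%x. qrot (qconj q) (grad u (qrot q x)))"
  unfolding l2_def norm_qrot[OF qc]
  using integral_qrot(2)[OF q, of "%x. (norm (grad u x))^2"] l2_integrable[OF grad_l2[OF uH]] by simp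
 show ?thesis using grad_eq[OF uH l w'] by eventually_elim (metis qrot_inverse'[OF q])
qed

text \<open>The gradient of a radial function commutes with rotations (\<open>grad_rot\<close>), so
  pairing it with each rotated copy of the gradient of \<open>v\<close> gives the same number. This
  and \<open>radial_times_avg\<close> are the principle of symmetric criticality.\<close>

lemma grad_avg_inner:
 assumes u: "u \<in> H1_rad" and v: "v \<in> H1"
 shows "(LINT x|R3. grad u x \<bullet> grad (avg v) x) = (LINT x|R3. grad u x \<bullet> grad v x)"
proof -
 have uH: "u \<in> H1" using u by (auto simp: H1_rad_def)
 have [measurable]: "grad u \<in> borel_measurable borel" "grad v \<in> borel_measurable borel" "grad (avg v) \<in> borel_measurable borel"
  "avg_grad (grad v) \<in> borel_measurable borel"
  using l2_measurable[OF grad_l2[OF uH]] l2_measurable[OF grad_l2[OF v]] l2_measurable[OF grad_l2, of "avg v"]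
   avg_H1_rad[OF v] l2_measurable[OF l2_avg_grad[OF grad_l2[OF v]]] by (simp_all add: H1_rad_def)
 have "AE x in R3. grad (avg v) x = avg_grad (grad v) x"
  using avg_H1_rad[OF v] weak_grad_avg[OF H1_l2[OF v] grad_l2[OF v] grad_weak[OF v]]
  by (intro grad_eq l2_avg_grad grad_l2 v) (auto simp: H1_rad_def)
 hence "(LINT x|R3. grad u x \<bullet> grad (avg v) x) = (LINT x|R3. (LINT q|QM. qrot (qconj q) (grad v (qrot q x))) \<bullet> grad u x)"
  by (intro integral_cong_AE) (auto simp: avg_grad_def[abs_def] inner_commute)
 also have "... = (LINT q|QM. LINT x|R3. qrot (qconj q) (grad v (qrot q x)) \<bullet> grad u x)"
  by (rule avg_kernel(2)[OF _ grad_l2[OF v] _ grad_l2[OF uH]]) (measurable, rule norm_qrot_le)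
 also have "... = (LINT q|QM. LINT x|R3. grad u x \<bullet> grad v x)"
 proof (rule integral_cong_AE)
  show "(%q. LINT x|R3. qrot (qconj q) (grad v (qrot q x)) \<bullet> grad u x) \<in> borel_measurable QM"
   by (rule lborel.borel_measurable_lebesgue_integral) measurable
  show "AE q in QM. (LINT x|R3. qrot (qconj q) (grad v (qrot q x)) \<bullet> grad u x) = (LINT x|R3. grad u x \<bullet> grad v x)"
   using QM_nonzero
  proof eventually_elim
   case (elim q)
   have "(LINT x|R3. qrot (qconj q) (grad v (qrot q x)) \<bullet> grad u x) = (LINT x|R3. grad u (qrot q x) \<bullet> grad v (qrot q x))"
   proof (rule integral_cong_AE)
    show "AE x in R3. qrot (qconj q) (grad v (qrot q x)) \<bullet> grad u x = grad u (qrot q x) \<bullet> grad v (qrot q x)"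
     using grad_rot[OF u elim] by eventually_elim (metis qrot_inner inner_commute)
   qed measurable
   also have "... = (LINT x|R3. grad u x \<bullet> grad v x)"
    by (rule integral_qrot(1)[OF elim, of "%x. grad u x \<bullet> grad v x"]) measurable
   finally show ?case .
  qed
 qed simp
 finally show ?thesis by simp
qed

text \<open>Fubini is applied to b(qx) v(qx), not to b(x) v(qx), so only integrability of the
  product enters; this suits coefficients such as f(u), for which no L2 bound is at hand.\<close>

lemma radial_times_avg:
 fixes b v :: "real^3 => real"
 assumes b: "radial b" and bm [measurable]: "b \<in> borel_measurable borel" and vm [measurable]: "v \<in> borel_measurable borel"
  and bv: "integrable R3 (%x. b x * v x)"
 shows "(LINT x|R3. b x * avg v x) = (LINT x|R3. b x * v x)"
proof -
 have p: "integrable (QM \<Otimes>\<^sub>M R3) (%(q, x). b (qrot q x) * v (qrot q x))"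
  by (rule integrable_pair_qrot(1)[OF bv])
 have "(LINT x|R3. b x * avg v x) = (LINT x|R3. LINT q|QM. b (qrot q x) * v (qrot q x))"
 proof (rule integral_cong_AE)
  have am [measurable]: "avg v \<in> borel_measurable R3"
   unfolding avg_def[abs_def] by (rule QM.borel_measurable_lebesgue_integral) measurable
  show "(%x. b x * avg v x) \<in> borel_measurable R3" by measurable
  show "(%x. LINT q|QM. b (qrot q x) * v (qrot q x)) \<in> borel_measurable R3"
   by (rule QM.borel_measurable_lebesgue_integral) measurable
  show "AE x in R3. b x * avg v x = (LINT q|QM. b (qrot q x) * v (qrot q x))"
   using AE_pair_rot[OF b bm]
  proof eventually_elim
   case (elim x)
   have "(LINT q|QM. b (qrot q x) * v (qrot q x)) = (LINT q|QM. b x * v (qrot q x))"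
    by (rule integral_cong_AE) (use elim in \<open>auto elim: eventually_mono\<close>)
   thus ?case by (simp add: avg_def)
  qed
 qed
 also have "... = (LINT q|QM. LINT x|R3. b (qrot q x) * v (qrot q x))" by (rule QL.Fubini_integral[OF p])
 also have "... = (LINT q|QM. LINT x|R3. b x * v x)"
 proof (rule integral_cong_AE)
  show "(%q. LINT x|R3. b (qrot q x) * v (qrot q x)) \<in> borel_measurable QM"
   by (rule lborel.borel_measurable_lebesgue_integral) measurable
  show "AE q in QM. (LINT x|R3. b (qrot q x) * v (qrot q x)) = (LINT x|R3. b x * v x)"
   using QM_nonzero by eventually_elim (rule integral_qrot(1)[of _ "%x. b x * v x"], auto)
 qed simp
 finally show ?thesis by simp
qed

section \<open>Pointwise representatives of radial functions\<close>

text \<open>The field x/|x|^3 outside the ball |x|^2 <= s. For a radial function vanishing at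
  infinity, the fundamental theorem of calculus along rays gives its value on the sphere |x|^2 = s
  as -1/(4 pi) times the integral of the gradient against this field.\<close>

definition evk :: "real => real^3 => real^3" where
 "evk s x = (indicator {x. s < (norm x)^2} x / norm x ^ 3) *\<^sub>R x"

lemma evk_measurable [measurable]: "evk s \<in> borel_measurable borel"
 unfolding evk_def[abs_def] by measurable

lemma norm_evk:
 assumes "s > 0"
 shows "(norm (evk s x))^2 = indicator {x. s < (norm x)^2} x * (1 / norm x ^ 4)"
proof (cases "s < (norm x)^2")
 case True
 hence "norm x > 0" using assms by auto
 thus ?thesis using True by (simp add: evk_def power_mult_distrib power_divide power2_eq_square field_simps power_eq_if)
qed (simp add: evk_def)

lemma evk_l2: "s > 0 ==> l2 (evk s)"
 unfolding l2_def norm_evk using tail_integrable(1) by simp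

lemma n2_evk: "s > 0 ==> n2 (evk s) = 4 * pi / sqrt s"
 unfolding n2_def norm_evk using tail_integrable(2) by simp

lemma n2_evk_diff:
 assumes "0 < a" "a <= b"
 shows "n2 (%x. evk a x - evk b x) = 4 * pi / sqrt a - 4 * pi / sqrt b"
proof -
 have "(norm (evk a x - evk b x))^2 = indicator {x. a < (norm x)^2} x * (1 / norm x ^ 4) - indicator {x. b < (norm x)^2} x * (1 / norm x ^ 4)" for x
 proof (cases "b < (norm x)^2")
  case True
  thus ?thesis using assms by (simp add: evk_def)
 next
  case False
  hence "evk b x = 0" by (simp add: evk_def)
  thus ?thesis using norm_evk[OF assms(1), of x] False by simp
 qed
 thus ?thesis
  using tail_integrable[of a] tail_integrable[of b] assms by (simp add: n2_def)
qed

definition ev :: "(real^3 => real) => real => real" where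
 "ev u s = - (LINT x|R3. grad u x \<bullet> evk s x) / (4 * pi)"

lemma ev_measurable [measurable]:
 assumes "u \<in> H1" shows "ev u \<in> borel_measurable borel"
proof -
 note [measurable] = grad_borel[OF assms]
 have "(%s. LINT x|R3. grad u x \<bullet> evk s x) \<in> borel_measurable borel"
  unfolding evk_def by (rule lborel.borel_measurable_lebesgue_integral) measurable
 thus ?thesis unfolding ev_def[abs_def] by measurable
qed

lemma four_pi_ge_1: "1 <= 4 * pi"
 using pi_gt3 by linarith

text \<open>Since 4 pi >= 1, the factor sqrt (4 pi) / (4 pi) is at most 1 and is dropped, which
  keeps constants out of the decay estimates.\<close>

lemma ev_scale_bound:
 assumes "|I| <= sqrt N * sqrt (4 * pi * r)" "r >= 0" "N >= 0"
 shows "|I / (4 * pi)| <= sqrt N * sqrt r"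
proof -
 have "sqrt (4 * pi * r) = sqrt (4 * pi) * sqrt r" by (simp add: real_sqrt_mult)
 moreover have "sqrt (4 * pi) <= 4 * pi"
  using four_pi_ge_1 by (intro real_le_lsqrt) (auto simp: power2_eq_square mult_le_cancel_left1)
 ultimately have "sqrt (4 * pi * r) <= 4 * pi * sqrt r" using assms(2) by (simp add: mult_right_mono)
 hence "|I| <= sqrt N * (4 * pi * sqrt r)" using assms(1,3) by (meson mult_left_mono order_trans real_sqrt_ge_zero)
 thus ?thesis using pi_gt_zero by (simp add: abs_divide divide_le_eq mult.commute mult.left_commute)
qed

lemma ev_bound:
 assumes "u \<in> H1" "s > 0"
 shows "|ev u s| <= sqrt (n2 (grad u)) / sqrt (sqrt s)"
proof -
 have "|LINT x|R3. grad u x \<bullet> evk s x| <= sqrt (n2 (grad u)) * sqrt (4 * pi * (1 / sqrt s))"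
  using cauchy_schwarz_inner[OF grad_l2[OF assms(1)] evk_l2[OF assms(2)]] n2_evk[OF assms(2)] by simp
 from ev_scale_bound[OF this] show ?thesis using assms(2) by (simp add: ev_def n2_nonneg real_sqrt_divide)
qed

text \<open>The fields for \<open>a\<close> and \<open>b\<close> differ only in a shell, whose
  contribution is 1/sqrt a - 1/sqrt b; profiles are thus equicontinuous away from 0 with a modulus
  set by the gradient norm alone.\<close>

lemma ev_diff_bound:
 assumes "u \<in> H1" "0 < a" "a <= b"
 shows "|ev u a - ev u b| <= sqrt (n2 (grad u)) * sqrt (1 / sqrt a - 1 / sqrt b)"
proof -
 have b: "0 < b" using assms by simp
 note L = l2_diff[OF evk_l2[OF assms(2)] evk_l2[OF b]]
 have eq: "ev u a - ev u b = - ((LINT x|R3. grad u x \<bullet> (evk a x - evk b x)) / (4 * pi))"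
  using l2_inner[OF grad_l2[OF assms(1)] evk_l2[OF assms(2)]] l2_inner[OF grad_l2[OF assms(1)] evk_l2[OF b]]
  by (simp add: ev_def inner_diff_right diff_divide_distrib)
 have "4 * pi * (1 / sqrt a - 1 / sqrt b) = n2 (%x. evk a x - evk b x)"
  unfolding n2_evk_diff[OF assms(2,3)] by (simp add: right_diff_distrib)
 hence "|LINT x|R3. grad u x \<bullet> (evk a x - evk b x)| <= sqrt (n2 (grad u)) * sqrt (4 * pi * (1 / sqrt a - 1 / sqrt b))"
  using cauchy_schwarz_inner[OF grad_l2[OF assms(1)] L] by simp
 from ev_scale_bound[OF this] show ?thesis unfolding eq abs_minus_cancel
  using assms b by (simp add: n2_nonneg frac_le)
qed

lemma grad_add_inner:
 assumes u: "u \<in> H1" and v: "v \<in> H1" and k: "l2 k"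
 shows "(LINT x|R3. grad (%x. u x + v x) x \<bullet> k x) = (LINT x|R3. grad u x \<bullet> k x) + (LINT x|R3. grad v x \<bullet> k x)"
proof -
 note [measurable] = grad_borel[OF u] grad_borel[OF v] grad_borel[OF H1_add[OF u v]] l2_borel[OF k]
 have "(LINT x|R3. grad (%x. u x + v x) x \<bullet> k x) = (LINT x|R3. grad u x \<bullet> k x + grad v x \<bullet> k x)"
  by (rule integral_cong_AE, measurable) (use grad_add[OF u v] in \<open>auto elim!: eventually_mono simp: inner_add_left\<close>)
 thus ?thesis using l2_inner[OF grad_l2[OF u] k] l2_inner[OF grad_l2[OF v] k] by simp
qed

lemma grad_scale_inner:
 assumes u: "u \<in> H1" and [measurable]: "k \<in> borel_measurable borel"
 shows "(LINT x|R3. grad (%x. c * u x) x \<bullet> k x) = c * (LINT x|R3. grad u x \<bullet> k x)"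
proof -
 note [measurable] = grad_borel[OF u] grad_borel[OF H1_scale[OF u]]
 have "(LINT x|R3. grad (%x. c * u x) x \<bullet> k x) = (LINT x|R3. c * (grad u x \<bullet> k x))"
  by (rule integral_cong_AE, measurable) (use grad_scale[OF u, of c] in \<open>auto elim!: eventually_mono\<close>)
 thus ?thesis by simp
qed

lemma ev_add:
 assumes "u \<in> H1" "v \<in> H1" "s > 0"
 shows "ev (%x. u x + v x) s = ev u s + ev v s"
 using grad_add_inner[OF assms(1,2) evk_l2[OF assms(3)]] by (simp add: ev_def add_divide_distrib diff_divide_distrib)

lemma ev_scale:
 assumes "u \<in> H1"
 shows "ev (%x. c * u x) s = c * ev u s"
 unfolding ev_def by (subst grad_scale_inner[OF assms]) simp_all

lemma ev_continuous:
 assumes u: "u \<in> H1"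
 shows "continuous_on {0<..} (ev u)"
 unfolding continuous_on_eq_continuous_at[OF open_greaterThan]
proof
 fix s :: real assume s: "s \<in> {0<..}"
 have "((%t. sqrt (n2 (grad u)) * sqrt |1 / sqrt s - 1 / sqrt t| ) \<longlongrightarrow> sqrt (n2 (grad u)) * sqrt |1 / sqrt s - 1 / sqrt s| ) (at s)"
  using s by (intro tendsto_intros) auto
 hence lim: "((%t. sqrt (n2 (grad u)) * sqrt |1 / sqrt s - 1 / sqrt t| ) \<longlongrightarrow> 0) (at s)" by simp
 have "((%t. ev u t - ev u s) \<longlongrightarrow> 0) (at s)"
 proof (rule Lim_null_comparison[OF _ lim])
  have "eventually (%t. t > 0) (at s)" using s order_tendstoD(1)[OF tendsto_ident_at, of 0 s UNIV] by simp
  thus "eventually (%t. norm (ev u t - ev u s) <= sqrt (n2 (grad u)) * sqrt |1 / sqrt s - 1 / sqrt t| ) (at s)"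
  proof eventually_elim
   case (elim t)
   show ?case
   proof (cases "s <= t")
    case True
    hence "|1 / sqrt s - 1 / sqrt t| = 1 / sqrt s - 1 / sqrt t" using s by (intro abs_of_nonneg) (simp add: frac_le)
    thus ?thesis using ev_diff_bound[OF u, of s t] s True by (simp add: abs_minus_commute)
   next
    case False
    hence "1 / sqrt s <= 1 / sqrt t" using elim by (intro frac_le) auto
    hence "|1 / sqrt s - 1 / sqrt t| = 1 / sqrt t - 1 / sqrt s" by simp
    thus ?thesis using ev_diff_bound[OF u elim, of s] False by simp
   qed
  qed
 qed
 thus "isCont (ev u) s" unfolding isCont_def by (simp add: LIM_zero_iff)
qed

section \<open>Identification of a radial function with its profile \<open>ev\<close>\<close>

lemma Sm_powr_mult:
 assumes a: "a > 0"
 shows "Sm n h ==> (!!s. s < a ==> h s = 0) ==> Sm n (%s. (if s > 0 then s powr c else 0) * h s)"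
proof (induction n arbitrary: h c)
 case 0
 let ?f = "%s. (if s > 0 then s powr c else 0) * h s"
 have "continuous_on {..<a} ?f" by (rule continuous_on_eq[of _ "%s. 0"]) (use 0 in auto)
 moreover have "continuous_on {0<..} ?f"
 proof (rule continuous_on_eq)
  show "continuous_on {0<..} (%s. s powr c * h s)"
   using continuous_on_subset[OF Sm_continuous[OF 0(1)]] by (intro continuous_intros) auto
 qed auto
 ultimately have "continuous_on ({..<a} \<union> {0<..}) ?f" by (rule continuous_on_open_Un[OF open_lessThan open_greaterThan])
 moreover have "{..<a} \<union> {0<..} = UNIV" using a by auto
 ultimately show ?case by simp
next
 case (Suc n)
 obtain h' where h': "!!x. (h has_real_derivative h' x) (at x)" "Sm n h'" using Suc.prems(1) by auto
 let ?P = "%c s. if s > 0 then s powr c else (0::real)"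
 have h0: "h' s = 0" if "s < a" for s
 proof -
  have "((%x. 0) has_real_derivative h' s) (at s)"
   by (rule has_field_derivative_transform_within_open[OF h'(1), of "{..<a}"]) (use that Suc.prems in auto)
  thus ?thesis using DERIV_const DERIV_unique by blast
 qed
 have der: "((%s. ?P c s * h s) has_real_derivative (c * (?P (c - 1) x * h x) + ?P c x * h' x)) (at x)" for x
 proof (cases "x > 0")
  case True
  have "((%s. s powr c * h s) has_real_derivative (c * (x powr (c - 1) * h x) + x powr c * h' x)) (at x)"
   using True by (auto intro!: derivative_eq_intros h'(1))
  hence "((%s. ?P c s * h s) has_real_derivative (c * (x powr (c - 1) * h x) + x powr c * h' x)) (at x)"
   by (rule has_field_derivative_transform_within_open[of _ _ _ "{0<..}"]) (use True in auto)
  thus ?thesis using True by simp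
 next
  case False
  hence "x < a" using a by simp
  have "((%s. ?P c s * h s) has_real_derivative 0) (at x)"
   by (rule has_field_derivative_transform_within_open[OF DERIV_const[of 0], of "{..<a}"]) (use \<open>x < a\<close> Suc.prems in auto)
  thus ?thesis using False by simp
 qed
 have "Sm n (%s. c * (?P (c - 1) s * h s) + ?P c s * h' s)"
  by (rule Sm_add[OF Sm_cmult[OF Suc.IH[OF Sm_Suc_D[OF Suc.prems(1)] Suc.prems(2)]] Suc.IH[OF h'(2) h0]])
 thus ?case unfolding Sm.simps by (intro exI conjI allI) (rule der, assumption)
qed

lemma antideriv:
 assumes c: "continuous_on UNIV k" and z: "!!s. s <= a ==> k s = (0::real)"
 defines "h \<equiv> %s. LINT r|lborel. indicator {..<s} r * k r"
 shows "(h has_real_derivative k x) (at x)"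
proof -
 define l where "l = min a x - 2"
 have lx: "l < x" "l <= a" by (simp_all add: l_def)
 have eq: "h y = integral {l..y} k" for y
 proof -
  have ck: "continuous_on {l..y} k" by (rule continuous_on_subset[OF c]) simp
  have [measurable]: "k \<in> borel_measurable borel" by (rule borel_measurable_continuous_onI[OF c])
  have si: "set_integrable lborel {l..y} k" by (rule borel_integrable_atLeastAtMost'[OF ck])
  have "h y = (LINT r|lborel. indicator {l..y} r * k r)"
   unfolding h_def
  proof (rule integral_cong_AE)
   show "AE r in lborel. indicator {..<y} r * k r = indicator {l..y} r * k r"
    using AE_lborel_singleton[of y]
   proof eventually_elim
    case (elim r)
    thus ?case using z[of r] lx by (auto simp: indicator_def)
   qed
  qed measurable
  also have "... = integral {l..y} k" using set_borel_integral_eq_integral(2)[OF si] by (simp add: set_lebesgue_integral_def)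
  finally show ?thesis .
 qed
 have "((%y. integral {l..y} k) has_real_derivative k x) (at x within {l..x+1})"
  by (rule integral_has_real_derivative) (auto intro: continuous_on_subset[OF c] simp: l_def)
 hence "((%y. integral {l..y} k) has_real_derivative k x) (at x)"
  unfolding at_within_Icc_at[OF lx(1), of "x + 1", simplified] .
 thus ?thesis by (simp add: eq[abs_def])
qed

text \<open>Integrating the profile against \<open>k\<close> and exchanging integrals leaves the
  antiderivative of \<open>k\<close> at |x|^2, the form in which the weak gradient can be applied.
  Vanishing of \<open>k\<close> near 0 keeps the singular field away from the origin.\<close>

lemma ev_fubini:
 assumes u: "u \<in> H1" and a: "a > 0" and k: "integrable lborel k" and z: "!!r. r <= a ==> k r = 0"
 shows "integrable lborel (%r. k r * ev u r)"
  and "(LINT x|R3. (grad u x \<bullet> x) / norm x ^ 3 * (LINT r|lborel. indicator {..<(norm x)^2} r * k r))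
   = - (4 * pi) * (LINT r|lborel. k r * ev u r)"
proof -
 note [measurable] = int_borel[OF k]
 note [measurable] = grad_borel[OF u]
 define F where "F x r = k r * (grad u x \<bullet> evk r x)" for x r
 have Fm [measurable]: "(%(x, r). F x r) \<in> borel_measurable (R3 \<Otimes>\<^sub>M lborel)"
  unfolding F_def evk_def by measurable
 define A where "A x = norm (grad u x) * norm (evk a x)" for x
 have Ai: "integrable R3 A" unfolding A_def by (rule l2_norm_prod[OF grad_l2[OF u] evk_l2[OF a]])
 note [measurable] = int_borel[OF Ai]
 have A0: "A x >= 0" for x by (simp add: A_def)
 have Bi: "integrable (R3 \<Otimes>\<^sub>M lborel) (%(x, r). A x * |k r| )"
 proof (rule lborel_pair.Fubini_integrable)
  show "integrable R3 (%x. LINT y|lborel. norm (case (x, y) of (x, r) => A x * |k r| ))"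
   using Ai A0 by (simp add: abs_mult)
  show "AE x in R3. integrable lborel (%y. case (x, y) of (x, r) => A x * |k r| )"
   using k by simp
 qed measurable
 have FA: "|F x r| <= A x * |k r|" for x r
 proof (cases "r <= a")
  case False
  have "norm (evk r x) <= norm (evk a x)" using False by (auto simp: evk_def indicator_def)
  hence "|grad u x \<bullet> evk r x| <= A x"
   unfolding A_def by (meson Cauchy_Schwarz_ineq2 mult_left_mono norm_ge_zero order_trans)
  from mult_right_mono[OF this, of "|k r|"] show ?thesis by (simp add: F_def abs_mult mult.commute)
 qed (simp add: F_def z A0)
 have Fi: "integrable (R3 \<Otimes>\<^sub>M lborel) (%(x, r). F x r)"
  by (rule L1_bound[OF Bi Fm]) (rule AE_I2, use FA A0 in \<open>auto simp: split_beta abs_mult\<close>)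
 have inner: "(LINT x|R3. F x r) = - (4 * pi) * (k r * ev u r)" for r
  by (simp add: F_def ev_def)
 have "integrable lborel (%r. LINT x|R3. F x r)" by (rule lborel_pair.integrable_snd[OF Fi])
 thus "integrable lborel (%r. k r * ev u r)" unfolding inner by simp
 have "(LINT x|R3. LINT r|lborel. F x r) = (LINT r|lborel. LINT x|R3. F x r)"
  by (rule lborel_pair.Fubini_integral[OF Fi, symmetric])
 also have "... = - (4 * pi) * (LINT r|lborel. k r * ev u r)" unfolding inner by simp
 also have "(LINT x|R3. LINT r|lborel. F x r)
   = (LINT x|R3. (grad u x \<bullet> x) / norm x ^ 3 * (LINT r|lborel. indicator {..<(norm x)^2} r * k r))"
 proof (rule LINT_cong[OF refl])
  fix x
  have "F x r = (grad u x \<bullet> x) / norm x ^ 3 * (indicator {..<(norm x)^2} r * k r)" for r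
   by (simp add: F_def evk_def indicator_def)
  thus "(LINT r|lborel. F x r) = (grad u x \<bullet> x) / norm x ^ 3 * (LINT r|lborel. indicator {..<(norm x)^2} r * k r)"
   by (simp only: integral_mult_right_zero)
 qed
 finally show "(LINT x|R3. (grad u x \<bullet> x) / norm x ^ 3 * (LINT r|lborel. indicator {..<(norm x)^2} r * k r))
   = - (4 * pi) * (LINT r|lborel. k r * ev u r)" .
qed

text \<open>The test field is x p(|x|^2) with p = s^(-3/2) h and h' = k. Its divergence 3 p + 2 s p'
  reduces to 2 k / sqrt s, as the power -3/2 makes the terms in h cancel. The zero mean of
  \<open>k\<close> makes h vanish beyond \<open>b\<close>, so the field has compact support.\<close>

lemma radial_test_identity:
 assumes u: "u \<in> H1" and a: "0 < a"
  and sm: "!!n. Sm n k" and z: "!!s. s <= a ==> k s = 0" "!!s. s >= b ==> k s = 0"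
  and mean: "(LINT s|lborel. k s) = 0"
 shows "2 * (LINT x|R3. u x * (k ((norm x)^2) / norm x))
  = - (LINT x|R3. (grad u x \<bullet> x) / norm x ^ 3 * (LINT r|lborel. indicator {..<(norm x)^2} r * k r))"
proof -
 define h where "h s = (LINT r|lborel. indicator {..<s} r * k r)" for s
 have ck: "continuous_on UNIV k" by (rule Sm_continuous[OF sm])
 have hd: "(h has_real_derivative k s) (at s)" for s
  unfolding h_def by (rule antideriv[OF ck z(1)])
 have hS: "Sm n h" for n by (rule Sm_Suc_D) (use hd sm in auto)
 have h0: "h s = 0" if "s <= a" for s
 proof -
  have "(%r. indicator {..<s} r * k r) = (%r. 0)" using that z(1) by (auto simp: indicator_def)
  thus ?thesis by (simp add: h_def)
 qed
 have hb: "h s = 0" if "s >= b" for s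
 proof -
  have "indicator {..<s} r * k r = k r" for r using that z(2)[of r] by (cases "r < s") auto
  thus ?thesis using mean by (simp only: h_def)
 qed
 define p where "p s = (if s > 0 then s powr (-3/2) else 0) * h s" for s
 have pS: "Sm n p" for n unfolding p_def[abs_def] by (rule Sm_powr_mult[OF a hS]) (simp add: h0)
 obtain p' where p': "!!s. (p has_real_derivative p' s) (at s)" using pS[of 1] by auto
 have p'eq: "p' s = -3/2 * s powr (-5/2) * h s + s powr (-3/2) * k s" if "s > 0" for s
 proof -
  have "((%s. s powr (-3/2) * h s) has_real_derivative (-3/2 * s powr (-5/2) * h s + s powr (-3/2) * k s)) (at s)"
   using that by (auto intro!: derivative_eq_intros hd)
  hence "(p has_real_derivative (-3/2 * s powr (-5/2) * h s + s powr (-3/2) * k s)) (at s)"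
   by (rule has_field_derivative_transform_within_open[of _ _ _ "{0<..}"]) (use that in \<open>auto simp: p_def\<close>)
  thus ?thesis using p' DERIV_unique by blast
 qed
 have p0: "p s = 0" if "s <= 0" for s using that by (simp add: p_def)
 define \<phi> where "\<phi> i x = x $ i * p ((norm x)^2)" for i and x :: "real^3"
 have t: "test_fun (\<phi> i)" for i
 proof (rule test_funI)
  show "Ck n (\<phi> i)" for n
   unfolding \<phi>_def by (rule Ck_mult[OF Ck_component Ck_Sm[OF pS Ck_norm_sq]])
  fix x :: "real^3" assume "norm x > sqrt |b|"
  hence "(norm x)^2 > b" using real_sqrt_less_iff[of "|b|" "(norm x)^2"] by simp
  thus "\<phi> i x = 0" by (simp add: \<phi>_def p_def hb)
 qed
 have dd\<phi>: "dd (\<phi> i) (axis i 1) x = p ((norm x)^2) + 2 * (x $ i)^2 * p' ((norm x)^2)" for i x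
 proof -
  have c: "((%x. p ((norm x)^2)) has_derivative (%v. (2 * (x \<bullet> v)) * p' ((norm x)^2))) (at x)"
  proof -
   have n: "((%x. (norm x)^2) has_derivative (%v. 2 * (x \<bullet> v))) (at x)"
    unfolding power2_norm_eq_inner by (auto intro!: derivative_eq_intros simp: inner_commute)
   have "((%x. p ((norm x)^2)) has_derivative (%v. p' ((norm x)^2) * (2 * (x \<bullet> v)))) (at x)"
    by (rule has_derivative_compose[OF n]) (use p'[of "(norm x)^2"] in \<open>simp add: has_field_derivative_def\<close>)
   thus ?thesis by (simp add: mult.commute)
  qed
  have "((%x. x $ i * p ((norm x)^2)) has_derivative (%v. x $ i * ((2 * (x \<bullet> v)) * p' ((norm x)^2)) + v $ i * p ((norm x)^2))) (at x)"
   by (rule has_derivative_mult[OF bounded_linear.has_derivative[OF bounded_linear_vec_nth has_derivative_ident] c])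
  from dd_eq[OF this, folded \<phi>_def] show ?thesis
   by (simp add: inner_axis axis_nth power2_eq_square \<phi>_def[abs_def])
 qed
 have w: "(LINT x|R3. u x * dd (\<phi> i) (axis i 1) x) = - (LINT x|R3. (grad u x \<bullet> axis i 1) * \<phi> i x)" for i
  using grad_weak[OF u] t[of i] unfolding weak_grad_def by blast
 have i1: "integrable R3 (%x. u x * dd (\<phi> i) (axis i 1) x)" for i
  by (rule l2_times[OF H1_l2[OF u] test_fun_dd_l2[OF t]])
 have i2: "integrable R3 (%x. (grad u x \<bullet> axis i 1) * \<phi> i x)" for i
  by (rule l2_times[OF l2_component[OF grad_l2[OF u]] test_fun_l2[OF t]])
 have "(LINT x|R3. u x * (2 * (k ((norm x)^2) / norm x))) = (LINT x|R3. (\<Sum>i\<in>UNIV. u x * dd (\<phi> i) (axis i 1) x))"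
 proof (rule LINT_cong[OF refl])
  fix x :: "real^3"
  have "(\<Sum>i\<in>UNIV. dd (\<phi> i) (axis i 1) x) = 3 * p ((norm x)^2) + 2 * (norm x)^2 * p' ((norm x)^2)"
   unfolding dd\<phi> sum_3 norm3 by (simp add: algebra_simps)
  also have "... = 2 * (k ((norm x)^2) / norm x)"
  proof (cases "x = 0")
   case False
   define s where "s = (norm x)^2"
   have s: "s > 0" using False by (simp add: s_def)
   have n: "norm x = s powr (1/2)" using s by (simp add: s_def powr_half_sqrt)
   have e1: "s * s powr (-5/2) = s powr (-3/2)" using s by (simp add: powr_mult_base)
   have "s * s powr (-3/2) = s powr (1 + -3/2)" by (rule powr_mult_base) (use s in simp)
   also have "1 + -3/2 = - (1/2::real)" by simp
   also have "s powr - (1/2) = 1 / norm x" unfolding n by (rule powr_minus_divide)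
   finally have e2: "s * s powr (-3/2) = 1 / norm x" .
   have "3 * p s + 2 * s * p' s = 3 * s powr (-3/2) * h s - 3 * (s * s powr (-5/2)) * h s + 2 * (s * s powr (-3/2)) * k s"
    using s by (simp add: p'eq p_def algebra_simps)
   thus ?thesis unfolding s_def[symmetric] e1 e2 by simp
  qed (simp add: p0)
  finally have "(\<Sum>i\<in>UNIV. dd (\<phi> i) (axis i 1) x) = 2 * (k ((norm x)^2) / norm x)" .
  from arg_cong[OF this, of "%z. u x * z", symmetric]
  show "u x * (2 * (k ((norm x)^2) / norm x)) = (\<Sum>i\<in>UNIV. u x * dd (\<phi> i) (axis i 1) x)"
   by (simp only: sum_distrib_left)
 qed
 also have "... = (\<Sum>i\<in>UNIV. (LINT x|R3. u x * dd (\<phi> i) (axis i 1) x))"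
  by (rule Bochner_Integration.integral_sum) (rule i1)
 also have "... = - (\<Sum>i\<in>UNIV. (LINT x|R3. (grad u x \<bullet> axis i 1) * \<phi> i x))"
  unfolding w sum_negf ..
 also have "(\<Sum>i\<in>UNIV. (LINT x|R3. (grad u x \<bullet> axis i 1) * \<phi> i x)) = (LINT x|R3. (\<Sum>i\<in>UNIV. (grad u x \<bullet> axis i 1) * \<phi> i x))"
  by (rule Bochner_Integration.integral_sum[symmetric]) (rule i2)
 also have "... = (LINT x|R3. (grad u x \<bullet> x) / norm x ^ 3 * h ((norm x)^2))"
 proof (rule LINT_cong[OF refl])
  fix x :: "real^3"
  have "(\<Sum>i\<in>UNIV. (grad u x \<bullet> axis i 1) * \<phi> i x) = (grad u x \<bullet> x) * p ((norm x)^2)"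
   by (simp add: sum_3 inner_vec_def[of "grad u x" x] inner_axis \<phi>_def algebra_simps)
  also have "p ((norm x)^2) = h ((norm x)^2) / norm x ^ 3"
  proof (cases "x = 0")
   case False
   have "((norm x)^2) powr (-3/2) = norm x powr (-3)"
    using False by (simp add: powr_powr flip: powr_numeral)
   also have "... = 1 / norm x ^ 3" using False by (simp add: powr_minus_divide powr_numeral)
   finally show ?thesis using False by (simp add: p_def)
  qed (simp add: p0)
  finally show "(\<Sum>i\<in>UNIV. (grad u x \<bullet> axis i 1) * \<phi> i x) = (grad u x \<bullet> x) / norm x ^ 3 * h ((norm x)^2)" by simp
 qed
 finally have "(LINT x|R3. u x * (2 * (k ((norm x)^2) / norm x)))
   = - (LINT x|R3. (grad u x \<bullet> x) / norm x ^ 3 * h ((norm x)^2))" .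
 moreover have "(LINT x|R3. u x * (2 * (k ((norm x)^2) / norm x))) = 2 * (LINT x|R3. u x * (k ((norm x)^2) / norm x))"
  by (simp only: mult.left_commute[of _ 2] integral_mult_right_zero)
 ultimately show ?thesis unfolding h_def by simp
qed

lemma integrable_indicator_Ioo: "integrable lborel (indicator {a<..<b::real} :: real => real)"
 by (rule integrable_real_indicator) (use emeasure_bounded_finite[of "{a<..<b}"] in auto)

text \<open>The lemma of du Bois-Reymond on the half-line. Each bump on {a<..<b} is corrected to
  mean zero by a multiple of the bump on {1<..<2}; in the limit the integral of \<open>w\<close>
  over an interval is c times its length.\<close>

lemma zero_mean_tests:
 fixes w :: "real => real"
 assumes [measurable]: "w \<in> borel_measurable borel"
  and loc: "!!a b. 0 < a ==> integrable lborel (%s. indicator {a<..<b} s * w s)"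
  and z: "!!k a b. 0 < a ==> (!!n. Sm n k) ==> (!!s. s <= a ==> k s = 0) ==> (!!s. s >= b ==> k s = 0) ==>
   (LINT s|lborel. k s) = 0 ==> (LINT s|lborel. w s * k s) = 0"
 shows "EX c. AE s in lborel. s > 0 --> w s = c"
proof -
 define m where "m n a b = (LINT s|lborel. bump n a b s)" for n a b
 define W where "W n a b = (LINT s|lborel. w s * bump n a b s)" for n a b
 have bm [measurable]: "bump n a b \<in> borel_measurable borel" for n a b
  by (rule borel_measurable_continuous_onI[OF Sm_continuous[OF Sm_bump]])
 have bi: "bump n a b s = indicator {a<..<b} s * bump n a b s" for n a b s
  using bump_nz[of n a b s] by (auto simp: indicator_def)
 have bint: "integrable lborel (%s. v s * bump n a b s)"
  if "integrable lborel (%s. indicator {a<..<b} s * v s)" and [measurable]: "v \<in> borel_measurable borel" for v n a b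
 proof (rule L1_bound[OF that(1)])
  show "AE s in lborel. norm (v s * bump n a b s) <= norm (indicator {a<..<b} s * v s)"
  proof (rule AE_I2)
   fix s show "norm (v s * bump n a b s) <= norm (indicator {a<..<b} s * v s)"
    using bump_nz[of n a b s] bump_nonneg[of n a b s] bump_le_1[of n a b s]
    by (cases "s \<in> {a<..<b}") (auto simp: abs_mult mult_left_le)
  qed
 qed measurable
 have lim: "(%n. LINT s|lborel. v s * bump n a b s) ----> (LINT s|lborel. indicator {a<..<b} s * v s)"
  if vi: "integrable lborel (%s. indicator {a<..<b} s * v s)" and [measurable]: "v \<in> borel_measurable borel" for v a b
 proof (rule integral_dominated_convergence[where w = "%s. |indicator {a<..<b} s * v s|"])
  show "integrable lborel (%s. |indicator {a<..<b} s * v s| )" using vi by (rule integrable_abs)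
  show "AE s in lborel. (%n. v s * bump n a b s) ----> indicator {a<..<b} s * v s"
  proof (rule AE_I2)
   fix s
   have "(%n. v s * bump n a b s) ----> v s * (if a < s & s < b then 1 else 0)"
    by (intro tendsto_intros bump_lim)
   moreover have "v s * (if a < s & s < b then 1 else 0) = indicator {a<..<b} s * v s" by (simp add: indicator_def)
   ultimately show "(%n. v s * bump n a b s) ----> indicator {a<..<b} s * v s" by (simp only:)
  qed
  fix n
  show "AE s in lborel. norm (v s * bump n a b s) <= |indicator {a<..<b} s * v s|"
  proof (rule AE_I2)
   fix s show "norm (v s * bump n a b s) <= |indicator {a<..<b} s * v s|"
    using bump_nz[of n a b s] bump_nonneg[of n a b s] bump_le_1[of n a b s]
    by (cases "s \<in> {a<..<b}") (auto simp: abs_mult mult_left_le)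
  qed
 qed measurable
 have one: "integrable lborel (%s. indicator {a<..<b} s * (1::real))" for a b :: real
  using integrable_indicator_Ioo by simp
 have mlim: "(%n. m n a b) ----> b - a" if "a <= b" for a b
  using lim[OF one[of a b]] that by (simp add: m_def)
 have Wlim: "(%n. W n a b) ----> (LINT s|lborel. indicator {a<..<b} s * w s)" if "0 < a" for a b
  unfolding W_def by (rule lim[OF loc[OF that]]) measurable
 define c where "c = (LINT s|lborel. indicator {1<..<2} s * w s)"
 have eq: "m n 1 2 * W n a b = m n a b * W n 1 2" if a: "0 < a" for n a b
 proof -
  define k where "k s = m n 1 2 * bump n a b s - m n a b * bump n 1 2 s" for s
  have i1: "integrable lborel (bump n a b)" for a b using bint[OF one[of a b], of n] by simp
  have i2: "integrable lborel (%s. w s * bump n a b s)" "integrable lborel (%s. w s * bump n 1 2 s)"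
   using bint[OF loc[OF a]] bint[OF loc[of 1 2]] by simp_all
  have "(LINT s|lborel. w s * k s) = 0"
  proof (rule z)
   show "0 < min a 1" using a by simp
   show "Sm j k" for j unfolding k_def[abs_def] by (intro Sm_diff Sm_cmult Sm_bump)
   show "k s = 0" if "s <= min a 1" for s using that bump_nz[of n a b s] bump_nz[of n 1 2 s] by (auto simp: k_def)
   show "k s = 0" if "s >= max b 2" for s using that bump_nz[of n a b s] bump_nz[of n 1 2 s] by (auto simp: k_def)
   show "(LINT s|lborel. k s) = 0" using i1[of a b] i1[of 1 2] by (simp add: k_def m_def)
  qed
  moreover have "(LINT s|lborel. w s * k s) = (LINT s|lborel. m n 1 2 * (w s * bump n a b s) - m n a b * (w s * bump n 1 2 s))"
   by (simp add: k_def right_diff_distrib mult.left_commute)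
  ultimately show ?thesis using i2 by (simp add: W_def)
 qed
 have box: "(LINT s|lborel. indicator {a<..<b} s * w s) = (b - a) * c" if a: "0 < a" "a <= b" for a b
 proof -
  have "(%n. m n 1 2 * W n a b) ----> (2 - 1) * (LINT s|lborel. indicator {a<..<b} s * w s)"
   by (intro tendsto_mult mlim Wlim) (use a in auto)
  moreover have "(%n. m n a b * W n 1 2) ----> (b - a) * c"
   unfolding c_def by (intro tendsto_mult mlim Wlim) (use a in auto)
  ultimately show ?thesis unfolding eq[OF a(1)] using LIMSEQ_unique by fastforce
 qed
 have "AE s in lborel. (ALL j::nat. indicator {1 / real (Suc j)<..} s * (w s - c) = 0)"
  unfolding AE_all_countable
 proof
  fix j :: nat
  define e where "e = 1 / real (Suc j)"
  have e: "e > 0" by (simp add: e_def)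
  have r: "indicator (box a b) s * (indicator {e<..} s * (w s - c)) = indicator {max a e<..<b} s * w s - c * indicator {max a e<..<b} s" for a b s :: real
   by (auto simp: indicator_def box_real)
  have me: "0 < max a e" for a using e by simp
  show "AE s in lborel. indicator {1 / real (Suc j)<..} s * (w s - c) = 0"
   unfolding e_def[symmetric]
  proof (rule zero_on_boxes_AE)
   show "integrable lborel (%s. indicator (box a b) s * (indicator {e<..} s * (w s - c)))" for a b :: real
    unfolding r using loc[OF me[of a], of b] integrable_indicator_Ioo by (intro Bochner_Integration.integrable_diff) auto
   show "(LINT s|lborel. indicator (box a b) s * (indicator {e<..} s * (w s - c))) = 0" for a b :: real
   proof (cases "max a e <= b")
    case True
    thus ?thesis unfolding r using loc[OF me[of a], of b] box[OF me[of a] True] integrable_indicator_Ioo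
     by (subst Bochner_Integration.integral_diff) (auto simp: algebra_simps)
   next
    case False
    hence "{max a e<..<b} = {}" by auto
    thus ?thesis unfolding r by simp
   qed
  qed measurable
 qed
 hence "AE s in lborel. s > 0 --> w s = c"
 proof eventually_elim
  case (elim s)
  show ?case
  proof
   assume "s > 0"
   then obtain j where "1 / real (Suc j) < s" using nat_approx_posE by blast
   thus "w s = c" using elim[rule_format, of j] by (simp add: indicator_def split: if_splits)
  qed
 qed
 thus ?thesis by blast
qed

lemma not_integrable_const:
 assumes "integrable R3 (%x. c)" shows "c = (0::real)"
proof (rule ccontr)
 assume c: "c ~= 0"
 have "(\<integral>\<^sup>+x. ennreal |c| \<partial>R3) < \<infinity>" using assms by (simp add: integrable_iff_bounded)
 thus False using c by (simp add: ennreal_mult_top)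
qed

text \<open>\<open>radial\<close> provides a profile without measurability. The rotation average of
  \<open>u\<close>, restricted to a ray, is a Borel profile.\<close>

lemma radial_borel_rep:
 assumes u: "u \<in> H1_rad"
 obtains k :: "real => real" where "k \<in> borel_measurable borel" "AE x in R3. u x = k ((norm x)^2)"
proof -
 have uH: "u \<in> H1" and ur: "radial u" using u by (auto simp: H1_rad_def)
 note um [measurable] = H1_borel[OF uH]
 note am [measurable] = l2_borel[OF l2_avg[OF H1_l2[OF uH]]]
 define k where "k s = avg u (sqrt |s| *\<^sub>R axis 1 1)" for s
 have "k \<in> borel_measurable borel" unfolding k_def[abs_def] by measurable
 moreover have "AE x in R3. u x = k ((norm x)^2)"
  using avg_eq_radial[OF ur um]
 proof eventually_elim
  case (elim x)
  have "avg u x = k ((norm x)^2)" unfolding k_def by (rule avg_radial) auto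
  thus ?case using elim by simp
 qed
 ultimately show ?thesis by (rule that)
qed

text \<open>The Borel profile and \<open>ev u\<close> satisfy the same identity against mean-zero
  tests, so they differ by a constant. The constant is 0, since \<open>ev u\<close> tends to 0 at
  infinity while \<open>u\<close> is square-integrable over a space of infinite volume.\<close>

theorem radial_ev:
 assumes u: "u \<in> H1_rad"
 shows "AE x in R3. u x = ev u ((norm x)^2)"
proof -
 have uH: "u \<in> H1" using u by (auto simp: H1_rad_def)
 note um [measurable] = H1_borel[OF uH]
 have em [measurable]: "ev u \<in> borel_measurable borel" by (rule ev_measurable[OF uH])
 obtain k where km [measurable]: "k \<in> borel_measurable borel" and uk: "AE x in R3. u x = k ((norm x)^2)"
  using radial_borel_rep[OF u] by metis
 have kint: "integrable lborel (%s. k s * c s)"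
  if cm [measurable]: "c \<in> borel_measurable borel" and cb: "!!s. |c s| <= B" and a: "0 < a"
   and cz: "!!s. s <= a ==> c s = 0" "!!s. s >= b ==> c s = 0" for c B a b
 proof -
  have B: "B >= 0" using cb[of 0] by linarith
  have l: "l2 (%x::real^3. c ((norm x)^2) / norm x)"
  proof (rule l2_bounded_support[where R = "sqrt |b|" and B = "B / sqrt a"])
   fix x :: "real^3"
   show "c ((norm x)^2) / norm x = 0" if "norm x > sqrt |b|"
   proof -
    have "(norm x)^2 > b" using that real_sqrt_less_iff[of "|b|" "(norm x)^2"] by simp
    thus ?thesis by (simp add: cz)
   qed
   show "norm (c ((norm x)^2) / norm x) <= B / sqrt a"
   proof (cases "(norm x)^2 <= a")
    case True
    thus ?thesis using B a by (simp add: cz)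
   next
    case False
    hence "sqrt a <= norm x" using real_sqrt_le_iff[of a "(norm x)^2"] by simp
    thus ?thesis using cb[of "(norm x)^2"] a B by (auto simp: abs_divide intro!: frac_le)
   qed
  qed measurable
  have i: "integrable R3 (%x. u x * (c ((norm x)^2) / norm x))" by (rule l2_times[OF H1_l2[OF uH] l])
  have "ennreal (2 * pi) * (\<integral>\<^sup>+s. ennreal |k s * c s| \<partial>lborel) = (\<integral>\<^sup>+x. ennreal (1 / norm x) * ennreal |k ((norm x)^2) * c ((norm x)^2)| \<partial>R3)"
   by (rule polar_weighted_nn[symmetric]) (use a in \<open>auto simp: cz\<close>)
  also have "... = (\<integral>\<^sup>+x. ennreal (norm (u x * (c ((norm x)^2) / norm x))) \<partial>R3)"
  proof (rule nn_integral_cong_AE)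
   show "AE x in R3. ennreal (1 / norm x) * ennreal |k ((norm x)^2) * c ((norm x)^2)| = ennreal (norm (u x * (c ((norm x)^2) / norm x)))"
    using uk by eventually_elim (simp add: abs_mult abs_divide flip: ennreal_mult'')
  qed
  also have "... < \<infinity>" using i by (simp add: integrable_iff_bounded)
  finally have "(\<integral>\<^sup>+s. ennreal |k s * c s| \<partial>lborel) < \<infinity>" by (auto simp: ennreal_mult_less_top)
  thus ?thesis by (intro integrableI_bounded) auto
 qed
 have "EX c. AE s in lborel. s > 0 --> k s - ev u s = c"
 proof (rule zero_mean_tests)
  show "integrable lborel (%s. indicator {a<..<b} s * (k s - ev u s))" if a: "0 < a" for a b :: real
  proof -
   have "integrable lborel (%s. k s * indicator {a<..<b} s)"
    by (rule kint[OF _ _ a, where B = 1 and b = b]) (auto simp: indicator_def)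
   moreover have "integrable lborel (%s. indicator {a<..<b} s * ev u s)"
    by (rule ev_fubini(1)[OF uH a integrable_indicator_Ioo]) auto
   ultimately show ?thesis using Bochner_Integration.integrable_diff by (force simp: right_diff_distrib mult.commute)
  qed
  fix q and a b :: real assume a: "0 < a" and sm: "!!n. Sm n q" and z: "!!s. s <= a ==> q s = 0" "!!s. s >= b ==> q s = 0"
   and mean: "(LINT s|lborel. q s) = 0"
  have qc: "continuous_on UNIV q" by (rule Sm_continuous[OF sm])
  have qm [measurable]: "q \<in> borel_measurable borel" by (rule borel_measurable_continuous_onI[OF qc])
  have "compact (q ` {a..b})" by (intro compact_continuous_image continuous_on_subset[OF qc]) auto
  then obtain B where B: "!!s. s \<in> {a..b} ==> |q s| <= B" using compact_imp_bounded[of "q ` {a..b}"] unfolding bounded_iff by (metis imageI real_norm_def)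
  have qb: "|q s| <= |B|" for s
   using B[of s] z[of s] by (cases "s \<in> {a..b}") auto
  have qi: "integrable lborel q"
  proof -
   have "integrable lborel (%s. indicator {a..b} s *\<^sub>R q s)"
    using borel_integrable_atLeastAtMost'[OF continuous_on_subset[OF qc], of a b] by (simp add: set_integrable_def)
   moreover have "indicator {a..b} s *\<^sub>R q s = q s" for s using z[of s] by (cases "s \<in> {a..b}") auto
   ultimately show ?thesis by (simp only:)
  qed
  have kq: "integrable lborel (%s. k s * q s)" by (rule kint[OF qm qb a z])
  have kq0: "k s * q s = 0" if "s <= 0" for s using z(1)[of s] that a by simp
  have "(LINT x|R3. u x * (q ((norm x)^2) / norm x)) = (LINT x|R3. k ((norm x)^2) * q ((norm x)^2) / norm x)"
   by (rule integral_cong_AE) (use uk in \<open>auto elim!: eventually_mono\<close>)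
  also have "... = 2 * pi * (LINT s|lborel. k s * q s)"
   by (rule polar_weighted(2)[of "%s. k s * q s", OF kq kq0])
  finally have "2 * (2 * pi * (LINT s|lborel. k s * q s)) = 4 * pi * (LINT s|lborel. q s * ev u s)"
   using radial_test_identity[OF uH a sm z mean] ev_fubini(2)[OF uH a qi z(1)] by simp
  hence "(LINT s|lborel. k s * q s) = (LINT s|lborel. q s * ev u s)" by simp
  thus "(LINT s|lborel. (k s - ev u s) * q s) = 0"
   using kq ev_fubini(1)[OF uH a qi z(1)] by (simp add: left_diff_distrib mult.commute[of "ev u _"])
 qed measurable
 then obtain c where "AE s in lborel. s > 0 --> k s - ev u s = c" by blast
 from AE_norm_sq[OF this] have ae: "AE x in R3. u x - ev u ((norm x)^2) = c"
  using uk by eventually_elim simp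
 have "c = 0"
 proof (rule ccontr)
  assume c: "c ~= 0"
  define N where "N = sqrt (n2 (grad u))"
  have N: "N >= 0" by (simp add: N_def n2_nonneg)
  \<comment> \<open>Beyond this radius the decay bound for \<open>ev u\<close> is at most |c|/2, so
    |u| is at least |c|/2 there.\<close>
  define r where "r = (2 * N / |c| + 1)^2"
  have r1: "r >= 1" using N c by (simp add: r_def)
  have far: "(c / 2)^2 <= (u x)^2" if e: "u x - ev u ((norm x)^2) = c" and x: "norm x > r" for x
  proof -
   have x0: "norm x > 0" using x r1 by linarith
   have sq: "2 * N / |c| + 1 <= sqrt (norm x)"
    using x N c by (intro real_le_rsqrt) (auto simp: r_def)
   have "|ev u ((norm x)^2)| <= N / sqrt (norm x)"
    using ev_bound[OF uH, of "(norm x)^2"] x0 by (simp add: N_def)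
   also have "... <= N / (2 * N / |c| + 1)"
    using sq N c by (intro frac_le) (auto intro: add_nonneg_pos)
   also have "... <= |c| / 2" using N c by (simp add: field_simps)
   finally have "|c / 2| <= |u x|" using e by (auto simp: abs_if split: if_splits)
   thus ?thesis by (simp only: abs_le_square_iff)
  qed
  have "integrable R3 (%x. (c / 2)^2)"
  proof (rule L1_bound)
   show "integrable R3 (%x. (c / 2)^2 * indicator (cball 0 r) x + (norm (u x))^2)"
    using l2_integrable[OF H1_l2[OF uH]] by (intro Bochner_Integration.integrable_add) auto
   show "AE x in R3. norm ((c / 2)^2) <= norm ((c / 2)^2 * indicator (cball 0 r) x + (norm (u x))^2)"
    using ae
   proof eventually_elim
    case (elim x)
    thus ?case using far[OF elim] by (cases "norm x <= r") auto
   qed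
  qed simp
  thus False using not_integrable_const[of "(c / 2)^2"] c by simp
 qed
 thus ?thesis using ae by simp
qed

lemma radial_decay:
 assumes u: "u \<in> H1_rad"
 shows "AE x in R3. |u x| <= sqrt (n2 (grad u)) / sqrt (norm x)"
proof -
 have uH: "u \<in> H1" using u by (auto simp: H1_rad_def)
 have "AE x in R3. x ~= 0" using AE_lborel_singleton by blast
 thus ?thesis using radial_ev[OF u]
 proof eventually_elim
  case (elim x)
  thus ?case using ev_bound[OF uH, of "(norm x)^2"] by simp
 qed
qed

section \<open>Tight families\<close>

text \<open>The two consequences of a bound in \<open>H1_rad\<close> that the integral estimates
  use. Unlike the bound itself, they pass to moduli and to any dominated measurable
  function.\<close>

definition rb :: "real => (real^3 => real) => bool" where
 "rb R b \<longleftrightarrow> l2 b & n2 b <= R^2 & (AE x in R3. |b x| <= R / sqrt (norm x))"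

lemma rb_l2: "rb R b ==> l2 b" by (simp add: rb_def)

lemma rb_measurable [measurable_dest]: "rb R b ==> b \<in> borel_measurable lborel"
 by (rule l2_measurable[OF rb_l2])

lemma rb_borel: "rb R b ==> b \<in> borel_measurable borel"
 by (rule l2_borel[OF rb_l2])

lemma rb_decay: "rb R b ==> AE x in R3. |b x| <= R / sqrt (norm x)" by (simp add: rb_def)

lemma rb_prod:
 assumes "rb R b" "rb S w" "0 <= R" "0 <= S"
 shows "integrable R3 (%x. |b x| * |w x| )" "(LINT x|R3. |b x| * |w x| ) <= R * S"
proof -
 show "integrable R3 (%x. |b x| * |w x| )" using l2_norm_prod[OF rb_l2[OF assms(1)] rb_l2[OF assms(2)]] by simp
 have "sqrt (n2 b) <= R" "sqrt (n2 w) <= S" using assms by (auto simp: rb_def intro: real_le_lsqrt n2_nonneg)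
 hence "sqrt (n2 b) * sqrt (n2 w) <= R * S" using assms by (intro mult_mono) (auto simp: n2_nonneg)
 thus "(LINT x|R3. |b x| * |w x| ) <= R * S"
  using cauchy_schwarz_norm[OF rb_l2[OF assms(1)] rb_l2[OF assms(2)]] by simp
qed

lemma rb_mono:
 assumes "rb R b" "0 <= R" "R <= S"
 shows "rb S b"
proof -
 have "R^2 <= S^2" using assms by (intro power_mono) auto
 moreover have "AE x in R3. |b x| <= S / sqrt (norm x)"
  using rb_decay[OF assms(1)]
 proof eventually_elim
  case (elim x)
  have "R / sqrt (norm x) <= S / sqrt (norm x)" using assms by (intro divide_right_mono) auto
  thus ?case using elim by linarith
 qed
 ultimately show ?thesis using assms(1) by (simp add: rb_def)
qed

lemma rb_dominated:
 assumes b: "rb R b" and cm: "c \<in> borel_measurable lborel" and le: "AE x in R3. |c x| <= |b x|"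
 shows "rb R c"
proof -
 have ib: "integrable R3 (%x. (norm (b x))^2)" by (rule l2_integrable[OF rb_l2[OF b]])
 have sq: "AE x in R3. (norm (c x))^2 <= (norm (b x))^2"
  using le by eventually_elim (simp add: abs_le_square_iff)
 have ic: "integrable R3 (%x. (norm (c x))^2)"
  by (rule L1_bound[OF ib]) (use cm sq in auto)
 have "n2 c <= n2 b" unfolding n2_def by (rule integral_mono_AE[OF ic ib sq])
 moreover have "AE x in R3. |c x| <= R / sqrt (norm x)"
  using le rb_decay[OF b] by eventually_elim simp
 ultimately show ?thesis using b ic cm by (simp add: rb_def l2_def)
qed

lemma rb_abs_add:
 assumes b: "rb R b" and w: "rb S w" and RS: "0 <= R" "0 <= S"
 shows "rb (R + S) (%x. |b x| + |w x| )"
proof -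
 note m [measurable] = rb_borel[OF b] rb_borel[OF w]
 have ib: "integrable R3 (%x. (norm (b x))^2)" "integrable R3 (%x. (norm (w x))^2)"
  using l2_integrable rb_l2 b w by blast+
 note ip = rb_prod[OF b w RS]
 have eq: "(norm ( |b x| + |w x| ))^2 = (norm (b x))^2 + 2 * ( |b x| * |w x| ) + (norm (w x))^2" for x
  by (simp add: power2_eq_square algebra_simps abs_mult)
 have l: "l2 (%x. |b x| + |w x| )" unfolding l2_def eq using ib ip(1) by simp
 have "n2 (%x. |b x| + |w x| ) = n2 b + 2 * (LINT x|R3. |b x| * |w x| ) + n2 w"
  unfolding n2_def eq using ib ip(1) by simp
 also have "... <= R^2 + 2 * (R * S) + S^2" using ip(2) b w by (simp add: rb_def)
 also have "... = (R + S)^2" by (simp add: power2_sum)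
 finally have "n2 (%x. |b x| + |w x| ) <= (R + S)^2" .
 moreover have "AE x in R3. | |b x| + |w x| | <= (R + S) / sqrt (norm x)"
  using rb_decay[OF b] rb_decay[OF w] by eventually_elim (simp add: add_divide_distrib)
 ultimately show ?thesis using l by (simp add: rb_def)
qed

text \<open>Families of coefficients \<open>c\<close> for which the pairing \<open>\<integral>c w\<close> with radial functions \<open>w\<close> is,
 up to a small error, concentrated on an annulus; the decay of radial functions makes this work without
 the Sobolev embedding.\<close>

definition tight_at :: "(real^3 => real) set => real => real => real => real => bool" where
 "tight_at C e r R K \<longleftrightarrow> (ALL c:C.
   (AE x in R3. r <= norm x & norm x <= R --> |c x| <= K) &
   (ALL S w. 0 <= S --> rb S w --> integrable R3 (%x. |c x * w x| ) &
     (LINT x|R3. indicator {x. norm x < r \<or> R < norm x} x * |c x * w x| ) <= e * S))"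

definition tight :: "(real^3 => real) set => bool" where
 "tight C \<longleftrightarrow> (ALL c:C. c \<in> borel_measurable borel) &
  (ALL e>0. EX r R K. 0 < r & r < R & 0 <= K & tight_at C e r R K)"

lemma small_ball:
 assumes c: "c < (3::real)" and e: "e > 0"
 obtains r where "0 < r" "r < 1" "integrable R3 (%x. indicator {x. norm x < r} x * norm x powr (- c))"
  "(LINT x|R3. indicator {x. norm x < r} x * norm x powr (- c)) <= e"
proof -
 define r where "r n = 1 / (real n + 2)" for n
 have r: "0 < r n" "r n < 1" for n by (simp_all add: r_def)
 let ?g = "%x::real^3. indicator {x. norm x < 1} x * norm x powr (- c)"
 have le: "norm (indicator {x. norm x < r n} x * norm x powr (- c)) <= ?g x" for n x
  using r(2)[of n] by (auto simp: indicator_def)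
 have i: "integrable R3 (%x. indicator {x. norm x < r n} x * norm x powr (- c))" for n
  by (rule L1_bound[OF ball_power_integrable[OF c]])
   (measurable, rule AE_I2, rule order_trans[OF le], simp)
 have rl: "r ----> 0" unfolding r_def by real_asymp
 have "(%n. LINT x|R3. indicator {x. norm x < r n} x * norm x powr (- c)) ----> (LINT x|R3. 0)"
 proof (rule integral_dominated_convergence[where w = ?g])
  show "integrable R3 ?g" by (rule ball_power_integrable[OF c])
  show "AE x in R3. (%n. indicator {x. norm x < r n} x * norm x powr (- c)) ----> 0"
  proof (rule AE_I2)
   fix x :: "real^3"
   show "(%n. indicator {x. norm x < r n} x * norm x powr (- c)) ----> 0"
   proof (cases "x = 0")
    case False
    hence "eventually (%n. r n < norm x) sequentially" using order_tendstoD(2)[OF rl] by simp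
    hence "eventually (%n. indicator {x. norm x < r n} x * norm x powr (- c) = 0) sequentially"
     by eventually_elim simp
    thus ?thesis by (rule tendsto_eventually)
   qed simp
  qed
  show "AE x in R3. norm (indicator {x. norm x < r n} x * norm x powr (- c)) <= ?g x" for n
   by (rule AE_I2) (rule le)
 qed measurable
 hence "eventually (%n. (LINT x|R3. indicator {x. norm x < r n} x * norm x powr (- c)) < e) sequentially"
  using order_tendstoD(2)[of _ 0 sequentially e] e by simp
 then obtain n where "(LINT x|R3. indicator {x. norm x < r n} x * norm x powr (- c)) < e"
  by (auto simp: eventually_sequentially)
 thus ?thesis using that[of "r n"] r i by simp
qed

text \<open>Near the origin the bound on \<open>c\<close> times the decay |x|^(-1/2) of
  \<open>w\<close> gives |x|^(-a), integrable for a < 3. Far out, \<open>c\<close> is a small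
  multiple of a function bounded in L2, and Cauchy-Schwarz applies. On the annulus left over,
  boundedness is all that is asked.\<close>

lemma tightI:
 assumes m: "!!c. c \<in> C ==> c \<in> borel_measurable borel"
  and R0: "0 <= R0" and a: "a < 3" and D: "0 <= D"
  and near: "!!c. c \<in> C ==> AE x in R3. norm x < 1 --> |c x| <= D * norm x powr (1/2 - a)"
  and far: "!!e. e > 0 ==> EX R. ALL c:C. EX b. rb R0 b & (AE x in R3. R < norm x --> |c x| <= e * |b x| )"
  and mid: "!!r. r > 0 ==> EX K>=0. ALL c:C. AE x in R3. r <= norm x --> |c x| <= K"
 shows "tight C"
 unfolding tight_def
proof (intro conjI ballI allI impI)
 show "c \<in> borel_measurable borel" if "c \<in> C" for c by (rule m[OF that])
 fix e :: real assume e: "e > 0"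
 obtain r where r: "0 < r" "r < 1" and ri: "integrable R3 (%x. indicator {x. norm x < r} x * norm x powr (- a))"
  and rJ: "(LINT x|R3. indicator {x. norm x < r} x * norm x powr (- a)) <= e / (2 * (D + 1))"
  using small_ball[OF a, of "e / (2 * (D + 1))"] e D by auto
 define e' where "e' = e / (2 * (R0 + 1))"
 have e': "e' > 0" using e R0 by (simp add: e'_def)
 obtain R1 where R1: "!!c. c \<in> C ==> EX b. rb R0 b & (AE x in R3. R1 < norm x --> |c x| <= e' * |b x| )"
  using far[OF e'] by blast
 obtain K where K: "K >= 0" "!!c. c \<in> C ==> AE x in R3. r <= norm x --> |c x| <= K"
  using mid[OF r(1)] by blast
 define R where "R = max R1 1"
 have R: "r < R" "R1 <= R" using r by (auto simp: R_def)
 have ae0: "AE x in R3. x ~= 0" using AE_lborel_singleton by blast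
 have "integrable R3 (%x. |c x * w x| ) &
   (LINT x|R3. indicator {x. norm x < r \<or> R < norm x} x * |c x * w x| ) <= e * S"
  if c: "c \<in> C" and S: "0 <= S" and w: "rb S w" for c S w
 proof -
  note [measurable] = m[OF c] rb_borel[OF w]
  obtain b where b: "rb R0 b" "AE x in R3. R1 < norm x --> |c x| <= e' * |b x|" using R1[OF c] by blast
  note [measurable] = rb_borel[OF b(1)]
  define H where "H x = D * S * (indicator {x. norm x < r} x * norm x powr (- a)) + e' * ( |b x| * |w x| )" for x :: "real^3"
  have H0: "H x >= 0" for x using D S e' by (simp add: H_def)
  note bw = rb_prod[OF b(1) w R0 S]
  have Hi: "integrable R3 H" unfolding H_def[abs_def] using ri bw(1) by simp
  have "(LINT x|R3. H x) = D * S * (LINT x|R3. indicator {x. norm x < r} x * norm x powr (- a)) + e' * (LINT x|R3. |b x| * |w x| )"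
   unfolding H_def using ri bw(1) by simp
  also have "... <= D * S * (e / (2 * (D + 1))) + e' * (R0 * S)"
   using rJ bw(2) D S e' by (intro add_mono mult_left_mono) auto
  also have "... <= e * S"
  proof -
   have "D * (e / (2 * (D + 1))) <= e / 2" using D e by (simp add: field_simps)
   moreover have "e' * R0 <= e / 2" using R0 e by (simp add: e'_def field_simps)
   ultimately have "D * (e / (2 * (D + 1))) + e' * R0 <= e" by linarith
   from mult_right_mono[OF this S] have "(D * (e / (2 * (D + 1))) + e' * R0) * S <= e * S" .
   thus ?thesis by (simp add: algebra_simps)
  qed
  finally have Hle: "(LINT x|R3. H x) <= e * S" .
  have out: "AE x in R3. norm x < r \<or> R < norm x --> |c x * w x| <= H x"
   using ae0 near[OF c] b(2) rb_decay[OF w]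
  proof eventually_elim
   case (elim x)
   show ?case
   proof (intro impI)
    assume o: "norm x < r \<or> R < norm x"
    show "|c x * w x| <= H x"
    proof (cases "norm x < r")
     case True
     have ws: "|w x| <= S * norm x powr (-1/2)"
      using elim by (simp add: powr_minus_divide powr_half_sqrt)
     have "|c x| * |w x| <= (D * norm x powr (1/2 - a)) * (S * norm x powr (-1/2))"
      using elim True r D ws by (intro mult_mono) auto
     also have "... = D * S * (norm x powr (1/2 - a) * norm x powr (-1/2))" by simp
     also have "norm x powr (1/2 - a) * norm x powr (-1/2) = norm x powr (- a)"
      by (simp flip: powr_add)
     finally have "|c x * w x| <= D * S * norm x powr (- a)" by (simp add: abs_mult)
     thus ?thesis using True e' by (simp add: H_def add_increasing2)
    next
     case False
     hence "|c x| <= e' * |b x|" using o R elim by auto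
     from mult_right_mono[OF this, of "|w x|"] show ?thesis using D S by (simp add: H_def abs_mult mult.assoc add_increasing)
    qed
   qed
  qed
  define k where "k = K * (S / sqrt r)"
  have k0: "k >= 0" using K S r by (simp add: k_def)
  have all: "AE x in R3. |c x * w x| <= H x + k * indicator (cball 0 R) x"
   using out K(2)[OF c] rb_decay[OF w]
  proof eventually_elim
   case (elim x)
   show ?case
   proof (cases "norm x < r \<or> R < norm x")
    case True
    thus ?thesis using elim(1) k0 by (simp add: add_increasing2)
   next
    case False
    have "S / sqrt (norm x) <= S / sqrt r" using False r S by (intro frac_le) auto
    hence "|w x| <= S / sqrt r" using elim by linarith
    hence "|c x| * |w x| <= k" unfolding k_def using elim False K by (intro mult_mono) auto
    thus ?thesis using False H0[of x] by (simp add: abs_mult)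
   qed
  qed
  have i: "integrable R3 (%x. |c x * w x| )"
  proof (rule L1_bound)
   show "integrable R3 (%x. H x + k * indicator (cball 0 R) x)" using Hi by simp
   show "AE x in R3. norm |c x * w x| <= norm (H x + k * indicator (cball 0 R) x)"
    using all by eventually_elim simp
  qed measurable
  have io: "integrable R3 (%x. indicator {x. norm x < r \<or> R < norm x} x * |c x * w x| )"
   by (rule L1_bound[OF i]) (auto simp: indicator_def)
  have "(LINT x|R3. indicator {x. norm x < r \<or> R < norm x} x * |c x * w x| ) <= (LINT x|R3. H x)"
   by (rule integral_mono_AE[OF io Hi]) (use out H0 in \<open>auto simp: indicator_def elim!: eventually_mono\<close>)
  thus ?thesis using Hle i by simp
 qed
 moreover have "AE x in R3. r <= norm x & norm x <= R --> |c x| <= K" if "c \<in> C" for c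
  using K(2)[OF that] by eventually_elim simp
 ultimately show "EX r R K. 0 < r & r < R & 0 <= K & tight_at C e r R K"
  unfolding tight_at_def using r(1) R(1) K(1) by (intro exI[of _ r] exI[of _ R] exI[of _ K] conjI ballI allI impI) auto
qed

lemma primitive_deriv:
 assumes g: "continuous_on UNIV g"
 shows "(primitive g has_real_derivative g t) (at t)"
proof -
 define M where "M = |t| + 1"
 have "((%u. LBINT y=ereal 0..ereal u. g y) has_vector_derivative (g t)) (at t within {-M..M})"
  by (rule interval_integral_FTC2) (auto simp: M_def intro: continuous_on_subset[OF g])
 hence "(primitive g has_real_derivative g t) (at t within {-M..M})"
  by (simp add: has_real_derivative_iff_has_vector_derivative primitive_def[abs_def])
 moreover have "at t within {-M..M} = at t" by (rule at_within_Icc_at) (auto simp: M_def)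
 ultimately show ?thesis by simp
qed

lemma annulus_split:
 fixes c w :: "real^3 => real"
 assumes i: "integrable R3 (%x. |c x * w x| )"
  and out: "(LINT x|R3. indicator {x. norm x < r \<or> R < norm x} x * |c x * w x| ) <= E"
  and k: "AE x in R3. r <= norm x & norm x <= R --> |c x| <= k" "0 <= k"
  and l: "AE x in R3. r <= norm x & norm x <= R --> |w x| <= l" "0 <= l"
 shows "(LINT x|R3. |c x * w x| ) <= E + k * l * measure lborel (cball (0::real^3) R)"
proof -
 let ?O = "%x. indicator {x. norm x < r \<or> R < norm x} x * |c x * w x|"
 note m [measurable] = int_borel[OF i]
 have io: "integrable R3 ?O"
  by (rule L1_bound[OF i]) (measurable, auto simp: indicator_def)
 have "(LINT x|R3. |c x * w x| ) <= (LINT x|R3. ?O x + k * l * indicator (cball 0 R) x)"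
 proof (rule integral_mono_AE[OF i])
  show "integrable R3 (%x. ?O x + k * l * indicator (cball 0 R) x)" using io by simp
  show "AE x in R3. |c x * w x| <= ?O x + k * l * indicator (cball 0 R) x"
   using k(1) l(1)
  proof eventually_elim
   case (elim x)
   show ?case
   proof (cases "norm x < r \<or> R < norm x")
    case True
    thus ?thesis using k l by simp
   next
    case False
    hence "|c x| * |w x| <= k * l" using elim k l by (intro mult_mono) auto
    thus ?thesis using False by (simp add: abs_mult)
   qed
  qed
 qed
 also have "... = (LINT x|R3. ?O x) + k * l * measure lborel (cball (0::real^3) R)"
  using io by simp
 finally show ?thesis using out by simp
qed

lemma tightE:
 assumes "tight C" "e > 0"
 obtains r R K where "0 < r" "r < R" "0 <= K"
  "!!c. c \<in> C ==> AE x in R3. r <= norm x & norm x <= R --> |c x| <= K"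
  "!!c S w. c \<in> C ==> 0 <= S ==> rb S w ==> integrable R3 (%x. |c x * w x| )"
  "!!c S w. c \<in> C ==> 0 <= S ==> rb S w ==>
   (LINT x|R3. indicator {x. norm x < r \<or> R < norm x} x * |c x * w x| ) <= e * S"
proof -
 from assms(1)[unfolded tight_def, THEN conjunct2, rule_format, OF assms(2)]
 obtain r R K where *: "0 < r" "r < R" "0 <= K" "tight_at C e r R K"
  by (elim exE conjE)
 show ?thesis by (rule that[OF *(1-3)]) (use *(4) in \<open>auto simp: tight_at_def\<close>)
qed

lemma tight_measurable: "tight C ==> c \<in> C ==> c \<in> borel_measurable borel"
 by (simp add: tight_def)

lemma tight_integrable:
 assumes "tight C" "c \<in> C" "rb S w" "0 <= S"
 shows "integrable R3 (%x. c x * w x)"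
proof -
 have i: "integrable R3 (%x. |c x * w x| )" using tightE[OF assms(1) zero_less_one] assms(2-4) by metis
 note [measurable] = tight_measurable[OF assms(1,2)] rb_borel[OF assms(3)]
 have "(%x. c x * w x) \<in> borel_measurable R3" by measurable
 thus ?thesis using i by (simp add: integrable_abs_iff)
qed

lemma rb_annulus:
 assumes w: "rb S w" and r: "0 < r" and S: "0 <= S"
 shows "AE x in R3. r <= norm x & norm x <= R --> |w x| <= S / sqrt r"
 using rb_decay[OF w]
proof eventually_elim
 case (elim x)
 show ?case
 proof
  assume x: "r <= norm x & norm x <= R"
  have "S / sqrt (norm x) <= S / sqrt r" using x r S by (intro frac_le) auto
  thus "|w x| <= S / sqrt r" using elim by linarith
 qed
qed

lemma tight_bound:
 assumes C: "tight C"
 obtains K where "K >= 0" "!!c S w. c \<in> C ==> 0 <= S ==> rb S w ==> (LINT x|R3. |c x * w x| ) <= K * S"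
proof -
 obtain r R K where r: "0 < r" "r < R" "0 <= K"
  and a: "!!c. c \<in> C ==> AE x in R3. r <= norm x & norm x <= R --> |c x| <= K"
  and b: "!!c S w. c \<in> C ==> 0 <= S ==> rb S w ==> integrable R3 (%x. |c x * w x| )"
   "!!c S w. c \<in> C ==> 0 <= S ==> rb S w ==>
     (LINT x|R3. indicator {x. norm x < r \<or> R < norm x} x * |c x * w x| ) <= 1 * S"
  using tightE[OF C zero_less_one] by blast
 define V where "V = measure lborel (cball (0::real^3) R)"
 show ?thesis
 proof (rule that)
  show "0 <= 1 + K * (1 / sqrt r) * V" using r by (simp add: V_def)
  fix c S w assume c: "c \<in> C" and S: "(0::real) <= S" and w: "rb S w"
  have "(LINT x|R3. |c x * w x| ) <= 1 * S + K * (S / sqrt r) * V"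
   unfolding V_def using r S
   by (intro annulus_split[OF b(1)[OF c S w] b(2)[OF c S w] a[OF c] _ rb_annulus[OF w r(1) S]]) auto
  also have "... = (1 + K * (1 / sqrt r) * V) * S" by (simp add: algebra_simps)
  finally show "(LINT x|R3. |c x * w x| ) <= (1 + K * (1 / sqrt r) * V) * S" .
 qed
qed

text \<open>Compactness in the test function: smallness of \<open>w\<close> on one annulus makes all
  pairings small. It serves for extracting subsequences, for the finite lists of functionals and for
  the convergence of averages.\<close>

lemma tight_small_w:
 assumes C: "tight C" and e: "e > 0" and S: "0 <= S"
 obtains r R d where "0 < r" "r < R" "0 < d"
  "!!c w. c \<in> C ==> rb S w ==> (AE x in R3. r <= norm x & norm x <= R --> |w x| <= d) ==> (LINT x|R3. |c x * w x| ) <= e"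
proof -
 have e2: "e / (2 * (S + 1)) > 0" using e S by simp
 obtain r R K where r: "0 < r" "r < R" "0 <= K"
  and a: "!!c. c \<in> C ==> AE x in R3. r <= norm x & norm x <= R --> |c x| <= K"
  and b: "!!c S w. c \<in> C ==> 0 <= S ==> rb S w ==> integrable R3 (%x. |c x * w x| )"
   "!!c T w. c \<in> C ==> 0 <= T ==> rb T w ==>
     (LINT x|R3. indicator {x. norm x < r \<or> R < norm x} x * |c x * w x| ) <= e / (2 * (S + 1)) * T"
  using tightE[OF C e2] by blast
 define V where "V = measure lborel (cball (0::real^3) R)"
 have V: "V >= 0" by (simp add: V_def)
 define d where "d = e / (2 * (K * V + 1))"
 have "K * V + 1 > 0" using r V by (intro add_nonneg_pos) auto
 hence d: "d > 0" using e by (simp add: d_def)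
 show ?thesis
 proof (rule that[OF r(1,2) d])
  fix c w assume c: "c \<in> C" and w: "rb S w" and l: "AE x in R3. r <= norm x & norm x <= R --> |w x| <= d"
  have "(LINT x|R3. |c x * w x| ) <= e / (2 * (S + 1)) * S + K * d * V"
   unfolding V_def using r d by (intro annulus_split[OF b(1)[OF c S w] b(2)[OF c S w] a[OF c] _ l]) auto
  also have "... <= e / 2 + e / 2"
  proof (rule add_mono)
   show "e / (2 * (S + 1)) * S <= e / 2" using S e by (simp add: field_simps)
   have "K * V / (K * V + 1) <= 1" using \<open>K * V + 1 > 0\<close> by (subst pos_divide_le_eq) auto
   hence "e / 2 * (K * V / (K * V + 1)) <= e / 2 * 1" using e by (intro mult_left_mono) auto
   thus "K * d * V <= e / 2" by (simp add: d_def mult.commute mult.left_commute)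
  qed
  finally show "(LINT x|R3. |c x * w x| ) <= e" by simp
 qed
qed

text \<open>The dual form, uniform in \<open>w\<close>: it bounds differences of derivatives in the
  dual norm once the coefficients are close on an annulus.\<close>

lemma tight_small_c:
 assumes C: "tight C" and e: "e > 0"
 obtains r R d where "0 < r" "r < R" "0 < d"
  "!!c S w. c \<in> C ==> (AE x in R3. r <= norm x & norm x <= R --> |c x| <= d) ==> 0 <= S ==> rb S w ==>
   (LINT x|R3. |c x * w x| ) <= e * S"
proof -
 have e2: "e / 2 > 0" using e by simp
 obtain r R K where r: "0 < r" "r < R" "0 <= K"
  and "!!c. c \<in> C ==> AE x in R3. r <= norm x & norm x <= R --> |c x| <= K"
  and b: "!!c S w. c \<in> C ==> 0 <= S ==> rb S w ==> integrable R3 (%x. |c x * w x| )"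
   "!!c S w. c \<in> C ==> 0 <= S ==> rb S w ==>
     (LINT x|R3. indicator {x. norm x < r \<or> R < norm x} x * |c x * w x| ) <= e / 2 * S"
  using tightE[OF C e2] by blast
 define V where "V = measure lborel (cball (0::real^3) R)"
 have V: "V >= 0" by (simp add: V_def)
 define d where "d = e * sqrt r / (2 * (V + 1))"
 have d: "d > 0" using e r V by (simp add: d_def add_nonneg_pos)
 show ?thesis
 proof (rule that[OF r(1,2) d])
  fix c S w assume c: "c \<in> C" and l: "AE x in R3. r <= norm x & norm x <= R --> |c x| <= d" and S: "0 <= S" and w: "rb S w"
  have "(LINT x|R3. |c x * w x| ) <= e / 2 * S + d * (S / sqrt r) * V"
   unfolding V_def using r d S by (intro annulus_split[OF b(1)[OF c S w] b(2)[OF c S w] l _ rb_annulus[OF w r(1) S]]) auto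
  also have "d * (S / sqrt r) * V = e / 2 * S * (V / (V + 1))" using r by (simp add: d_def)
  also have "... <= e / 2 * S * 1" using V e S by (intro mult_left_mono) auto
  finally show "(LINT x|R3. |c x * w x| ) <= e * S" by (simp add: mult.commute)
 qed
qed

section \<open>The local nonlinearity\<close>

locale nonlinearity =
 fixes f :: "real => real"
 assumes f_cont: "continuous_on UNIV f"
  and f_odd: "f (- t) = - f t"
  and f_nonneg: "t >= 0 ==> f t >= 0"
  and f_growth: "EX q. 2 < q & q < 6 & ((%t. f t / t powr (q - 1)) \<longlongrightarrow> 0) at_top"
  and f_zero: "((%t. f t / t) \<longlongrightarrow> 0) (at 0)"
begin

lemma f_0 [simp]: "f 0 = 0"
 using f_odd[of 0] by simp

lemma f_abs: "|f t| = f |t|"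
 using f_nonneg[of t] f_nonneg[of "- t"] f_odd[of t] by (cases "t >= 0") auto

lemma f_measurable [measurable]: "f \<in> borel_measurable borel"
 by (rule borel_measurable_continuous_onI[OF f_cont])

lemma f_small:
 assumes "e > 0"
 obtains d where "d > 0" "!!t. |t| <= d ==> |f t| <= e * |t|"
proof -
 have "eventually (%t. dist (f t / t) 0 < e) (at 0)" using f_zero assms by (rule tendstoD)
 then obtain d where d: "d > 0" "!!t. t ~= 0 ==> |t| < d ==> |f t / t| < e"
  by (auto simp: eventually_at dist_norm)
 show ?thesis
 proof (rule that[of "d / 2"])
  show "d / 2 > 0" using d by simp
  fix t :: real assume t: "|t| <= d / 2"
  show "|f t| <= e * |t|"
  proof (cases "t = 0")
   case False
   hence "|f t / t| < e" using d t by auto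
   thus ?thesis using False by (simp add: abs_divide divide_less_eq)
  qed simp
 qed
qed

lemma f_bounded_on:
 obtains K where "K >= 0" "!!t. |t| <= T ==> |f t| <= K"
proof -
 have "compact (f ` {-T..T})" by (intro compact_continuous_image continuous_on_subset[OF f_cont]) auto
 then obtain K where K: "ALL y:f ` {-T..T}. norm y <= K" using compact_imp_bounded bounded_iff by metis
 show ?thesis
 proof (rule that[of "|K|"])
  fix t assume "|t| <= T"
  hence "t \<in> {-T..T}" by auto
  hence "|f t| <= K" using K by auto
  thus "|f t| <= |K|" by simp
 qed simp
qed

lemma f_growth_bound:
 obtains C p where "0 <= C" "1 <= p" "p < 5" "!!t. |f t| <= C * ( |t| + |t| powr p)"
proof -
 obtain q where q: "2 < q" "q < 6" "((%t. f t / t powr (q - 1)) \<longlongrightarrow> 0) at_top" using f_growth by blast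
 have "eventually (%t. dist (f t / t powr (q - 1)) 0 < 1) at_top" by (rule tendstoD[OF q(3)]) simp
 then obtain T where T: "!!t. t >= T ==> |f t / t powr (q - 1)| < 1"
  by (auto simp: eventually_at_top_linorder)
 define T' where "T' = max T 1"
 have far: "|f t| <= t powr (q - 1)" if "t >= T'" for t
  using T[of t] that by (simp add: T'_def abs_divide divide_less_eq)
 obtain d where d: "d > 0" "!!t. |t| <= d ==> |f t| <= 1 * |t|" using f_small[OF zero_less_one] by blast
 obtain K where K: "K >= 0" "!!t. |t| <= T' ==> |f t| <= K" using f_bounded_on by blast
 \<comment> \<open>K / d absorbs the middle range d < t <= T', where \<open>f\<close> is only known
   to be bounded by \<open>K\<close>; the 1 serves both ends.\<close>
 define C where "C = 1 + K / d"
 have C: "C >= 1" using K d by (simp add: C_def)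
 have pos: "|f t| <= C * (t + t powr (q - 1))" if t: "t >= 0" for t
 proof -
  have n: "t >= 0" "t powr (q - 1) >= 0" using t by simp_all
  consider "t <= d" | "d < t" "t <= T'" | "T' < t" by linarith
  hence "|f t| <= C * t \<or> |f t| <= C * t powr (q - 1)"
  proof cases
   case 1
   hence "|f t| <= 1 * t" using d(2)[of t] t by simp
   also have "... <= C * t" using C t by (intro mult_right_mono)
   finally show ?thesis by simp
  next
   case 2
   hence "|f t| <= K" using K(2)[of t] t by simp
   also have "K <= K / d * t" using 2 d K(1) by (simp add: pos_le_divide_eq mult_left_mono)
   also have "... <= C * t" using t by (intro mult_right_mono) (auto simp: C_def)
   finally show ?thesis by simp
  next
   case 3
   hence "|f t| <= 1 * t powr (q - 1)" using far by simp
   also have "... <= C * t powr (q - 1)" using C by (intro mult_right_mono) auto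
   finally show ?thesis by simp
  qed
  moreover have "C * t >= 0" "C * t powr (q - 1) >= 0" using C n by simp_all
  ultimately show ?thesis unfolding distrib_left by linarith
 qed
 show ?thesis
 proof (rule that[of C "q - 1"])
  fix t show "|f t| <= C * ( |t| + |t| powr (q - 1))" using pos[of "|t|"] f_nonneg[of "|t|"] by (simp add: f_abs)
 qed (use C q in auto)
qed

text \<open>Covers f(u), mean slopes of \<open>F\<close>, and differences of two such terms, whence
  the factor 2. As \<open>f\<close> need not be monotone, the bound is by \<open>f\<close> at some
  point below |b| instead of by f(|b|).\<close>

definition fcl :: "real => (real^3 => real) set" where
 "fcl R = {c \<in> borel_measurable borel. EX b. rb R b & (AE x in R3. EX \<xi>. |\<xi>| <= |b x| & |c x| <= 2 * |f \<xi>| )}"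

lemma tight_fcl:
 assumes R: "R >= 0"
 shows "tight (fcl R)"
proof -
 obtain C p where C: "0 <= C" "1 <= p" "p < 5" "!!t. |f t| <= C * ( |t| + |t| powr p)"
  using f_growth_bound by blast
 have mono: "|f \<xi>| <= C * (y + y powr p)" if "|\<xi>| <= y" for \<xi> y
 proof -
  have "|\<xi>| + |\<xi>| powr p <= y + y powr p" using that C by (intro add_mono powr_mono2) auto
  thus ?thesis using C(4)[of \<xi>] C(1) mult_left_mono order_trans by blast
 qed
 show ?thesis
 \<comment> \<open>Applied to a function of size |x|^(-1/2), \<open>f\<close> is of size |x|^(-p/2)
   near 0; the exponent (p+1)/2 stays below 3 precisely because p < 5, the subcritical
   range.\<close>
 proof (rule tightI[of _ R "(p + 1) / 2" "2 * (C * (R + R powr p))"])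
  show "c \<in> borel_measurable borel" if "c \<in> fcl R" for c using that by (simp add: fcl_def)
  show "0 <= R" "(p + 1) / 2 < 3" "0 <= 2 * (C * (R + R powr p))" using C R by auto
 next
  fix c assume "c \<in> fcl R"
  then obtain b where b: "rb R b" "AE x in R3. EX \<xi>. |\<xi>| <= |b x| & |c x| <= 2 * |f \<xi>|" by (auto simp: fcl_def)
  have "AE x in R3. x ~= 0" using AE_lborel_singleton by blast
  thus "AE x in R3. norm x < 1 --> |c x| <= 2 * (C * (R + R powr p)) * norm x powr (1 / 2 - (p + 1) / 2)"
   using b(2) rb_decay[OF b(1)]
  proof eventually_elim
   case (elim x)
   show ?case
   proof
    assume x1: "norm x < 1"
    have x0: "norm x > 0" using elim by simp
    obtain \<xi> where xi: "|\<xi>| <= |b x|" "|c x| <= 2 * |f \<xi>|" using elim by blast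
    define y where "y = R * norm x powr (-1/2)"
    have "R / sqrt (norm x) = y" using x0 by (simp add: y_def powr_minus_divide powr_half_sqrt)
    hence "|\<xi>| <= y" using xi elim by simp
    hence 1: "|c x| <= 2 * (C * (y + y powr p))" using mono[of \<xi> y] xi by linarith
    have yp: "y powr p = R powr p * norm x powr (- p / 2)"
     using R x0 by (simp add: y_def powr_mult powr_powr)
    have "norm x powr (-1/2) <= norm x powr (- p / 2)"
     using x0 x1 C by (intro powr_mono') auto
    hence "y <= R * norm x powr (- p / 2)" using R by (simp add: y_def mult_left_mono)
    hence "y + y powr p <= (R + R powr p) * norm x powr (- p / 2)" by (simp add: yp distrib_right)
    hence "C * (y + y powr p) <= C * ((R + R powr p) * norm x powr (- p / 2))" using C by (intro mult_left_mono)
    moreover have "1 / 2 - (p + 1) / 2 = - p / 2" by (simp add: field_simps)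
    ultimately show "|c x| <= 2 * (C * (R + R powr p)) * norm x powr (1 / 2 - (p + 1) / 2)"
     using 1 by (simp only: mult.assoc)
   qed
  qed
 next
  fix e :: real assume e: "e > 0"
  obtain d where d: "d > 0" "!!t. |t| <= d ==> |f t| <= e / 2 * |t|" using f_small[of "e / 2"] e by auto
  show "EX R1. ALL c:fcl R. EX b. rb R b & (AE x in R3. R1 < norm x --> |c x| <= e * |b x| )"
  proof (rule exI, rule ballI)
   fix c assume "c \<in> fcl R"
   then obtain b where b: "rb R b" "AE x in R3. EX \<xi>. |\<xi>| <= |b x| & |c x| <= 2 * |f \<xi>|" by (auto simp: fcl_def)
   have "AE x in R3. (R / d)^2 < norm x --> |c x| <= e * |b x|"
    using b(2) rb_decay[OF b(1)]
   proof eventually_elim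
    case (elim x)
    show ?case
    proof
     assume x: "(R / d)^2 < norm x"
     obtain \<xi> where xi: "|\<xi>| <= |b x|" "|c x| <= 2 * |f \<xi>|" using elim by blast
     have x0: "norm x > 0" using x zero_le_power2[of "R / d"] by linarith
     have "R / d <= sqrt (norm x)" using x by (intro real_le_rsqrt) auto
     hence "R / sqrt (norm x) <= d" using d x0 by (simp add: divide_le_eq mult.commute)
     hence "|\<xi>| <= d" using xi elim by linarith
     hence "|c x| <= e * |\<xi>|" using d(2)[of \<xi>] xi by simp
     also have "... <= e * |b x|" using xi e by (intro mult_left_mono) auto
     finally show "|c x| <= e * |b x|" .
    qed
   qed
   thus "EX b. rb R b & (AE x in R3. (R / d)^2 < norm x --> |c x| <= e * |b x| )" using b(1) by blast
  qed
 next
  fix r :: real assume r: "r > 0"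
  define y where "y = R / sqrt r"
  show "EX K>=0. ALL c:fcl R. AE x in R3. r <= norm x --> |c x| <= K"
  proof (intro exI conjI ballI)
   show "0 <= 2 * (C * (y + y powr p))" using C R r by (auto simp: y_def)
   fix c assume "c \<in> fcl R"
   then obtain b where b: "rb R b" "AE x in R3. EX \<xi>. |\<xi>| <= |b x| & |c x| <= 2 * |f \<xi>|" by (auto simp: fcl_def)
   show "AE x in R3. r <= norm x --> |c x| <= 2 * (C * (y + y powr p))"
    using b(2) rb_decay[OF b(1)]
   proof eventually_elim
    case (elim x)
    show ?case
    proof
     assume x: "r <= norm x"
     obtain \<xi> where xi: "|\<xi>| <= |b x|" "|c x| <= 2 * |f \<xi>|" using elim by blast
     have "R / sqrt (norm x) <= y" unfolding y_def using x r R by (intro frac_le) auto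
     hence "|\<xi>| <= y" using xi elim by linarith
     thus "|c x| <= 2 * (C * (y + y powr p))" using mono[of \<xi> y] xi by linarith
    qed
   qed
  qed
 qed
qed

abbreviation F :: "real => real" where "F \<equiv> primitive f"

lemmas F_deriv = primitive_deriv[OF f_cont]

lemma F_0 [simp]: "F 0 = 0"
 by (simp add: primitive_def)

lemma F_measurable [measurable]: "F \<in> borel_measurable borel"
 by (rule borel_measurable_continuous_onI) (meson DERIV_isCont F_deriv continuous_at_imp_continuous_on)

lemma F_slope:
 obtains \<xi> where "|\<xi> - a| <= |b - a|" "|\<xi>| <= max |a| |b|" "F b - F a = (b - a) * f \<xi>"
proof -
 consider "a < b" | "b < a" | "a = b" by linarith
 thus ?thesis
 proof cases
  case 1
  obtain z where "a < z" "z < b" "F b - F a = (b - a) * f z" using MVT2[OF 1, of F f] F_deriv by blast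
  thus ?thesis by (intro that[of z]) auto
 next
  case 2
  obtain z where "b < z" "z < a" "F a - F b = (a - b) * f z" using MVT2[OF 2, of F f] F_deriv by blast
  thus ?thesis by (intro that[of z]) (auto simp: algebra_simps)
 next
  case 3
  thus ?thesis by (intro that[of a]) auto
 qed
qed

lemma F_nonneg: "F t >= 0"
proof -
 obtain \<xi> where xi: "F t - F 0 = (t - 0) * f \<xi>" "|\<xi> - 0| <= |t - 0|" by (metis F_slope)
 have "F t >= 0" if "t >= 0" for t
 proof (rule ccontr)
  assume "\<not> F t >= 0"
  hence "F t < F 0" by simp
  moreover have "F 0 <= F t"
   by (rule DERIV_nonneg_imp_nondecreasing[OF that]) (use F_deriv f_nonneg in blast)
  ultimately show False by simp
 qed
 moreover have "F 0 <= F t" if "t <= 0" for t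
 proof (rule DERIV_nonpos_imp_nonincreasing[OF that])
  fix x assume "x <= (0::real)"
  thus "EX y. (F has_real_derivative y) (at x) & y <= 0" using F_deriv f_nonneg[of "- x"] f_odd[of x] by fastforce
 qed
 ultimately show ?thesis by (cases "t >= 0") auto
qed

lemma F_even: "F (- t) = F t"
proof -
 have "((%t. F (- t) - F t) has_real_derivative 0) (at t)" for t
 proof -
  have "((%t. F (- t)) has_real_derivative f (- t) * (- 1)) (at t)"
   by (rule DERIV_chain2[OF F_deriv]) (auto intro!: derivative_eq_intros)
  from DERIV_diff[OF this F_deriv[of t]] show ?thesis by (simp add: f_odd)
 qed
 hence "(%t. F (- t) - F t) t = (%t. F (- t) - F t) 0" by (intro DERIV_isconst_all) blast
 thus ?thesis by simp
qed

lemma f_times_nonneg: "f t * t >= 0"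
 using f_nonneg[of t] f_nonneg[of "- t"] f_odd[of t] by (cases "t >= 0") (auto simp: mult_nonpos_nonpos)

end

section \<open>The nonlocal term\<close>

text \<open>The Bopp-Podolsky kernel, 4 pi times the fundamental solution of -Laplace + Laplace^2.
  Unlike the Coulomb kernel it is at most 1, so L1 bounds on densities suffice; on the diagonal
  division by zero gives the value 0.\<close>

definition kern :: "real^3 => real^3 => real" where
 "kern x y = (1 - exp (- dist x y)) / dist x y"

lemma kern_nonneg: "0 <= kern x y"
 by (simp add: kern_def)

lemma kern_pos: "x ~= y ==> 0 < kern x y"
 by (simp add: kern_def)

lemma kern_le_1: "kern x y <= 1"
proof (cases "x = y")
 case False
 have "1 - exp (- dist x y) <= dist x y" using exp_ge_add_one_self[of "- dist x y"] by linarith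
 thus ?thesis using False by (simp add: kern_def divide_le_eq)
qed (simp add: kern_def)

lemma kern_le_inverse: "kern x y <= 1 / dist x y"
 unfolding kern_def by (intro divide_right_mono) auto

lemma kern_sym: "kern x y = kern y x"
 by (simp add: kern_def dist_commute)

lemma kern_measurable [measurable]: "(%(x, y). kern x y) \<in> borel_measurable (R3 \<Otimes>\<^sub>M R3)"
 unfolding kern_def by measurable

lemma kern_measurable1 [measurable]: "kern x \<in> borel_measurable borel"
 unfolding kern_def[abs_def] by measurable

definition pot :: "(real^3 => real) => real^3 => real" where
 "pot s x = (LINT y|R3. kern x y * s y)"

definition L1 :: "(real^3 => real) => real" where
 "L1 s = (LINT x|R3. |s x| )"

text \<open>A bilinear form on densities. The densities used are squares and products of L2
  functions, so the quartic functional is handled by bilinearity and the L1 bound.\<close>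

definition Q :: "(real^3 => real) => (real^3 => real) => real" where
 "Q s t = (LINT x|R3. pot s x * t x)"

lemma phi_pot: "phi u = pot (%y. (u y)^2)"
 by (simp add: phi_def[abs_def] pot_def[abs_def] kern_def)

lemma L1_nonneg: "0 <= L1 s" by (simp add: L1_def)

lemma pot_integrable:
 assumes s: "integrable R3 s"
 shows "integrable R3 (%y. kern x y * s y)"
proof (rule L1_bound[OF s])
 note [measurable] = int_borel[OF s]
 show "(%y. kern x y * s y) \<in> borel_measurable R3" by measurable
 show "AE y in R3. norm (kern x y * s y) <= norm (s y)"
  using kern_nonneg kern_le_1 by (intro AE_I2) (auto simp: abs_mult mult_left_le_one_le)
qed

lemma pot_bound:
 assumes s: "integrable R3 s"
 shows "|pot s x| <= L1 s"
proof -
 have "|pot s x| <= (LINT y|R3. norm (kern x y * s y))"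
  unfolding pot_def using integral_norm_bound[of R3 "%y. kern x y * s y"] by simp
 also have "... <= L1 s" unfolding L1_def
 proof (rule integral_mono)
  show "integrable R3 (%y. norm (kern x y * s y))" using pot_integrable[OF s] by simp
  show "integrable R3 (%y. |s y| )" using s by simp
  show "norm (kern x y * s y) <= |s y|" for y
   using kern_nonneg[of x y] kern_le_1[of x y] by (auto simp: abs_mult mult_left_le_one_le)
 qed
 finally show ?thesis .
qed

lemma pot_measurable [measurable]:
 assumes [measurable]: "s \<in> borel_measurable borel"
 shows "pot s \<in> borel_measurable borel"
proof -
 have "pot s \<in> borel_measurable R3"
  unfolding pot_def[abs_def] by (rule lborel.borel_measurable_lebesgue_integral) measurable
 thus ?thesis by simp
qed

lemma Q_integrable:
 assumes s: "integrable R3 s" and t: "integrable R3 t"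
 shows "integrable R3 (%x. pot s x * t x)"
proof (rule L1_bound)
 note [measurable] = int_borel[OF s] int_borel[OF t]
 show "integrable R3 (%x. L1 s * |t x| )" using t by simp
 show "(%x. pot s x * t x) \<in> borel_measurable R3" by measurable
 show "AE x in R3. norm (pot s x * t x) <= norm (L1 s * |t x| )"
  using pot_bound[OF s] L1_nonneg[of s] by (intro AE_I2) (auto simp: abs_mult mult_right_mono)
qed

lemma Q_bound:
 assumes s: "integrable R3 s" and t: "integrable R3 t"
 shows "|Q s t| <= L1 s * L1 t"
proof -
 have "|Q s t| <= (LINT x|R3. norm (pot s x * t x))"
  unfolding Q_def using integral_norm_bound[of R3 "%x. pot s x * t x"] by simp
 also have "... <= (LINT x|R3. L1 s * |t x| )"
 proof (rule integral_mono)
  show "integrable R3 (%x. norm (pot s x * t x))" using Q_integrable[OF s t] by simp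
  show "integrable R3 (%x. L1 s * |t x| )" using t by simp
  show "norm (pot s x * t x) <= L1 s * |t x|" for x
   using pot_bound[OF s, of x] by (simp add: abs_mult mult_right_mono)
 qed
 finally show ?thesis by (simp add: L1_def)
qed

lemma Q_sym:
 assumes s: "integrable R3 s" and t: "integrable R3 t"
 shows "Q s t = Q t s"
proof -
 note [measurable] = int_borel[OF s] int_borel[OF t]
 let ?k = "%x y. kern x y * s y * t x"
 have st: "integrable (R3 \<Otimes>\<^sub>M R3) (%(x, y). t x * s y)"
 proof (rule lborel_pair.Fubini_integrable)
  show "integrable R3 (%x. LINT y|R3. norm (case (x, y) of (x, y) => t x * s y))"
   using t by (simp add: abs_mult)
  show "AE x in R3. integrable R3 (%y. case (x, y) of (x, y) => t x * s y)"
   using s by simp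
 qed measurable
 have i: "integrable (R3 \<Otimes>\<^sub>M R3) (%(x, y). ?k x y)"
 proof (rule L1_bound[OF st])
  show "(%(x, y). ?k x y) \<in> borel_measurable (R3 \<Otimes>\<^sub>M R3)" by measurable
  have "|?k x y| <= |t x * s y|" for x y
   using kern_nonneg[of x y] kern_le_1[of x y] mult_left_le_one_le[of "|t x * s y|" "kern x y"]
   by (simp add: abs_mult mult.assoc mult.commute mult.left_commute)
  thus "AE z in R3 \<Otimes>\<^sub>M R3. norm (case z of (x, y) => ?k x y) <= norm (case z of (x, y) => t x * s y)"
   by (intro AE_I2) (auto simp: split_beta)
 qed
 have "Q s t = (LINT x|R3. LINT y|R3. ?k x y)" by (simp add: Q_def pot_def)
 also have "... = (LINT y|R3. LINT x|R3. ?k x y)" by (rule lborel_pair.Fubini_integral[OF i, symmetric])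
 also have "... = (LINT y|R3. (LINT x|R3. kern y x * t x) * s y)"
  by (simp add: kern_sym[of _ "_ :: real^3"] mult.commute mult.left_commute flip: integral_mult_right_zero)
 finally show ?thesis by (simp add: Q_def pot_def)
qed

lemma pot_add: "integrable R3 s ==> integrable R3 t ==> pot (%x. s x + t x) x = pot s x + pot t x"
 unfolding pot_def distrib_left by (rule Bochner_Integration.integral_add) (auto intro: pot_integrable)

lemma pot_scale: "pot (%x. c * s x) x = c * pot s x"
 unfolding pot_def by (simp add: mult.left_commute)

lemma Q_add1:
 assumes "integrable R3 s" "integrable R3 t" "integrable R3 r"
 shows "Q (%x. s x + t x) r = Q s r + Q t r"
 unfolding Q_def pot_add[OF assms(1,2)] distrib_right
 by (rule Bochner_Integration.integral_add) (use assms Q_integrable in auto)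

lemma Q_scale1: "Q (%x. c * s x) r = c * Q s r"
 unfolding Q_def pot_scale by (simp add: mult.assoc)

lemma Q_add2:
 assumes "integrable R3 s" "integrable R3 t" "integrable R3 r"
 shows "Q r (%x. s x + t x) = Q r s + Q r t"
 unfolding Q_def distrib_left
 by (rule Bochner_Integration.integral_add) (use assms Q_integrable in auto)

lemma Q_scale2: "Q r (%x. c * s x) = c * Q r s"
 unfolding Q_def by (simp add: mult.left_commute)

lemma Q_cong_AE:
 assumes "AE x in R3. s x = s' x" "AE x in R3. t x = t' x"
  and [measurable]: "s \<in> borel_measurable borel" "s' \<in> borel_measurable borel" "t \<in> borel_measurable borel" "t' \<in> borel_measurable borel"
 shows "Q s t = Q s' t'"
proof -
 have "pot s x = pot s' x" for x
  unfolding pot_def by (rule integral_cong_AE) (use assms(1) in \<open>auto elim!: eventually_mono\<close>)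
 thus ?thesis unfolding Q_def
  by (intro integral_cong_AE) (use assms(2) in \<open>auto elim!: eventually_mono\<close>)
qed

section \<open>The quartic constraint functional and its derivative\<close>

lemma L1_prod:
 fixes u v :: "real^3 => real"
 assumes "l2 u" "l2 v"
 shows "integrable R3 (%x. u x * v x)" "L1 (%x. u x * v x) <= sqrt (n2 u) * sqrt (n2 v)"
 using l2_times[OF assms] cauchy_schwarz_norm[OF assms] by (simp_all add: L1_def abs_mult)

lemma L1_sq:
 fixes u :: "real^3 => real"
 assumes "l2 u"
 shows "integrable R3 (%x. (u x)^2)" "L1 (%x. (u x)^2) = n2 u"
 using l2_integrable[OF assms] by (simp_all add: L1_def n2_def)

definition GG :: "(real^3 => real) => real" where
 "GG u = (LINT x|R3. phi u x * (u x)^2)"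

definition dGG :: "(real^3 => real) => (real^3 => real) => real" where
 "dGG u v = 4 * (LINT x|R3. phi u x * u x * v x)"

lemma GG_Q: "GG u = Q (%x. (u x)^2) (%x. (u x)^2)"
 by (simp add: GG_def Q_def phi_pot)

lemma dGG_Q: "dGG u v = 4 * Q (%x. (u x)^2) (%x. u x * v x)"
 by (simp add: dGG_def Q_def phi_pot mult.assoc)

lemma GG_nonneg: "0 <= GG u"
 unfolding GG_def phi_pot pot_def
 by (intro integral_nonneg_AE AE_I2 mult_nonneg_nonneg integral_nonneg_AE) (auto simp: kern_nonneg)

lemma GG_bound:
 assumes "l2 u"
 shows "|GG u| <= (n2 u)^2"
 using Q_bound[OF L1_sq(1)[OF assms] L1_sq(1)[OF assms]]
 unfolding GG_Q[symmetric] L1_sq(2)[OF assms] power2_eq_square[of "n2 u"] .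

lemma dGG_bound:
 assumes "l2 u" "l2 v"
 shows "|dGG u v| <= 4 * (n2 u * sqrt (n2 u) * sqrt (n2 v))"
proof -
 have "|Q (%x. (u x)^2) (%x. u x * v x)| <= L1 (%x. (u x)^2) * L1 (%x. u x * v x)"
  using assms by (intro Q_bound L1_prod L1_sq)
 also have "... <= n2 u * (sqrt (n2 u) * sqrt (n2 v))"
  using L1_prod(2)[OF assms] n2_nonneg[of u] by (simp add: L1_sq[OF assms(1)] mult_left_mono)
 finally show ?thesis by (simp add: dGG_Q)
qed

lemma dGG_add: "l2 u ==> l2 v ==> l2 w ==> dGG u (%x. v x + w x) = dGG u v + dGG u w"
 unfolding dGG_Q distrib_left by (subst Q_add2) (auto intro: L1_prod L1_sq)

lemma dGG_scale: "dGG u (%x. c * v x) = c * dGG u v"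
 unfolding dGG_Q by (simp add: mult.left_commute Q_scale2)

lemma dGG_uminus: "dGG (%x. - u x) v = - dGG u v"
 using Q_scale2[of "%x. (u x)^2" "-1" "%x. u x * v x"] by (simp add: dGG_Q)

lemma GG_scale: "GG (%x. c * u x) = c ^ 4 * GG u"
 unfolding GG_Q power_mult_distrib by (simp add: Q_scale1 Q_scale2 power_add[symmetric] mult.assoc[symmetric])

lemma GG_euler: "dGG u u = 4 * GG u"
 by (simp add: GG_Q dGG_Q power2_eq_square)

text \<open>Expanding (u+h)^2 = u^2 + 2uh + h^2 in both slots of \<open>Q\<close> leaves only terms
  of order at least two in h once the value and the derivative are removed.\<close>

lemma GG_expand:
 assumes u: "l2 u" and h: "l2 h"
 shows "|GG (%x. u x + h x) - GG u - dGG u h|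
  <= n2 h * (6 * n2 u + 4 * sqrt (n2 u) * sqrt (n2 h) + n2 h)"
proof -
 define s where "s x = (u x)^2" for x
 define p where "p x = u x * h x" for x
 define q where "q x = (h x)^2" for x
 define A where "A = sqrt (n2 u)"
 define B where "B = sqrt (n2 h)"
 have A: "A >= 0" "A * A = n2 u" and B: "B >= 0" "B * B = n2 h"
  by (simp_all add: A_def B_def n2_nonneg flip: power2_eq_square)
 have i: "integrable R3 s" "integrable R3 p" "integrable R3 q"
  unfolding s_def p_def q_def using L1_sq(1)[OF u] L1_prod(1)[OF u h] L1_sq(1)[OF h] by simp_all
 have L: "L1 s = A * A" "L1 p <= A * B" "L1 q = B * B"
  unfolding A(2) B(2) using L1_sq(2)[OF u] L1_prod(2)[OF u h] L1_sq(2)[OF h]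
  by (simp_all add: s_def[abs_def] p_def[abs_def] q_def[abs_def] A_def B_def)
 define t where "t x = s x + (2 * p x + q x)" for x
 have i2: "integrable R3 (%x. 2 * p x)" "integrable R3 (%x. 2 * p x + q x)" "integrable R3 t"
  using i unfolding t_def by simp_all
 have tq: "Q t z = Q s z + (2 * Q p z + Q q z)" if z: "integrable R3 z" for z
  unfolding t_def using i i2 z by (simp add: Q_add1 Q_scale1)
 have zt: "Q z t = Q z s + (2 * Q z p + Q z q)" if z: "integrable R3 z" for z
  unfolding t_def using i i2 z by (simp add: Q_add2 Q_scale2)
 have "GG (%x. u x + h x) = Q t t"
  unfolding GG_Q t_def s_def p_def q_def by (simp add: power2_sum add.assoc add.commute[of "_ * _"] mult.assoc add.left_commute)
 also have "... = Q s s + 4 * Q s p + 2 * Q s q + 4 * Q p p + 4 * Q p q + Q q q"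
  using tq[OF i2(3)] zt[OF i(1)] zt[OF i(2)] zt[OF i(3)] Q_sym[OF i(1,2)] Q_sym[OF i(1,3)] Q_sym[OF i(2,3)] by simp
 finally have "GG (%x. u x + h x) - GG u - dGG u h = 2 * Q s q + 4 * Q p p + 4 * Q p q + Q q q"
  by (simp add: GG_Q[of u] dGG_Q s_def[abs_def] p_def[abs_def])
 moreover have "|Q s q| <= A * A * (B * B)" using Q_bound[OF i(1,3)] L by simp
 moreover have "|Q p p| <= (A * B) * (A * B)"
  using Q_bound[OF i(2,2)] mult_mono[OF L(2) L(2)] A B L1_nonneg[of p] by simp
 moreover have "|Q p q| <= (A * B) * (B * B)"
  using Q_bound[OF i(2,3)] mult_right_mono[OF L(2), of "B * B"] B L n2_nonneg[of h] by simp
 moreover have "|Q q q| <= (B * B) * (B * B)" using Q_bound[OF i(3,3)] L by simp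
 ultimately have "|GG (%x. u x + h x) - GG u - dGG u h|
   <= 2 * (A * A * (B * B)) + 4 * ((A * B) * (A * B)) + 4 * ((A * B) * (B * B)) + (B * B) * (B * B)" by linarith
 also have "... = (B * B) * (6 * (A * A) + 4 * A * B + B * B)" by (simp add: algebra_simps)
 finally show ?thesis unfolding A(2) B(2) by (simp add: A_def B_def)
qed

lemma dGG_lipschitz:
 assumes u: "l2 u" and h: "l2 h" and w: "l2 w"
 shows "|dGG (%x. u x + h x) w - dGG u w|
  <= 4 * ((2 * sqrt (n2 u) * sqrt (n2 h) + n2 h) * (sqrt (n2 u) * sqrt (n2 w)) + n2 (%x. u x + h x) * (sqrt (n2 h) * sqrt (n2 w)))"
proof -
 have v: "l2 (%x. u x + h x)" by (rule l2_add[OF u h])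
 define s where "s x = (u x)^2" for x
 define p where "p x = u x * h x" for x
 define q where "q x = (h x)^2" for x
 define t where "t x = (u x + h x)^2" for x
 have i: "integrable R3 s" "integrable R3 p" "integrable R3 q" "integrable R3 t"
  unfolding s_def p_def q_def t_def using L1_sq(1)[OF u] L1_prod(1)[OF u h] L1_sq(1)[OF h] L1_sq(1)[OF v] by simp_all
 have iw: "integrable R3 (%x. u x * w x)" "integrable R3 (%x. h x * w x)"
  using L1_prod(1) u h w by blast+
 have i2: "integrable R3 (%x. 2 * p x + q x)" using i by simp
 have tt: "t x = s x + (2 * p x + q x)" for x by (simp add: t_def s_def p_def q_def power2_sum)
 have t: "Q t (%x. u x * w x) = Q s (%x. u x * w x) + Q (%x. 2 * p x + q x) (%x. u x * w x)"
  unfolding tt[abs_def] by (rule Q_add1[OF i(1) i2 iw(1)])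
 have "Q t (%x. (u x + h x) * w x) = Q t (%x. u x * w x) + Q t (%x. h x * w x)"
  unfolding distrib_right by (rule Q_add2[OF iw i(4)])
 hence "dGG (%x. u x + h x) w - dGG u w = 4 * (Q (%x. 2 * p x + q x) (%x. u x * w x) + Q t (%x. h x * w x))"
  unfolding dGG_Q t_def[symmetric] s_def[symmetric] t by simp
 moreover have "|Q (%x. 2 * p x + q x) (%x. u x * w x)| <= (2 * sqrt (n2 u) * sqrt (n2 h) + n2 h) * (sqrt (n2 u) * sqrt (n2 w))"
 proof -
  have "L1 (%x. 2 * p x + q x) <= (LINT x|R3. 2 * |p x| + |q x| )"
   unfolding L1_def by (rule integral_mono) (use i in \<open>auto simp: abs_mult intro: order_trans[OF abs_triangle_ineq]\<close>)
  also have "... = 2 * L1 p + L1 q" using i by (simp add: L1_def)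
  also have "... <= 2 * (sqrt (n2 u) * sqrt (n2 h)) + n2 h"
   using L1_prod(2)[OF u h] L1_sq(2)[OF h] by (simp add: p_def[abs_def] q_def[abs_def])
  finally have "L1 (%x. 2 * p x + q x) <= 2 * sqrt (n2 u) * sqrt (n2 h) + n2 h" by simp
  moreover note L1_prod(2)[OF u w]
  ultimately have "L1 (%x. 2 * p x + q x) * L1 (%x. u x * w x) <= (2 * sqrt (n2 u) * sqrt (n2 h) + n2 h) * (sqrt (n2 u) * sqrt (n2 w))"
   by (intro mult_mono) (auto simp: L1_nonneg n2_nonneg)
  thus ?thesis using Q_bound[OF i2 iw(1)] by linarith
 qed
 moreover have "|Q t (%x. h x * w x)| <= n2 (%x. u x + h x) * (sqrt (n2 h) * sqrt (n2 w))"
 proof -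
  have "L1 t * L1 (%x. h x * w x) <= n2 (%x. u x + h x) * (sqrt (n2 h) * sqrt (n2 w))"
   using L1_sq(2)[OF v] L1_prod(2)[OF h w] by (simp add: t_def[abs_def] mult_left_mono n2_nonneg)
  thus ?thesis using Q_bound[OF i(4) iw(2)] by linarith
 qed
 moreover have "|d| <= 4 * (a' + b')" if "d = 4 * (a + b)" "|a| <= a'" "|b| <= b'" for d a b a' b' :: real
  unfolding that(1) abs_mult using order_trans[OF abs_triangle_ineq[of a b] add_mono[OF that(2,3)]] by simp
 ultimately show ?thesis by blast
qed

text \<open>The kernel is positive off the diagonal, so the potential of a nonzero \<open>u\<close>
  is positive at every point, and a zero integral would force u = 0 almost everywhere.\<close>

lemma GG_pos:
 assumes u: "l2 u" and nz: "n2 u > 0"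
 shows "GG u > 0"
proof (rule ccontr)
 assume "\<not> GG u > 0"
 hence z: "(LINT x|R3. phi u x * (u x)^2) = 0" using GG_nonneg[of u] by (simp add: GG_def)
 note [measurable] = l2_borel[OF u]
 have su: "integrable R3 (%x. (u x)^2)" by (rule L1_sq(1)[OF u])
 have notAE: "\<not> (AE x in R3. u x = 0)"
 proof
  assume "AE x in R3. u x = 0"
  hence "n2 u = (LINT x|R3. 0)" unfolding n2_def by (intro integral_cong_AE) (auto elim!: eventually_mono)
  thus False using nz by simp
 qed
 have ppos: "phi u x > 0" for x
 proof (rule ccontr)
  assume "\<not> phi u x > 0"
  moreover have "phi u x >= 0" unfolding phi_pot pot_def by (intro integral_nonneg_AE AE_I2) (simp add: kern_nonneg)
  ultimately have "(LINT y|R3. kern x y * (u y)^2) = 0" by (simp add: phi_pot pot_def)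
  hence "AE y in R3. kern x y * (u y)^2 = 0"
   by (subst (asm) integral_nonneg_eq_0_iff_AE[OF pot_integrable[OF su]]) (auto simp: kern_nonneg)
  moreover have "AE y in R3. y ~= x" using AE_lborel_singleton by blast
  ultimately have "AE y in R3. u y = 0"
  proof eventually_elim
   case (elim y)
   thus ?case using kern_pos[of x y] by auto
  qed
  thus False using notAE by blast
 qed
 have i: "integrable R3 (%x. phi u x * (u x)^2)" unfolding phi_pot by (rule Q_integrable[OF su su])
 have "AE x in R3. phi u x * (u x)^2 = 0"
  using z by (subst (asm) integral_nonneg_eq_0_iff_AE[OF i]) (auto simp: ppos less_imp_le)
 hence "AE x in R3. u x = 0"
 proof eventually_elim
  case (elim x)
  thus ?case using ppos[of x] by auto
 qed
 thus False using notAE by blast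
qed

lemma phi_nonneg: "0 <= phi u x"
 unfolding phi_pot pot_def by (intro integral_nonneg_AE AE_I2) (simp add: kern_nonneg)

lemma phi_le: "l2 u ==> phi u x <= n2 u"
 using pot_bound[OF L1_sq(1), of u x] L1_sq(2)[of u] by (simp add: phi_pot)

lemma phi_measurable [measurable]: "u \<in> borel_measurable borel ==> phi u \<in> borel_measurable borel"
 unfolding phi_pot by measurable

lemma phi_decay:
 assumes R: "0 <= R" and e: "e > 0"
 obtains R1 where "!!b x. rb R b ==> R1 < norm x ==> phi b x <= e"
proof -
 \<comment> \<open>Mass farther than \<open>T\<close> from x contributes at most R^2/T <= e/2,
   because the kernel is below 1/dist. Mass within \<open>T\<close> of x lies at distance at least
   \<open>R2\<close> from the origin, where b^2 <= R^2/R2, so the ball of volume \<open>V\<close>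
   contributes at most e/2.\<close>
 define T where "T = 2 * R^2 / e + 1"
 define V where "V = measure lborel (cball (0::real^3) T)"
 define R2 where "R2 = 2 * R^2 * V / e + 1"
 have T: "T > 0" and V: "V >= 0" and R2: "R2 > 0"
  using e by (simp_all add: T_def V_def R2_def add_nonneg_pos)
 show ?thesis
 proof (rule that[of "T + R2"])
  fix b and x :: "real^3" assume b: "rb R b" and x: "T + R2 < norm x"
  have bi: "integrable R3 (%y. (b y)^2)" by (rule L1_sq(1)[OF rb_l2[OF b]])
  have V': "measure lborel (cball x T) = V" unfolding V_def using T by (simp add: content_cball)
  have "phi b x <= (LINT y|R3. indicator (cball x T) y * (R^2 / R2) + (1 / T) * (b y)^2)"
   unfolding phi_pot pot_def
  proof (rule integral_mono_AE)
   show "integrable R3 (%y. kern x y * (b y)^2)" by (rule pot_integrable[OF bi])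
   show "integrable R3 (%y. indicator (cball x T) y * (R^2 / R2) + (1 / T) * (b y)^2)" using bi by simp
   show "AE y in R3. kern x y * (b y)^2 <= indicator (cball x T) y * (R^2 / R2) + (1 / T) * (b y)^2"
    using rb_decay[OF b]
   proof eventually_elim
    case (elim y)
    show ?case
    proof (cases "dist x y <= T")
     case True
     have "norm x <= norm y + dist x y" using norm_triangle_sub[of x y] by (simp add: dist_norm)
     hence ny: "norm y >= R2" using True x by linarith
     have "(b y)^2 <= (R / sqrt (norm y))^2" using elim R by (simp add: abs_le_square_iff[symmetric])
     also have "... = R^2 / norm y" by (simp add: power_divide)
     also have "... <= R^2 / R2" using ny R2 by (intro frac_le) auto
     finally have "(b y)^2 <= R^2 / R2" .
     moreover have "kern x y * (b y)^2 <= (b y)^2"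
      using kern_nonneg[of x y] kern_le_1[of x y] by (simp add: mult_left_le_one_le)
     moreover have "(1 / T) * (b y)^2 >= 0" using T by simp
     ultimately show ?thesis using True by simp
    next
     case False
     have "kern x y <= 1 / dist x y" by (rule kern_le_inverse)
     also have "... <= 1 / T" using False T by (intro frac_le) auto
     finally have "kern x y * (b y)^2 <= (1 / T) * (b y)^2" by (rule mult_right_mono) simp
     thus ?thesis using False by simp
    qed
   qed
  qed
  also have "... = V * (R^2 / R2) + (1 / T) * n2 b" using bi V' by (simp add: n2_def)
  also have "... <= e / 2 + e / 2"
  proof (rule add_mono)
   show "V * (R^2 / R2) <= e / 2" using e R2 by (simp add: R2_def field_simps)
   have "(1 / T) * n2 b <= (1 / T) * R^2" using b T by (intro mult_left_mono) (auto simp: rb_def)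
   also have "... <= e / 2" using e T by (simp add: T_def field_simps)
   finally show "(1 / T) * n2 b <= e / 2" .
  qed
  finally show "phi b x <= e" by simp
 qed
qed

definition pcl :: "real => (real^3 => real) set" where
 "pcl R = {c \<in> borel_measurable borel. EX b. rb R b & (AE x in R3. |c x| <= phi b x * |b x| )}"

text \<open>Here smallness at infinity comes from the potential, not from superlinearity of the
  coefficient; near the origin the potential is bounded and a single factor |x|^(-1/2)
  remains.\<close>

lemma tight_pcl:
 assumes R: "R >= 0"
 shows "tight (pcl R)"
proof -
 have pb: "phi b x <= R^2" if "rb R b" for b x
  using phi_le[OF rb_l2[OF that], of x] that by (simp add: rb_def)
 have cb: "AE x in R3. |c x| <= R^2 * (R / sqrt (norm x))" if "c \<in> pcl R" for c
 proof -
  obtain b where b: "rb R b" "AE x in R3. |c x| <= phi b x * |b x|" using \<open>c \<in> pcl R\<close> by (auto simp: pcl_def)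
  show ?thesis using b(2) rb_decay[OF b(1)]
  proof eventually_elim
   case (elim x)
   have "phi b x * |b x| <= R^2 * (R / sqrt (norm x))"
    using elim pb[OF b(1), of x] phi_nonneg[of b x] by (intro mult_mono) auto
   thus ?case using elim by linarith
  qed
 qed
 show ?thesis
 proof (rule tightI[of _ R 1 "R ^ 3"])
  show "c \<in> borel_measurable borel" if "c \<in> pcl R" for c using that by (simp add: pcl_def)
  show "0 <= R" "(1::real) < 3" "0 <= R ^ 3" using R by auto
  show "AE x in R3. norm x < 1 --> |c x| <= R ^ 3 * norm x powr (1 / 2 - 1)" if "c \<in> pcl R" for c
   using cb[OF that]
  proof eventually_elim
   case (elim x)
   have "norm x powr (1 / 2 - 1) = 1 / sqrt (norm x)"
    using powr_minus_divide[of "norm x" "1/2"] by (simp add: powr_half_sqrt)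
   thus ?case using elim by (simp add: power_eq_if power2_eq_square)
  qed
 next
  fix e :: real assume e: "e > 0"
  obtain R1 where R1: "!!b x. rb R b ==> R1 < norm x ==> phi b x <= e" using phi_decay[OF R e] by blast
  show "EX R1. ALL c:pcl R. EX b. rb R b & (AE x in R3. R1 < norm x --> |c x| <= e * |b x| )"
  proof (rule exI, rule ballI)
   fix c assume "c \<in> pcl R"
   then obtain b where b: "rb R b" "AE x in R3. |c x| <= phi b x * |b x|" by (auto simp: pcl_def)
   have "AE x in R3. R1 < norm x --> |c x| <= e * |b x|"
    using b(2)
   proof eventually_elim
    case (elim x)
    show ?case
    proof
     assume "R1 < norm x"
     hence "phi b x * |b x| <= e * |b x|" by (intro mult_right_mono R1[OF b(1)]) auto
     thus "|c x| <= e * |b x|" using elim by linarith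
    qed
   qed
   thus "EX b. rb R b & (AE x in R3. R1 < norm x --> |c x| <= e * |b x| )" using b(1) by blast
  qed
 next
  fix r :: real assume r: "r > 0"
  show "EX K>=0. ALL c:pcl R. AE x in R3. r <= norm x --> |c x| <= K"
  proof (intro exI conjI ballI)
   show "0 <= R^2 * (R / sqrt r)" using R r by simp
   fix c assume "c \<in> pcl R"
   from cb[OF this] show "AE x in R3. r <= norm x --> |c x| <= R^2 * (R / sqrt r)"
   proof eventually_elim
    case (elim x)
    show ?case
    proof
     assume x: "r <= norm x"
     have "R^2 * (R / sqrt (norm x)) <= R^2 * (R / sqrt r)"
      using x r R by (intro mult_left_mono frac_le) auto
     thus "|c x| <= R^2 * (R / sqrt r)" using elim by linarith
    qed
   qed
  qed
 qed
qed

lemma phi_times_pcl: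
 assumes "rb R b"
 shows "(%x. phi b x * b x) \<in> pcl R"
proof -
 note [measurable] = rb_borel[OF assms]
 have "AE x in R3. |phi b x * b x| <= phi b x * |b x|" by (intro AE_I2) (simp add: abs_mult phi_nonneg)
 thus ?thesis using assms unfolding pcl_def by auto
qed

section \<open>The space of radial functions\<close>

lemma radial_add: "radial u ==> radial v ==> radial (%x. u x + v x)"
proof -
 assume "radial u" "radial v"
 then obtain h k where h: "AE x in R3. u x = h (norm x)" and k: "AE x in R3. v x = k (norm x)" by (auto simp: radial_def)
 have "AE x in R3. u x + v x = h (norm x) + k (norm x)" using h k by eventually_elim simp
 thus ?thesis unfolding radial_def by (rule exI[of _ "%t. h t + k t"])
qed

lemma radial_scale: "radial u ==> radial (%x. c * u x)"
proof -
 assume "radial u"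
 then obtain h where h: "AE x in R3. u x = h (norm x)" by (auto simp: radial_def)
 have "AE x in R3. c * u x = c * h (norm x)" using h by eventually_elim simp
 thus ?thesis unfolding radial_def by (rule exI[of _ "%t. c * h t"])
qed

lemma H1_rad_H1: "u \<in> H1_rad ==> u \<in> H1" by (simp add: H1_rad_def)

lemma H1_rad_add: "u \<in> H1_rad ==> v \<in> H1_rad ==> u + v \<in> H1_rad"
 using H1_add[of u v] radial_add[of u v] by (auto simp: H1_rad_def plus_fun_def)

lemma H1_rad_scale: "u \<in> H1_rad ==> c *\<^sub>R u \<in> H1_rad"
 using H1_scale[of u c] radial_scale[of u c] by (auto simp: H1_rad_def scaleR_fun_def)

lemma zero_H1_rad: "0 \<in> H1_rad"
proof -
 have "weak_grad (%x. 0) (%x. 0)" by (simp add: weak_grad_def)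
 from H1_I[OF l2_zero l2_zero this] have "(%x. 0) \<in> H1" .
 moreover have "radial (%x. 0)" unfolding radial_def by (intro exI[of _ "%t. 0"]) simp
 ultimately show ?thesis by (simp add: H1_rad_def zero_fun_def)
qed

lemma H1_rad_diff: "u \<in> H1_rad ==> v \<in> H1_rad ==> u - v \<in> H1_rad"
 using H1_rad_add[of u "(-1) *\<^sub>R v"] H1_rad_scale[of v "-1"] by simp

lemma grad_diff:
 assumes "u \<in> H1" "v \<in> H1"
 shows "AE x in R3. grad (u - v) x = grad u x - grad v x"
proof -
 have e: "u - v = (%x. u x + (%x. (-1) * v x) x)" by (auto simp: fun_eq_iff)
 show ?thesis
  using grad_add[OF assms(1) H1_scale[OF assms(2), of "-1"]] grad_scale[OF assms(2), of "-1"]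
  unfolding e by eventually_elim simp
qed

lemma grad_zero_AE:
 assumes "u \<in> H1" "AE x in R3. u x = 0"
 shows "AE x in R3. grad u x = 0"
proof (rule grad_eq[OF assms(1) l2_zero])
 have "weak_grad (%x. 0) (%x. 0)" by (simp add: weak_grad_def)
 thus "weak_grad u (%x. 0)"
  by (rule weak_grad_cong) (use assms H1_l2[OF assms(1)] l2_measurable in auto)
qed

lemma n2_diff_cong:
 assumes "u \<in> H1" "v \<in> H1"
 shows "n2 (grad (u - v)) = n2 (%x. grad u x - grad v x)"
proof (rule n2_cong_AE)
 have e: "u - v = (%x. u x + (-1) * v x)" by (auto simp: fun_eq_iff)
 have "u - v \<in> H1" unfolding e by (rule H1_add[OF assms(1) H1_scale[OF assms(2)]])
 thus "grad (u - v) \<in> borel_measurable R3" by (rule l2_measurable[OF grad_l2])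
 show "(%x. grad u x - grad v x) \<in> borel_measurable R3"
  using l2_measurable[OF grad_l2[OF assms(1)]] l2_measurable[OF grad_l2[OF assms(2)]] by measurable
 show "AE x in R3. grad (u - v) x = grad u x - grad v x" by (rule grad_diff[OF assms])
qed

lemma radial_C1:
 fixes A A' :: "real => real"
 assumes A: "!!s. (A has_real_derivative A' s) (at s)" and cA: "continuous_on UNIV A'"
  and l: "l2 (%x::real^3. A ((norm x)^2))" "l2 (%x::real^3. (2 * A' ((norm x)^2)) *\<^sub>R x)"
 shows "(%x. A ((norm x)^2)) \<in> H1_rad"
  and "AE x in R3. grad (%x. A ((norm x)^2)) x = (2 * A' ((norm x)^2)) *\<^sub>R x"
proof -
 have w: "weak_grad (%x. A ((norm x)^2)) (%x. (2 * A' ((norm x)^2)) *\<^sub>R x)"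
 proof (rule C1_weak_grad)
  fix x :: "real^3"
  have n: "((%x. (norm x)^2) has_derivative (%v. 2 * (x \<bullet> v))) (at x)"
   unfolding power2_norm_eq_inner by (auto intro!: derivative_eq_intros simp: inner_commute)
  have "((%x. A ((norm x)^2)) has_derivative (%v. A' ((norm x)^2) * (2 * (x \<bullet> v)))) (at x)"
   by (rule has_derivative_compose[OF n]) (use A[of "(norm x)^2"] in \<open>simp add: has_field_derivative_def\<close>)
  thus "((%x. A ((norm x)^2)) has_derivative (%h. ((2 * A' ((norm x)^2)) *\<^sub>R x) \<bullet> h)) (at x)"
   by (simp add: mult.assoc mult.left_commute)
 next
  show "continuous_on UNIV (%x::real^3. (2 * A' ((norm x)^2)) *\<^sub>R x)"
   by (intro continuous_intros continuous_on_compose2[OF cA]) auto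
 qed (use l in auto)
 have H: "(%x. A ((norm x)^2)) \<in> H1" by (rule H1_I[OF l w])
 moreover have "radial (%x. A ((norm x)^2))"
  unfolding radial_def by (intro exI[of _ "%t. A (t^2)"]) simp
 ultimately show "(%x. A ((norm x)^2)) \<in> H1_rad" by (simp add: H1_rad_def)
 show "AE x in R3. grad (%x. A ((norm x)^2)) x = (2 * A' ((norm x)^2)) *\<^sub>R x"
  by (rule grad_eq[OF H l(2) w])
qed

section \<open>Equicontinuity of the radial profiles\<close>

text \<open>One finite set of positive rationals serves all functions with gradient norm at most
  \<open>R\<close>, because the modulus of continuity in \<open>ev_diff_bound\<close> depends on
  nothing else.\<close>

lemma ev_net:
 assumes a: "0 < a" and d: "0 < d"
 obtains K where "finite K" "K \<subseteq> {q \<in> \<rat>. 0 < q}"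
  "!!t. t \<in> {a..b} ==> EX q:K. ALL u:H1. sqrt (n2 (grad u)) <= R --> |ev u t - ev u q| <= d"
proof -
 define g where "g t = 1 / sqrt t" for t :: real
 \<comment> \<open>The interval starts at a/2 since the grid point just below t may lie to the left
   of \<open>a\<close>. The tolerance w is chosen so that (|R| + 1) * sqrt w = d.\<close>
 have "continuous_on {a/2..b} g" unfolding g_def using a by (intro continuous_intros) auto
 hence "uniformly_continuous_on {a/2..b} g" by (rule compact_uniformly_continuous) simp
 moreover define w where "w = (d / ( |R| + 1))^2"
 have w: "w > 0" using d by (simp add: w_def)
 ultimately obtain e where e: "e > 0" "!!s t. s \<in> {a/2..b} ==> t \<in> {a/2..b} ==> dist s t < e ==> dist (g s) (g t) < w"
  unfolding uniformly_continuous_on_def by metis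
 obtain n where n: "1 / real (Suc n) < min e (a / 2)" using nat_approx_posE[of "min e (a / 2)"] a e by auto
 define h where "h = 1 / real (Suc n)"
 have h: "h > 0" "h < e" "h < a / 2" using n by (simp_all add: h_def)
 define K where "K = ((%i::int. of_int i * h) ` {\<lfloor>a / h\<rfloor>..\<lfloor>b / h\<rfloor>}) \<inter> {0<..}"
 show ?thesis
 proof (rule that[of K])
  show "finite K" by (simp add: K_def)
  show "K \<subseteq> {q \<in> \<rat>. 0 < q}" by (auto simp: K_def h_def)
  fix t assume t: "t \<in> {a..b}"
  define q where "q = of_int \<lfloor>t / h\<rfloor> * h"
  have "of_int \<lfloor>t / h\<rfloor> <= t / h" by simp
  from mult_right_mono[OF this, of h] have q1: "q <= t" using h by (simp add: q_def)
  have "t / h < of_int \<lfloor>t / h\<rfloor> + 1" by linarith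
  from mult_strict_right_mono[OF this, of h] have q2: "t - h < q" using h by (simp add: q_def distrib_right)
  have q3: "q > a / 2" using q2 h t by simp
  have "\<lfloor>a / h\<rfloor> <= \<lfloor>t / h\<rfloor>" "\<lfloor>t / h\<rfloor> <= \<lfloor>b / h\<rfloor>"
   using t h by (auto intro!: floor_mono divide_right_mono)
  hence "q \<in> K" using q3 a by (auto simp: K_def q_def)
  moreover have "|ev u t - ev u q| <= d" if u: "u \<in> H1" and R: "sqrt (n2 (grad u)) <= R" for u
  proof -
   have "dist (g q) (g t) < w" using e(2)[of q t] q1 q2 q3 h t by (auto simp: dist_real_def)
   hence "g q - g t <= w" by (simp add: dist_real_def)
   hence "sqrt (g q - g t) <= d / ( |R| + 1)" using d by (intro real_le_lsqrt) (auto simp: w_def)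
   moreover have "sqrt (n2 (grad u)) <= |R| + 1" using R by linarith
   ultimately have "sqrt (n2 (grad u)) * sqrt (g q - g t) <= ( |R| + 1) * (d / ( |R| + 1))"
   proof (intro mult_mono)
    show "0 <= sqrt (g q - g t)" using q1 q3 a by (simp add: g_def frac_le)
   qed auto
   also have "... = d" using abs_ge_zero[of R] by simp
   finally have "sqrt (n2 (grad u)) * sqrt (1 / sqrt q - 1 / sqrt t) <= d" by (simp add: g_def)
   moreover have "|ev u q - ev u t| <= sqrt (n2 (grad u)) * sqrt (1 / sqrt q - 1 / sqrt t)"
    by (rule ev_diff_bound[OF u]) (use q1 q3 a in auto)
   ultimately show ?thesis by (simp add: abs_minus_commute)
  qed
  ultimately show "EX q:K. ALL u:H1. sqrt (n2 (grad u)) <= R --> |ev u t - ev u q| <= d" by blast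
 qed
qed

lemma ev_subsequence:
 assumes s: "!!n::nat. s n \<in> H1" and R: "!!n. sqrt (n2 (grad (s n))) <= R"
 obtains r :: "nat => nat" where "strict_mono r"
  "!!a b d. 0 < a ==> 0 < d ==> EX N. ALL m>=N. ALL n>=N. ALL t:{a..b}. |ev (s (r m)) t - ev (s (r n)) t| <= d"
proof -
 let ?S = "{q \<in> \<rat>. (0::real) < q}"
 \<comment> \<open>The factor q^(1/4) undoes the decay bound, so all values are bounded by the one
   constant \<open>R\<close> and a diagonal subsequence converges at every positive
   rational.\<close>
 let ?f = "%n q. ev (s n) q * sqrt (sqrt q)"
 have cS: "countable ?S" by (rule countable_subset[OF _ countable_rat]) auto
 have bd: "norm (?f n q) <= R" if "q \<in> ?S" for n q
 proof -
  have q: "q > 0" using that by simp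
  have "|ev (s n) q| * sqrt (sqrt q) <= sqrt (n2 (grad (s n))) / sqrt (sqrt q) * sqrt (sqrt q)"
   using ev_bound[OF s q, of n] q by (intro mult_right_mono) auto
  also have "... = sqrt (n2 (grad (s n)))" using q by simp
  finally show ?thesis using R[of n] q by (simp add: abs_mult)
 qed
 obtain r :: "nat => nat" where r: "strict_mono r" "!!q. q \<in> ?S ==> EX l. (%n. ?f (r n) q) ----> l"
  using function_convergent_subsequence[OF cS, of ?f R] bd by blast
 have conv: "Cauchy (%n. ev (s (r n)) q)" if q: "q \<in> ?S" for q
 proof -
  obtain l where "(%n. ?f (r n) q) ----> l" using r(2)[OF q] by blast
  hence "(%n. ?f (r n) q * (1 / sqrt (sqrt q))) ----> l * (1 / sqrt (sqrt q))" by (intro tendsto_intros)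
  thus ?thesis using q by (intro LIMSEQ_imp_Cauchy) simp
 qed
 show ?thesis
 proof (rule that[OF r(1)])
  fix a b d :: real assume a: "0 < a" and d: "0 < d"
  obtain K where K: "finite K" "K \<subseteq> ?S"
   "!!t. t \<in> {a..b} ==> EX q:K. ALL u:H1. sqrt (n2 (grad u)) <= R --> |ev u t - ev u q| <= d / 3"
   using ev_net[OF a, of "d / 3" b R] d by auto
  have "ALL q:K. EX N. ALL m>=N. ALL n>=N. |ev (s (r m)) q - ev (s (r n)) q| < d / 3"
  proof
   fix q assume "q \<in> K"
   hence "Cauchy (%n. ev (s (r n)) q)" using conv K(2) by blast
   from CauchyD[OF this, of "d / 3"] show "EX N. ALL m>=N. ALL n>=N. |ev (s (r m)) q - ev (s (r n)) q| < d / 3"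
    using d by simp
  qed
  then obtain N where N: "!!q m n. q \<in> K ==> m >= N q ==> n >= N q ==> |ev (s (r m)) q - ev (s (r n)) q| < d / 3"
   by metis
  show "EX N. ALL m>=N. ALL n>=N. ALL t:{a..b}. |ev (s (r m)) t - ev (s (r n)) t| <= d"
  proof (intro exI[of _ "Max (insert 0 (N ` K))"] allI impI ballI)
   fix m n t assume m: "Max (insert 0 (N ` K)) <= m" and n: "Max (insert 0 (N ` K)) <= n" and t: "t \<in> {a..b}"
   obtain q where q: "q \<in> K" "!!u. u \<in> H1 ==> sqrt (n2 (grad u)) <= R ==> |ev u t - ev u q| <= d / 3"
    using K(3)[OF t] by blast
   have "N q <= Max (insert 0 (N ` K))" using q(1) K(1) by (intro Max_ge) auto
   hence "|ev (s (r m)) q - ev (s (r n)) q| < d / 3" using m n by (intro N[OF q(1)]) auto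
   moreover have "|ev (s (r m)) t - ev (s (r m)) q| <= d / 3" "|ev (s (r n)) t - ev (s (r n)) q| <= d / 3"
    using q(2) s R by blast+
   ultimately show "|ev (s (r m)) t - ev (s (r n)) t| <= d" by linarith
  qed
 qed
qed

lemma ev_diff:
 assumes "u \<in> H1" "v \<in> H1" "t > 0"
 shows "ev (u - v) t = ev u t - ev v t"
proof -
 have e: "u - v = (%x. u x + (%x. (-1) * v x) x)" by (auto simp: fun_eq_iff)
 show ?thesis unfolding e using ev_add[OF assms(1) H1_scale[OF assms(2), of "-1"] assms(3)] ev_scale[OF assms(2), of "-1" t] by simp
qed

lemma radial_annulus_le:
 assumes u: "u \<in> H1_rad" and le: "!!t. t \<in> {r^2..R^2} ==> |ev u t| <= d" and r: "0 < r"
 shows "AE x in R3. r <= norm x & norm x <= R --> |u x| <= d"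
 using radial_ev[OF u]
proof eventually_elim
 case (elim x)
 show ?case
 proof
  assume "r <= norm x & norm x <= R"
  hence "(norm x)^2 \<in> {r^2..R^2}" using r by (auto intro: power_mono)
  thus "|u x| <= d" using le elim by simp
 qed
qed

section \<open>The variational setting\<close>

locale problem = nonlinearity f for f :: "real => real" +
 fixes \<mu> :: real
 assumes mu_pos: "\<mu> > 0"
begin

definition ip :: "(real^3 => real) => (real^3 => real) => real" where
 "ip u v = (LINT x|R3. grad u x \<bullet> grad v x) + \<mu> * (LINT x|R3. u x * v x)"

lemma ip_self: "ip u u = n2 (grad u) + \<mu> * n2 u"
proof -
 have "grad u x \<bullet> grad u x = (norm (grad u x))^2" "u x * u x = (norm (u x))^2" for x
  by (simp add: dot_square_norm, simp add: power2_eq_square)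
 thus ?thesis by (simp only: ip_def n2_def)
qed

lemma ip_normsq: "ip u u = normsq_mu \<mu> u"
 by (simp add: ip_self normsq_mu_n2)

lemma ip_add_left:
 assumes u: "u \<in> H1_rad" "v \<in> H1_rad" "w \<in> H1_rad"
 shows "ip (u + v) w = ip u w + ip v w"
proof -
 note H = H1_rad_H1[OF u(1)] H1_rad_H1[OF u(2)] H1_rad_H1[OF u(3)]
 have "u + v = (%x. u x + v x)" by (auto simp: fun_eq_iff)
 note 1 = grad_add_inner[OF H(1,2) grad_l2[OF H(3)], folded this]
 have 2: "(LINT x|R3. (u + v) x * w x) = (LINT x|R3. u x * w x) + (LINT x|R3. v x * w x)"
  unfolding plus_fun_apply distrib_right by (rule Bochner_Integration.integral_add) (intro l2_times H1_l2 H)+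
 show ?thesis unfolding ip_def 1 2 by (simp add: algebra_simps)
qed

lemma ip_scale_left:
 assumes u: "u \<in> H1_rad" "w \<in> H1_rad"
 shows "ip (c *\<^sub>R u) w = c * ip u w"
proof -
 have "c *\<^sub>R u = (%x. c * u x)" by (auto simp: fun_eq_iff)
 thus ?thesis
  using grad_scale_inner[OF H1_rad_H1[OF u(1)] grad_borel[OF H1_rad_H1[OF u(2)]], of c]
  by (simp add: ip_def algebra_simps)
qed

lemma ip_diff_self:
 assumes "u \<in> H1_rad" "v \<in> H1_rad"
 shows "ip (u - v) (u - v) = n2 (%x. grad u x - grad v x) + \<mu> * n2 (%x. u x - v x)"
 using n2_diff_cong[OF H1_rad_H1[OF assms(1)] H1_rad_H1[OF assms(2)]] by (simp add: ip_self fun_diff_def)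

text \<open>Functions and gradients converge separately in L2, and the weak gradient passes to the
  limit. The limit is radial because an almost everywhere convergent subsequence has a pointwise
  limit of profiles.\<close>

lemma ip_complete:
 assumes s: "!!n::nat. s n \<in> H1_rad"
  and C: "ALL e>0. EX N. ALL m>=N. ALL n>=N. ip (s m - s n) (s m - s n) < e"
 shows "EX u:H1_rad. (%n. ip (s n - u) (s n - u)) ----> 0"
proof -
 note sH = H1_rad_H1[OF s]
 have C1: "EX N. ALL m>=N. ALL n>=N. n2 (%x. grad (s m) x - grad (s n) x) < e" if "e > 0" for e
 proof -
  obtain N where N: "ALL m>=N. ALL n>=N. ip (s m - s n) (s m - s n) < e" using C \<open>e > 0\<close> by blast
  have "n2 (%x. grad (s m) x - grad (s n) x) <= ip (s m - s n) (s m - s n)" for m n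
   using mu_pos n2_nonneg[of "%x. s m x - s n x"] by (simp add: ip_diff_self s)
  thus ?thesis using N by (meson le_less_trans)
 qed
 have C2: "EX N. ALL m>=N. ALL n>=N. n2 (%x. s m x - s n x) < e" if "e > 0" for e
 proof -
  obtain N where N: "ALL m>=N. ALL n>=N. ip (s m - s n) (s m - s n) < \<mu> * e" using C \<open>e > 0\<close> mu_pos by (meson mult_pos_pos)
  have "\<mu> * n2 (%x. s m x - s n x) <= ip (s m - s n) (s m - s n)" for m n
   using n2_nonneg[of "%x. grad (s m) x - grad (s n) x"] by (simp add: ip_diff_self s)
  hence "\<mu> * n2 (%x. s m x - s n x) < \<mu> * e" if "m >= N" "n >= N" for m n using N that by (meson le_less_trans)
  thus ?thesis using mu_pos by auto
 qed
 have "EX u r. l2 u & (%n. n2 (%x. s n x - u x)) ----> 0 & strict_mono (r::nat => nat) &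
  (AE x in R3. (%n. s (r n) x) ----> u x)"
  by (rule l2_complete[OF H1_l2[OF sH]]) (rule C2)
 then
 obtain u and r :: "nat => nat" where u: "l2 u" "(%n. n2 (%x. s n x - u x)) ----> 0" "strict_mono r"
   "AE x in R3. (%n. s (r n) x) ----> u x"
  by (elim exE conjE)
 have "EX h r. l2 h & (%n. n2 (%x. grad (s n) x - h x)) ----> 0 & strict_mono (r::nat => nat) &
  (AE x in R3. (%n. grad (s (r n)) x) ----> h x)"
  by (rule l2_complete[OF grad_l2[OF sH]]) (rule C1)
 then
 obtain h and r' :: "nat => nat" where h: "l2 h" "(%n. n2 (%x. grad (s n) x - h x)) ----> 0"
   "strict_mono r'" "AE x in R3. (%n. grad (s (r' n)) x) ----> h x"
  by (elim exE conjE)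
 have w: "weak_grad u h"
  by (rule weak_grad_limit[OF H1_l2[OF sH] u(1,2) grad_l2[OF sH] h(1,2) grad_weak[OF sH]])
 have uH: "u \<in> H1" by (rule H1_I[OF u(1) h(1) w])
 have "radial u"
 proof -
  have "ALL n. EX k. AE x in R3. s n x = k (norm x)" using s by (auto simp: H1_rad_def radial_def)
  then obtain k where k: "!!n. AE x in R3. s n x = k n (norm x)" by metis
  have "AE x in R3. ALL n. s (r n) x = k (r n) (norm x)" unfolding AE_all_countable using k by blast
  hence "AE x in R3. u x = lim (%n. k (r n) (norm x))"
   using u(4)
  proof eventually_elim
   case (elim x)
   thus ?case by (simp add: limI)
  qed
  thus ?thesis unfolding radial_def by (rule exI[of _ "%t. lim (%n. k (r n) t)"])
 qed
 hence uR: "u \<in> H1_rad" using uH by (simp add: H1_rad_def)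
 have gu: "AE x in R3. grad u x = h x" by (rule grad_eq[OF uH h(1) w])
 note [measurable] = grad_borel[OF uH] l2_borel[OF h(1)] grad_borel[OF sH]
 have "n2 (%x. grad (s n) x - grad u x) = n2 (%x. grad (s n) x - h x)" for n
  by (rule n2_cong_AE) (use gu in \<open>auto elim!: eventually_mono\<close>)
 hence eq: "ip (s n - u) (s n - u) = n2 (%x. grad (s n) x - h x) + \<mu> * n2 (%x. s n x - u x)" for n
  by (simp add: ip_diff_self s uR)
 have "(%n. n2 (%x. grad (s n) x - h x) + \<mu> * n2 (%x. s n x - u x)) ----> 0 + \<mu> * 0"
  by (intro tendsto_intros h u)
 hence "(%n. ip (s n - u) (s n - u)) ----> 0" unfolding eq by simp
 thus ?thesis using uR by blast
qed

sublocale H: semi_hilbert H1_rad ip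
proof
 show "EX u:H1_rad. (%n. ip (s n - u) (s n - u)) ----> 0"
  if "ALL n. s n \<in> H1_rad" "ALL e>0. EX N. ALL m>=N. ALL n>=N. ip (s m - s n) (s m - s n) < e" for s :: "nat => real^3 => real"
  by (rule ip_complete) (use that in auto)
 show "ip u v = ip v u" if "u \<in> H1_rad" "v \<in> H1_rad" for u v by (simp add: ip_def inner_commute mult.commute)
 show "0 <= ip u u" if "u \<in> H1_rad" for u using mu_pos by (simp add: ip_self n2_nonneg)
qed (simp_all add: zero_H1_rad H1_rad_add H1_rad_scale ip_add_left ip_scale_left)

text \<open>One constant through which the norm controls the gradient norm and the L2 norm, hence
  both bounds in \<open>rb\<close>.\<close>

definition C0 :: real where "C0 = max 1 (1 / sqrt \<mu>)"

lemma C0_ge_1: "1 <= C0" by (simp add: C0_def)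

lemma sqrt_n2_grad: "u \<in> H1_rad ==> sqrt (n2 (grad u)) <= H.nm u"
 using mu_pos by (simp add: H.nm_def ip_self n2_nonneg)

lemma sqrt_n2: "u \<in> H1_rad ==> sqrt (n2 u) <= C0 * H.nm u"
proof -
 assume u: "u \<in> H1_rad"
 have "sqrt \<mu> * sqrt (n2 u) <= H.nm u"
  using mu_pos by (simp add: H.nm_def ip_self n2_nonneg flip: real_sqrt_mult)
 hence "sqrt (n2 u) <= 1 / sqrt \<mu> * H.nm u" using mu_pos by (simp add: pos_le_divide_eq mult.commute)
 also have "... <= C0 * H.nm u" by (intro mult_right_mono) (auto simp: C0_def H.nm_nonneg u)
 finally show ?thesis .
qed

lemma rb_nm:
 assumes u: "u \<in> H1_rad"
 shows "rb (C0 * H.nm u) u"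
 unfolding rb_def
proof (intro conjI)
 show "l2 u" by (rule H1_l2[OF H1_rad_H1[OF u]])
 show "n2 u <= (C0 * H.nm u)^2"
  using sqrt_n2[OF u] power_mono[of "sqrt (n2 u)" "C0 * H.nm u" 2] by (simp add: n2_nonneg)
 have "H.nm u <= C0 * H.nm u" using C0_ge_1 H.nm_nonneg[OF u] by (simp add: mult_le_cancel_right1)
 hence le: "sqrt (n2 (grad u)) <= C0 * H.nm u" using sqrt_n2_grad[OF u] by linarith
 show "AE x in R3. |u x| <= C0 * H.nm u / sqrt (norm x)"
  using radial_decay[OF u]
 proof eventually_elim
  case (elim x)
  have "sqrt (n2 (grad u)) / sqrt (norm x) <= C0 * H.nm u / sqrt (norm x)" using le by (intro divide_right_mono) auto
  thus ?case using elim by linarith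
 qed
qed

lemma rb_nm_le:
 assumes u: "u \<in> H1_rad" and R: "H.nm u <= R"
 shows "rb (C0 * R) u"
 using rb_mono[OF rb_nm[OF u]] C0_ge_1 H.nm_nonneg[OF u] R by (simp add: mult_left_mono)

end

section \<open>The local term as a differentiable functional\<close>

lemma L1_le_bound:
 fixes c w :: "real^3 => real"
 assumes "(LINT x|R3. |c x * w x| ) <= K"
 shows "|LINT x|R3. c x * w x| <= K"
 using integral_abs_bound[of R3 "%x. c x * w x"] assms by linarith

lemma (in nonlinearity) f_uniform:
 assumes "d > 0"
 obtains e where "e > 0" "!!a b. |a| <= T ==> |b| <= T ==> |a - b| <= e ==> |f a - f b| <= d"
proof -
 have "uniformly_continuous_on {-T..T} f"
  by (rule compact_uniformly_continuous[OF continuous_on_subset[OF f_cont]]) auto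
 then obtain e where e: "e > 0" "!!a b. a \<in> {-T..T} ==> b \<in> {-T..T} ==> dist a b < e ==> dist (f a) (f b) < d"
  unfolding uniformly_continuous_on_def using assms by metis
 show ?thesis
 proof (rule that[of "e / 2"])
  show "e / 2 > 0" using e by simp
  fix a b assume "|a| <= T" "|b| <= T" "|a - b| <= e / 2"
  hence "a \<in> {-T..T}" "b \<in> {-T..T}" "dist a b < e" using e(1) by (auto simp: dist_real_def)
  from e(2)[OF this] show "|f a - f b| <= d" by (simp add: dist_real_def)
 qed
qed

context problem
begin

definition Phi :: "(real^3 => real) => real" where
 "Phi u = (LINT x|R3. F (u x))"

definition dPhi :: "(real^3 => real) => (real^3 => real) => real" where
 "dPhi u v = (LINT x|R3. f (u x) * v x)"

lemma f_fcl:
 assumes "rb R u"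
 shows "(%x. f (u x)) \<in> fcl R"
proof -
 note [measurable] = rb_borel[OF assms]
 have "AE x in R3. EX \<xi>. |\<xi>| <= |u x| & |f (u x)| <= 2 * |f \<xi>|" by (intro AE_I2 exI[of _ "u _"]) auto
 thus ?thesis unfolding fcl_def using assms by auto
qed

text \<open>Off the diagonal the difference quotient equals \<open>f\<close> at a mean-value point,
  yet it is measurable without selecting such points; the value 0 on the diagonal is harmless, as it
  is multiplied by b - a.\<close>

definition slope :: "real => real => real" where
 "slope a b = (if b = a then 0 else (F b - F a) / (b - a))"

lemma slope_eq: "F b - F a = slope a b * (b - a)"
 by (simp add: slope_def)

lemma slope_mean:
 obtains \<xi> where "|\<xi> - a| <= |b - a|" "|\<xi>| <= max |a| |b|" "b ~= a ==> slope a b = f \<xi>"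
proof -
 obtain \<xi> where "|\<xi> - a| <= |b - a|" "|\<xi>| <= max |a| |b|" "F b - F a = (b - a) * f \<xi>" by (rule F_slope)
 thus ?thesis by (intro that[of \<xi>]) (auto simp: slope_def)
qed

lemma slope_measurable [measurable]:
 assumes [measurable]: "u \<in> borel_measurable M" "v \<in> borel_measurable M"
 shows "(%x. slope (u x) (v x)) \<in> borel_measurable M"
 unfolding slope_def by measurable

lemma slope_fcl:
 assumes u: "rb R u" and v: "rb S v" and RS: "0 <= R" "0 <= S"
 shows "(%x. slope (u x) (v x)) \<in> fcl (R + S)"
proof -
 note [measurable] = rb_borel[OF u] rb_borel[OF v]
 have "EX \<xi>. |\<xi>| <= | |u x| + |v x| | & |slope (u x) (v x)| <= 2 * |f \<xi>|" for x
 proof -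
  obtain \<xi> where "|\<xi>| <= max |u x| |v x|" "v x ~= u x ==> slope (u x) (v x) = f \<xi>"
   using slope_mean[of "u x" "v x"] by metis
  thus ?thesis by (intro exI[of _ \<xi>]) (cases "v x = u x", auto simp: slope_def)
 qed
 thus ?thesis unfolding fcl_def using rb_abs_add[OF u v RS] by auto
qed

lemma rb_zero: "0 <= R ==> rb R (%x. 0)"
 by (simp add: rb_def l2_zero n2_def)

lemma F_integrable:
 assumes u: "rb R u" and R: "0 <= R"
 shows "integrable R3 (%x. F (u x))"
proof -
 have "integrable R3 (%x. slope 0 (u x) * u x)"
  by (rule tight_integrable[OF tight_fcl slope_fcl[OF rb_zero u] u]) (use R in auto)
 moreover have "slope 0 (u x) * u x = F (u x)" for x using slope_eq[of "u x" 0] by simp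
 ultimately show ?thesis by simp
qed

lemma Phi_diff:
 assumes u: "rb R u" and v: "rb S v" and RS: "0 <= R" "0 <= S"
 shows "Phi v - Phi u = (LINT x|R3. slope (u x) (v x) * (v x - u x))"
 unfolding Phi_def slope_eq[symmetric] using F_integrable[OF u RS(1)] F_integrable[OF v RS(2)] by simp

lemma dPhi_integrable: "rb R u ==> rb S v ==> 0 <= R ==> 0 <= S ==> integrable R3 (%x. f (u x) * v x)"
 by (rule tight_integrable[OF tight_fcl f_fcl])

lemma rbV: "u \<in> H1_rad ==> rb (C0 * H.nm u) u" "u \<in> H1_rad ==> 0 <= C0 * H.nm u"
 using rb_nm C0_ge_1 H.nm_nonneg by auto

lemma C0_pos: "C0 > 0" using C0_ge_1 by linarith

text \<open>In the second part the coefficient is set to 0 where v = u, since \<open>slope\<close>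
  is 0 there and would leave -f(u) uncancelled.\<close>

lemma diff_fcl:
 assumes u: "rb R u" and v: "rb S v" and RS: "0 <= R" "0 <= S"
 shows "(%x. f (v x) - f (u x)) \<in> fcl (R + S)"
  and "(%x. if v x = u x then 0 else slope (u x) (v x) - f (u x)) \<in> fcl (R + S)"
proof -
 note [measurable] = rb_borel[OF u] rb_borel[OF v]
 have two: "EX \<xi>. |\<xi>| <= T & |f a - f b| <= 2 * |f \<xi>|" if "|a| <= T" "|b| <= T" for a b T
 proof (cases "|f a| <= |f b|")
  case True
  thus ?thesis using that by (intro exI[of _ b]) auto
 next
  case False
  thus ?thesis using that by (intro exI[of _ a]) auto
 qed
 have "EX \<xi>. |\<xi>| <= | |u x| + |v x| | & |f (v x) - f (u x)| <= 2 * |f \<xi>|" for x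
  by (rule two) auto
 thus "(%x. f (v x) - f (u x)) \<in> fcl (R + S)"
  unfolding fcl_def using rb_abs_add[OF u v RS] by auto
 have "EX \<xi>. |\<xi>| <= | |u x| + |v x| | & |if v x = u x then 0 else slope (u x) (v x) - f (u x)| <= 2 * |f \<xi>|" for x
 proof (cases "v x = u x")
  case False
  obtain \<xi> where "|\<xi>| <= max |u x| |v x|" "v x ~= u x ==> slope (u x) (v x) = f \<xi>"
   using slope_mean[of "u x" "v x"] by metis
  thus ?thesis using two[of \<xi> "| |u x| + |v x| |" "u x"] False by auto
 qed (auto intro: exI[of _ 0])
 hence ae: "AE x in R3. EX \<xi>. |\<xi>| <= | |u x| + |v x| | & |if v x = u x then 0 else slope (u x) (v x) - f (u x)| <= 2 * |f \<xi>|"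
  by (intro AE_I2)
 show "(%x. if v x = u x then 0 else slope (u x) (v x) - f (u x)) \<in> fcl (R + S)"
  unfolding fcl_def
  by (intro CollectI conjI exI[of _ "%x. |u x| + |v x|"] rb_abs_add[OF u v RS] ae) measurable
qed

lemma close_on_annulus:
 assumes u: "u \<in> H1_rad" "v \<in> H1_rad" and R: "H.nm u <= R" "H.nm v <= R" and d: "H.nm (v - u) <= e * sqrt r / C0" and r: "0 < r"
 shows "AE x in R3. r <= norm x & norm x <= R' -->
  |u x| <= C0 * R / sqrt r & |v x| <= C0 * R / sqrt r & |v x - u x| <= e"
proof -
 have R0: "0 <= R" using H.nm_nonneg[OF u(1)] R by linarith
 have w: "v - u \<in> H1_rad" by (rule H1_rad_diff[OF u(2,1)])
 have "C0 * H.nm (v - u) / sqrt r <= e"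
  using d r C0_pos by (simp add: pos_le_divide_eq pos_divide_le_eq mult.commute)
 moreover have C: "0 <= C0 * R" using C0_pos R0 by simp
 ultimately have e': "C0 * H.nm (v - u) / sqrt r <= e" and C: "0 <= C0 * R" by simp_all
 show ?thesis
  using rb_annulus[OF rb_nm_le[OF u(1) R(1)] r C, of R'] rb_annulus[OF rb_nm_le[OF u(2) R(2)] r C, of R']
   rb_annulus[OF rbV(1)[OF w] r rbV(2)[OF w], of R']
 proof eventually_elim
  case (elim x)
  thus ?case using e' by auto
 qed
qed

text \<open>On an annulus the functions are bounded and uniformly close
  (\<open>close_on_annulus\<close>), so uniform continuity of \<open>f\<close> makes both
  coefficients small there; \<open>tight_small_c\<close> turns this into a bound in the dual
  norm.\<close>

lemma Phi_c1_diff: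
 assumes e: "e > 0"
 shows "EX d>0. ALL u:H1_rad. ALL v:H1_rad. H.nm u <= R --> H.nm v <= R --> H.nm (v - u) <= d -->
    |Phi v - Phi u - dPhi u (v - u)| <= e * H.nm (v - u)" (is ?A)
  and "EX d>0. ALL u:H1_rad. ALL v:H1_rad. H.nm u <= R --> H.nm v <= R --> H.nm (v - u) <= d -->
    (ALL w:H1_rad. |dPhi v w - dPhi u w| <= e * H.nm w)" (is ?B)
proof -
 define S where "S = C0 * |R|"
 have S: "S >= 0" using C0_pos by (simp add: S_def)
 have rbS: "rb S u" if "u \<in> H1_rad" "H.nm u <= R" for u
  unfolding S_def by (rule rb_nm_le[OF that(1)]) (use that in linarith)
 have eC: "e / C0 > 0" using e C0_pos by simp
 obtain r R' d where r: "0 < r" "r < R'" "0 < d"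
  and T: "!!c T w. c \<in> fcl (S + S) ==> (AE x in R3. r <= norm x & norm x <= R' --> |c x| <= d) ==> 0 <= T ==> rb T w ==>
   (LINT x|R3. |c x * w x| ) <= e / C0 * T"
  using tight_small_c[OF tight_fcl eC, of "S + S"] S by auto
 obtain h where h: "h > 0" "!!a b. |a| <= S / sqrt r ==> |b| <= S / sqrt r ==> |a - b| <= h ==> |f a - f b| <= d"
  using f_uniform[OF r(3)] by blast
 define dd where "dd = h * sqrt r / C0"
 have dd: "dd > 0" using h r C0_pos by (simp add: dd_def)
 have close: "AE x in R3. r <= norm x & norm x <= R' --> |u x| <= S / sqrt r & |v x| <= S / sqrt r & |v x - u x| <= h"
  if "u \<in> H1_rad" "v \<in> H1_rad" "H.nm u <= R" "H.nm v <= R" "H.nm (v - u) <= dd" for u v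
  unfolding S_def by (rule close_on_annulus) (use that r dd_def in auto)
 have app: "|LINT x|R3. c x * w x| <= e * H.nm w"
  if c: "c \<in> fcl (S + S)" and a: "AE x in R3. r <= norm x & norm x <= R' --> |c x| <= d" and w: "w \<in> H1_rad" for c w
  using L1_le_bound[OF T[OF c a rbV(2)[OF w] rbV(1)[OF w]]] C0_pos by simp
 show ?A
 proof (rule exI[of _ dd], intro conjI dd ballI impI)
  fix u v assume uv: "u \<in> H1_rad" "v \<in> H1_rad" "H.nm u <= R" "H.nm v <= R" "H.nm (v - u) <= dd"
  note ru = rbS[OF uv(1,3)] and rv = rbS[OF uv(2,4)]
  have w: "v - u \<in> H1_rad" by (rule H1_rad_diff[OF uv(2,1)])
  let ?c = "%x. if v x = u x then 0 else slope (u x) (v x) - f (u x)"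
  have "AE x in R3. r <= norm x & norm x <= R' --> |?c x| <= d"
   using close[OF uv]
  proof eventually_elim
   case (elim x)
   show ?case
   proof
    assume x: "r <= norm x & norm x <= R'"
    obtain \<xi> where xi: "|\<xi> - u x| <= |v x - u x|" "|\<xi>| <= max |u x| |v x|" "v x ~= u x ==> slope (u x) (v x) = f \<xi>"
     using slope_mean[of "u x" "v x"] by metis
    have "|\<xi>| <= S / sqrt r" using elim x by (intro order_trans[OF xi(2)] max.boundedI) auto
    hence "|f \<xi> - f (u x)| <= d" using elim x xi by (intro h(2)) auto
    thus "|?c x| <= d" using xi(3) r(3) by auto
   qed
  qed
  from app[OF diff_fcl(2)[OF ru rv S S] this w]
  have 1: "|LINT x|R3. ?c x * (v - u) x| <= e * H.nm (v - u)" .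
  have i1: "integrable R3 (%x. slope (u x) (v x) * (v x - u x))"
   unfolding slope_eq[symmetric] using F_integrable[OF ru S] F_integrable[OF rv S] by simp
  have i2: "integrable R3 (%x. f (u x) * (v - u) x)"
   by (rule dPhi_integrable[OF ru rbV(1)[OF w] S rbV(2)[OF w]])
  have "Phi v - Phi u - dPhi u (v - u) = (LINT x|R3. slope (u x) (v x) * (v x - u x) - f (u x) * (v - u) x)"
   unfolding Phi_diff[OF ru rv S S] dPhi_def using i1 i2 by simp
  also have "... = (LINT x|R3. ?c x * (v - u) x)"
   by (intro LINT_cong) (auto simp: left_diff_distrib)
  finally show "|Phi v - Phi u - dPhi u (v - u)| <= e * H.nm (v - u)" using 1 by simp
 qed
 show ?B
 proof (rule exI[of _ dd], intro conjI dd ballI impI)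
  fix u v w assume uv: "u \<in> H1_rad" "v \<in> H1_rad" "H.nm u <= R" "H.nm v <= R" "H.nm (v - u) <= dd" and w: "w \<in> H1_rad"
  note ru = rbS[OF uv(1,3)] and rv = rbS[OF uv(2,4)]
  have "AE x in R3. r <= norm x & norm x <= R' --> |f (v x) - f (u x)| <= d"
   using close[OF uv] by eventually_elim (auto intro: h(2))
  from app[OF diff_fcl(1)[OF ru rv S S] this w]
  have "|LINT x|R3. (f (v x) - f (u x)) * w x| <= e * H.nm w" .
  moreover have "(LINT x|R3. (f (v x) - f (u x)) * w x) = dPhi v w - dPhi u w"
   unfolding dPhi_def left_diff_distrib
   using dPhi_integrable[OF rv rbV(1)[OF w] S rbV(2)[OF w]] dPhi_integrable[OF ru rbV(1)[OF w] S rbV(2)[OF w]] by simp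
  ultimately show "|dPhi v w - dPhi u w| <= e * H.nm w" by simp
 qed
qed

lemma Phi_c1_bdd:
 "EX C>=0. ALL u:H1_rad. H.nm u <= R --> |Phi u| <= C & (ALL w:H1_rad. |dPhi u w| <= C * H.nm w)"
proof -
 define S where "S = C0 * |R|"
 have S: "S >= 0" using C0_pos by (simp add: S_def)
 have rbS: "rb S u" if "u \<in> H1_rad" "H.nm u <= R" for u
  unfolding S_def by (rule rb_nm_le[OF that(1)]) (use that in linarith)
 obtain K where K: "K >= 0" "!!c T w. c \<in> fcl S ==> 0 <= T ==> rb T w ==> (LINT x|R3. |c x * w x| ) <= K * T"
  using tight_bound[OF tight_fcl[OF S]] by blast
 show ?thesis
 proof (rule exI[of _ "K * S + K * C0"], intro conjI ballI impI)
  show "0 <= K * S + K * C0" using K S C0_pos by simp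
  fix u assume u: "u \<in> H1_rad" "H.nm u <= R"
  have "|LINT x|R3. slope 0 (u x) * u x| <= K * S"
   using slope_fcl[OF rb_zero[of 0] rbS[OF u]] S by (intro L1_le_bound K(2)[OF _ S rbS[OF u]]) auto
  moreover have "slope 0 (u x) * u x = F (u x)" for x using slope_eq[of "u x" 0] by simp
  ultimately have "|Phi u| <= K * S" by (simp add: Phi_def)
  thus "|Phi u| <= K * S + K * C0" using mult_nonneg_nonneg[OF K(1) less_imp_le[OF C0_pos]] by linarith
  fix w assume w: "w \<in> H1_rad"
  have "|dPhi u w| <= K * (C0 * H.nm w)"
   unfolding dPhi_def by (intro L1_le_bound K(2)[OF f_fcl[OF rbS[OF u]] rbV(2)[OF w] rbV(1)[OF w]])
  also have "... <= (K * S + K * C0) * H.nm w"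
   using mult_nonneg_nonneg[OF mult_nonneg_nonneg[OF K(1) S] H.nm_nonneg[OF w]] by (simp add: distrib_right mult.assoc)
  finally show "|dPhi u w| <= (K * S + K * C0) * H.nm w" .
 qed
qed

text \<open>The subsequence is chosen before the family \<open>C\<close> and the tolerance
  \<open>e\<close>, so one extraction serves every tight family.\<close>

lemma common_subsequence:
 assumes s: "!!n::nat. s n \<in> H1_rad" and R: "!!n. H.nm (s n) <= R"
 obtains r :: "nat => nat" where "strict_mono r"
  "!!C e. tight C ==> 0 < e ==> EX N. ALL m>=N. ALL n>=N. ALL c:C. (LINT x|R3. |c x * (s (r m) - s (r n)) x| ) <= e"
proof -
 have gR: "sqrt (n2 (grad (s n))) <= R" for n using sqrt_n2_grad[OF s[of n]] R[of n] by linarith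
 have R0: "0 <= R" using H.nm_nonneg[OF s[of 0]] R[of 0] by linarith
 obtain r :: "nat => nat" where r: "strict_mono r"
  "!!a b d. 0 < a ==> 0 < d ==> EX N. ALL m>=N. ALL n>=N. ALL t:{a..b}. |ev (s (r m)) t - ev (s (r n)) t| <= d"
  using ev_subsequence[of s R, OF H1_rad_H1[OF s] gR] by blast
 show ?thesis
 proof (rule that[OF r(1)])
  fix C and e :: real assume C: "tight C" and e: "0 < e"
  define S where "S = C0 * (R + R)"
  have S: "0 <= S" using C0_pos R0 by (simp add: S_def)
  obtain a b d where ab: "0 < a" "a < b" "0 < d"
   and sm: "!!c w. c \<in> C ==> rb S w ==> (AE x in R3. a <= norm x & norm x <= b --> |w x| <= d) ==> (LINT x|R3. |c x * w x| ) <= e"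
   using tight_small_w[OF C e S] by blast
  obtain N where N: "!!m n t. m >= N ==> n >= N ==> t \<in> {a^2..b^2} ==> |ev (s (r m)) t - ev (s (r n)) t| <= d"
   using r(2)[OF zero_less_power[OF ab(1)] ab(3)] by blast
  show "EX N. ALL m>=N. ALL n>=N. ALL c:C. (LINT x|R3. |c x * (s (r m) - s (r n)) x| ) <= e"
  proof (rule exI[of _ N], intro allI impI ballI)
   fix m n c assume mn: "N <= m" "N <= n" and c: "c \<in> C"
   have w: "s (r m) - s (r n) \<in> H1_rad" by (rule H1_rad_diff[OF s s])
   have "H.nm (s (r m) - s (r n)) <= R + R"
    using H.nm_triangle_diff[OF s s, of "r m" "r n"] R[of "r m"] R[of "r n"] by linarith
   hence "rb S (s (r m) - s (r n))" unfolding S_def by (rule rb_nm_le[OF w])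
   moreover have "AE x in R3. a <= norm x & norm x <= b --> |(s (r m) - s (r n)) x| <= d"
   proof (rule radial_annulus_le[OF w _ ab(1)])
    fix t assume t: "t \<in> {a^2..b^2}"
    hence "a^2 <= t" by simp
    hence "t > 0" using zero_less_power[OF ab(1), of 2] by linarith
    thus "|ev (s (r m) - s (r n)) t| <= d"
     using N[OF mn t] by (simp add: ev_diff H1_rad_H1[OF s])
   qed
   ultimately show "(LINT x|R3. |c x * (s (r m) - s (r n)) x| ) <= e" by (rule sm[OF c])
  qed
 qed
qed

sublocale P: c1_functional H1_rad ip Phi dPhi
proof
 fix u v w assume V: "u \<in> H1_rad" "v \<in> H1_rad" "w \<in> H1_rad"
 show "dPhi u (v + w) = dPhi u v + dPhi u w"
  unfolding dPhi_def plus_fun_apply distrib_left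
  using dPhi_integrable[OF rbV(1)[OF V(1)] rbV(1)[OF V(2)] rbV(2)[OF V(1)] rbV(2)[OF V(2)]]
   dPhi_integrable[OF rbV(1)[OF V(1)] rbV(1)[OF V(3)] rbV(2)[OF V(1)] rbV(2)[OF V(3)]] by simp
next
 fix u v c
 show "dPhi u (c *\<^sub>R v) = c * dPhi u v" by (simp add: dPhi_def mult.left_commute)
 show "dPhi (- u) v = - dPhi u v" by (simp add: dPhi_def f_odd)
 show "Phi (- u) = Phi u" by (simp add: Phi_def F_even)
next
 fix s :: "nat => real^3 => real" and R :: real assume s: "!!n. s n \<in> H1_rad" and R: "!!n. H.nm (s n) <= R"
 obtain r :: "nat => nat" where r: "strict_mono r"
  "!!C e. tight C ==> 0 < e ==> EX N. ALL m>=N. ALL n>=N. ALL c:C. (LINT x|R3. |c x * (s (r m) - s (r n)) x| ) <= e"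
  using common_subsequence[of s R, OF s R] by blast
 have R0: "0 <= C0 * R" using H.nm_nonneg[OF s[of 0]] R[of 0] C0_pos by simp
 have c: "(%x. f (s m x)) \<in> fcl (C0 * R)" for m by (rule f_fcl[OF rb_nm_le[OF s R]])
 have "EX N. ALL m>=N. ALL n>=N. |dPhi (s (r m)) (s (r m) - s (r n))| <= e" if e: "e > 0" for e
 proof -
  obtain N where N: "!!m n c. m >= N ==> n >= N ==> c \<in> fcl (C0 * R) ==> (LINT x|R3. |c x * (s (r m) - s (r n)) x| ) <= e"
   using r(2)[OF tight_fcl[OF R0] e] by blast
  show ?thesis unfolding dPhi_def by (rule exI[of _ N], intro allI impI L1_le_bound N[OF _ _ c]) auto
 qed
 thus "EX r::nat => nat. strict_mono r & (ALL e>0. EX N. ALL m>=N. ALL n>=N. |dPhi (s (r m)) (s (r m) - s (r n))| <= e)"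
  using r(1) by blast
qed (fact Phi_c1_bdd Phi_c1_diff)+

section \<open>The nonlocal term as a differentiable functional\<close>

lemma V_l2: "u \<in> H1_rad ==> l2 u" by (rule H1_l2[OF H1_rad_H1])

lemma GG_c1_diff:
 assumes e: "e > 0"
 shows "EX d>0. ALL u:H1_rad. ALL v:H1_rad. H.nm u <= R --> H.nm v <= R --> H.nm (v - u) <= d -->
    |GG v - GG u - dGG u (v - u)| <= e * H.nm (v - u) & (ALL w:H1_rad. |dGG v w - dGG u w| <= e * H.nm w)"
proof -
 define S where "S = C0 * |R|"
 have S: "S >= 0" using C0_pos by (simp add: S_def)
 \<comment> \<open>With B <= 2 S the expansion gives 6 + 8 + 4 = 18 times S^2, and the difference of
   derivatives 4 * (4 + 1) = 20 times S^2; 20 covers both, and C0^2 converts L2 norms.\<close>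
 define K where "K = 20 * S^2 * C0^2 + 1"
 have K: "K > 0" by (simp add: K_def add_nonneg_pos)
 show ?thesis
 proof (rule exI[of _ "e / K"], intro conjI ballI impI)
  show "0 < e / K" using e K by simp
  fix u v assume uv: "u \<in> H1_rad" "v \<in> H1_rad" "H.nm u <= R" "H.nm v <= R" "H.nm (v - u) <= e / K"
  have h: "v - u \<in> H1_rad" by (rule H1_rad_diff[OF uv(2,1)])
  have veq: "v = (%x. u x + (v - u) x)" by (auto simp: fun_eq_iff)
  define n where "n = H.nm (v - u)"
  define A where "A = sqrt (n2 u)"
  define B where "B = sqrt (n2 (v - u))"
  have n0: "n >= 0" by (simp add: n_def H.nm_nonneg h)
  have A: "0 <= A" "A * A = n2 u" by (simp_all add: A_def n2_nonneg)
  have B: "0 <= B" "B * B = n2 (v - u)" by (simp_all add: B_def n2_nonneg)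
  have AS: "A <= S" unfolding A_def S_def
   using sqrt_n2[OF uv(1)] mult_left_mono[of "H.nm u" "|R|" C0] uv(3) C0_pos by linarith
  have VS: "sqrt (n2 v) <= S" unfolding S_def
   using sqrt_n2[OF uv(2)] mult_left_mono[of "H.nm v" "|R|" C0] uv(4) C0_pos by linarith
  have VS2: "n2 v <= S * S" using mult_mono[OF VS VS] S n2_nonneg[of v] by simp
  have Bn: "B <= C0 * n" unfolding B_def n_def by (rule sqrt_n2[OF h])
  have B2S: "B <= 2 * S"
  proof -
   have "n <= |R| + |R|" using H.nm_triangle_diff[OF uv(2,1)] uv(3,4) unfolding n_def by linarith
   hence "C0 * n <= C0 * ( |R| + |R| )" using C0_pos by (intro mult_left_mono) auto
   thus ?thesis using Bn by (simp add: S_def distrib_left)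
  qed
  have Kn: "K * n <= e" using uv(5) K by (simp add: n_def pos_le_divide_eq mult.commute)
  have BB: "B * B <= C0^2 * n * n" using mult_mono[OF Bn Bn] B n0 C0_pos by (simp add: power2_eq_square mult.assoc mult.left_commute)
  have "|GG v - GG u - dGG u (v - u)| <= B * B * (6 * (A * A) + 4 * A * B + B * B)"
   using GG_expand[OF V_l2[OF uv(1)] V_l2[OF h]] unfolding veq[symmetric] A(2) B(2) by (simp add: A_def B_def)
  also have "... <= (C0^2 * n * n) * (20 * S^2)"
  proof (rule mult_mono[OF BB])
   have "A * A <= S * S" "A * B <= S * (2 * S)" "B * B <= (2 * S) * (2 * S)"
    using mult_mono[OF AS AS S A(1)] mult_mono[OF AS B2S S B(1)] mult_mono[OF B2S B2S _ B(1)] S by simp_all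
   hence "6 * (A * A) + 4 * (A * B) + B * B <= 6 * (S * S) + 4 * (S * (2 * S)) + (2 * S) * (2 * S)" by linarith
   also have "... <= 20 * S^2" by (simp add: power2_eq_square)
   finally show "6 * (A * A) + 4 * A * B + B * B <= 20 * S^2" by simp
   show "0 <= 6 * (A * A) + 4 * A * B + B * B"
    using A(1) B(1) by (intro add_nonneg_nonneg mult_nonneg_nonneg) auto
  qed (use n0 in simp)
  also have "... <= K * n * n" using n0 by (simp add: K_def algebra_simps)
  also have "... <= e * n" using Kn n0 by (intro mult_right_mono)
  finally show "|GG v - GG u - dGG u (v - u)| <= e * H.nm (v - u)" by (simp add: n_def)
  fix w assume w: "w \<in> H1_rad"
  define W where "W = sqrt (n2 w)"
  have W: "0 <= W" "W <= C0 * H.nm w" using sqrt_n2[OF w] by (simp_all add: W_def n2_nonneg)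
  have "|dGG v w - dGG u w| <= 4 * ((2 * A * B + B * B) * (A * W) + n2 v * (B * W))"
   using dGG_lipschitz[OF V_l2[OF uv(1)] V_l2[OF h] V_l2[OF w]] unfolding veq[symmetric] B(2) by (simp add: A_def B_def W_def)
  also have "... <= 4 * ((4 * S * B) * (S * W) + S * S * (B * W))"
  proof -
   have "2 * A * B + B * B <= 4 * S * B"
    using mult_right_mono[OF AS B(1)] mult_right_mono[OF B2S B(1)] by simp
   hence "(2 * A * B + B * B) * (A * W) <= (4 * S * B) * (S * W)"
    using A B S W AS by (intro mult_mono) (auto intro: mult_right_mono)
   moreover have "n2 v * (B * W) <= S * S * (B * W)" using VS2 B W by (intro mult_right_mono) auto
   ultimately show ?thesis by (intro mult_left_mono add_mono) auto
  qed
  also have "... = 20 * S^2 * (B * W)" by (simp add: power2_eq_square algebra_simps)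
  also have "... <= 20 * S^2 * ((C0 * n) * (C0 * H.nm w))"
   using Bn B W n0 C0_pos by (intro mult_left_mono mult_mono) auto
  also have "... <= K * n * H.nm w" using mult_nonneg_nonneg[OF n0 H.nm_nonneg[OF w]] by (simp add: K_def power2_eq_square algebra_simps)
  also have "... <= e * H.nm w" using Kn H.nm_nonneg[OF w] by (intro mult_right_mono)
  finally show "|dGG v w - dGG u w| <= e * H.nm w" .
 qed
qed

lemma GG_c1_bdd:
 "EX C>=0. ALL u:H1_rad. H.nm u <= R --> |GG u| <= C & (ALL w:H1_rad. |dGG u w| <= C * H.nm w)"
proof -
 define S where "S = C0 * |R|"
 have S: "S >= 0" using C0_pos by (simp add: S_def)
 show ?thesis
 proof (rule exI[of _ "S ^ 4 + 4 * S ^ 3 * C0"], intro conjI ballI impI)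
  show "0 <= S ^ 4 + 4 * S ^ 3 * C0" using S C0_pos by simp
  fix u assume u: "u \<in> H1_rad" "H.nm u <= R"
  define A where "A = sqrt (n2 u)"
  have A: "0 <= A" "A * A = n2 u" by (simp_all add: A_def n2_nonneg)
  have AS: "A <= S" unfolding A_def S_def
   using sqrt_n2[OF u(1)] mult_left_mono[of "H.nm u" "|R|" C0] u(2) C0_pos by linarith
  have n2S: "n2 u <= S^2" using mult_mono[OF AS AS S A(1)] A(2) by (simp add: power2_eq_square)
  have "(n2 u)^2 <= (S^2)^2" using n2S n2_nonneg by (intro power_mono) auto
  hence "|GG u| <= S ^ 4" using GG_bound[OF V_l2[OF u(1)]] by (simp add: power_mult[symmetric])
  thus "|GG u| <= S ^ 4 + 4 * S ^ 3 * C0" using S C0_pos by (simp add: add_increasing2)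
  fix w assume w: "w \<in> H1_rad"
  have "|dGG u w| <= 4 * (n2 u * A * sqrt (n2 w))" using dGG_bound[OF V_l2[OF u(1)] V_l2[OF w]] by (simp add: A_def)
  also have "... <= 4 * (S^2 * S * (C0 * H.nm w))"
   using n2S AS A S sqrt_n2[OF w] n2_nonneg[of u] n2_nonneg[of w] by (intro mult_left_mono mult_mono) auto
  also have "... <= (S ^ 4 + 4 * S ^ 3 * C0) * H.nm w"
   using mult_nonneg_nonneg[OF zero_le_power[OF S, of 4] H.nm_nonneg[OF w]] by (simp add: algebra_simps power_eq_if)
  finally show "|dGG u w| <= (S ^ 4 + 4 * S ^ 3 * C0) * H.nm w" .
 qed
qed

sublocale N: c1_functional H1_rad ip GG dGG
proof
 fix u v w assume V: "u \<in> H1_rad" "v \<in> H1_rad" "w \<in> H1_rad"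
 show "dGG u (v + w) = dGG u v + dGG u w"
  using dGG_add[OF V_l2[OF V(1)] V_l2[OF V(2)] V_l2[OF V(3)]] by (simp add: plus_fun_def)
next
 fix u v c
 show "dGG u (c *\<^sub>R v) = c * dGG u v" using dGG_scale[of u c v] by (simp add: scaleR_fun_def)
 show "dGG (- u) v = - dGG u v" using dGG_uminus[of u v] by (simp add: fun_Compl_def)
 show "GG (- u) = GG u" using GG_scale[of "-1" u] by (simp add: fun_Compl_def)
next
 fix s :: "nat => real^3 => real" and R :: real assume s: "!!n. s n \<in> H1_rad" and R: "!!n. H.nm (s n) <= R"
 obtain r :: "nat => nat" where r: "strict_mono r"
  "!!C e. tight C ==> 0 < e ==> EX N. ALL m>=N. ALL n>=N. ALL c:C. (LINT x|R3. |c x * (s (r m) - s (r n)) x| ) <= e"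
  using common_subsequence[of s R, OF s R] by blast
 have R0: "0 <= C0 * R" using H.nm_nonneg[OF s[of 0]] R[of 0] C0_pos by simp
 have c: "(%x. phi (s m) x * s m x) \<in> pcl (C0 * R)" for m by (rule phi_times_pcl[OF rb_nm_le[OF s R]])
 have "EX N. ALL m>=N. ALL n>=N. |dGG (s (r m)) (s (r m) - s (r n))| <= e" if e: "e > 0" for e
 proof -
  have e4: "e / 4 > 0" using e by simp
  obtain N where N: "!!m n c. m >= N ==> n >= N ==> c \<in> pcl (C0 * R) ==> (LINT x|R3. |c x * (s (r m) - s (r n)) x| ) <= e / 4"
   using r(2)[OF tight_pcl[OF R0] e4] by blast
  show ?thesis
  proof (rule exI[of _ N], intro allI impI)
   fix m n assume "N <= m" "N <= n"
   from L1_le_bound[OF N[OF this c[of "r m"]]] show "|dGG (s (r m)) (s (r m) - s (r n))| <= e" by (simp add: dGG_def abs_mult)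
  qed
 qed
 thus "EX r::nat => nat. strict_mono r & (ALL e>0. EX N. ALL m>=N. ALL n>=N. |dGG (s (r m)) (s (r m) - s (r n))| <= e)"
  using r(1) by blast
qed (fact GG_c1_bdd, (frule GG_c1_diff, blast)+)

lemma GG_positive: "u \<in> H1_rad ==> H.nm u > 0 ==> GG u > 0"
proof -
 assume u: "u \<in> H1_rad" and p: "H.nm u > 0"
 have "n2 u ~= 0"
 proof
  assume z: "n2 u = 0"
  have "AE x in R3. u x = 0" by (rule n2_zero_AE[OF V_l2[OF u] z])
  hence "AE x in R3. grad u x = 0" by (rule grad_zero_AE[OF H1_rad_H1[OF u]])
  hence "n2 (grad u) = (LINT x|R3. 0)" unfolding n2_def
   by (intro integral_cong_AE) (use l2_measurable[OF grad_l2[OF H1_rad_H1[OF u]]] in \<open>auto elim!: eventually_mono\<close>)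
  thus False using p z by (simp add: H.nm_def ip_self)
 qed
 thus "GG u > 0" using GG_pos[OF V_l2[OF u]] n2_nonneg[of u] by simp
qed

text \<open>The functionals are the profile values at the points of a finite net. If all of them
  vanish, u is small on a whole annulus, which makes GG u at most 1/2 and puts u off the
  constraint.\<close>

lemma GG_finite_rank:
 "EX (m::nat) l. (ALL i<m. (ALL u:H1_rad. ALL v:H1_rad. l i (u + v) = l i u + l i v) & (EX C. ALL u:H1_rad. |l i u| <= C * H.nm u))
    & (ALL u:H1_rad. H.nm u <= R --> GG u = 1 --> (EX i<m. l i u ~= (0::real)))"
proof -
 define S where "S = C0 * |R|"
 have S: "S >= 0" using C0_pos by (simp add: S_def)
 obtain r R' d where r: "0 < r" "r < R'" "0 < d"
  and sm: "!!c w. c \<in> pcl S ==> rb S w ==> (AE x in R3. r <= norm x & norm x <= R' --> |w x| <= d) ==> (LINT x|R3. |c x * w x| ) <= 1 / 2"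
  using tight_small_w[OF tight_pcl[OF S] _ S, of "1 / 2"] by auto
 obtain K where K: "finite K" "K \<subseteq> {q \<in> \<rat>. 0 < q}"
  "!!t. t \<in> {r^2..R'^2} ==> EX q:K. ALL u:H1. sqrt (n2 (grad u)) <= R --> |ev u t - ev u q| <= d"
  using ev_net[of "r^2" d "R'^2" R] r by auto
 obtain q :: "nat => real" where q: "K = q ` {..<card K}"
  using ex_bij_betw_nat_finite[OF K(1)] unfolding bij_betw_def by (metis atLeast0LessThan)
 show ?thesis
 proof (rule exI[of _ "card K"], rule exI[of _ "%i u. ev u (q i)"], intro conjI allI impI ballI)
  fix i assume "i < card K"
  hence "q i \<in> K" using q by auto
  hence qi: "q i > 0" using K(2) by auto
  show "ev (u + v) (q i) = ev u (q i) + ev v (q i)" if "u \<in> H1_rad" "v \<in> H1_rad" for u v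
   using ev_add[OF H1_rad_H1[OF that(1)] H1_rad_H1[OF that(2)] qi] by (simp add: plus_fun_def)
  have "|ev u (q i)| <= 1 / sqrt (sqrt (q i)) * H.nm u" if u: "u \<in> H1_rad" for u
  proof -
   have "|ev u (q i)| <= sqrt (n2 (grad u)) / sqrt (sqrt (q i))" by (rule ev_bound[OF H1_rad_H1[OF u] qi])
   also have "... <= H.nm u / sqrt (sqrt (q i))" using qi by (intro divide_right_mono sqrt_n2_grad[OF u]) auto
   finally show ?thesis by simp
  qed
  thus "EX C. ALL u:H1_rad. |ev u (q i)| <= C * H.nm u" by blast
 next
  fix u assume u: "u \<in> H1_rad" "H.nm u <= R" "GG u = 1"
  show "EX i<card K. ev u (q i) ~= 0"
  proof (rule ccontr)
   assume "\<not> ?thesis"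
   hence z: "ev u y = 0" if "y \<in> K" for y using that q by (metis imageE lessThan_iff)
   have gR: "sqrt (n2 (grad u)) <= R" using sqrt_n2_grad[OF u(1)] u(2) by linarith
   have "AE x in R3. r <= norm x & norm x <= R' --> |u x| <= d"
   proof (rule radial_annulus_le[OF u(1) _ r(1)])
    fix t assume "t \<in> {r^2..R'^2}"
    then obtain y where "y \<in> K" "|ev u t - ev u y| <= d" using K(3) H1_rad_H1[OF u(1)] gR by blast
    thus "|ev u t| <= d" using z by simp
   qed
   moreover have rS: "rb S u" unfolding S_def by (rule rb_nm_le[OF u(1)]) (use u(2) in linarith)
   ultimately have "(LINT x|R3. |(phi u x * u x) * u x| ) <= 1 / 2" by (intro sm[OF phi_times_pcl])
   from L1_le_bound[OF this] have "GG u <= 1 / 2" by (simp add: GG_def power2_eq_square mult.assoc)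
   thus False using u(3) by simp
  qed
 qed
qed

lemma Sm_radial_test:
 assumes sm: "!!n. Sm n h" and z: "!!s. s >= b ==> h s = 0"
 shows "(%x. h ((norm x)^2)) \<in> H1_rad"
proof -
 obtain h' where h': "!!s. (h has_real_derivative h' s) (at s)" "Sm 0 h'" using sm[of 1] by auto
 have ch: "continuous_on UNIV h" "continuous_on UNIV h'" using sm[of 0] h'(2) by simp_all
 have big: "(norm x)^2 > b" if "norm x > sqrt |b|" for x :: "real^3"
  using that real_sqrt_less_iff[of "|b|" "(norm x)^2"] by simp
 have z': "h' s = 0" if "s > b" for s
 proof -
  have "((%x. 0) has_real_derivative h' s) (at s)"
   by (rule has_field_derivative_transform_within_open[OF h'(1), of "{b<..}"]) (use that z in auto)
  thus ?thesis using DERIV_const DERIV_unique by blast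
 qed
 have l2I: "l2 g" if g: "continuous_on UNIV g" "!!x. norm x > sqrt |b| ==> g x = 0" for g :: "real^3 => 'b::euclidean_space"
 proof -
  have "compact (g ` cball 0 (sqrt |b| ))" by (intro compact_continuous_image continuous_on_subset[OF g(1)]) auto
  then obtain B where B: "ALL y:g ` cball 0 (sqrt |b| ). norm y <= B" using compact_imp_bounded bounded_iff by metis
  have "norm (g x) <= |B|" for x
  proof (cases "norm x > sqrt |b|")
   case False
   hence "norm (g x) <= B" using B by auto
   thus ?thesis by simp
  qed (simp add: g(2))
  thus ?thesis using g borel_measurable_continuous_onI[OF g(1)] by (intro l2_bounded_support[of g "sqrt |b|" "|B|"]) auto
 qed
 show ?thesis
 proof (rule radial_C1(1)[OF h'(1) ch(2)])
  show "l2 (%x::real^3. h ((norm x)^2))"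
  proof (rule l2I)
   show "continuous_on UNIV (%x::real^3. h ((norm x)^2))"
    by (rule continuous_on_compose2[OF ch(1)]) (auto intro!: continuous_intros)
  qed (use big z in \<open>auto simp: less_imp_le\<close>)
  show "l2 (%x::real^3. (2 * h' ((norm x)^2)) *\<^sub>R x)"
  proof (rule l2I)
   show "continuous_on UNIV (%x::real^3. (2 * h' ((norm x)^2)) *\<^sub>R x)"
    by (intro continuous_intros continuous_on_compose2[OF ch(2)]) auto
  qed (use big z' in auto)
 qed
qed

lemma nonzero_open_n2:
 assumes l: "l2 u" and U: "open U" "U ~= {}" "!!x. x \<in> U ==> u x ~= (0::real)"
 shows "n2 u > 0"
proof (rule ccontr)
 assume "\<not> n2 u > 0"
 hence "n2 u = 0" using n2_nonneg[of u] by simp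
 hence "AE x in R3. u x = 0" by (rule n2_zero_AE[OF l])
 hence "AE x in R3. x \<notin> U" using U(3) by (auto elim!: eventually_mono)
 hence "U \<in> null_sets lborel" using U(1) by (subst (asm) AE_iff_null_sets[symmetric]) auto
 hence "negligible U" by (simp add: negligible_iff_null_sets null_sets_completionI)
 thus False using open_not_negligible[OF U(1,2)] by blast
qed

lemma sum_apply: "(\<Sum>i\<in>A. g i) x = (\<Sum>i\<in>A. g i x)"
 for g :: "'i => 'x => 'y::comm_monoid_add"
 by (induction A rule: infinite_finite_induct) auto

lemma H1_rad_rich:
 "EX e. (ALL i<=k. e i \<in> H1_rad) & (ALL a. (EX i<=k. a i ~= 0) --> H.nm (\<Sum>i\<le>(k::nat). a i *\<^sub>R e i) > 0)"
proof -
 \<comment> \<open>Bumps in the disjoint shells 2i+1 < |x|^2 < 2i+2: a nonzero coefficient is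
   visible on its own shell.\<close>
 define e where "e i x = bump 0 (2 * real i + 1) (2 * real i + 2) ((norm x)^2)" for i :: nat and x :: "real^3"
 have eV: "e i \<in> H1_rad" for i
  unfolding e_def[abs_def]
  by (rule Sm_radial_test[OF Sm_bump, of "2 * real i + 2"]) (metis bump_nz not_less)
 have pos: "H.nm (\<Sum>i\<le>k. a i *\<^sub>R e i) > 0" if j: "j <= k" "a j ~= 0" for a j
 proof -
  let ?u = "\<Sum>i\<le>k. a i *\<^sub>R e i"
  have uV: "?u \<in> H1_rad" by (rule H.sum_V) (use eV H1_rad_scale in blast)
  define U where "U = {x::real^3. 2 * real j + 1 < (norm x)^2} \<inter> {x. (norm x)^2 < 2 * real j + 2}"
  have "n2 ?u > 0"
  proof (rule nonzero_open_n2[OF V_l2[OF uV]])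
   show "open U" unfolding U_def by (intro open_Int open_Collect_less continuous_intros)
   show "U ~= {}"
   proof -
    have "sqrt (2 * real j + 3/2) *\<^sub>R axis 1 1 \<in> U" by (simp add: U_def)
    thus ?thesis by blast
   qed
   fix x assume x: "x \<in> U"
   have z: "e i x = 0" if "i ~= j" for i
   proof (rule ccontr)
    assume "e i x ~= 0"
    hence "2 * real i + 1 < (norm x)^2" "(norm x)^2 < 2 * real i + 2" using bump_nz by (auto simp: e_def)
    hence "2 * real i + 1 < 2 * real j + 2" "2 * real j + 1 < 2 * real i + 2" using x by (auto simp: U_def)
    thus False using that by linarith
   qed
   have "?u x = (\<Sum>i\<le>k. a i * e i x)" by (simp add: sum_apply)
   also have "... = (\<Sum>i\<in>{j}. a i * e i x)" by (rule sum.mono_neutral_right) (use j z in auto)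
   finally have "?u x = a j * e j x" by simp
   moreover have "e j x ~= 0" using x bump_nz by (auto simp: e_def U_def)
   ultimately show "?u x ~= 0" using j(2) by simp
  qed
  moreover have "\<mu> * n2 ?u <= ip ?u ?u" by (simp add: ip_self n2_nonneg)
  ultimately have "ip ?u ?u > 0" using mu_pos by (meson less_le_trans mult_pos_pos)
  thus ?thesis by (simp add: H.nm_def)
 qed
 show ?thesis by (rule exI[of _ e]) (use eV pos in blast)
qed

sublocale C: constrained H1_rad ip Phi dPhi GG dGG
proof
 fix u assume u: "u \<in> H1_rad"
 show "Phi u >= 0" unfolding Phi_def by (intro integral_nonneg_AE AE_I2 F_nonneg)
 show "dPhi u u >= 0" unfolding dPhi_def by (intro integral_nonneg_AE AE_I2 f_times_nonneg)
 show "GG (c *\<^sub>R u) = c ^ 4 * GG u" for c using GG_scale[of c u] by (simp add: scaleR_fun_def)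
 show "dGG u u = 4 * GG u" by (rule GG_euler)
 show "GG u > 0" if "H.nm u > 0" by (rule GG_positive[OF u that])
qed (rule GG_finite_rank H1_rad_rich)+

end

section \<open>A nonnegative minimiser\<close>

lemma inverse_sqrt_diff_le:
 assumes "0 < a" "a <= b"
 shows "1 / sqrt a - 1 / sqrt b <= (b - a) / (2 * (a * sqrt a))"
proof -
 define x y where "x = sqrt a" and "y = sqrt b"
 have xy: "0 < x" "x <= y" "a = x * x" "b = y * y" using assms by (simp_all add: x_def y_def)
 have "1 / x - 1 / y = (y - x) / (x * y)" using xy by (simp add: field_simps)
 also have "... <= (y - x) * (y + x) / (2 * (x * x * x))"
 proof -
  have le: "2 * (x * x * x) <= (y + x) * (x * y)"
  proof -
   have "2 * x * (x * x) <= (y + x) * (x * y)" using xy by (intro mult_mono) auto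
   thus ?thesis by (simp add: mult.assoc)
  qed
  have "1 / (x * y) = (y + x) / ((y + x) * (x * y))" using xy by simp
  also have "... <= (y + x) / (2 * (x * x * x))" using le xy by (intro divide_left_mono) auto
  finally have "1 / (x * y) <= (y + x) / (2 * (x * x * x))" .
  from mult_left_mono[OF this, of "y - x"] show ?thesis using xy by simp
 qed
 also have "(y - x) * (y + x) = b - a" using xy by (simp add: algebra_simps)
 finally have fin: "1 / x - 1 / y <= (b - a) / (2 * (x * x * x))" .
 have e3: "a * sqrt a = x * x * x" by (metis xy(3) x_def)
 show ?thesis unfolding e3 using fin by (simp only: x_def[symmetric] y_def[symmetric])
qed

text \<open>Cauchy-Schwarz is applied after cutting the gradient to the shell where the two fields
  differ. The constant 8 pi is not relaxed, because the Dirichlet bound for the averages leaves no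
  room for an extra factor.\<close>

lemma ev_diff_local:
 assumes u: "u \<in> H1" and a: "0 < a" "a <= b"
 shows "(ev u b - ev u a)^2 <= (LINT x|R3. indicator {x. a <= (norm x)^2 & (norm x)^2 <= b} x * (norm (grad u x))^2) * (b - a) / (8 * pi * (a * sqrt a))"
proof -
 have b: "0 < b" using a by simp
 note [measurable] = grad_borel[OF u]
 define g where "g x = indicator {x. a <= (norm x)^2 & (norm x)^2 <= b} x *\<^sub>R grad u x" for x
 have ng: "(norm (g x))^2 = indicator {x. a <= (norm x)^2 & (norm x)^2 <= b} x * (norm (grad u x))^2" for x
  by (simp add: g_def indicator_def)
 have gl: "l2 g" unfolding l2_def
 proof
  show "g \<in> borel_measurable R3" unfolding g_def[abs_def] by measurable
  hence [measurable]: "g \<in> borel_measurable borel" by simp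
  show "integrable R3 (%x. (norm (g x))^2)"
   by (rule L1_bound[OF l2_integrable[OF grad_l2[OF u]]]) (measurable, auto simp: ng indicator_def)
 qed
 note L = l2_diff[OF evk_l2[OF a(1)] evk_l2[OF b]]
 have "(LINT x|R3. grad u x \<bullet> evk a x) - (LINT x|R3. grad u x \<bullet> evk b x) = (LINT x|R3. grad u x \<bullet> (evk a x - evk b x))"
  unfolding inner_diff_right
  using l2_inner[OF grad_l2[OF u] evk_l2[OF a(1)]] l2_inner[OF grad_l2[OF u] evk_l2[OF b]] by simp
 also have "... = (LINT x|R3. g x \<bullet> (evk a x - evk b x))"
 proof (intro LINT_cong refl)
  fix x :: "real^3"
  show "grad u x \<bullet> (evk a x - evk b x) = g x \<bullet> (evk a x - evk b x)"
  proof (cases "a <= (norm x)^2 & (norm x)^2 <= b")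
   case False
   hence "evk a x = evk b x" using a by (auto simp: evk_def indicator_def)
   thus ?thesis by simp
  qed (simp add: g_def)
 qed
 finally have eq: "ev u b - ev u a = (LINT x|R3. g x \<bullet> (evk a x - evk b x)) / (4 * pi)"
  by (simp add: ev_def diff_divide_distrib[symmetric])
 define r where "r = 1 / sqrt a - 1 / sqrt b"
 have r0: "r >= 0" unfolding r_def using a by (simp add: frac_le)
 have n2k: "n2 (%x. evk a x - evk b x) = 4 * pi * r"
  unfolding n2_evk_diff[OF a] r_def by (simp add: right_diff_distrib)
 have "(LINT x|R3. g x \<bullet> (evk a x - evk b x))^2 <= (sqrt (n2 g) * sqrt (4 * pi * r))^2"
  using power_mono[OF cauchy_schwarz_inner[OF gl L] abs_ge_zero, of 2] unfolding n2k by simp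
 also have "... = n2 g * (4 * pi * r)" using r0 by (simp add: power_mult_distrib n2_nonneg)
 finally have "(LINT x|R3. g x \<bullet> (evk a x - evk b x))^2 / (4 * pi)^2 <= n2 g * (4 * pi * r) / (4 * pi)^2"
  by (rule divide_right_mono) simp
 also have "... = n2 g * r / (4 * pi)" by (simp add: power2_eq_square)
 also have "... <= n2 g * ((b - a) / (2 * (a * sqrt a))) / (4 * pi)"
  using inverse_sqrt_diff_le[OF a] n2_nonneg[of g] unfolding r_def by (intro divide_right_mono mult_left_mono) auto
 also have "... = n2 g * (b - a) / (8 * pi * (a * sqrt a))" by simp
 finally show ?thesis unfolding eq n2_def ng by (simp add: power_divide)
qed

text \<open>By Tonelli every x is counted for the shifts s in an interval of length
  \<open>e\<close>, so the factor 1/e restores the full integral; the restriction to s >= 0 only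
  loses mass.\<close>

lemma shift_average:
 fixes p :: "real^3 => ennreal"
 assumes [measurable]: "p \<in> borel_measurable borel" and e: "e > 0"
 shows "(\<integral>\<^sup>+s. indicator {0..} s * (ennreal (1 / e) * (\<integral>\<^sup>+x. p x * indicator {x. s + e <= (norm x)^2 & (norm x)^2 <= s + 2 * e} x \<partial>R3)) \<partial>lborel)
  <= (\<integral>\<^sup>+x. p x \<partial>R3)"
proof -
 let ?I = "%s x. indicator {x. s + e <= (norm x)^2 & (norm x)^2 <= s + 2 * e} x :: ennreal"
 have "(\<integral>\<^sup>+s. indicator {0..} s * (ennreal (1 / e) * (\<integral>\<^sup>+x. p x * ?I s x \<partial>R3)) \<partial>lborel)
   <= (\<integral>\<^sup>+s. (\<integral>\<^sup>+x. ennreal (1 / e) * (p x * ?I s x) \<partial>R3) \<partial>lborel)"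
  by (intro nn_integral_mono) (auto simp: nn_integral_cmult indicator_def)
 also have "... = (\<integral>\<^sup>+x. (\<integral>\<^sup>+s. ennreal (1 / e) * (p x * ?I s x) \<partial>lborel) \<partial>R3)"
  by (rule lborel_pair.Fubini') measurable
 also have "... = (\<integral>\<^sup>+x. p x \<partial>R3)"
 proof (rule nn_integral_cong)
  fix x :: "real^3"
  have "?I s x = indicator {(norm x)^2 - 2 * e..(norm x)^2 - e} s" for s by (auto simp: indicator_def)
  hence "(\<integral>\<^sup>+s. ennreal (1 / e) * (p x * ?I s x) \<partial>lborel)
    = ennreal (1 / e) * (p x * (\<integral>\<^sup>+s. indicator {(norm x)^2 - 2 * e..(norm x)^2 - e} s \<partial>lborel))"
   by (simp add: nn_integral_cmult)
  also have "... = ennreal (1 / e) * (p x * ennreal e)" using e by simp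
  also have "... = p x * (ennreal (1 / e) * ennreal e)" by (simp add: mult.commute mult.left_commute)
  also have "ennreal (1 / e) * ennreal e = 1" using e by (simp flip: ennreal_mult'')
  finally show "(\<integral>\<^sup>+s. ennreal (1 / e) * (p x * ?I s x) \<partial>lborel) = p x" by simp
 qed
 finally show ?thesis .
qed

text \<open>Jensen's inequality for a moving average: with A the mean, a function with derivative (g
  - A)^2 is nondecreasing.\<close>

lemma mean_square_le:
 assumes g: "continuous_on UNIV g" and e: "e > 0"
 shows "((primitive g (a + e) - primitive g a) / e)^2 <= (primitive (%t. (g t)^2) (a + e) - primitive (%t. (g t)^2) a) / e"
proof -
 define A where "A = (primitive g (a + e) - primitive g a) / e"
 have g2: "continuous_on UNIV (%t. (g t)^2)" by (intro continuous_intros g)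
 define D where "D t = primitive (%t. (g t)^2) t - 2 * A * primitive g t + A^2 * t" for t
 have D: "(D has_real_derivative (g t - A)^2) (at t)" for t
 proof -
  have "(D has_real_derivative ((g t)^2 - 2 * A * g t + A^2)) (at t)"
   unfolding D_def[abs_def]
   by (rule derivative_eq_intros primitive_deriv[OF g] primitive_deriv[OF g2] refl | simp)+
  thus ?thesis by (simp add: power2_diff algebra_simps)
 qed
 have "D a <= D (a + e)"
  by (rule DERIV_nonneg_imp_nondecreasing) (use e D in \<open>auto intro: zero_le_power2\<close>)
 hence "0 <= (primitive (%t. (g t)^2) (a + e) - primitive (%t. (g t)^2) a) - 2 * A * (primitive g (a + e) - primitive g a) + A^2 * e"
  by (simp add: D_def algebra_simps)
 also have "primitive g (a + e) - primitive g a = A * e" using e by (simp add: A_def)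
 finally have "A^2 * e <= primitive (%t. (g t)^2) (a + e) - primitive (%t. (g t)^2) a"
  by (simp add: power2_eq_square algebra_simps)
 thus ?thesis using e by (simp add: A_def pos_le_divide_eq)
qed

text \<open>Steklov averages of the modulus of the radial profile: smooth enough to lie in \<open>H1_rad\<close>, with
 Dirichlet and mass integrals not larger than those of \<open>u\<close>.\<close>

definition prof :: "(real^3 => real) => real => real => real" where
 "prof u e t = |ev u (max t e)|"

definition stek :: "(real^3 => real) => real => real => real" where
 "stek u e s = (primitive (prof u e) (s + e + e) - primitive (prof u e) (s + e)) / e"

definition stz :: "(real^3 => real) => real => real^3 => real" where
 "stz u e x = stek u e ((norm x)^2)"

lemma prof_continuous:
 assumes u: "u \<in> H1" and e: "e > 0"
 shows "continuous_on UNIV (prof u e)"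
proof -
 have "continuous_on UNIV (%t. ev u (max t e))"
  by (rule continuous_on_compose2[OF ev_continuous[OF u]]) (use e in \<open>auto intro!: continuous_intros\<close>)
 thus ?thesis unfolding prof_def[abs_def] by (intro continuous_intros)
qed

lemma stek_deriv:
 assumes u: "u \<in> H1" and e: "e > 0"
 shows "(stek u e has_real_derivative ((prof u e (s + e + e) - prof u e (s + e)) / e)) (at s)"
proof -
 have s1: "((%s. primitive (prof u e) (s + c)) has_real_derivative prof u e (s + c)) (at s)" for c
  using DERIV_shift[of "primitive (prof u e)" "prof u e (s + c)" s c] primitive_deriv[OF prof_continuous[OF u e], of "s + c"] by simp
 show ?thesis unfolding stek_def[abs_def]
  using DERIV_cdivide[OF DERIV_diff[OF s1[of "e + e"] s1[of e]], of e] by (simp add: add.assoc)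
qed

lemma stek_nonneg:
 assumes u: "u \<in> H1" and e: "e > 0"
 shows "stek u e s >= 0"
proof -
 have "primitive (prof u e) (s + e) <= primitive (prof u e) (s + e + e)"
 proof (rule DERIV_nonneg_imp_nondecreasing[of "s + e" "s + e + e" "primitive (prof u e)"])
  show "EX y. (primitive (prof u e) has_real_derivative y) (at x) & 0 <= y" for x
   using primitive_deriv[OF prof_continuous[OF u e], of x] by (intro exI conjI) (assumption, simp add: prof_def)
 qed (use e in simp)
 thus ?thesis using e by (simp add: stek_def)
qed

lemma stek_mean:
 assumes u: "u \<in> H1" and e: "e > 0"
 obtains t where "s + e < t" "t < s + 2 * e" "stek u e s = prof u e t"
proof -
 have "s + e < s + e + e" using e by simp
 from MVT2[OF this, of "primitive (prof u e)" "prof u e"] primitive_deriv[OF prof_continuous[OF u e]]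
 obtain t where t: "s + e < t" "t < s + e + e" "primitive (prof u e) (s + e + e) - primitive (prof u e) (s + e) = (s + e + e - (s + e)) * prof u e t"
  by blast
 show ?thesis by (rule that[of t]) (use t e in \<open>auto simp: stek_def\<close>)
qed

lemma stek_measurable [measurable]:
 assumes "u \<in> H1" "e > 0" shows "stek u e \<in> borel_measurable borel"
proof -
 have "continuous_on UNIV (stek u e)"
  using stek_deriv[OF assms] by (meson DERIV_isCont continuous_at_imp_continuous_on)
 thus ?thesis by (rule borel_measurable_continuous_onI)
qed

text \<open>The averaging window lies to the right of s, where the density sqrt t is at least sqrt
  s; with Jensen's inequality this bounds the mass at s by the mean of the mass of \<open>u\<close>
  over the shell from s+e to s+2e, and \<open>shift_average\<close> integrates over the shells. For
  s >= 0 the cutoff in \<open>prof\<close> is inactive on the window.\<close>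

lemma stz_mass:
 assumes u: "u \<in> H1_rad" and e: "e > 0"
 shows "l2 (stz u e)" "n2 (stz u e) <= n2 u"
proof -
 have uH: "u \<in> H1" by (rule H1_rad_H1[OF u])
 note [measurable] = H1_borel[OF uH] ev_measurable[OF uH] stek_measurable[OF uH e]
 have zm [measurable]: "stz u e \<in> borel_measurable borel" unfolding stz_def[abs_def] by measurable
 have pc: "continuous_on UNIV (prof u e)" by (rule prof_continuous[OF uH e])
 have pc2: "continuous_on UNIV (%t. (prof u e t)^2)" by (intro continuous_intros pc)
 have [measurable]: "prof u e \<in> borel_measurable borel" by (rule borel_measurable_continuous_onI[OF pc])
 let ?I = "%s x. indicator {x. s + e <= (norm x)^2 & (norm x)^2 <= s + 2 * e} x :: ennreal"
 let ?J = "%s t. indicator {s + e..s + 2 * e} t :: ennreal"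
 have pt: "ennreal (2 * pi * sqrt s) * indicator {0..} s * ennreal ((stek u e s)^2)
   <= indicator {0..} s * (ennreal (1 / e) * (\<integral>\<^sup>+x. ennreal ((u x)^2) * ?I s x \<partial>R3))" for s
 proof (cases "s >= 0")
  case True
  have "(\<integral>\<^sup>+x. ennreal ((u x)^2) * ?I s x \<partial>R3) = (\<integral>\<^sup>+x. ennreal ((ev u ((norm x)^2))^2) * ?J s ((norm x)^2) \<partial>R3)"
   by (rule nn_integral_cong_AE) (use radial_ev[OF u] in \<open>auto elim!: eventually_mono simp: indicator_def\<close>)
  also have "... = (\<integral>\<^sup>+t. ennreal (2 * pi * sqrt t) * indicator {0..} t * (ennreal ((ev u t)^2) * ?J s t) \<partial>lborel)"
   by (rule polar_nn) measurable
  also have "... >= (\<integral>\<^sup>+t. ennreal (2 * pi * sqrt s) * (ennreal ((prof u e t)^2) * ?J s t) \<partial>lborel)"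
  proof (rule nn_integral_mono)
   fix t
   show "ennreal (2 * pi * sqrt s) * (ennreal ((prof u e t)^2) * ?J s t)
     <= ennreal (2 * pi * sqrt t) * indicator {0..} t * (ennreal ((ev u t)^2) * ?J s t)"
   proof (cases "t \<in> {s + e..s + 2 * e}")
    case t: True
    hence "prof u e t = |ev u t|" "t >= 0" "s <= t" using True e by (auto simp: prof_def)
    thus ?thesis using t by (auto intro!: mult_right_mono ennreal_leI)
   qed simp
  qed
  also have "(\<integral>\<^sup>+t. ennreal (2 * pi * sqrt s) * (ennreal ((prof u e t)^2) * ?J s t) \<partial>lborel)
    = ennreal (2 * pi * sqrt s) * (\<integral>\<^sup>+t. ennreal ((prof u e t)^2) * ?J s t \<partial>lborel)"
   by (rule nn_integral_cmult) measurable
  also have "(\<integral>\<^sup>+t. ennreal ((prof u e t)^2) * ?J s t \<partial>lborel)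
    = ennreal (primitive (%t. (prof u e t)^2) (s + 2 * e) - primitive (%t. (prof u e t)^2) (s + e))"
   by (rule nn_integral_FTC_Icc) (use e primitive_deriv[OF pc2] in \<open>auto intro: DERIV_subset has_field_derivative_at_within\<close>)
  finally have le: "ennreal (2 * pi * sqrt s) * ennreal (primitive (%t. (prof u e t)^2) (s + 2 * e) - primitive (%t. (prof u e t)^2) (s + e))
    <= (\<integral>\<^sup>+x. ennreal ((u x)^2) * ?I s x \<partial>R3)" .
  define P where "P = primitive (%t. (prof u e t)^2) (s + 2 * e) - primitive (%t. (prof u e t)^2) (s + e)"
  have "(stek u e s)^2 <= P / e"
   using mean_square_le[OF pc e, of "s + e"] by (simp add: stek_def P_def add.assoc)
  hence "ennreal (2 * pi * sqrt s) * ennreal ((stek u e s)^2) <= ennreal (2 * pi * sqrt s) * ennreal (1 / e * P)"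
   by (intro mult_left_mono ennreal_leI) auto
  also have "... = ennreal (1 / e) * (ennreal (2 * pi * sqrt s) * ennreal P)"
  proof -
   have "ennreal (1 / e * P) = ennreal (1 / e) * ennreal P" using e by (intro ennreal_mult') auto
   thus ?thesis by (simp only: mult.left_commute)
  qed
  also have "... <= ennreal (1 / e) * (\<integral>\<^sup>+x. ennreal ((u x)^2) * ?I s x \<partial>R3)"
   using le unfolding P_def by (intro mult_left_mono) auto
  finally show ?thesis using True by simp
 qed simp
 have "(\<integral>\<^sup>+x. ennreal ((norm (stz u e x))^2) \<partial>R3) = (\<integral>\<^sup>+s. ennreal (2 * pi * sqrt s) * indicator {0..} s * ennreal ((stek u e s)^2) \<partial>lborel)"
  unfolding stz_def by (subst polar_nn[symmetric]) auto
 also have "... <= (\<integral>\<^sup>+s. indicator {0..} s * (ennreal (1 / e) * (\<integral>\<^sup>+x. ennreal ((u x)^2) * ?I s x \<partial>R3)) \<partial>lborel)"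
  by (rule nn_integral_mono) (rule pt)
 also have "... <= (\<integral>\<^sup>+x. ennreal ((u x)^2) \<partial>R3)" by (rule shift_average[OF _ e]) measurable
 also have "... = ennreal (n2 u)" using nn_integral_l2[OF H1_l2[OF uH]] by simp
 finally have le: "(\<integral>\<^sup>+x. ennreal ((norm (stz u e x))^2) \<partial>R3) <= ennreal (n2 u)" .
 show l: "l2 (stz u e)"
  unfolding l2_def
 proof
  show "integrable R3 (%x. (norm (stz u e x))^2)"
   by (rule integrableI_bounded) (use le in \<open>auto intro: le_less_trans[OF _ ennreal_less_top]\<close>)
 qed simp
 show "n2 (stz u e) <= n2 u" using le unfolding nn_integral_l2[OF l] by (simp add: n2_nonneg)
qed

text \<open>The derivative of the average is the increment of |ev u| over the window divided by
  \<open>e\<close>. \<open>ev_diff_local\<close> bounds its square by the shell energy over 8 pi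
  a^(3/2) e with a = s + e, and the polar weight 2 pi sqrt s times 4 s is at most 8 pi a^(3/2) as s
  <= a: the constants cancel exactly.\<close>

lemma stz_dirichlet:
 assumes u: "u \<in> H1_rad" and e: "e > 0"
 defines "G \<equiv> %x::real^3. (2 * ((prof u e ((norm x)^2 + e + e) - prof u e ((norm x)^2 + e)) / e)) *\<^sub>R x"
 shows "l2 G" "n2 G <= n2 (grad u)"
proof -
 have uH: "u \<in> H1" by (rule H1_rad_H1[OF u])
 have pc: "continuous_on UNIV (prof u e)" by (rule prof_continuous[OF uH e])
 have [measurable]: "prof u e \<in> borel_measurable borel" by (rule borel_measurable_continuous_onI[OF pc])
 note [measurable] = grad_borel[OF uH]
 have Gm [measurable]: "G \<in> borel_measurable borel" unfolding G_def by measurable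
 define a' where "a' s = (prof u e (s + e + e) - prof u e (s + e)) / e" for s
 have [measurable]: "a' \<in> borel_measurable borel" unfolding a'_def[abs_def] by measurable
 let ?I = "%s x. indicator {x. s + e <= (norm x)^2 & (norm x)^2 <= s + 2 * e} x :: ennreal"
 have pt: "ennreal (2 * pi * sqrt s) * indicator {0..} s * ennreal (4 * (a' s)^2 * s)
   <= indicator {0..} s * (ennreal (1 / e) * (\<integral>\<^sup>+x. ennreal ((norm (grad u x))^2) * ?I s x \<partial>R3))" for s
 proof (cases "s >= 0")
  case True
  define a b where "a = s + e" and "b = s + 2 * e"
  have ab: "0 < a" "a <= b" "s <= a" "b - a = e" using True e by (auto simp: a_def b_def)
  let ?S = "{x::real^3. a <= (norm x)^2 & (norm x)^2 <= b}"
  define I where "I = (LINT x|R3. indicator ?S x * (norm (grad u x))^2)"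
  have Ii: "integrable R3 (%x. indicator ?S x * (norm (grad u x))^2)"
   by (rule L1_bound[OF l2_integrable[OF grad_l2[OF uH]]]) (measurable, auto simp: indicator_def)
  have I0: "I >= 0" unfolding I_def by (intro integral_nonneg_AE AE_I2) auto
  have nnI: "(\<integral>\<^sup>+x. ennreal ((norm (grad u x))^2) * ?I s x \<partial>R3) = ennreal I"
  proof -
   have "(\<integral>\<^sup>+x. ennreal ((norm (grad u x))^2) * ?I s x \<partial>R3) = (\<integral>\<^sup>+x. ennreal (indicator ?S x * (norm (grad u x))^2) \<partial>R3)"
    by (intro nn_integral_cong) (auto simp: a_def b_def indicator_def)
   also have "... = ennreal I" unfolding I_def by (rule nn_integral_eq_integral[OF Ii]) auto
   finally show ?thesis .
  qed
  have p: "prof u e (s + e + e) = |ev u b|" "prof u e (s + e) = |ev u a|"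
   using True e by (auto simp: prof_def a_def b_def max_def add.assoc)
  have "| |ev u b| - |ev u a| | <= |ev u b - ev u a|" by (rule abs_triangle_ineq3)
  hence "( |ev u b| - |ev u a| )^2 <= (ev u b - ev u a)^2" by (simp add: abs_le_square_iff)
  also have "... <= I * e / (8 * pi * (a * sqrt a))"
   using ev_diff_local[OF uH ab(1,2)] unfolding I_def[symmetric] ab(4) .
  finally have "(a' s)^2 <= I * e / (8 * pi * (a * sqrt a)) / e^2"
   unfolding a'_def p power_divide by (rule divide_right_mono) simp
  also have "... = I / (e * (8 * pi * (a * sqrt a)))" using e by (simp add: power2_eq_square)
  finally have "8 * pi * (s * sqrt s) * (a' s)^2 <= 8 * pi * (s * sqrt s) * (I / (e * (8 * pi * (a * sqrt a))))"
   using True by (intro mult_left_mono) auto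
  also have "... <= 8 * pi * (a * sqrt a) * (I / (e * (8 * pi * (a * sqrt a))))"
   using True ab I0 e by (intro mult_right_mono mult_mono mult_left_mono) auto
  also have "... = 1 / e * I" using ab e by simp
  finally have "2 * pi * sqrt s * (4 * (a' s)^2 * s) <= 1 / e * I" by (simp add: mult.assoc mult.left_commute mult.commute)
  hence "ennreal (2 * pi * sqrt s) * ennreal (4 * (a' s)^2 * s) <= ennreal (1 / e) * ennreal I"
   using e I0 True by (simp add: ennreal_leI flip: ennreal_mult)
  thus ?thesis unfolding nnI using True by simp
 qed simp
 have "(\<integral>\<^sup>+x. ennreal ((norm (G x))^2) \<partial>R3) = (\<integral>\<^sup>+x. ennreal (4 * (a' ((norm x)^2))^2 * (norm x)^2) \<partial>R3)"
 proof (intro nn_integral_cong)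
  fix x :: "real^3"
  have "norm (G x) = 2 * |a' ((norm x)^2)| * norm x"
   unfolding G_def a'_def by (simp only: norm_scaleR abs_mult abs_numeral times_divide_eq_right[symmetric])
  thus "ennreal ((norm (G x))^2) = ennreal (4 * (a' ((norm x)^2))^2 * (norm x)^2)"
   by (simp add: power_mult_distrib)
 qed
 also have "... = (\<integral>\<^sup>+s. ennreal (2 * pi * sqrt s) * indicator {0..} s * ennreal (4 * (a' s)^2 * s) \<partial>lborel)"
  by (rule polar_nn[of "%s. ennreal (4 * (a' s)^2 * s)"]) measurable
 also have "... <= (\<integral>\<^sup>+s. indicator {0..} s * (ennreal (1 / e) * (\<integral>\<^sup>+x. ennreal ((norm (grad u x))^2) * ?I s x \<partial>R3)) \<partial>lborel)"
  by (rule nn_integral_mono) (rule pt)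
 also have "... <= (\<integral>\<^sup>+x. ennreal ((norm (grad u x))^2) \<partial>R3)" by (rule shift_average[OF _ e]) measurable
 also have "... = ennreal (n2 (grad u))" by (rule nn_integral_l2[OF grad_l2[OF uH]])
 finally have le: "(\<integral>\<^sup>+x. ennreal ((norm (G x))^2) \<partial>R3) <= ennreal (n2 (grad u))" .
 show l: "l2 G"
  unfolding l2_def
 proof
  show "integrable R3 (%x. (norm (G x))^2)"
   by (rule integrableI_bounded) (use le in \<open>auto intro: le_less_trans[OF _ ennreal_less_top]\<close>)
 qed simp
 show "n2 G <= n2 (grad u)" using le unfolding nn_integral_l2[OF l] by (simp add: n2_nonneg)
qed

lemma stz_H1_rad:
 assumes u: "u \<in> H1_rad" and e: "e > 0"
 shows "stz u e \<in> H1_rad" "n2 (grad (stz u e)) <= n2 (grad u)"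
proof -
 have uH: "u \<in> H1" by (rule H1_rad_H1[OF u])
 let ?G = "%x::real^3. (2 * ((prof u e ((norm x)^2 + e + e) - prof u e ((norm x)^2 + e)) / e)) *\<^sub>R x"
 have c: "continuous_on UNIV (%s. (prof u e (s + e + e) - prof u e (s + e)) / e)"
  by (intro continuous_intros continuous_on_compose2[OF prof_continuous[OF uH e]]) (use e in auto)
 have zeq: "stz u e = (%x. stek u e ((norm x)^2))" by (simp add: stz_def fun_eq_iff)
 note C = radial_C1[OF stek_deriv[OF uH e] c stz_mass(1)[OF u e, unfolded zeq] stz_dirichlet(1)[OF u e]]
 show z: "stz u e \<in> H1_rad" unfolding zeq by (rule C(1))
 have "n2 (grad (stz u e)) = n2 ?G"
  unfolding zeq by (rule n2_cong_AE[OF _ l2_measurable[OF stz_dirichlet(1)[OF u e]] C(2)])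
   (use l2_measurable[OF grad_l2[OF H1_rad_H1[OF z]]] in \<open>simp add: zeq\<close>)
 thus "n2 (grad (stz u e)) <= n2 (grad u)" using stz_dirichlet(2)[OF u e] by simp
qed

lemma stek_close:
 assumes u: "u \<in> H1" and a: "0 < a" and d: "0 < d"
 obtains e0 where "e0 > 0" "!!e s. 0 < e ==> e <= e0 ==> s \<in> {a..b} ==> |stek u e s - |ev u s| | <= d"
proof -
 have "continuous_on {a..b + 1} (ev u)" by (rule continuous_on_subset[OF ev_continuous[OF u]]) (use a in auto)
 hence "uniformly_continuous_on {a..b + 1} (ev u)" by (rule compact_uniformly_continuous) simp
 then obtain h where h: "h > 0" "!!s t. s \<in> {a..b + 1} ==> t \<in> {a..b + 1} ==> dist s t < h ==> dist (ev u s) (ev u t) < d"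
  unfolding uniformly_continuous_on_def using d by metis
 show ?thesis
 proof (rule that[of "min (h / 2) (1 / 2)"])
  show "min (h / 2) (1 / 2) > 0" using h by simp
  fix e s assume e: "0 < e" "e <= min (h / 2) (1 / 2)" and s: "s \<in> {a..b}"
  obtain t where t: "s + e < t" "t < s + 2 * e" "stek u e s = prof u e t" using stek_mean[OF u e(1), of s] by blast
  have "max t e = t" using t s a e by simp
  hence "stek u e s = |ev u t|" using t by (simp add: prof_def)
  moreover have "dist (ev u s) (ev u t) < d" by (rule h(2)) (use t e s a in \<open>auto simp: dist_real_def\<close>)
  ultimately show "|stek u e s - |ev u s| | <= d"
   using abs_triangle_ineq3[of "ev u t" "ev u s"] by (simp add: dist_real_def abs_minus_commute)
 qed
qed

section \<open>Convergence of the averages and the sign of the minimiser\<close>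

lemma phi_mono:
 assumes "l2 b" "u \<in> borel_measurable borel" "!!x. |u x| <= |b x|"
 shows "phi u x <= phi b x"
proof -
 have [measurable]: "u \<in> borel_measurable borel" by (rule assms(2))
 have sq: "(u y)^2 <= (b y)^2" for y using assms(3)[of y] by (simp add: abs_le_square_iff)
 have "integrable R3 (%y. (u y)^2)"
  by (rule L1_bound[OF L1_sq(1)[OF assms(1)]]) (auto simp: sq)
 thus ?thesis unfolding phi_pot pot_def
  by (intro integral_mono pot_integrable L1_sq(1)[OF assms(1)] mult_left_mono sq kern_nonneg)
qed

context problem
begin

text \<open>With d = z^2 - w^2 and the symmetry of \<open>Q\<close>, the difference is Q(z^2, d) +
  Q(w^2, d), and d = (z + w)(z - w) presents it as pairings of tight coefficients with z -
  w.\<close>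

lemma GG_diff:
 assumes z: "rb S z" and w: "rb S w" and S: "0 <= S"
 shows "|GG z - GG w| <= (LINT x|R3. |(phi z x * (z x + w x)) * (z x - w x)| ) + (LINT x|R3. |(phi w x * (z x + w x)) * (z x - w x)| )"
  and "(%x. phi z x * (z x + w x)) \<in> pcl (S + S)" "(%x. phi w x * (z x + w x)) \<in> pcl (S + S)"
proof -
 note [measurable] = rb_borel[OF z] rb_borel[OF w]
 note zl = rb_l2[OF z] and wl = rb_l2[OF w]
 note iz = L1_sq(1)[OF zl] and iw = L1_sq(1)[OF wl]
 define d where "d x = (z x)^2 - (w x)\<^sup>2" for x
 have id: "integrable R3 d" unfolding d_def[abs_def] using iz iw by simp
 have zd: "(%x. (z x)^2) = (%x. (w x)^2 + d x)" by (simp add: d_def)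
 have "GG z = Q (%x. (z x)^2) (%x. (w x)^2) + Q (%x. (z x)^2) d"
  unfolding GG_Q by (subst (2) zd) (rule Q_add2[OF iw id iz])
 also have "Q (%x. (z x)^2) (%x. (w x)^2) = Q (%x. (w x)^2) (%x. (w x)^2) + Q d (%x. (w x)^2)"
  by (subst (1) zd) (rule Q_add1[OF iw id iw])
 also have "Q d (%x. (w x)^2) = Q (%x. (w x)^2) d" by (rule Q_sym[OF id iw])
 finally have eq: "GG z - GG w = Q (%x. (z x)^2) d + Q (%x. (w x)^2) d" by (simp add: GG_Q)
 have dd: "d x = (z x + w x) * (z x - w x)" for x by (simp add: d_def power2_eq_square algebra_simps)
 have "|Q (%x. (z x)^2) d| <= (LINT x|R3. |(phi z x * (z x + w x)) * (z x - w x)| )"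
  "|Q (%x. (w x)^2) d| <= (LINT x|R3. |(phi w x * (z x + w x)) * (z x - w x)| )"
  unfolding Q_def phi_pot[symmetric] dd mult.assoc[symmetric] by (rule L1_le_bound, simp)+
 thus "|GG z - GG w| <= (LINT x|R3. |(phi z x * (z x + w x)) * (z x - w x)| ) + (LINT x|R3. |(phi w x * (z x + w x)) * (z x - w x)| )"
  unfolding eq by linarith
 define b where "b x = |z x| + |w x|" for x
 have rbb: "rb (S + S) b" unfolding b_def[abs_def] by (rule rb_abs_add[OF z w S S])
 have pc: "(%x. phi v x * (z x + w x)) \<in> pcl (S + S)" if [measurable]: "v \<in> borel_measurable borel" and v: "!!x. |v x| <= |b x|" for v
 proof -
  have "|z x + w x| <= |b x|" for x by (simp add: b_def)
  hence "|phi v x * (z x + w x)| <= phi b x * |b x|" for x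
   unfolding abs_mult using phi_mono[OF rb_l2[OF rbb] that(1) v, of x] phi_nonneg[of v x] phi_nonneg[of b x]
   by (intro mult_mono) auto
  hence "AE x in R3. |phi v x * (z x + w x)| <= phi b x * |b x|" by simp
  thus ?thesis using rbb unfolding pcl_def by auto
 qed
 show "(%x. phi z x * (z x + w x)) \<in> pcl (S + S)" "(%x. phi w x * (z x + w x)) \<in> pcl (S + S)"
  by (rule pc; simp add: b_def)+
qed

text \<open>The averages approach v = |u|, which has the same values of \<open>Phi\<close> and
  \<open>GG\<close> as \<open>u\<close>. Only the class \<open>rb\<close> is claimed for v, and this
  is enough for both estimates.\<close>

lemma stz_convergence:
 assumes u: "u \<in> H1_rad" and e: "e > 0"
 obtains e0 where "e0 > 0" "!!h. 0 < h ==> h <= e0 ==> |Phi (stz u h) - Phi u| <= e"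
  "!!h. 0 < h ==> h <= e0 ==> |GG (stz u h) - GG u| <= e"
proof -
 define S where "S = C0 * H.nm u"
 have S: "S >= 0" using rbV(2)[OF u] by (simp add: S_def)
 have uH: "u \<in> H1" by (rule H1_rad_H1[OF u])
 note [measurable] = H1_borel[OF uH]
 define v where "v x = |u x|" for x
 have [measurable]: "v \<in> borel_measurable borel" unfolding v_def[abs_def] by measurable
 have rv: "rb S v" unfolding S_def by (rule rb_dominated[OF rbV(1)[OF u]]) (auto simp: v_def)
 have Pv: "Phi v = Phi u" unfolding Phi_def v_def by (intro LINT_cong) (auto simp: abs_if F_even)
 have Gv: "GG v = GG u" unfolding GG_Q v_def by simp
 have zv: "stz u h \<in> H1_rad" "rb S (stz u h)" if "h > 0" for h
 proof -
  show z: "stz u h \<in> H1_rad" by (rule stz_H1_rad(1)[OF u that])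
  have "ip (stz u h) (stz u h) <= ip u u"
   unfolding ip_self using stz_H1_rad(2)[OF u that] stz_mass(2)[OF u that] mu_pos by (intro add_mono mult_left_mono) auto
  hence "H.nm (stz u h) <= H.nm u" by (simp add: H.nm_def)
  thus "rb S (stz u h)" unfolding S_def by (rule rb_nm_le[OF z])
 qed
 have SS: "0 <= S + S" using S by simp
 have e2: "e / 2 > 0" using e by simp
 obtain r R d where f1: "0 < r" "r < R" "0 < d"
  "!!c w. c \<in> fcl (S + S) ==> rb (S + S) w ==> (AE x in R3. r <= norm x & norm x <= R --> |w x| <= d) ==> (LINT x|R3. |c x * w x| ) <= e"
  using tight_small_w[OF tight_fcl[OF SS] e SS] by blast
 obtain r' R' d' where g1: "0 < r'" "r' < R'" "0 < d'"
  "!!c w. c \<in> pcl (S + S) ==> rb (S + S) w ==> (AE x in R3. r' <= norm x & norm x <= R' --> |w x| <= d') ==> (LINT x|R3. |c x * w x| ) <= e / 2"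
  using tight_small_w[OF tight_pcl[OF SS] e2 SS] by blast
 have cl: "EX e0>0. ALL h. 0 < h --> h <= e0 --> (AE x in R3. r <= norm x & norm x <= R --> |stz u h x - v x| <= d)"
  if rd: "0 < r" "0 < d" for r R d
 proof -
  obtain e0 where e0: "e0 > 0" "!!h s. 0 < h ==> h <= e0 ==> s \<in> {r^2..R^2} ==> |stek u h s - |ev u s| | <= d"
   using stek_close[OF uH zero_less_power[OF rd(1)] rd(2), of 2 "R^2"] by blast
  show ?thesis
  proof (intro exI[of _ e0] conjI allI impI e0(1))
   fix h assume h: "0 < h" "h <= e0"
   show "AE x in R3. r <= norm x & norm x <= R --> |stz u h x - v x| <= d"
    using radial_ev[OF u]
   proof eventually_elim
    case (elim x)
    show ?case
    proof
     assume "r <= norm x & norm x <= R"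
     hence "(norm x)^2 \<in> {r^2..R^2}" using rd by (auto intro: power_mono)
     from e0(2)[OF h this] show "|stz u h x - v x| <= d" using elim by (simp add: stz_def v_def)
    qed
   qed
  qed
 qed
 obtain e1 where e1: "e1 > 0" "!!h. 0 < h ==> h <= e1 ==> (AE x in R3. r <= norm x & norm x <= R --> |stz u h x - v x| <= d)"
  using cl[OF f1(1,3), of R] by blast
 obtain e2 where e2: "e2 > 0" "!!h. 0 < h ==> h <= e2 ==> (AE x in R3. r' <= norm x & norm x <= R' --> |stz u h x - v x| <= d')"
  using cl[OF g1(1,3), of R'] by blast
 have rw: "rb (S + S) (%x. stz u h x - v x)" if "h > 0" for h
 proof (rule rb_dominated[OF rb_abs_add[OF zv(2)[OF that] rv S S]])
  note [measurable] = rb_borel[OF zv(2)[OF that]] rb_borel[OF rv]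
  show "(%x. stz u h x - v x) \<in> borel_measurable R3" by measurable
 qed auto
 show ?thesis
 proof (rule that[of "min e1 e2"])
  show "min e1 e2 > 0" using e1 e2 by simp
  fix h assume h: "0 < h" "h <= min e1 e2"
  have "(LINT x|R3. |slope (v x) (stz u h x) * (stz u h x - v x)| ) <= e"
   by (rule f1(4)[OF slope_fcl[OF rv zv(2)[OF h(1)] S S] rw[OF h(1)] e1(2)]) (use h in auto)
  from L1_le_bound[OF this] show "|Phi (stz u h) - Phi u| <= e"
   using Phi_diff[OF rv zv(2)[OF h(1)] S S] by (simp add: Pv)
  note G = GG_diff[OF zv(2)[OF h(1)] rv S]
  have hh: "h <= e2" using h by simp
  show "|GG (stz u h) - GG u| <= e"
   using G(1) g1(4)[OF G(2) rw[OF h(1)] e2(2)[OF h(1) hh]] g1(4)[OF G(3) rw[OF h(1)] e2(2)[OF h(1) hh]] by (simp add: Gv)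
 qed
qed

end

context problem
begin

lemma energy_E: "energy \<mu> f u = C.E u"
 by (simp add: energy_def C.E_def ip_normsq Phi_def)

lemma M_rad_M: "M_rad = C.M"
 by (simp add: M_rad_def C.M_def GG_def)

lemma minimizing_sequence_exists:
 obtains s where "!!n::nat. s n \<in> C.M" "(%n. C.E (s n)) ----> Inf (C.E ` C.M)"
proof -
 let ?m = "Inf (C.E ` C.M)"
 obtain u0 :: "nat => real^3 => real" where "!!n. u0 n \<in> C.M" using C.infinitely_many_critical_points by blast
 hence ne: "C.E ` C.M ~= {}" by blast
 have bb: "bdd_below (C.E ` C.M)" by (intro bdd_belowI[of _ 0]) (auto intro: C.E_nonneg simp: C.M_def)
 have "EX x:C.M. C.E x < ?m + 1 / real (Suc n)" for n
  using cInf_lessD[OF ne, of "?m + 1 / real (Suc n)"] by auto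
 then obtain s where s: "!!n. s n \<in> C.M" "!!n. C.E (s n) < ?m + 1 / real (Suc n)" by metis
 have "(%n. ?m + 1 / real (Suc n)) ----> ?m + 0" by (intro tendsto_add tendsto_const LIMSEQ_Suc[OF lim_1_over_n])
 hence lim: "(%n. ?m + 1 / real (Suc n)) ----> ?m" by simp
 have "?m <= C.E (s n)" for n by (rule cInf_lower) (use s bb in auto)
 moreover have "C.E (s n) <= ?m + 1 / real (Suc n)" for n using s(2)[of n] by simp
 ultimately have "(%n. C.E (s n)) ----> ?m"
  by (intro tendsto_sandwich[OF _ _ tendsto_const lim] always_eventually allI)
 thus ?thesis using that s(1) by blast
qed

lemma Phi_scale_close:
 assumes S: "0 <= S"
 obtains K where "K >= 0" "!!z t. rb S z ==> 0 <= t ==> t <= 2 ==> |Phi (t *\<^sub>R z) - Phi z| <= K * |t - 1|"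
proof -
 obtain K where K: "K >= 0" "!!c T w. c \<in> fcl (S + 2 * S) ==> 0 <= T ==> rb T w ==> (LINT x|R3. |c x * w x| ) <= K * T"
  using tight_bound[OF tight_fcl[of "S + 2 * S"]] S by auto
 show ?thesis
 proof (rule that[of "K * S"])
  show "0 <= K * S" using K S by simp
  fix z t assume z: "rb S z" and t: "0 <= t" "(t::real) <= 2"
  note [measurable] = rb_borel[OF z]
  have tz: "rb (2 * S) (t *\<^sub>R z)"
  proof (rule rb_dominated[OF rb_abs_add[OF z z S S, unfolded mult_2[symmetric]]])
   show "t *\<^sub>R z \<in> borel_measurable R3" unfolding scaleR_fun_def by measurable
   have "|t * z x| <= 2 * |z x|" for x using mult_right_mono[OF t(2) abs_ge_zero[of "z x"]] t by (simp add: abs_mult)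
   thus "AE x in R3. |(t *\<^sub>R z) x| <= |2 * |z x| |" by (intro AE_I2) simp
  qed
  have S2: "0 <= 2 * S" using S by simp
  have "|LINT x|R3. slope (z x) ((t *\<^sub>R z) x) * z x| <= K * S"
   by (rule L1_le_bound[OF K(2)[OF slope_fcl[OF z tz S S2] S z]])
  moreover have "Phi (t *\<^sub>R z) - Phi z = (t - 1) * (LINT x|R3. slope (z x) ((t *\<^sub>R z) x) * z x)"
   unfolding Phi_diff[OF z tz S S2] integral_mult_right_zero[symmetric]
   by (intro LINT_cong) (auto simp: algebra_simps)
  ultimately show "|Phi (t *\<^sub>R z) - Phi z| <= K * S * |t - 1|"
   using mult_left_mono[of "|LINT x|R3. slope (z x) ((t *\<^sub>R z) x) * z x|" "K * S" "|t - 1|"] by (simp add: abs_mult mult.commute)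
 qed
qed

text \<open>The averages of a minimiser have norm at most that of \<open>u\<close> and nearly the
  same \<open>Phi\<close> and \<open>GG\<close>; the factors t n that rescale them to the constraint
  tend to 1, so the energies tend to the infimum.\<close>

lemma nonneg_minimizing_sequence:
 assumes u: "u \<in> C.M" and m: "C.E u = Inf (C.E ` C.M)"
 obtains w where "!!n::nat. w n \<in> C.M" "(%n. C.E (w n)) ----> Inf (C.E ` C.M)" "!!n x. w n x >= 0"
proof -
 have uV: "u \<in> H1_rad" and G1: "GG u = 1" using u by (auto simp: C.M_def)
 define S where "S = C0 * H.nm u"
 have S: "S >= 0" using rbV(2)[OF uV] by (simp add: S_def)
 obtain K where K: "K >= 0" "!!z t. rb S z ==> 0 <= t ==> t <= 2 ==> |Phi (t *\<^sub>R z) - Phi z| <= K * |t - 1|"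
  using Phi_scale_close[OF S] by blast
 have "EX h>0. |Phi (stz u h) - Phi u| <= 1 / (real n + 2) & |GG (stz u h) - GG u| <= 1 / (real n + 2)" for n :: nat
 proof -
  have "0 < 1 / (real n + 2)" by simp
  from stz_convergence[OF uV this] obtain e0 where "e0 > 0"
   "!!h. 0 < h ==> h <= e0 ==> |Phi (stz u h) - Phi u| <= 1 / (real n + 2)"
   "!!h. 0 < h ==> h <= e0 ==> |GG (stz u h) - GG u| <= 1 / (real n + 2)" by blast
  thus ?thesis by (intro exI[of _ e0]) simp
 qed
 then obtain h where h: "!!n. h n > 0" "!!n. |Phi (stz u (h n)) - Phi u| <= 1 / (real n + 2)"
   "!!n. |GG (stz u (h n)) - GG u| <= 1 / (real n + 2)" by metis
 define z where "z n = stz u (h n)" for n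
 define g where "g n = GG (z n)" for n
 define t where "t n = g n powr (-1/4)" for n
 have zV: "z n \<in> H1_rad" for n unfolding z_def by (rule stz_H1_rad(1)[OF uV h(1)])
 have ipz: "ip (z n) (z n) <= ip u u" for n
  unfolding ip_self z_def using stz_H1_rad(2)[OF uV h(1)] stz_mass(2)[OF uV h(1)] mu_pos by (intro add_mono mult_left_mono) auto
 have rz: "rb S (z n)" for n
  unfolding S_def by (rule rb_nm_le[OF zV]) (use ipz in \<open>simp add: H.nm_def\<close>)
 have gb: "|g n - 1| <= 1 / (real n + 2)" for n using h(3)[of n] by (simp add: g_def z_def G1)
 have ghalf: "g n >= 1 / 2" for n
 proof -
  have "1 / (real n + 2) <= 1 / 2" by (intro divide_left_mono) auto
  thus ?thesis using gb[of n] by linarith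
 qed
 have d0: "(%n. 1 / (real n + 2)) ----> 0" by real_asymp
 have g1: "g ----> 1"
 proof -
  have "(%n. g n - 1) ----> 0" by (rule null_comparison[where C = 1 and b = "%n. 1 / (real n + 2)"]) (use gb d0 in auto)
  thus ?thesis by (simp add: LIM_zero_iff)
 qed
 have t1: "t ----> 1"
 proof -
  have "(%n. g n powr (-1/4)) ----> 1 powr (-1/4)" by (intro tendsto_powr g1 tendsto_const) simp
  thus ?thesis by (simp add: t_def[abs_def])
 qed
 have t2: "0 <= t n" "t n <= 2" for n
 proof -
  show "0 <= t n" by (simp add: t_def)
  have "t n <= (1/2) powr (-1/4)" unfolding t_def by (rule powr_mono2') (use ghalf in auto)
  also have "(1/2) powr (-1/4) = (2::real) powr (1/4)" by (simp add: powr_minus_divide powr_divide)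
  also have "... <= 2 powr 1" by (rule powr_mono) auto
  finally show "t n <= 2" by simp
 qed
 define w where "w n = C.nrmz (z n)" for n
 have wt: "w n = t n *\<^sub>R z n" for n by (simp add: w_def C.nrmz_def t_def g_def)
 have gpos: "GG (z n) > 0" for n using ghalf[of n] by (simp add: g_def)
 have wM: "w n \<in> C.M" for n unfolding w_def by (rule C.nrmz_M[OF zV gpos])
 have bb: "bdd_below (C.E ` C.M)" by (intro bdd_belowI[of _ 0]) (auto intro: C.E_nonneg simp: C.M_def)
 have low: "Inf (C.E ` C.M) <= C.E (w n)" for n by (rule cInf_lower) (use wM bb in auto)
 have up: "C.E (w n) <= (t n)^2 * ip u u / 2 + (Phi u + 1 / (real n + 2) + K * |t n - 1| )" for n
 proof -
  have "ip (w n) (w n) = (t n)^2 * ip (z n) (z n)"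
   unfolding wt by (simp add: H.ip_scale H.ip_scale2 H.scale_V zV power2_eq_square)
  also have "... <= (t n)^2 * ip u u" by (intro mult_left_mono ipz) simp
  finally have 1: "ip (w n) (w n) <= (t n)^2 * ip u u" .
  have "|Phi (w n) - Phi (z n)| <= K * |t n - 1|" unfolding wt by (rule K(2)[OF rz t2])
  moreover have "|Phi (z n) - Phi u| <= 1 / (real n + 2)" unfolding z_def by (rule h(2))
  ultimately show ?thesis using 1 unfolding C.E_def by linarith
 qed
 have "(%n. (t n)^2 * ip u u / 2 + (Phi u + 1 / (real n + 2) + K * |t n - 1| )) ----> 1^2 * ip u u / 2 + (Phi u + 0 + K * |1 - 1| )"
  by (intro tendsto_intros t1 d0) auto
 hence upl: "(%n. (t n)^2 * ip u u / 2 + (Phi u + 1 / (real n + 2) + K * |t n - 1| )) ----> Inf (C.E ` C.M)"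
  unfolding m[symmetric] C.E_def by simp
 have "(%n. C.E (w n)) ----> Inf (C.E ` C.M)"
  by (rule tendsto_sandwich[OF _ _ tendsto_const upl]) (use low up in auto)
 moreover have "w n x >= 0" for n x
  unfolding wt scaleR_fun_apply z_def stz_def using t2(1)[of n] stek_nonneg[OF H1_rad_H1[OF uV] h(1)] by simp
 ultimately show ?thesis using that wM by blast
qed

lemma M_cong_AE:
 assumes v: "v \<in> C.M" and [measurable]: "w \<in> borel_measurable borel" and vw: "AE x in R3. v x = w x"
 shows "w \<in> C.M" "C.E w = C.E v"
proof -
 have vV: "v \<in> H1_rad" "GG v = 1" using v by (auto simp: C.M_def)
 have vH: "v \<in> H1" by (rule H1_rad_H1[OF vV(1)])
 note [measurable] = H1_borel[OF vH]
 have wH: "w \<in> H1" by (rule H1_cong[OF vH _ vw]) simp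
 obtain h where "AE x in R3. v x = h (norm x)" using vV by (auto simp: H1_rad_def radial_def)
 hence "AE x in R3. w x = h (norm x)" using vw by eventually_elim simp
 hence wV: "w \<in> H1_rad" using wH by (auto simp: H1_rad_def radial_def)
 have "GG w = GG v" unfolding GG_Q
  by (rule Q_cong_AE) (use vw in \<open>auto elim!: eventually_mono\<close>)
 thus "w \<in> C.M" using wV vV by (simp add: C.M_def)
 have gw: "AE x in R3. grad w x = grad v x" by (rule grad_cong[OF vH _ vw]) simp
 have "n2 (grad w) = n2 (grad v)"
  by (rule n2_cong_AE[OF l2_measurable[OF grad_l2[OF wH]] l2_measurable[OF grad_l2[OF vH]] gw])
 moreover have "n2 w = n2 v" by (rule n2_cong_AE) (use vw in \<open>auto elim!: eventually_mono\<close>)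
 moreover have "Phi w = Phi v" unfolding Phi_def by (rule integral_cong_AE) (use vw in \<open>auto elim!: eventually_mono\<close>)
 ultimately show "C.E w = C.E v" by (simp add: C.E_def ip_self)
qed

text \<open>The negative part of the limit v is dominated by |w - v| for each nonnegative w of the
  sequence, so its L2 norm is 0. Passing to |v| changes v on a null set only and gives the sign at
  every point.\<close>

lemma nonneg_minimizer:
 "EX u:C.M. C.E u = Inf (C.E ` C.M) & (ALL x. u x >= 0)"
proof -
 obtain s where s: "!!n::nat. s n \<in> C.M" "(%n. C.E (s n)) ----> Inf (C.E ` C.M)" using minimizing_sequence_exists by blast
 obtain u where u: "u \<in> C.M" "C.E u = Inf (C.E ` C.M)" using C.minimizing_sequence_converges[OF s] by blast
 obtain w where w: "!!n::nat. w n \<in> C.M" "(%n. C.E (w n)) ----> Inf (C.E ` C.M)" "!!n x. w n x >= 0"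
  using nonneg_minimizing_sequence[OF u] by blast
 obtain r :: "nat => nat" and v where v: "v \<in> C.M" "(%n. H.nm (w (r n) - v)) ----> 0" "C.E v = Inf (C.E ` C.M)"
  using C.minimizing_sequence_converges[OF w(1,2)] by blast
 have vV: "v \<in> H1_rad" and wV: "w n \<in> H1_rad" for n using v(1) w(1) by (auto simp: C.M_def)
 note [measurable] = l2_borel[OF V_l2[OF vV]] l2_borel[OF V_l2[OF wV]]
 define n where "n x = min (v x) 0" for x
 have [measurable]: "n \<in> borel_measurable borel" unfolding n_def[abs_def] by measurable
 have dV: "w (r k) - v \<in> H1_rad" for k by (rule H1_rad_diff[OF wV vV])
 have rbn: "rb (C0 * H.nm (w (r k) - v)) n" for k
 proof (rule rb_dominated[OF rbV(1)[OF dV]])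
  show "AE x in R3. |n x| <= |(w (r k) - v) x|"
  proof (rule AE_I2)
   fix x show "|n x| <= |(w (r k) - v) x|" using w(3)[of "r k" x] by (simp add: n_def min_def)
  qed
 qed simp
 have nl: "l2 n" by (rule rb_l2[OF rbn])
 have "n2 n <= (C0 * H.nm (w (r k) - v))^2" for k using rbn[of k] by (simp add: rb_def)
 moreover have "(%k. (C0 * H.nm (w (r k) - v))^2) ----> (C0 * 0)^2" by (intro tendsto_intros v(2))
 ultimately have "n2 n <= (C0 * 0)^2" by (intro LIMSEQ_le_const[of "%k. (C0 * H.nm (w (r k) - v))^2"]) auto
 hence "n2 n = 0" using n2_nonneg[of n] by simp
 from n2_zero_AE[OF nl this] have "AE x in R3. v x = |v x|" by eventually_elim (auto simp: n_def min_def split: if_splits)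
 from M_cong_AE[OF v(1) _ this] have "(%x. |v x| ) \<in> C.M" "C.E (%x. |v x| ) = C.E v" by simp_all
 thus ?thesis using v(3) by (intro bexI[of _ "%x. |v x|"]) auto
qed

section \<open>Critical points solve the equation\<close>

lemma kern_qrot: "q ~= 0 ==> kern (qrot q x) (qrot q y) = kern x y"
proof -
 assume q: "q ~= 0"
 have "dist (qrot q x) (qrot q y) = dist x y"
  using norm_qrot[OF q, of "x - y"] linear_diff[OF linear_qrot, of q x y] by (simp add: dist_norm)
 thus ?thesis by (simp add: kern_def)
qed

lemma phi_radial:
 assumes r: "radial u" and [measurable]: "u \<in> borel_measurable borel"
 shows "radial (phi u)"
proof -
 have rot: "phi u (qrot q x) = phi u x" if q: "q ~= 0" for q x
 proof -
  have "phi u (qrot q x) = (LINT y|R3. kern (qrot q x) (qrot q y) * (u (qrot q y))^2)"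
   unfolding phi_pot pot_def by (rule integral_qrot(1)[OF q, of "%y. kern (qrot q x) y * (u y)^2", symmetric]) measurable
  also have "... = (LINT y|R3. kern x y * (u y)^2)"
   unfolding kern_qrot[OF q] by (rule integral_cong_AE) (use radial_rot[OF r q] in \<open>auto elim!: eventually_mono\<close>)
  finally show ?thesis by (simp add: phi_pot pot_def)
 qed
 have eq: "phi u x = phi u y" if n: "norm x = norm y" for x y
 proof (cases "x = y")
  case False
  then obtain p where p: "norm p = 1" "qrot p x = y" using qrot_transitive[OF n] by blast
  have "p ~= 0" using p(1) by force
  thus ?thesis using rot[of p x] p(2) by simp
 qed simp
 show ?thesis unfolding radial_def
  by (intro exI[of _ "%t. phi u ( |t| *\<^sub>R axis 1 1)"] AE_I2 eq) simp
qed

text \<open>A test function is replaced by its rotation average, which is radial, without changing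
  the pairings. Since L/4 * dGG u v is L times the integral of phi u * u * v, the multiplier in the
  equation is -L.\<close>

lemma critical_point_weak_solution:
 assumes u: "u \<in> C.M" and crit: "!!v. v \<in> H1_rad ==> C.dE u v = L / 4 * dGG u v"
 shows "weak_solution \<mu> f u (- L)"
 unfolding weak_solution_def
proof (intro conjI ballI)
 have uV: "u \<in> H1_rad" using u by (simp add: C.M_def)
 show uH: "u \<in> H1" by (rule H1_rad_H1[OF uV])
 have ur: "radial u" using uV by (simp add: H1_rad_def)
 fix v assume v: "v \<in> H1"
 note [measurable] = H1_borel[OF uH] H1_borel[OF v]
 define b where "b x = \<mu> * u x + - L * phi u x * u x + f (u x)" for x
 have bm [measurable]: "b \<in> borel_measurable borel" unfolding b_def[abs_def] by measurable
 have br: "radial b"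
 proof -
  obtain h k where hk: "AE x in R3. u x = h (norm x)" "AE x in R3. phi u x = k (norm x)"
   using ur phi_radial[OF ur] by (auto simp: radial_def)
  have "AE x in R3. b x = \<mu> * h (norm x) + - L * k (norm x) * h (norm x) + f (h (norm x))"
   using hk by eventually_elim (simp add: b_def)
  thus ?thesis unfolding radial_def by (rule exI[of _ "%t. \<mu> * h t + - L * k t * h t + f (h t)"])
 qed
 have gi: "integrable R3 (%x. grad u x \<bullet> grad v x)" by (rule l2_inner[OF grad_l2[OF uH] grad_l2[OF v]])
 have eq: "(%x. grad u x \<bullet> grad v x + \<mu> * u x * v x + - L * phi u x * u x * v x + f (u x) * v x)
   = (%x. grad u x \<bullet> grad v x + b x * v x)" by (simp add: b_def algebra_simps)
 show "(LINT x|R3. grad u x \<bullet> grad v x + \<mu> * u x * v x + - L * phi u x * u x * v x + f (u x) * v x) = 0"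
  unfolding eq
 proof (cases "integrable R3 (%x. b x * v x)")
  \<comment> \<open>For a non-radial \<open>v\<close> integrability of b v is not derived. If it
    fails, the whole integrand is not integrable either, and its Bochner integral is 0 by
    convention, the required value.\<close>
  case False
  have "\<not> integrable R3 (%x. grad u x \<bullet> grad v x + b x * v x)"
  proof
   assume "integrable R3 (%x. grad u x \<bullet> grad v x + b x * v x)"
   from Bochner_Integration.integrable_diff[OF this gi] show False using False by simp
  qed
  thus "(LINT x|R3. grad u x \<bullet> grad v x + b x * v x) = 0" by (rule not_integrable_integral_eq)
 next
  case True
  define a where "a = avg v"
  have aV: "a \<in> H1_rad" unfolding a_def by (rule avg_H1_rad[OF v])
  have i1: "integrable R3 (%x. u x * a x)" by (rule l2_times[OF H1_l2[OF uH] V_l2[OF aV]])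
  have i2: "integrable R3 (%x. phi u x * u x * a x)"
   using Q_integrable[OF L1_sq(1)[OF H1_l2[OF uH]] i1] by (simp add: phi_pot mult.assoc)
  have i3: "integrable R3 (%x. f (u x) * a x)"
   by (rule dPhi_integrable[OF rbV(1)[OF uV] rbV(1)[OF aV] rbV(2)[OF uV] rbV(2)[OF aV]])
  have "(LINT x|R3. grad u x \<bullet> grad v x + b x * v x) = (LINT x|R3. grad u x \<bullet> grad v x) + (LINT x|R3. b x * v x)"
   using gi True by simp
  also have "... = (LINT x|R3. grad u x \<bullet> grad a x) + (LINT x|R3. b x * a x)"
   unfolding a_def using grad_avg_inner[OF uV v] radial_times_avg[OF br bm _ True] by simp
  also have "(LINT x|R3. b x * a x) = (LINT x|R3. \<mu> * (u x * a x) + (- L) * (phi u x * u x * a x) + f (u x) * a x)"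
   by (simp add: b_def algebra_simps)
  also have "... = \<mu> * (LINT x|R3. u x * a x) + (- L) * (LINT x|R3. phi u x * u x * a x) + dPhi u a"
   using i1 i2 i3 by (simp add: dPhi_def)
  finally have "(LINT x|R3. grad u x \<bullet> grad v x + b x * v x) = C.dE u a - L / 4 * dGG u a"
   by (simp add: C.dE_def ip_def dGG_def)
  thus "(LINT x|R3. grad u x \<bullet> grad v x + b x * v x) = 0" using crit[OF aV] by simp
 qed
qed

end

theorem theorem4p2:
  fixes \<mu> :: real and f :: "real \<Rightarrow> real"
  assumes mu_pos: "\<mu> > 0"
    and f_cont: "continuous_on UNIV f"
    and f_odd: "\<And>t. f (- t) = - f t"
    and f_nonneg: "\<And>t. t \<ge> 0 \<Longrightarrow> f t \<ge> 0"
    and f_growth: "\<exists>q. 2 < q \<and> q < 6 \<and> ((\<lambda>t. f t / t powr (q - 1)) \<longlongrightarrow> 0) at_top"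
    and f_zero: "((\<lambda>t. f t / t) \<longlongrightarrow> 0) (at 0)"
  shows
    "(\<forall>s :: nat \<Rightarrow> real^3 \<Rightarrow> real.
        (\<forall>n. s n \<in> M_rad) \<and> ((\<lambda>n. energy \<mu> f (s n)) \<longlonglongrightarrow> Inf (energy \<mu> f ` M_rad))
        \<longrightarrow> (\<exists>r u. strict_mono r \<and> u \<in> M_rad \<and>
               ((\<lambda>n. normsq_mu \<mu> (\<lambda>x. s (r n) x - u x)) \<longlonglongrightarrow> 0)))
     \<and> (\<exists>u \<in> M_rad. energy \<mu> f u = Inf (energy \<mu> f ` M_rad) \<and> (\<forall>x. u x \<ge> 0))
     \<and> (\<exists>(u :: nat \<Rightarrow> real^3 \<Rightarrow> real) (lam :: nat \<Rightarrow> real).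
          (\<forall>n. crit_point_rad \<mu> f (u n) (lam n) \<and> lam n < 0 \<and>
               lam n = - (normsq_mu \<mu> (u n) + (LINT x|lborel. f (u n x) * u n x))) \<and>
          filterlim (\<lambda>n. energy \<mu> f (u n)) at_top sequentially \<and>
          filterlim (\<lambda>n. normsq_mu \<mu> (u n)) at_top sequentially \<and>
          filterlim lam at_bot sequentially)"
proof -
 interpret problem f \<mu>
  by unfold_locales (fact f_cont f_odd f_nonneg f_growth f_zero mu_pos)+
 have E: "energy \<mu> f = C.E" by (rule ext) (rule energy_E)
 show ?thesis
  unfolding E M_rad_M
 proof (intro conjI)
  show "ALL s. (ALL n. s n \<in> C.M) & ((%n. C.E (s n)) ----> Inf (C.E ` C.M))
    --> (EX r u. strict_mono r & u \<in> C.M & ((%n. normsq_mu \<mu> (%x. s (r n) x - u x)) ----> 0))"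
  proof (intro allI impI)
   fix s :: "nat => real^3 => real"
   assume "(ALL n. s n \<in> C.M) & ((%n. C.E (s n)) ----> Inf (C.E ` C.M))"
   hence s: "!!n. s n \<in> C.M" "(%n. C.E (s n)) ----> Inf (C.E ` C.M)" by auto
   obtain r :: "nat => nat" and u where r: "strict_mono r" "u \<in> C.M" "(%n. H.nm (s (r n) - u)) ----> 0"
    using C.minimizing_sequence_converges[OF s] by blast
   have V: "s n \<in> H1_rad" "u \<in> H1_rad" for n using s(1) r(2) by (auto simp: C.M_def)
   have "normsq_mu \<mu> (%x. s (r n) x - u x) = (H.nm (s (r n) - u))^2" for n
    using H.nm_sq[OF H1_rad_diff[OF V(1) V(2)], of "r n"] by (simp add: ip_normsq fun_diff_def)
   moreover have "(%n. (H.nm (s (r n) - u))^2) ----> 0^2" by (intro tendsto_intros r(3))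
   ultimately have "(%n. normsq_mu \<mu> (%x. s (r n) x - u x)) ----> 0" by simp
   thus "EX r u. strict_mono r & u \<in> C.M & ((%n. normsq_mu \<mu> (%x. s (r n) x - u x)) ----> 0)"
    using r(1,2) by blast
  qed
  show "EX u:C.M. C.E u = Inf (C.E ` C.M) & (ALL x. u x >= 0)" by (rule nonneg_minimizer)
  obtain u :: "nat => real^3 => real" where u: "!!n. u n \<in> C.M" "!!n v. v \<in> H1_rad ==> C.dE (u n) v = C.Lam (u n) / 4 * dGG (u n) v"
    "filterlim (%n. C.E (u n)) at_top sequentially" "filterlim (%n. ip (u n) (u n)) at_top sequentially"
    "filterlim (%n. C.Lam (u n)) at_top sequentially"
   using C.infinitely_many_critical_points by blast
  show "EX (u :: nat => real^3 => real) (lam :: nat => real).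
     (ALL n. crit_point_rad \<mu> f (u n) (lam n) & lam n < 0 &
       lam n = - (normsq_mu \<mu> (u n) + (LINT x|lborel. f (u n x) * u n x))) &
     filterlim (%n. C.E (u n)) at_top sequentially &
     filterlim (%n. normsq_mu \<mu> (u n)) at_top sequentially &
     filterlim lam at_bot sequentially"
  proof (rule exI[of _ u], rule exI[of _ "%n. - C.Lam (u n)"], intro conjI allI)
   fix n
   have uV: "u n \<in> H1_rad" using u(1) by (auto simp: C.M_def)
   have "weak_solution \<mu> f (u n) (- C.Lam (u n))" by (rule critical_point_weak_solution[OF u(1) u(2)])
   thus "crit_point_rad \<mu> f (u n) (- C.Lam (u n))" using u(1) by (simp add: crit_point_rad_def M_rad_M)
   have "0 < ip (u n) (u n)" using C.M_pos[OF u(1)] by (simp add: H.nm_def)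
   thus "- C.Lam (u n) < 0" using C.Lam_ge[OF uV] by linarith
   show "- C.Lam (u n) = - (normsq_mu \<mu> (u n) + (LINT x|lborel. f (u n x) * u n x))"
    by (simp add: C.Lam_def C.dE_def ip_normsq dPhi_def)
   show "filterlim (%n. C.E (u n)) at_top sequentially" by (rule u(3))
   show "filterlim (%n. normsq_mu \<mu> (u n)) at_top sequentially" using u(4) by (simp only: ip_normsq)
   show "filterlim (%n. - C.Lam (u n)) at_bot sequentially" using u(5) by (simp add: filterlim_uminus_at_bot)
  qed
 qed
qed

end
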